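(* Let $K$ be a field, $q\in K^\times$ with $q\ne 1$, $Q_1,\dots,Q_\ell\in K$, and suppose that the non-degenerate cyclotomic Hecke algebra $\mathscr H_{\ell,n}(q,\mathbf Q)$ over $K$ is semisimple. Let $\lambda\in\mathscr P_n$ and $\mathfrak s,\mathfrak t\in\mathrm{Std}(\lambda)$. Then $\mathfrak g_{\mathfrak s\mathfrak t}=\alpha_{\mathfrak s\mathfrak t}\,\mathfrak f_{\mathfrak s\mathfrak t}$ with $\alpha_{\mathfrak s\mathfrak t}\in K^\times$ given by $$\alpha_{\mathfrak s\mathfrak t}=(-q)^{-\ell(d(\mathfrak s'))-\ell(d(\mathfrak t'))}\,\frac{\gamma_{\mathfrak t_\lambda}\,\gamma'_{\mathfrak t^{\lambda'}}}{\gamma_{\mathfrak s}\,\gamma_{\mathfrak t}}=(-q)^{\ell(d(\mathfrak s'))+\ell(d(\mathfrak t'))}\,\frac{\gamma'_{\mathfrak s'}\,\gamma'_{\mathfrak t'}}{\gamma_{\mathfrak t_\lambda}\,\gamma'_{\mathfrak t^{\lambda'}}}.$$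
   Context: **Combinatorics.** $\ell,n\ge 1$ are integers. A multipartition of $n$ is an $\ell$-tuple $\lambda=(\lambda^{(1)},\dots,\lambda^{(\ell)})$ of partitions whose sizes sum to $n$; $\mathscr P_n$ is the set of these. Its diagram is $[\lambda]=\{(i,j,c):1\le c\le \ell,\ 1\le j\le \lambda^{(c)}_i\}$. A $\lambda$-tableau is a bijection $\mathfrak t:[\lambda]\to\{1,\dots,n\}$, written $\mathfrak t=(\mathfrak t^{(1)},\dots,\mathfrak t^{(\ell)})$; it is standard if in every component entries increase along rows and down columns; $\mathrm{Std}(\lambda)$ is the set of standard $\lambda$-tableaux. Conjugates: $\lambda'=(\lambda^{(\ell)\prime},\dots,\lambda^{(1)\prime})$ and $\mathfrak t'=(\mathfrak t^{(\ell)\prime},\dots,\mathfrak t^{(1)\prime})\in\mathrm{Std}(\lambda')$, where on single components the prime is transposition. Dominance: $\lambda\unrhd\mu$ if $\sum_{t<s}|\lambda^{(t)}|+\sum_{j\le i}\lambda^{(s)}_j\ge\sum_{t<s}|\mu^{(t)}|+\sum_{j\le i}\mu^{(s)}_j$ for all $1\le s\le \ell$, $i\ge 1$; for standard tableaux $\mathfrak s\unrhd\mathfrak t$ if for every $k$ the shape of the subtableau of $\mathfrak s$ with entries $1,\dots,k$ dominates that of $\mathfrak t$; $\rhd$ means $\unrhd$ and $\ne$. $\mathfrak t^\lambda$ is the standard $\lambda$-tableau with $1,\dots,n$ entered in order along the rows of component 1, then the rows of component 2, etc.; $\mathfrak t_\lambda:=(\mathfrak t^{\lambda'})'$. $\mathfrak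 S_n$ acts from the right on tableaux by permuting entries (permutations are composed left to right); $s_i=(i,i+1)$; $\ell(w)$ is the length of $w\in\mathfrak S_n$; $d(\mathfrak t),d'(\mathfrak t)\in\mathfrak S_n$ are defined by $\mathfrak t^\lambda d(\mathfrak t)=\mathfrak t$ and $\mathfrak t_\lambda d'(\mathfrak t)=\mathfrak t$. $\mathfrak S_\lambda$ is the standard Young subgroup of $\lambda$ (the row stabiliser of $\mathfrak t^\lambda$). **Algebra.** $\mathscr H_{\ell,n}(q,\mathbf Q)$, $\mathbf Q=(Q_1,\dots,Q_\ell)$, is the unital associative $K$-algebra with generators $T_0,\dots,T_{n-1}$ and relations $(T_0-Q_1)\cdots(T_0-Q_\ell)=0$; $T_0T_1T_0T_1=T_1T_0T_1T_0$; $(T_i-q)(T_i+1)=0$ for $1\le i\le n-1$; $T_iT_j=T_jT_i$ for $|i-j|>1$; $T_iT_{i+1}T_i=T_{i+1}T_iT_{i+1}$ for $1\le i<n-1$. For a reduced expression $w=s_{i_1}\cdots s_{i_k}$, $T_w=T_{i_1}\cdots T_{i_k}$. $*$ is the $K$-linear anti-involution fixing each $T_i$. $\mathcal L_m=q^{1-m}T_{m-1}\cdots T_1T_0T_1\cdots T_{m-1}$, $1\le m\le n$. For $q\neq1$, semisimplicity is equivalent to $\prod_{i=1}^n(1+q+\cdots+q^{i-1})\prod_{1\le i<j\le \ell,\,|d|<n}(q^dQ_i-Q_j)\ne 0$. **Residues.** $\mathrm{res}_{\mathfrak t}(k)=q^{j-i}Q_c$ if $k$ is in row $i$, column $j$ of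 $\mathfrak t^{(c)}$. $R(k)=\{\mathrm{res}_{\mathfrak t}(k):\mathfrak t\in\mathrm{Std}(\lambda),\lambda\in\mathscr P_n\}$. **Bases.** For $\mathfrak s,\mathfrak t\in\mathrm{Std}(\lambda)$: $$\mathfrak m_{\mathfrak s\mathfrak t}=T_{d(\mathfrak s)}^*\Big(\sum_{w\in\mathfrak S_\lambda}T_w\Big)\Big(\prod_{s=2}^{\ell}\prod_{k=1}^{|\lambda^{(1)}|+\cdots+|\lambda^{(s-1)}|}(\mathcal L_k-Q_s)\Big)T_{d(\mathfrak t)},$$ $$\mathfrak n_{\mathfrak t_\lambda\mathfrak t_\lambda}=\Big(\sum_{w\in\mathfrak S_{\lambda'}}(-q)^{-\ell(w)}T_w\Big)\Big(\prod_{s=2}^{\ell}\ \prod_{k=1}^{|\lambda^{(\ell)}|+|\lambda^{(\ell-1)}|+\cdots+|\lambda^{(\ell-s+2)}|}(\mathcal L_k-Q_{\ell-s+1})\Big),$$ $$\mathfrak n_{\mathfrak s\mathfrak t}=(-q)^{-\ell(d'(\mathfrak s))-\ell(d'(\mathfrak t))}T_{d'(\mathfrak s)}^*\,\mathfrak n_{\mathfrak t_\lambda\mathfrak t_\lambda}T_{d'(\mathfrak t)}.$$ Put $F_{\mathfrak t}=\prod_{k=1}^n\prod_{c\in R(k),\,c\ne\mathrm{res}_{\mathfrak t}(k)}\frac{\mathcal L_k-c}{\mathrm{res}_{\mathfrak t}(k)-c}$, $\ \mathfrak f_{\mathfrak s\mathfrak t}=F_{\mathfrak s}\mathfrak m_{\mathfrak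 s\mathfrak t}F_{\mathfrak t}$ (seminormal basis) and $\mathfrak g_{\mathfrak s\mathfrak t}=F_{\mathfrak s}\mathfrak n_{\mathfrak s\mathfrak t}F_{\mathfrak t}$ (dual seminormal basis). **$\gamma$-coefficients.** With $[k]_q=1+q+\cdots+q^{k-1}$, $[m]_q^!=[1]_q\cdots[m]_q$, $[\lambda]_q^!=\prod_{c}\prod_{i}[\lambda^{(c)}_i]_q^!$, the scalars $\gamma_{\mathfrak t}\in K^\times$ are uniquely determined by: (a) $\gamma_{\mathfrak t^\lambda}=[\lambda]^!_q\prod_{1\le s<t\le \ell}\prod_{(i,j):\,1\le j\le\lambda^{(s)}_i}(q^{j-i}Q_s-Q_t)$; (b) if $\mathfrak s=\mathfrak t(i,i+1)\rhd\mathfrak t$ then $\frac{\gamma_{\mathfrak t}}{\gamma_{\mathfrak s}}=\frac{(q\,\mathrm{res}_{\mathfrak s}(i)-\mathrm{res}_{\mathfrak t}(i))(\mathrm{res}_{\mathfrak s}(i)-q\,\mathrm{res}_{\mathfrak t}(i))}{(\mathrm{res}_{\mathfrak s}(i)-\mathrm{res}_{\mathfrak t}(i))^2}$. These formulas exhibit $\gamma_{\mathfrak t}$ as the value at $(q,Q_1,\dots,Q_\ell)$ of a rational function $\gamma_{\mathfrak t}(\hat q,\hat Q_1,\dots,\hat Q_\ell)$ in indeterminates; $\gamma'_{\mathfrak t}\in K^\times$ is the value at $(q,Q_1,\dots,Q_\ell)$ of the rational function obtained from it by the substitution $\hat q\mapsto\hat q^{-1}$, $\hat Q_j\mapsto\hat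 Q_{\ell-j+1}$.
   Formalization: For n ≥ 2 all parameters Q_1,…,Q_ℓ are additionally assumed nonzero; otherwise the claim fails: for ℓ=1, n=2, Q_1=0, q≠±1 and λ=(2), the algebra is semisimple, but f=1+T_1 and g=1 are not proportional. *)

theory Defs
  imports
    "HOL-Algebra.QuotRing"
    "HOL-Library.Poly_Mapping"
    "HOL-Combinatorics.Permutations"
begin

section \<open>Multipartitions and tableaux\<close>

text \<open>
  A partition is a finitely supported function whose value at \<open>i \<ge> 1\<close> is the \<open>i\<close>-th part (the
  unused value at \<open>0\<close> is \<open>0\<close>). A multipartition \<open>lam\<close> with \<open>ell\<close> components has
  \<open>lam c i\<close> equal to the \<open>i\<close>-th part of component \<open>c\<close>, for \<open>1 \<le> c \<le> ell\<close>, and is zero at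
  every other \<open>c\<close>. All indices start at 1.
\<close>

type_synonym part = "nat \<Rightarrow> nat"
type_synonym mpart = "nat \<Rightarrow> part"
type_synonym node = "nat \<times> nat \<times> nat"
type_synonym tab = "node \<Rightarrow> nat"

definition is_partition :: "part \<Rightarrow> bool" where
  "is_partition p \<longleftrightarrow> p 0 = 0 \<and> (\<forall>i\<ge>1. p (Suc i) \<le> p i) \<and> finite {i. p i \<noteq> 0}"

definition psize :: "part \<Rightarrow> nat" where
  "psize p = (\<Sum>i | p i \<noteq> 0. p i)"

definition multipartitions :: "nat \<Rightarrow> nat \<Rightarrow> mpart set" where
  "multipartitions ell n =
     {lam. (\<forall>c\<in>{1..ell}. is_partition (lam c)) \<and> (\<forall>c. c \<notin> {1..ell} \<longrightarrow> lam c = (\<lambda>_. 0)) \<and>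
           (\<Sum>c=1..ell. psize (lam c)) = n}"

definition diagram :: "nat \<Rightarrow> mpart \<Rightarrow> node set" where
  "diagram ell lam = {(i, j, c). 1 \<le> c \<and> c \<le> ell \<and> 1 \<le> i \<and> 1 \<le> j \<and> j \<le> lam c i}"

definition conj_part :: "part \<Rightarrow> part" where
  "conj_part p = (\<lambda>j. if j = 0 then 0 else card {i. 1 \<le> i \<and> j \<le> p i})"

definition conj_mpart :: "nat \<Rightarrow> mpart \<Rightarrow> mpart" where
  "conj_mpart ell lam = (\<lambda>c. if c \<in> {1..ell} then conj_part (lam (ell + 1 - c)) else (\<lambda>_. 0))"

text \<open>
  Tableaux take the value \<open>0\<close>, which is never an entry, outside the diagram, so that equality of
  functions is equality of tableaux.
\<close>

definition tableaux :: "nat \<Rightarrow> nat \<Rightarrow> mpart \<Rightarrow> tab set" where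
  "tableaux ell n lam =
     {t. bij_betw t (diagram ell lam) {1..n} \<and> (\<forall>x. x \<notin> diagram ell lam \<longrightarrow> t x = 0)}"

definition Std :: "nat \<Rightarrow> nat \<Rightarrow> mpart \<Rightarrow> tab set" where
  "Std ell n lam = {t \<in> tableaux ell n lam.
     (\<forall>i j c. (i, j, c) \<in> diagram ell lam \<and> (i, j + 1, c) \<in> diagram ell lam
        \<longrightarrow> t (i, j, c) < t (i, j + 1, c)) \<and>
     (\<forall>i j c. (i, j, c) \<in> diagram ell lam \<and> (i + 1, j, c) \<in> diagram ell lam
        \<longrightarrow> t (i, j, c) < t (i + 1, j, c))}"

definition conj_tab :: "nat \<Rightarrow> tab \<Rightarrow> tab" where
  "conj_tab ell t = (\<lambda>(i, j, c). if c \<in> {1..ell} then t (j, i, ell + 1 - c) else 0)"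

definition dominates :: "nat \<Rightarrow> mpart \<Rightarrow> mpart \<Rightarrow> bool" where
  "dominates ell lam mu \<longleftrightarrow> (\<forall>s\<in>{1..ell}. \<forall>i\<ge>1.
     (\<Sum>c=1..<s. psize (lam c)) + (\<Sum>j=1..i. lam s j)
       \<ge> (\<Sum>c=1..<s. psize (mu c)) + (\<Sum>j=1..i. mu s j))"

definition subshape :: "tab \<Rightarrow> nat \<Rightarrow> mpart" where
  "subshape t k = (\<lambda>c i. card {j. 1 \<le> t (i, j, c) \<and> t (i, j, c) \<le> k})"

definition tab_dominates :: "nat \<Rightarrow> nat \<Rightarrow> tab \<Rightarrow> tab \<Rightarrow> bool" where
  "tab_dominates ell n s t \<longleftrightarrow> (\<forall>k\<in>{1..n}. dominates ell (subshape s k) (subshape t k))"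

definition tab_strictly_dominates :: "nat \<Rightarrow> nat \<Rightarrow> tab \<Rightarrow> tab \<Rightarrow> bool" where
  "tab_strictly_dominates ell n s t \<longleftrightarrow> tab_dominates ell n s t \<and> s \<noteq> t"

text \<open>\<open>init_tab ell lam\<close> is $\mathfrak t^\lambda$ and \<open>final_tab ell lam\<close> is $\mathfrak t_\lambda$.\<close>

definition init_tab :: "nat \<Rightarrow> mpart \<Rightarrow> tab" where
  "init_tab ell lam = (\<lambda>(i, j, c). if (i, j, c) \<in> diagram ell lam
     then (\<Sum>b=1..<c. psize (lam b)) + (\<Sum>a=1..<i. lam c a) + j else 0)"

definition final_tab :: "nat \<Rightarrow> mpart \<Rightarrow> tab" where
  "final_tab ell lam = conj_tab ell (init_tab ell (conj_mpart ell lam))"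


section \<open>Permutations\<close>

text \<open>
  Permutations act from the right and are composed from left to right, so the product
  $s_{i_1}\cdots s_{i_k}$ applies $s_{i_1}$ first, and \<open>t w\<close> is the function \<open>w \<circ> t\<close>.
\<close>

definition sperm :: "nat \<Rightarrow> nat \<Rightarrow> nat" where
  "sperm i = Transposition.transpose i (i + 1)"

primrec word_perm :: "nat list \<Rightarrow> nat \<Rightarrow> nat" where
  "word_perm [] = id"
| "word_perm (i # is) = word_perm is \<circ> sperm i"

definition perm_words :: "nat \<Rightarrow> (nat \<Rightarrow> nat) \<Rightarrow> nat list set" where
  "perm_words n w = {is. set is \<subseteq> {1..<n} \<and> word_perm is = w}"

definition perm_length :: "nat \<Rightarrow> (nat \<Rightarrow> nat) \<Rightarrow> nat" where
  "perm_length n w = (LEAST k. \<exists>is\<in>perm_words n w. length is = k)"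

definition reduced_words :: "nat \<Rightarrow> (nat \<Rightarrow> nat) \<Rightarrow> nat list set" where
  "reduced_words n w = {is \<in> perm_words n w. length is = perm_length n w}"

definition d_perm :: "nat \<Rightarrow> nat \<Rightarrow> mpart \<Rightarrow> tab \<Rightarrow> nat \<Rightarrow> nat" where
  "d_perm ell n lam t = (THE w. w permutes {1..n} \<and> w \<circ> init_tab ell lam = t)"

definition d'_perm :: "nat \<Rightarrow> nat \<Rightarrow> mpart \<Rightarrow> tab \<Rightarrow> nat \<Rightarrow> nat" where
  "d'_perm ell n lam t = (THE w. w permutes {1..n} \<and> w \<circ> final_tab ell lam = t)"

definition young_subgroup :: "nat \<Rightarrow> nat \<Rightarrow> mpart \<Rightarrow> (nat \<Rightarrow> nat) set" where
  "young_subgroup ell n lam = {w. w permutes {1..n} \<and>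
     (\<forall>i c. let row = {init_tab ell lam (i, j, c) | j. (i, j, c) \<in> diagram ell lam}
            in w ` row = row)}"


section \<open>Residues and gamma coefficients\<close>

definition residue :: "'k::field \<Rightarrow> (nat \<Rightarrow> 'k) \<Rightarrow> tab \<Rightarrow> nat \<Rightarrow> 'k" where
  "residue q Q t k =
     (THE r. \<exists>i j c. t (i, j, c) = k \<and> r = q powi (int j - int i) * Q c)"

definition residue_set :: "nat \<Rightarrow> nat \<Rightarrow> 'k::field \<Rightarrow> (nat \<Rightarrow> 'k) \<Rightarrow> nat \<Rightarrow> 'k set" where
  "residue_set ell n q Q k =
     {residue q Q t k | t lam. lam \<in> multipartitions ell n \<and> t \<in> Std ell n lam}"

definition qint :: "'k::field \<Rightarrow> nat \<Rightarrow> 'k" where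
  "qint q k = (\<Sum>i<k. q ^ i)"

definition qfact :: "'k::field \<Rightarrow> nat \<Rightarrow> 'k" where
  "qfact q m = (\<Prod>k=1..m. qint q k)"

definition qfact_mpart :: "nat \<Rightarrow> 'k::field \<Rightarrow> mpart \<Rightarrow> 'k" where
  "qfact_mpart ell q lam = (\<Prod>c=1..ell. \<Prod>i | lam c i \<noteq> 0. qfact q (lam c i))"

text \<open>Conditions (a) and (b) for scalars in $K^\times$ indexed by the standard tableaux.\<close>

definition gamma_system ::
  "nat \<Rightarrow> nat \<Rightarrow> 'k::field \<Rightarrow> (nat \<Rightarrow> 'k) \<Rightarrow> mpart \<Rightarrow> (tab \<Rightarrow> 'k) \<Rightarrow> bool" where
  "gamma_system ell n q Q lam g \<longleftrightarrow>
     (\<forall>t\<in>Std ell n lam. g t \<noteq> 0) \<and>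
     g (init_tab ell lam) = qfact_mpart ell q lam *
       (\<Prod>(s, t)\<in>{(s, t). 1 \<le> s \<and> s < t \<and> t \<le> ell}.
          \<Prod>(i, j)\<in>{(i, j). 1 \<le> i \<and> 1 \<le> j \<and> j \<le> lam s i}.
            q powi (int j - int i) * Q s - Q t) \<and>
     (\<forall>s\<in>Std ell n lam. \<forall>t\<in>Std ell n lam. \<forall>i\<in>{1..<n}.
        s = sperm i \<circ> t \<and> tab_strictly_dominates ell n s t \<longrightarrow>
        g t / g s =
          (q * residue q Q s i - residue q Q t i) * (residue q Q s i - q * residue q Q t i)
            / (residue q Q s i - residue q Q t i)\<^sup>2)"

text \<open>
  The conditions only concern the values on \<open>Std ell n lam\<close>; requiring the value \<open>0\<close> elsewhere
  makes the function itself unique.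
\<close>

definition gamma_coeff ::
  "nat \<Rightarrow> nat \<Rightarrow> 'k::field \<Rightarrow> (nat \<Rightarrow> 'k) \<Rightarrow> mpart \<Rightarrow> tab \<Rightarrow> 'k" where
  "gamma_coeff ell n q Q lam =
     (THE g. gamma_system ell n q Q lam g \<and> (\<forall>t. t \<notin> Std ell n lam \<longrightarrow> g t = 0))"

text \<open>
  The rational function $\gamma_{\mathfrak t}(\hat q^{-1},\hat Q_\ell,\dots,\hat Q_1)$ at
  $(q,Q_1,\dots,Q_\ell)$ is $\gamma_{\mathfrak t}$ at $(q^{-1},Q_\ell,\dots,Q_1)$. The
  denominators in (b) do not vanish there in the semisimple case: at the new parameters the residue
  of \<open>k\<close> in a tableau is its residue in the conjugate tableau at the old ones.
\<close>

definition gamma'_coeff ::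
  "nat \<Rightarrow> nat \<Rightarrow> 'k::field \<Rightarrow> (nat \<Rightarrow> 'k) \<Rightarrow> mpart \<Rightarrow> tab \<Rightarrow> 'k" where
  "gamma'_coeff ell n q Q = gamma_coeff ell n (inverse q) (\<lambda>j. Q (ell + 1 - j))"


section \<open>Semisimple rings\<close>

definition left_ideal :: "'a set \<Rightarrow> ('a, 'b) ring_scheme \<Rightarrow> bool" where
  "left_ideal I R \<longleftrightarrow> additive_subgroup I R \<and> (\<forall>a\<in>carrier R. \<forall>x\<in>I. a \<otimes>\<^bsub>R\<^esub> x \<in> I)"

definition minimal_left_ideal :: "'a set \<Rightarrow> ('a, 'b) ring_scheme \<Rightarrow> bool" where
  "minimal_left_ideal I R \<longleftrightarrow> left_ideal I R \<and> I \<noteq> {\<zero>\<^bsub>R\<^esub>} \<and>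
     (\<forall>J. left_ideal J R \<and> J \<subseteq> I \<longrightarrow> J = {\<zero>\<^bsub>R\<^esub>} \<or> J = I)"

text \<open>
  The left regular module is a direct sum of simple submodules. The sum may be taken to be finite
  because \<open>R\<close> is generated by its unit.
\<close>

definition semisimple_ring :: "('a, 'b) ring_scheme \<Rightarrow> bool" where
  "semisimple_ring R \<longleftrightarrow> ring R \<and>
     (\<exists>S. finite S \<and> (\<forall>M\<in>S. minimal_left_ideal M R) \<and>
        (\<forall>x\<in>carrier R. \<exists>!y. y \<in> (\<Pi>\<^sub>E M\<in>S. M) \<and> x = (\<Oplus>\<^bsub>R\<^esub>M\<in>S. y M)))"


section \<open>The cyclotomic Hecke algebra\<close>

text \<open>
  The free monoid on the natural numbers, written additively because the multiplication of
  \<^typ>\<open>'a \<Rightarrow>\<^sub>0 'b\<close> is the convolution over an additive monoid. Thus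
  \<open>word \<Rightarrow>\<^sub>0 'k\<close> is the free associative \<open>'k\<close>-algebra on countably many generators.
\<close>

datatype word = Word (letters: "nat list")

instantiation word :: monoid_add
begin

definition zero_word :: word where "0 = Word []"

definition plus_word :: "word \<Rightarrow> word \<Rightarrow> word" where
  "u + v = Word (letters u @ letters v)"

instance
  by standard (auto simp: zero_word_def plus_word_def)

end

definition gen :: "nat \<Rightarrow> word \<Rightarrow>\<^sub>0 'k::field" where
  "gen i = Poly_Mapping.single (Word [i]) 1"

definition scal :: "'k::field \<Rightarrow> word \<Rightarrow>\<^sub>0 'k" where
  "scal c = Poly_Mapping.single 0 c"

definition free_algebra :: "nat \<Rightarrow> (word \<Rightarrow>\<^sub>0 'k::field) ring" where
  "free_algebra n =
     \<lparr>carrier = {p. \<forall>w\<in>Poly_Mapping.keys p. set (letters w) \<subseteq> {..<n}},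
      monoid.mult = (*), one = 1, zero = 0, add = (+)\<rparr>"

definition hecke_relators ::
  "nat \<Rightarrow> nat \<Rightarrow> 'k::field \<Rightarrow> (nat \<Rightarrow> 'k) \<Rightarrow> (word \<Rightarrow>\<^sub>0 'k) set" where
  "hecke_relators ell n q Q =
     {prod_list [gen 0 - scal (Q c). c \<leftarrow> [1..<Suc ell]]} \<union>
     (if 2 \<le> n then {gen 0 * gen 1 * gen 0 * gen 1 - gen 1 * gen 0 * gen 1 * gen 0} else {}) \<union>
     {(gen i - scal q) * (gen i + 1) | i. 1 \<le> i \<and> i < n} \<union>
     {gen i * gen j - gen j * gen i | i j. i < n \<and> j < n \<and> (i + 1 < j \<or> j + 1 < i)} \<union>
     {gen i * gen (i + 1) * gen i - gen (i + 1) * gen i * gen (i + 1) | i. 1 \<le> i \<and> i + 1 < n}"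

definition hecke_ideal ::
  "nat \<Rightarrow> nat \<Rightarrow> 'k::field \<Rightarrow> (nat \<Rightarrow> 'k) \<Rightarrow> (word \<Rightarrow>\<^sub>0 'k) set" where
  "hecke_ideal ell n q Q = Idl\<^bsub>free_algebra n\<^esub> (hecke_relators ell n q Q)"

definition hecke_algebra ::
  "nat \<Rightarrow> nat \<Rightarrow> 'k::field \<Rightarrow> (nat \<Rightarrow> 'k) \<Rightarrow> (word \<Rightarrow>\<^sub>0 'k) set ring" where
  "hecke_algebra ell n q Q = free_algebra n Quot hecke_ideal ell n q Q"

definition hecke_class ::
  "nat \<Rightarrow> nat \<Rightarrow> 'k::field \<Rightarrow> (nat \<Rightarrow> 'k) \<Rightarrow> (word \<Rightarrow>\<^sub>0 'k) \<Rightarrow> (word \<Rightarrow>\<^sub>0 'k) set" where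
  "hecke_class ell n q Q x = hecke_ideal ell n q Q +>\<^bsub>free_algebra n\<^esub> x"


section \<open>Seminormal bases\<close>

text \<open>
  Elements of the Hecke algebra are written through representatives in the free algebra, and
  \<open>hecke_class\<close> is applied at the end. The choice of a reduced expression in \<open>T_perm\<close> and the
  order of the factors in the products of polynomials in the \<open>jm\<close> affect the representative but not
  its class. The map \<open>star\<close> reverses words; it maps the ideal of relations to itself and induces
  the anti-involution $*$.
\<close>

definition T_perm :: "nat \<Rightarrow> (nat \<Rightarrow> nat) \<Rightarrow> word \<Rightarrow>\<^sub>0 'k::field" where
  "T_perm n w = prod_list (map gen (SOME is. is \<in> reduced_words n w))"

definition star :: "(word \<Rightarrow>\<^sub>0 'k::field) \<Rightarrow> word \<Rightarrow>\<^sub>0 'k" where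
  "star p = (\<Sum>w\<in>Poly_Mapping.keys p.
     Poly_Mapping.single (Word (rev (letters w))) (Poly_Mapping.lookup p w))"

definition jm :: "'k::field \<Rightarrow> nat \<Rightarrow> word \<Rightarrow>\<^sub>0 'k" where
  "jm q m = scal (q powi (1 - int m)) *
     prod_list (map gen (rev [1..<m])) * gen 0 * prod_list (map gen [1..<m])"

definition m_elt ::
  "nat \<Rightarrow> nat \<Rightarrow> 'k::field \<Rightarrow> (nat \<Rightarrow> 'k) \<Rightarrow> mpart \<Rightarrow> tab \<Rightarrow> tab \<Rightarrow> word \<Rightarrow>\<^sub>0 'k" where
  "m_elt ell n q Q lam s t =
     star (T_perm n (d_perm ell n lam s)) *
     (\<Sum>w\<in>young_subgroup ell n lam. T_perm n w) *
     prod_list [jm q k - scal (Q r).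
       r \<leftarrow> [2..<Suc ell], k \<leftarrow> [1..<Suc (\<Sum>c=1..<r. psize (lam c))]] *
     T_perm n (d_perm ell n lam t)"

definition n_final ::
  "nat \<Rightarrow> nat \<Rightarrow> 'k::field \<Rightarrow> (nat \<Rightarrow> 'k) \<Rightarrow> mpart \<Rightarrow> word \<Rightarrow>\<^sub>0 'k" where
  "n_final ell n q Q lam =
     (\<Sum>w\<in>young_subgroup ell n (conj_mpart ell lam).
        scal ((- q) powi (- int (perm_length n w))) * T_perm n w) *
     prod_list [jm q k - scal (Q (ell + 1 - r)).
       r \<leftarrow> [2..<Suc ell], k \<leftarrow> [1..<Suc (\<Sum>c=ell + 2 - r..ell. psize (lam c))]]"

definition n_elt ::
  "nat \<Rightarrow> nat \<Rightarrow> 'k::field \<Rightarrow> (nat \<Rightarrow> 'k) \<Rightarrow> mpart \<Rightarrow> tab \<Rightarrow> tab \<Rightarrow> word \<Rightarrow>\<^sub>0 'k" where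
  "n_elt ell n q Q lam s t =
     scal ((- q) powi (- int (perm_length n (d'_perm ell n lam s))
                       - int (perm_length n (d'_perm ell n lam t)))) *
     star (T_perm n (d'_perm ell n lam s)) * n_final ell n q Q lam *
     T_perm n (d'_perm ell n lam t)"

definition enum_set :: "'a set \<Rightarrow> 'a list" where
  "enum_set A = (SOME xs. distinct xs \<and> set xs = A)"

definition F_elt ::
  "nat \<Rightarrow> nat \<Rightarrow> 'k::field \<Rightarrow> (nat \<Rightarrow> 'k) \<Rightarrow> tab \<Rightarrow> word \<Rightarrow>\<^sub>0 'k" where
  "F_elt ell n q Q t =
     prod_list [scal (inverse (residue q Q t k - c)) * (jm q k - scal c).
       k \<leftarrow> [1..<Suc n], c \<leftarrow> enum_set (residue_set ell n q Q k - {residue q Q t k})]"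

definition f_elt ::
  "nat \<Rightarrow> nat \<Rightarrow> 'k::field \<Rightarrow> (nat \<Rightarrow> 'k) \<Rightarrow> mpart \<Rightarrow> tab \<Rightarrow> tab \<Rightarrow> word \<Rightarrow>\<^sub>0 'k" where
  "f_elt ell n q Q lam s t = F_elt ell n q Q s * m_elt ell n q Q lam s t * F_elt ell n q Q t"

definition g_elt ::
  "nat \<Rightarrow> nat \<Rightarrow> 'k::field \<Rightarrow> (nat \<Rightarrow> 'k) \<Rightarrow> mpart \<Rightarrow> tab \<Rightarrow> tab \<Rightarrow> word \<Rightarrow>\<^sub>0 'k" where
  "g_elt ell n q Q lam s t = F_elt ell n q Q s * n_elt ell n q Q lam s t * F_elt ell n q Q t"

end

theory Submission
  imports Defs "HOL-Library.Function_Algebras" "HOL.Vector_Spaces"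
begin

text \<open>
  Semisimplicity makes the parameters separated: \<open>q\<close> has no order up to \<open>n\<close>, and
  \<open>q\<^sup>d Q\<^sub>i \<noteq> Q\<^sub>j\<close> for \<open>i \<noteq> j\<close>, \<open>\<bar>d\<bar> < n\<close>. A semisimple ring is von Neumann regular
  (\<open>semisimple_regular\<close>), but if separation fails, there is an element \<open>u\<close> and a module with a vector
  \<open>e\<close> such that \<open>u e \<noteq> 0\<close> spans a one-dimensional submodule killed by \<open>u\<close>, and such a \<open>u\<close> has no
  quasi-inverse. For \<open>q\<^sup>d = 1\<close>, \<open>u\<close> is the sum of all \<open>T\<^sub>w\<close>; for \<open>q\<^sup>d Q\<^sub>i = Q\<^sub>j\<close> it is the
  product of the \<open>L\<^sub>k - Q\<^sub>j\<close> (\<open>semisimple_q_pow\<close>, \<open>semisimple_Q_sep\<close>).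

  For separated parameters everything takes place in an arbitrary ring \<open>'a\<close> that satisfies the
  relations. On every module over it, \<open>L\<^sub>1, \<dots>, L\<^sub>n\<close> are simultaneously diagonalisable, and the joint
  eigenvalues are residue sequences of standard tableaux (\<open>decomposes_n\<close>, by induction on the number
  of the \<open>L\<^sub>k\<close>). So the elements \<open>F\<^sub>t\<close> are orthogonal idempotents with sum 1. The elements
  \<open>\<Psi>\<^sub>s\<^sub>t = F\<^sub>s T\<^sub>d F\<^sub>t\<close>, where \<open>d\<close> is the permutation that carries \<open>s\<close> to \<open>t\<close>, are then matrix
  units up to scalars. The scalars are products, over the pairs of nodes that \<open>s\<close> and \<open>t\<close> order
  differently, of the factor in condition (b) for \<open>\<gamma>\<close> (\<open>Psi_Psi_gam\<close>). Hence \<open>\<gamma>\<^sub>t\<close> is the constant in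
  condition (a) times such a product (\<open>gamma_coeff_eq\<close>).

  In \<open>f\<^sub>s\<^sub>t\<close> the element \<open>m\<^sub>\<lambda>\<close> sits between \<open>F\<close>'s of shape \<open>\<lambda>\<close>, and only the initial tableau \<open>a\<close>
  survives there (\<open>F_sym_U_0\<close>), with the eigenvalue of (a). So \<open>f\<^sub>s\<^sub>t = \<gamma>\<^sub>a \<Psi>\<^sub>s\<^sub>a \<Psi>\<^sub>a\<^sub>t\<close>
  (\<open>seminormal_Psi\<close>). The generators \<open>T\<^sub>0\<close>, \<open>-q\<^sup>-\<^sup>1 T\<^sub>i\<close> satisfy the relations for the parameters
  \<open>q\<^sup>-\<^sup>1, Q\<^sub>\<ell>, \<dots>, Q\<^sub>1\<close>, have the same \<open>L\<^sub>k\<close>, and turn \<open>g\<^sub>s\<^sub>t\<close> into the seminormal element of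
  \<open>s', t'\<close>. The same formula therefore expresses \<open>g\<^sub>s\<^sub>t\<close> by \<open>\<Psi>\<^sub>s\<^sub>z \<Psi>\<^sub>z\<^sub>t\<close> with the final tableau \<open>z\<close>.
  Every tableau lies between \<open>a\<close> and \<open>z\<close> in the weak order, so that \<open>\<Psi>\<^sub>a\<^sub>z\<close> factors as
  \<open>\<Psi>\<^sub>a\<^sub>s \<Psi>\<^sub>s\<^sub>z\<close>, and the two products differ by a quotient of \<open>\<gamma>\<close>'s (\<open>Psi_base_change\<close>). This gives the
  first formula for \<open>\<alpha>\<close>. The second follows because \<open>\<gamma>\<^sub>t \<gamma>'\<^sub>t\<^sub>'\<close> is, up to a power of \<open>q\<close>,
  the product over all pairs that \<open>a\<close> and \<open>z\<close> order differently, so independent of \<open>t\<close> (\<open>alpha\<close>).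

  The ring is the endomorphism ring of a vector space on which the Hecke algebra acts faithfully
  (\<open>faithful_representation\<close>), so that identities of operators are identities in the Hecke algebra.
\<close>


(* Indices start at 1, and the first one is kept in this form. *)
declare One_nat_def [simp del]

section \<open>Inversions and reduced words\<close>

lemma sperm_simps [simp]: "sperm i i = Suc i" "sperm i (Suc i) = i"
  "k \<noteq> i \<Longrightarrow> k \<noteq> Suc i \<Longrightarrow> sperm i k = k"
  by (auto simp: sperm_def Transposition.transpose_def)

lemma sperm_sperm [simp]: "sperm i (sperm i k) = k" "sperm i \<circ> sperm i = id"
  by (auto simp: sperm_def fun_eq_iff)

lemma comp_sperm_sperm [simp]: "(w \<circ> sperm i) \<circ> sperm i = w" "sperm i \<circ> (sperm i \<circ> t) = t"
  by (auto simp: fun_eq_iff)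

lemma sperm_braid: "sperm i \<circ> (sperm (Suc i) \<circ> sperm i) = sperm (Suc i) \<circ> (sperm i \<circ> sperm (Suc i))"
proof
  fix k
  consider "k = i" | "k = Suc i" | "k = Suc (Suc i)" | "k \<noteq> i" "k \<noteq> Suc i" "k \<noteq> Suc (Suc i)" by blast
  then show "(sperm i \<circ> (sperm (Suc i) \<circ> sperm i)) k = (sperm (Suc i) \<circ> (sperm i \<circ> sperm (Suc i))) k"
    by cases simp_all
qed

lemma sperm_far_commute: "Suc i < j \<Longrightarrow> sperm i \<circ> sperm j = sperm j \<circ> sperm i"
proof
  fix k assume "Suc i < j"
  then show "(sperm i \<circ> sperm j) k = (sperm j \<circ> sperm i) k"
    by (cases "k = i"; cases "k = Suc i"; cases "k = j"; cases "k = Suc j") simp_all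
qed

abbreviation pinv :: "('a \<Rightarrow> 'b) \<Rightarrow> 'b \<Rightarrow> 'a" where
  "pinv \<equiv> inv_into UNIV"

lemma inv_sperm [simp]: "pinv (sperm i) = sperm i"
  by (simp add: sperm_def)

lemma bij_sperm [simp]: "bij (sperm i)"
  by (simp add: sperm_def)

lemma sperm_permutes: "1 \<le> i \<Longrightarrow> i < n \<Longrightarrow> sperm i permutes {1..n}"
  by (auto simp: sperm_def intro: permutes_swap_id)

lemma sperm_eq_iff [simp]: "sperm i a = sperm i b \<longleftrightarrow> a = b"
  by (metis sperm_sperm(1))

lemma sperm_less: "a < b \<Longrightarrow> (a, b) \<noteq> (i, Suc i) \<Longrightarrow> sperm i a < sperm i b"
  by (cases "a = i"; cases "a = Suc i"; cases "b = i"; cases "b = Suc i") auto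

lemma sperm_range: "1 \<le> i \<Longrightarrow> i < n \<Longrightarrow> sperm i a \<in> {1..n} \<longleftrightarrow> a \<in> {1..n}"
  using permutes_in_image[OF sperm_permutes] by blast

definition inversions :: "nat \<Rightarrow> (nat \<Rightarrow> nat) \<Rightarrow> (nat \<times> nat) set" where
  "inversions n w = {(a, b). 1 \<le> a \<and> a < b \<and> b \<le> n \<and> w b < w a}"

abbreviation inv_count :: "nat \<Rightarrow> (nat \<Rightarrow> nat) \<Rightarrow> nat" where
  "inv_count n w \<equiv> card (inversions n w)"

lemma finite_inversions [simp]: "finite (inversions n w)"
  by (rule finite_subset[of _ "{..n} \<times> {..n}"]) (auto simp: inversions_def)

lemma inversions_id [simp]: "inversions n id = {}"
  by (auto simp: inversions_def)

lemma inversions_comp_sperm_iff: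
  assumes "1 \<le> i" "i < n" "w i < w (Suc i)"
  shows "(a, b) \<in> inversions n (w \<circ> sperm i) \<longleftrightarrow>
    (a, b) = (i, Suc i) \<or> (sperm i a, sperm i b) \<in> inversions n w"
proof (cases "(a, b) = (i, Suc i)")
  case True then show ?thesis using assms by (auto simp: inversions_def)
next
  case False
  note r = sperm_range[OF assms(1,2), unfolded atLeastAtMost_iff]
  show ?thesis
  proof
    assume "(a, b) \<in> inversions n (w \<circ> sperm i)"
    then have "a < b" "a \<in> {1..n}" "b \<in> {1..n}" "w (sperm i b) < w (sperm i a)"
      by (auto simp: inversions_def)
    with r[of a] r[of b] sperm_less[of a b i] False show "(a, b) = (i, Suc i) \<or> (sperm i a, sperm i b) \<in> inversions n w"
      by (simp add: inversions_def)
  next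
    assume "(a, b) = (i, Suc i) \<or> (sperm i a, sperm i b) \<in> inversions n w"
    with False have *: "sperm i a < sperm i b" "sperm i a \<in> {1..n}" "sperm i b \<in> {1..n}"
      "w (sperm i b) < w (sperm i a)" by (auto simp: inversions_def)
    have "(sperm i a, sperm i b) \<noteq> (i, Suc i)" using * assms by auto
    from sperm_less[OF *(1) this] have "a < b" by simp
    with * r[of a] r[of b] show "(a, b) \<in> inversions n (w \<circ> sperm i)"
      by (simp add: inversions_def)
  qed
qed

lemma inv_count_comp_sperm:
  assumes "1 \<le> i" "i < n" "w i < w (Suc i)"
  shows "inv_count n (w \<circ> sperm i) = Suc (inv_count n w)"
proof -
  let ?f = "\<lambda>(a, b). (sperm i a, sperm i b)"
  have *: "(i, Suc i) \<in> inversions n (w \<circ> sperm i)" "(Suc i, i) \<notin> inversions n w"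
    using assms by (auto simp: inversions_def)
  have "bij_betw ?f (inversions n (w \<circ> sperm i) - {(i, Suc i)}) (inversions n w)"
  proof (rule bij_betw_byWitness[of _ ?f])
    show "?f ` (inversions n (w \<circ> sperm i) - {(i, Suc i)}) \<subseteq> inversions n w"
      using inversions_comp_sperm_iff[of i n w, OF assms] by auto
    show "?f ` inversions n w \<subseteq> inversions n (w \<circ> sperm i) - {(i, Suc i)}"
    proof clarify
      fix a b assume ab: "(a, b) \<in> inversions n w"
      then have "(sperm i a, sperm i b) \<noteq> (i, Suc i)"
        using *(2) by (metis Pair_inject sperm_sperm(1) sperm_simps(1,2))
      with ab show "(sperm i a, sperm i b) \<in> inversions n (w \<circ> sperm i) - {(i, Suc i)}"
        using inversions_comp_sperm_iff[of i n w, OF assms] by simp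
    qed
  qed auto
  from bij_betw_same_card[OF this] *(1) show ?thesis
    by (metis card_Suc_Diff1 finite_inversions)
qed

lemma inv_count_comp_sperm_descent:
  assumes "1 \<le> i" "i < n" "w (Suc i) < w i"
  shows "inv_count n w = Suc (inv_count n (w \<circ> sperm i))"
  using inv_count_comp_sperm[of i n "w \<circ> sperm i"] assms by simp

lemma inv_count_inv:
  assumes "w permutes {1..n}"
  shows "inv_count n (pinv w) = inv_count n w"
proof -
  have le: "inv_count n (pinv v) \<le> inv_count n v" if v: "v permutes {1..n}" for v
  proof (rule card_inj_on_le)
    have "pinv v a = pinv v b \<longleftrightarrow> a = b" for a b
      using inj_eq[OF permutes_inj[OF permutes_inv[OF v]]] .
    then show "inj_on (\<lambda>(a, b). (pinv v b, pinv v a)) (inversions n (pinv v))"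
      by (auto simp: inj_on_def)
    show "(\<lambda>(a, b). (pinv v b, pinv v a)) ` inversions n (pinv v) \<subseteq> inversions n v"
    proof (rule image_subsetI)
      fix p assume p: "p \<in> inversions n (pinv v)"
      obtain a b where pab: "p = (a, b)" by (cases p)
      with p have ab: "1 \<le> a" "a < b" "b \<le> n" "pinv v b < pinv v a" by (auto simp: inversions_def)
      have "v (pinv v a) = a" "v (pinv v b) = b" using v by (simp_all add: permutes_inverses)
      moreover have "pinv v a \<in> {1..n}" "pinv v b \<in> {1..n}"
        using permutes_in_image[OF permutes_inv[OF v], of a]
          permutes_in_image[OF permutes_inv[OF v], of b] ab by simp_all
      ultimately show "(case p of (a, b) \<Rightarrow> (pinv v b, pinv v a)) \<in> inversions n v"
        unfolding inversions_def pab using ab by simp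
    qed
  qed simp
  show ?thesis
    using le[OF assms] le[OF permutes_inv[OF assms], unfolded permutes_inv_inv[OF assms]] by (rule antisym)
qed

lemma no_descent_fixes:
  fixes f :: "nat \<Rightarrow> nat"
  assumes asc: "\<And>i. 1 \<le> i \<Longrightarrow> i < n \<Longrightarrow> f i < f (Suc i)" and rng: "\<And>k. 1 \<le> k \<Longrightarrow> k \<le> n \<Longrightarrow> 1 \<le> f k \<and> f k \<le> n"
    and k: "1 \<le> k" "k \<le> n"
  shows "f k = k"
proof (rule antisym)
  have "f k + m \<le> f (k + m)" if "m \<le> n - k" for m
    using that
  proof (induction m)
    case (Suc m)
    then have "f (k + m) < f (Suc (k + m))" using asc[of "k + m"] k by linarith
    then show ?case using Suc by simp
  qed simp
  from this[of "n - k"] have "f k + (n - k) \<le> f n" using k by simp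
  then show "f k \<le> k" using rng[of n] k by linarith
  have "m \<le> f m" if "1 \<le> m" "m \<le> n" for m
    using that
  proof (induction m)
    case (Suc m)
    show ?case
    proof (cases "m = 0")
      case True then show ?thesis using rng[of "Suc m"] Suc.prems by simp
    next
      case False then show ?thesis using asc[of m] Suc by simp
    qed
  qed simp
  then show "k \<le> f k" using k by simp
qed

lemma permutes_range:
  "w permutes {1..n} \<Longrightarrow> 1 \<le> k \<Longrightarrow> k \<le> n \<Longrightarrow> 1 \<le> w k \<and> w k \<le> n"
  using permutes_in_image[of w "{1..n}" k] by simp

lemma permutes_eq_id_or_descent:
  assumes "w permutes {1..n}"
  obtains "w = id" | i where "1 \<le> i" "i < n" "w (Suc i) < w i"
proof (cases "\<exists>i. 1 \<le> i \<and> i < n \<and> w (Suc i) < w i")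
  case False
  have "w k = k" for k
  proof (cases "k \<in> {1..n}")
    case True
    show ?thesis
    proof (rule no_descent_fixes[of n])
      fix i assume i: "1 \<le> i" "i < n"
      have "w i \<noteq> w (Suc i)" using inj_eq[OF permutes_inj[OF assms], of i "Suc i"] by simp
      then show "w i < w (Suc i)" using False i by (meson linorder_neqE_nat)
    qed (use True permutes_range[OF assms] in \<open>simp_all\<close>)
  next
    case False then show ?thesis using permutes_not_in[OF assms] by blast
  qed
  then show ?thesis using that by (auto simp: fun_eq_iff)
qed (use that in blast)

declare word_perm.simps [simp del]

lemma word_perm_Nil [simp]: "word_perm [] = id"
  and word_perm_Cons [simp]: "word_perm (i # is) = word_perm is \<circ> sperm i"
  by (simp_all add: fun_eq_iff word_perm.simps)

lemma word_perm_append [simp]: "word_perm (is @ js) = word_perm js \<circ> word_perm is"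
  by (induction "is") (auto simp: fun_eq_iff)

lemma bij_word_perm [simp]: "bij (word_perm is)"
  by (induction "is") (simp_all only: word_perm_Nil word_perm_Cons bij_id bij_comp bij_sperm)

lemma word_perm_rev: "word_perm (rev is) = pinv (word_perm is)"
  by (induction "is") (simp_all only: rev.simps word_perm_append word_perm_Nil word_perm_Cons inv_id
    o_inv_distrib bij_word_perm bij_sperm inv_sperm id_comp comp_id)

lemma word_perm_permutes: "set is \<subseteq> {1..<n} \<Longrightarrow> word_perm is permutes {1..n}"
  by (induction "is") (auto intro: permutes_compose sperm_permutes permutes_id)

lemma perm_words_exist:
  "w permutes {1..n} \<Longrightarrow> \<exists>is\<in>perm_words n w. length is = inv_count n w"
proof (induction "inv_count n w" arbitrary: w rule: less_induct)
  case less
  from less.prems show ?case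
  proof (cases rule: permutes_eq_id_or_descent)
    case 1 then show ?thesis by (intro bexI[of _ "[]"]) (auto simp: perm_words_def)
  next
    case (2 i)
    have "w \<circ> sperm i permutes {1..n}"
      using less.prems 2 by (auto intro: permutes_compose sperm_permutes)
    with less.hyps[of "w \<circ> sperm i"] inv_count_comp_sperm_descent[of i n w] 2
    obtain js where "js \<in> perm_words n (w \<circ> sperm i)" "length js = inv_count n (w \<circ> sperm i)" by auto
    then show ?thesis using 2 inv_count_comp_sperm_descent[of i n w]
      by (intro bexI[of _ "i # js"]) (auto simp: perm_words_def)
  qed
qed

lemma inv_count_word_perm_le: "set is \<subseteq> {1..<n} \<Longrightarrow> inv_count n (word_perm is) \<le> length is"
proof (induction "is")
  case (Cons i js)
  let ?w = "word_perm js"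
  have i: "1 \<le> i" "i < n" "set js \<subseteq> {1..<n}" using Cons.prems by auto
  have "?w i \<noteq> ?w (Suc i)" using inj_eq[OF bij_is_inj[OF bij_word_perm[of js]], of i "Suc i"] by simp
  then have "?w i < ?w (Suc i) \<or> ?w (Suc i) < ?w i" by linarith
  then have "inv_count n (?w \<circ> sperm i) \<le> Suc (inv_count n ?w)"
    using inv_count_comp_sperm[of i n ?w, OF i(1,2)] inv_count_comp_sperm_descent[of i n ?w, OF i(1,2)]
    by linarith
  then show ?case using Cons.IH[OF i(3)] unfolding word_perm_Cons list.size by linarith
qed simp

lemma perm_length_eq: "w permutes {1..n} \<Longrightarrow> perm_length n w = inv_count n w"
  unfolding perm_length_def
  by (rule Least_equality)
    (use perm_words_exist[of w n] inv_count_word_perm_le in \<open>auto simp: perm_words_def\<close>)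

lemma reduced_words_iff:
  "is \<in> reduced_words n w \<longleftrightarrow> set is \<subseteq> {1..<n} \<and> word_perm is = w \<and> length is = inv_count n w"
  using perm_length_eq[of w n] word_perm_permutes[of "is" n]
  by (auto simp: reduced_words_def perm_words_def)

lemma reduced_words_exist: "w permutes {1..n} \<Longrightarrow> \<exists>is. is \<in> reduced_words n w"
  using perm_words_exist[of w n] by (auto simp: reduced_words_iff perm_words_def)

locale braided =
  fixes n :: nat and T :: "nat \<Rightarrow> 'a::monoid_mult"
  assumes far_comm: "1 \<le> i \<Longrightarrow> Suc i < j \<Longrightarrow> j < n \<Longrightarrow> T i * T j = T j * T i"
    and braid: "1 \<le> i \<Longrightarrow> Suc i < n \<Longrightarrow> T i * T (Suc i) * T i = T (Suc i) * T i * T (Suc i)"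
begin

definition word_prod :: "nat list \<Rightarrow> 'a" where
  "word_prod is = prod_list (map T is)"

lemma word_prod_simps [simp]: "word_prod [] = 1" "word_prod (i # is) = T i * word_prod is"
  "word_prod (is @ js) = word_prod is * word_prod js"
  by (auto simp: word_prod_def)

definition T_of :: "(nat \<Rightarrow> nat) \<Rightarrow> 'a" where
  "T_of w = word_prod (SOME is. is \<in> reduced_words n w)"

text \<open>Matsumoto's theorem. Two descents \<open>i\<close>, \<open>j\<close> of \<open>w\<close> are bridged by a third reduced word that
  starts with the longest element of the group generated by \<open>s\<^sub>i\<close> and \<open>s\<^sub>j\<close>.\<close>
theorem word_prod_reduced_unique:
  "is \<in> reduced_words n w \<Longrightarrow> js \<in> reduced_words n w \<Longrightarrow> word_prod is = word_prod js"
proof (induction "length is" arbitrary: w "is" js rule: less_induct)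
  case less
  note isr = less.prems(1)[unfolded reduced_words_iff] and jsr = less.prems(2)[unfolded reduced_words_iff]
  have red_tl: "1 \<le> i \<and> i < n \<and> w (Suc i) < w i \<and> ks \<in> reduced_words n (w \<circ> sperm i)"
    if "i # ks \<in> reduced_words n w" for i ks w
  proof -
    from that have *: "1 \<le> i" "i < n" "set ks \<subseteq> {1..<n}" "word_perm ks \<circ> sperm i = w"
      "Suc (length ks) = inv_count n w" by (auto simp: reduced_words_iff)
    then have wk: "w \<circ> sperm i = word_perm ks" by auto
    have "w (Suc i) < w i"
    proof (rule ccontr)
      assume "\<not> w (Suc i) < w i"
      moreover have "w i \<noteq> w (Suc i)"
        using * inj_eq[OF bij_is_inj[OF bij_word_perm[of "i # ks"]], of i "Suc i"] by simp
      ultimately have "inv_count n (word_perm ks) = Suc (inv_count n w)"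
        using inv_count_comp_sperm[of i n w] * wk by simp
      with inv_count_word_perm_le[OF *(3)] * show False by simp
    qed
    then show ?thesis
      using * wk inv_count_comp_sperm_descent[of i n w] by (auto simp: reduced_words_iff)
  qed
  have red_Cons: "i # ks \<in> reduced_words n w"
    if "1 \<le> i" "i < n" "w (Suc i) < w i" "ks \<in> reduced_words n (w \<circ> sperm i)" for i ks w
    using that inv_count_comp_sperm_descent[of i n w] by (auto simp: reduced_words_iff)
  show ?case
  proof (cases "is")
    case Nil
    then show ?thesis using isr jsr by auto
  next
    case (Cons i is')
    then obtain j js' where js: "js = j # js'" using isr jsr by (cases js) auto
    note i = red_tl[of i is' w, folded Cons, OF less.prems(1)]
    note j = red_tl[of j js' w, folded js, OF less.prems(2)]
    have wperm: "w permutes {1..n}" using isr word_perm_permutes by blast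
    have lens: "length is' < length is" "length js' < length is" using Cons js isr jsr by auto
    note IH = less.hyps[OF lens(1)] less.hyps[OF lens(2)]
    have far: "word_prod is = word_prod js"
      if "Suc i < j \<or> Suc j < i"
    proof -
      have "w \<circ> sperm i \<circ> sperm j permutes {1..n}"
        using wperm i j by (auto intro!: permutes_compose sperm_permutes)
      then obtain c where c: "c \<in> reduced_words n (w \<circ> sperm i \<circ> sperm j)"
        using reduced_words_exist by blast
      have ji: "sperm j \<circ> sperm i = sperm i \<circ> sperm j"
        using that sperm_far_commute by metis
      have "j # c \<in> reduced_words n (w \<circ> sperm i)"
        using c i j that by (intro red_Cons) auto
      moreover have "i # c \<in> reduced_words n (w \<circ> sperm j)"
        using c i j that by (intro red_Cons) (auto simp: comp_assoc ji)
      ultimately have "word_prod is' = T j * word_prod c" "word_prod js' = T i * word_prod c"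
        using IH(1)[of "w \<circ> sperm i" "j # c"] IH(2)[of "w \<circ> sperm j" "i # c"] i j by simp_all
      moreover have "T i * T j = T j * T i" using that far_comm[of i j] far_comm[of j i] i j by auto
      ultimately show ?thesis using Cons js by (simp add: mult.assoc[symmetric])
    qed
    have near: "word_prod (a # as) = word_prod (b # bs)"
      if ab [simp]: "b = Suc a" and a: "a # as \<in> reduced_words n w" and b: "b # bs \<in> reduced_words n w"
        and len: "Suc (length as) = length is" for a b as bs
    proof -
      note ra = red_tl[OF a] and rb = red_tl[OF b]
      let ?v = "w \<circ> sperm a \<circ> sperm b \<circ> sperm a"
      have v: "?v = w \<circ> sperm b \<circ> sperm a \<circ> sperm b"
        by (simp add: comp_assoc sperm_braid)
      have "?v permutes {1..n}"
        using wperm ra rb by (auto intro!: permutes_compose sperm_permutes)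
      then obtain c where c: "c \<in> reduced_words n ?v"
        using reduced_words_exist by blast
      have lens2: "length as < length is" "length bs < length is"
        using len a b by (auto simp: reduced_words_iff)
      have 1: "a # c \<in> reduced_words n (w \<circ> sperm a \<circ> sperm b)"
        by (rule red_Cons) (use c ra rb in \<open>simp_all\<close>)
      have "b # a # c \<in> reduced_words n (w \<circ> sperm a)"
        by (rule red_Cons) (use 1 ra rb in \<open>auto\<close>)
      moreover have 2: "b # c \<in> reduced_words n (w \<circ> sperm b \<circ> sperm a)"
        by (rule red_Cons) (use c[unfolded v] ra rb in \<open>auto\<close>)
      have "a # b # c \<in> reduced_words n (w \<circ> sperm b)"
        by (rule red_Cons) (use 2 ra rb in \<open>auto\<close>)
      ultimately have "word_prod as = T b * (T a * word_prod c)" "word_prod bs = T a * (T b * word_prod c)"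
        using less.hyps[OF lens2(1), of "w \<circ> sperm a" "b # a # c"]
          less.hyps[OF lens2(2), of "w \<circ> sperm b" "a # b # c"] ra rb by simp_all
      moreover have "T a * (T b * (T a * x)) = T b * (T a * (T b * x))" for x
        using arg_cong[OF braid[of a], of "\<lambda>y. y * x"] ra rb ab by (simp add: mult.assoc)
      ultimately show ?thesis by simp
    qed
    consider "i = j" | "Suc i < j \<or> Suc j < i" | "j = Suc i" | "i = Suc j" by linarith
    then show ?thesis
    proof cases
      case 1 then show ?thesis using IH(1)[of "w \<circ> sperm i" js'] i j Cons js by simp
    next
      case 2 then show ?thesis by (rule far)
    next
      case 3 then show ?thesis
        using near[of j i is' js'] less.prems Cons js by (simp del: word_prod_simps)
    next
      case 4 then show ?thesis
        using near[of i j js' is'] less.prems Cons js isr jsr by (simp del: word_prod_simps)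
    qed
  qed
qed

lemma T_of_reduced: "is \<in> reduced_words n w \<Longrightarrow> T_of w = word_prod is"
  unfolding T_of_def using word_prod_reduced_unique someI[of "\<lambda>is. is \<in> reduced_words n w"] by blast

lemma T_of_id [simp]: "T_of id = 1"
  using T_of_reduced[of "[]" id] by (simp add: reduced_words_iff)

lemma T_of_comp_sperm:
  assumes "w permutes {1..n}" "1 \<le> i" "i < n" "w i < w (Suc i)"
  shows "T_of (w \<circ> sperm i) = T i * T_of w"
proof -
  obtain c where c: "c \<in> reduced_words n w" using reduced_words_exist[OF assms(1)] by blast
  then have "i # c \<in> reduced_words n (w \<circ> sperm i)"
    using inv_count_comp_sperm[of i n w] assms by (auto simp: reduced_words_iff)
  then show ?thesis using T_of_reduced[of "i # c"] T_of_reduced[OF c] by simp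
qed

lemma T_of_sperm_comp:
  assumes "w permutes {1..n}" "1 \<le> i" "i < n" "pinv w i < pinv w (Suc i)"
  shows "T_of (sperm i \<circ> w) = T_of w * T i"
    "inv_count n (sperm i \<circ> w) = Suc (inv_count n w)"
proof -
  have p: "sperm i \<circ> w permutes {1..n}"
    using assms by (auto intro: permutes_compose sperm_permutes)
  have "pinv (sperm i \<circ> w) = pinv w \<circ> sperm i"
    using permutes_bij[OF assms(1)] by (simp add: o_inv_distrib)
  then show *: "inv_count n (sperm i \<circ> w) = Suc (inv_count n w)"
    using inv_count_comp_sperm[of i n "pinv w"] assms inv_count_inv[OF p] inv_count_inv[OF assms(1)] by simp
  obtain c where c: "c \<in> reduced_words n w" using reduced_words_exist[OF assms(1)] by blast
  then have "c @ [i] \<in> reduced_words n (sperm i \<circ> w)" using * assms by (auto simp: reduced_words_iff)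
  then show "T_of (sperm i \<circ> w) = T_of w * T i" using T_of_reduced[of "c @ [i]"] T_of_reduced[OF c] by simp
qed

end

declare split_paired_All [simp del] split_paired_Ex [simp del]

section \<open>Young sets and standard fillings\<close>

definition nw_le :: "node \<Rightarrow> node \<Rightarrow> bool" where
  "nw_le x y \<longleftrightarrow> (case x of (i, j, c) \<Rightarrow> case y of (i', j', c') \<Rightarrow> c = c' \<and> i \<le> i' \<and> j \<le> j')"

lemma nw_le_simp [simp]: "nw_le (i, j, c) (i', j', c') \<longleftrightarrow> c = c' \<and> i \<le> i' \<and> j \<le> j'"
  by (simp add: nw_le_def)

lemma nw_le_refl [simp]: "nw_le x x"
  by (cases x) auto

definition nodes :: "nat \<Rightarrow> node set" where
  "nodes ell = {(i, j, c). 1 \<le> i \<and> 1 \<le> j \<and> 1 \<le> c \<and> c \<le> ell}"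

definition young :: "nat \<Rightarrow> node set \<Rightarrow> bool" where
  "young ell D \<longleftrightarrow> finite D \<and> D \<subseteq> nodes ell \<and> (\<forall>y\<in>D. \<forall>x\<in>nodes ell. nw_le x y \<longrightarrow> x \<in> D)"

definition addable :: "nat \<Rightarrow> node set \<Rightarrow> node set" where
  "addable ell D = {x \<in> nodes ell. x \<notin> D \<and> young ell (insert x D)}"

definition supp :: "tab \<Rightarrow> node set" where
  "supp t = {x. t x \<noteq> 0}"

text \<open>Standard tableaux of size \<open>k\<close> and of any shape. The shape is the support, and monotonicity is
  stated for the whole order on nodes, of which rows and columns are the covering relations.\<close>
definition tabs :: "nat \<Rightarrow> nat \<Rightarrow> tab set" where
  "tabs ell k = {t. young ell (supp t) \<and> bij_betw t (supp t) {1..k} \<and>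
     (\<forall>x\<in>supp t. \<forall>y\<in>supp t. nw_le x y \<longrightarrow> t x \<le> t y)}"

text \<open>The node that carries a given entry.\<close>
definition nd :: "tab \<Rightarrow> nat \<Rightarrow> node" where
  "nd t k = (THE x. t x = k)"

lemma youngD: "young ell D \<Longrightarrow> y \<in> D \<Longrightarrow> x \<in> nodes ell \<Longrightarrow> nw_le x y \<Longrightarrow> x \<in> D"
  and young_finite: "young ell D \<Longrightarrow> finite D"
  and young_nodes: "young ell D \<Longrightarrow> D \<subseteq> nodes ell"
  by (auto simp: young_def)

lemma addableD:
  assumes "x \<in> addable ell D"
  shows "x \<in> nodes ell" "x \<notin> D" "young ell (insert x D)"
    "y \<in> nodes ell \<Longrightarrow> nw_le y x \<Longrightarrow> y \<noteq> x \<Longrightarrow> y \<in> D"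
  using assms by (auto simp: addable_def young_def)

lemma in_nodes [simp]: "(i, j, c) \<in> nodes ell \<longleftrightarrow> 1 \<le> i \<and> 1 \<le> j \<and> 1 \<le> c \<and> c \<le> ell"
  by (simp add: nodes_def)

lemma tabsD:
  assumes "t \<in> tabs ell k"
  shows tabs_young: "young ell (supp t)" and tabs_bij: "bij_betw t (supp t) {1..k}"
    and tabs_mono: "x \<in> supp t \<Longrightarrow> y \<in> supp t \<Longrightarrow> nw_le x y \<Longrightarrow> t x \<le> t y"
  using assms by (auto simp: tabs_def)

lemma tabs_eqD: "t \<in> tabs ell k \<Longrightarrow> t x = t y \<Longrightarrow> t x \<noteq> 0 \<Longrightarrow> x = y"
  using bij_betw_imp_inj_on[OF tabs_bij, of t ell k] by (simp add: inj_on_def supp_def)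

lemma tabs_le: "t \<in> tabs ell k \<Longrightarrow> t x \<le> k"
  using tabs_bij[of t ell k] by (cases "x \<in> supp t") (auto simp: supp_def bij_betw_def)

lemma tabs_card: "t \<in> tabs ell k \<Longrightarrow> card (supp t) = k"
  using bij_betw_same_card[OF tabs_bij, of t ell k] by simp

lemma nd_eq: "t \<in> tabs ell k \<Longrightarrow> t x = m \<Longrightarrow> m \<noteq> 0 \<Longrightarrow> nd t m = x"
  unfolding nd_def by (rule the_equality) (auto dest: tabs_eqD)

lemma nd_entry [simp]: assumes "t \<in> tabs ell k" "1 \<le> m" "m \<le> k" shows "t (nd t m) = m"
proof -
  have "m \<in> t ` supp t" using tabs_bij[OF assms(1)] assms by (auto simp: bij_betw_def)
  then show ?thesis using nd_eq[OF assms(1)] assms(2) by auto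
qed

lemma nd_supp [simp]: "t \<in> tabs ell k \<Longrightarrow> 1 \<le> m \<Longrightarrow> m \<le> k \<Longrightarrow> nd t m \<in> supp t"
  using nd_entry[of t ell k m] by (auto simp: supp_def)

lemma nd_inj: "t \<in> tabs ell k \<Longrightarrow> 1 \<le> l \<Longrightarrow> l \<le> k \<Longrightarrow> 1 \<le> m \<Longrightarrow> m \<le> k \<Longrightarrow> nd t l = nd t m \<longleftrightarrow> l = m"
  using nd_entry[of t ell k m] nd_entry[of t ell k l] by metis

lemma tabs_0: "tabs ell 0 = {\<lambda>_. 0}"
proof -
  have "t = (\<lambda>_. 0)" if "t \<in> tabs ell 0" for t
    using tabs_le[OF that] by (simp add: fun_eq_iff)
  moreover have "supp (\<lambda>_. 0) = {}" by (simp add: supp_def)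
  then have "(\<lambda>_. 0) \<in> tabs ell 0" by (simp add: tabs_def young_def bij_betw_def)
  ultimately show ?thesis by blast
qed

lemma tabs_eqI:
  assumes "t \<in> tabs ell k" "u \<in> tabs ell k" "\<And>m. 1 \<le> m \<Longrightarrow> m \<le> k \<Longrightarrow> nd t m = nd u m"
  shows "t = u"
proof
  have *: "u x = t x" if tu: "t \<in> tabs ell k" "u \<in> tabs ell k"
    and eq: "\<And>m. 1 \<le> m \<Longrightarrow> m \<le> k \<Longrightarrow> nd t m = nd u m" and x: "t x \<noteq> 0" for t u x
  proof -
    have m: "1 \<le> t x" "t x \<le> k" using x tabs_le[OF tu(1), of x] by simp_all
    have "nd u (t x) = x" using nd_eq[OF tu(1) refl x] eq[OF m] by simp
    then show ?thesis using nd_entry[OF tu(2) m] by simp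
  qed
  fix x show "t x = u x"
  proof (cases "t x = 0 \<and> u x = 0")
    case False
    then show ?thesis using *[OF assms, of x] *[OF assms(2,1) assms(3)[symmetric], of x] by metis
  qed simp
qed

definition restrict_tab :: "tab \<Rightarrow> nat \<Rightarrow> tab" where
  "restrict_tab t m = (\<lambda>x. if t x \<le> m then t x else 0)"

lemma restrict_tab_tabs:
  assumes "t \<in> tabs ell k" "m \<le> k"
  shows "restrict_tab t m \<in> tabs ell m" "supp (restrict_tab t m) = {x. 1 \<le> t x \<and> t x \<le> m}"
    "1 \<le> l \<Longrightarrow> l \<le> m \<Longrightarrow> nd (restrict_tab t m) l = nd t l"
proof -
  let ?t = "restrict_tab t m"
  show s: "supp ?t = {x. 1 \<le> t x \<and> t x \<le> m}" by (auto simp: supp_def restrict_tab_def)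
  have sub: "supp ?t \<subseteq> supp t" unfolding s by (auto simp: supp_def)
  have "young ell (supp ?t)" unfolding young_def
  proof (intro conjI ballI impI)
    show "finite (supp ?t)" using finite_subset[OF sub young_finite[OF tabs_young[OF assms(1)]]] .
    show "supp ?t \<subseteq> nodes ell" using sub young_nodes[OF tabs_young[OF assms(1)]] by auto
    fix x y assume xy: "y \<in> supp ?t" "x \<in> nodes ell" "nw_le x y"
    then have "x \<in> supp t" using youngD[OF tabs_young[OF assms(1)]] sub by blast
    moreover from this have "t x \<le> t y" using tabs_mono[OF assms(1)] xy sub by blast
    ultimately show "x \<in> supp ?t" using xy(1) unfolding s by (simp add: supp_def)
  qed
  moreover have "bij_betw ?t (supp ?t) {1..m}"
  proof (rule bij_betw_imageI)
    show "inj_on ?t (supp ?t)"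
    proof (rule inj_onI)
      fix x y assume "x \<in> supp ?t" "y \<in> supp ?t" "?t x = ?t y"
      then have "t x = t y" "t x \<noteq> 0" unfolding s by (simp_all add: restrict_tab_def)
      then show "x = y" by (rule tabs_eqD[OF assms(1)])
    qed
    have "l \<in> ?t ` supp ?t" if "1 \<le> l" "l \<le> m" for l
    proof (rule image_eqI[of _ _ "nd t l"])
      show "l = ?t (nd t l)" using nd_entry[OF assms(1), of l] that assms(2) by (simp add: restrict_tab_def)
      show "nd t l \<in> supp ?t" using nd_entry[OF assms(1), of l] that assms(2) unfolding s by simp
    qed
    moreover have "?t x \<in> {1..m}" if "x \<in> supp ?t" for x
      using that unfolding s by (simp add: restrict_tab_def)
    ultimately show "?t ` supp ?t = {1..m}"
      by (intro subset_antisym image_subsetI subsetI) (simp_all only: atLeastAtMost_iff)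
  qed
  moreover have "?t x \<le> ?t y" if "x \<in> supp ?t" "y \<in> supp ?t" "nw_le x y" for x y
  proof -
    have "t x \<le> t y" using that tabs_mono[OF assms(1)] sub by blast
    then show ?thesis using that(1,2) unfolding s by (simp add: restrict_tab_def)
  qed
  ultimately show r: "?t \<in> tabs ell m" by (simp add: tabs_def)
  show "nd ?t l = nd t l" if "1 \<le> l" "l \<le> m"
    using nd_entry[OF assms(1), of l] that assms(2) by (intro nd_eq[OF r]) (auto simp: restrict_tab_def)
qed

lemma restrict_tab_addable:
  assumes "t \<in> tabs ell k" "m < k"
  shows "nd t (Suc m) \<in> addable ell (supp (restrict_tab t m))"
proof -
  have k: "m \<le> k" "Suc m \<le> k" using assms(2) by auto
  have ins: "supp (restrict_tab t (Suc m)) = insert (nd t (Suc m)) (supp (restrict_tab t m))"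
  proof (rule Set.set_eqI)
    fix x
    have e: "t (nd t (Suc m)) = Suc m" using nd_entry[OF assms(1), of "Suc m"] k by simp
    have "t x = Suc m \<longleftrightarrow> x = nd t (Suc m)" using nd_eq[OF assms(1), of x "Suc m"] e by auto
    then show "x \<in> supp (restrict_tab t (Suc m)) \<longleftrightarrow> x \<in> insert (nd t (Suc m)) (supp (restrict_tab t m))"
      using e le_Suc_eq[of "t x" m]
      by (cases "x = nd t (Suc m)") (simp_all add: restrict_tab_tabs(2)[OF assms(1)] k)
  qed
  have y: "young ell (supp (restrict_tab t (Suc m)))"
    by (rule tabs_young[OF restrict_tab_tabs(1)[OF assms(1) k(2)]])
  have "nd t (Suc m) \<in> nodes ell"
    using y young_nodes unfolding ins by blast
  moreover have "nd t (Suc m) \<notin> supp (restrict_tab t m)"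
    using nd_entry[OF assms(1), of "Suc m"] k by (simp add: restrict_tab_tabs(2)[OF assms(1)])
  ultimately show ?thesis using y unfolding addable_def ins by simp
qed

lemma extend_tab:
  assumes "t \<in> tabs ell k" "x \<in> addable ell (supp t)"
  shows "t(x := Suc k) \<in> tabs ell (Suc k)" "supp (t(x := Suc k)) = insert x (supp t)"
    "1 \<le> m \<Longrightarrow> m \<le> k \<Longrightarrow> nd (t(x := Suc k)) m = nd t m" "nd (t(x := Suc k)) (Suc k) = x"
proof -
  let ?t = "t(x := Suc k)"
  note x = addableD[OF assms(2)]
  show s: "supp ?t = insert x (supp t)" by (auto simp: supp_def)
  have "bij_betw ?t (supp t) {1..k}"
    using tabs_bij[OF assms(1)] x(2) by (subst bij_betw_cong[of _ _ t]) auto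
  then have "bij_betw ?t (supp ?t) (insert (Suc k) {1..k})"
    using notIn_Un_bij_betw[of x "supp t" ?t "{1..k}"] x(2) by (simp add: s)
  moreover have "insert (Suc k) {1..k} = {1..Suc k}" by auto
  ultimately have b: "bij_betw ?t (supp ?t) {1..Suc k}" by simp
  have "?t a \<le> ?t b" if "a \<in> supp ?t" "b \<in> supp ?t" "nw_le a b" for a b
  proof (cases "b = x")
    case True then show ?thesis using tabs_le[OF assms(1), of a] by auto
  next
    case False
    then have "a \<in> supp t"
      using that x youngD[OF tabs_young[OF assms(1)], of b a] s by (cases "a = x") auto
    then show ?thesis using False tabs_mono[OF assms(1)] that s x by auto
  qed
  with b x(3) show r: "?t \<in> tabs ell (Suc k)" by (simp add: tabs_def s)
  show "nd ?t m = nd t m" if "1 \<le> m" "m \<le> k"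
  proof (rule nd_eq[OF r])
    have "nd t m \<noteq> x" using nd_supp[OF assms(1) that] x by blast
    then show "?t (nd t m) = m" using assms that by simp
  qed (use that in auto)
  show "nd ?t (Suc k) = x" by (rule nd_eq[OF r]) auto
qed

lemma extend_restrict:
  assumes "t \<in> tabs ell (Suc k)"
  shows "(restrict_tab t k)(nd t (Suc k) := Suc k) = t"
    "supp t = insert (nd t (Suc k)) (supp (restrict_tab t k))"
proof -
  have e: "t (nd t (Suc k)) = Suc k" using nd_entry[OF assms, of "Suc k"] by simp
  show "(restrict_tab t k)(nd t (Suc k) := Suc k) = t"
  proof
    fix x show "((restrict_tab t k)(nd t (Suc k) := Suc k)) x = t x"
      using e nd_eq[OF assms refl, of x] tabs_le[OF assms, of x]
      by (cases "x = nd t (Suc k)"; cases "t x = Suc k") (simp_all add: restrict_tab_def le_Suc_eq)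
  qed
  then show "supp t = insert (nd t (Suc k)) (supp (restrict_tab t k))"
    using extend_tab(2)[OF restrict_tab_tabs(1)[OF assms] restrict_tab_addable[OF assms], of k] by simp
qed

lemma swap_tab:
  assumes "t \<in> tabs ell k" "1 \<le> i" "i < k"
  shows swap_supp: "supp (sperm i \<circ> t) = supp t"
    and swap_tabs: "\<not> nw_le (nd t i) (nd t (Suc i)) \<Longrightarrow> sperm i \<circ> t \<in> tabs ell k"
    and swap_tabsD: "sperm i \<circ> t \<in> tabs ell k \<Longrightarrow> \<not> nw_le (nd t i) (nd t (Suc i))"
    and swap_nd: "sperm i \<circ> t \<in> tabs ell k \<Longrightarrow> 1 \<le> m \<Longrightarrow> m \<le> k \<Longrightarrow> nd (sperm i \<circ> t) m = nd t (sperm i m)"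
proof -
  have z: "sperm i m = 0 \<longleftrightarrow> m = 0" for m using assms(2) sperm_eq_iff[of i m 0] by simp
  show s: "supp (sperm i \<circ> t) = supp t" by (auto simp: supp_def z)
  have bs: "bij_betw (sperm i) {1..k} {1..k}"
    using permutes_imp_bij[OF sperm_permutes[OF assms(2,3)]] .
  have b: "bij_betw (sperm i \<circ> t) (supp t) {1..k}"
    by (rule bij_betw_trans[OF tabs_bij[OF assms(1)] bs])
  show "sperm i \<circ> t \<in> tabs ell k" if n: "\<not> nw_le (nd t i) (nd t (Suc i))"
  proof -
    have "sperm i (t x) \<le> sperm i (t y)" if xy: "x \<in> supp t" "y \<in> supp t" "nw_le x y" for x y
    proof (cases "t x = t y")
      case False
      then have l: "t x < t y" using tabs_mono[OF assms(1) xy] by simp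
      have "(t x, t y) \<noteq> (i, Suc i)"
        using n nd_eq[OF assms(1), of x i] nd_eq[OF assms(1), of y "Suc i"] xy assms(2) by auto
      then show ?thesis by (intro less_imp_le sperm_less[OF l])
    qed simp
    then show ?thesis using b tabs_young[OF assms(1)] by (simp add: tabs_def s)
  qed
  show "\<not> nw_le (nd t i) (nd t (Suc i))" if "sperm i \<circ> t \<in> tabs ell k"
  proof
    assume "nw_le (nd t i) (nd t (Suc i))"
    then have "(sperm i \<circ> t) (nd t i) \<le> (sperm i \<circ> t) (nd t (Suc i))"
      using assms by (intro tabs_mono[OF that]) (simp_all add: s)
    then show False using assms by simp
  qed
  show "nd (sperm i \<circ> t) m = nd t (sperm i m)" if "sperm i \<circ> t \<in> tabs ell k" "1 \<le> m" "m \<le> k"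
  proof (rule nd_eq[OF that(1)])
    have "sperm i m \<in> {1..k}" using sperm_range[OF assms(2,3), of m] that by simp
    then show "(sperm i \<circ> t) (nd t (sperm i m)) = m" using assms by simp
  qed (use that in auto)
qed

lemma adjacent_entries:
  assumes "t \<in> tabs ell k" "1 \<le> i" "i < k" "nw_le (nd t i) (nd t (Suc i))"
  obtains (right) a b c where "nd t i = (a, b, c)" "nd t (Suc i) = (a, Suc b, c)"
    | (below) a b c where "nd t i = (a, b, c)" "nd t (Suc i) = (Suc a, b, c)"
proof -
  obtain a b c where x: "nd t i = (a, b, c)" by (metis prod_cases3)
  moreover obtain a' b' c' where y: "nd t (Suc i) = (a', b', c')" by (metis prod_cases3)
  moreover have xs: "nd t i \<in> supp t" and ys: "nd t (Suc i) \<in> supp t" using assms by auto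
  moreover have nodes: "supp t \<subseteq> nodes ell" using young_nodes[OF tabs_young[OF assms(1)]] .
  have tx: "t (nd t i) = i" and ty: "t (nd t (Suc i)) = Suc i" using assms by simp_all
  have between: "z = nd t i" if "z \<in> nodes ell" "nw_le (nd t i) z" "nw_le z (nd t (Suc i))" "z \<noteq> nd t (Suc i)" for z
  proof -
    have z: "z \<in> supp t" using youngD[OF tabs_young[OF assms(1)] ys that(1,3)] .
    have "i \<le> t z" "t z \<le> Suc i"
      using tabs_mono[OF assms(1) xs z that(2)] tabs_mono[OF assms(1) z ys that(3)] tx ty by simp_all
    moreover have "t z \<noteq> Suc i" using that(4) tabs_eqD[OF assms(1), of z "nd t (Suc i)"] ty by auto
    ultimately have "t z = i" by simp
    then show ?thesis using nd_eq[OF assms(1), of z i] assms by simp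
  qed
  have "nd t i \<noteq> nd t (Suc i)" using nd_inj[OF assms(1), of i "Suc i"] assms by simp
  then have ne: "(a, b, c) \<noteq> (a', b', c')" using x y by simp
  have n: "(a, b, c) \<in> nodes ell" "(a', b', c') \<in> nodes ell"
    using subsetD[OF nodes xs] subsetD[OF nodes ys] unfolding x y .
  have le: "c = c'" "a \<le> a'" "b \<le> b'" using assms(4) x y by simp_all
  have "(a' = a \<and> b' = Suc b \<or> a' = Suc a \<and> b' = b) \<and> c' = c"
  proof (cases "b < b'")
    case True
    have "(a', b' - 1, c') = (a, b, c)"
      using between[of "(a', b' - 1, c')"] True n le unfolding x y by simp
    then show ?thesis using True by auto
  next
    case False
    then have "a < a'" using ne le by simp
    moreover have "(a' - 1, b', c') = (a, b, c)"
      using between[of "(a' - 1, b', c')"] False calculation n le unfolding x y by simp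
    ultimately show ?thesis by auto
  qed
  then show ?thesis using right[OF x] below[OF x] y by blast
qed

text \<open>The pairs of nodes that \<open>s\<close> and \<open>t\<close> order differently. They are counted by the length of the
  permutation that carries \<open>s\<close> to \<open>t\<close>.\<close>
definition Invs :: "tab \<Rightarrow> tab \<Rightarrow> (node \<times> node) set" where
  "Invs s t = {(x, y). x \<in> supp t \<and> y \<in> supp t \<and> s x < s y \<and> t y < t x}"

lemma finite_Invs: "finite (supp t) \<Longrightarrow> finite (Invs s t)"
  by (rule finite_subset[of _ "supp t \<times> supp t"]) (auto simp: Invs_def)

lemma Invs_self [simp]: "Invs t t = {}"
  by (auto simp: Invs_def)

text \<open>Swapping two neighbouring entries that are out of order relative to \<open>s\<close> removes
  exactly their pair from the inversions.\<close>
lemma Invs_swap: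
  assumes t: "t \<in> tabs ell k" and i: "1 \<le> i" "i < k" and lt: "s (nd t (Suc i)) < s (nd t i)"
  shows "Invs s t = insert (nd t (Suc i), nd t i) (Invs s (sperm i \<circ> t))"
    "(nd t (Suc i), nd t i) \<notin> Invs s (sperm i \<circ> t)"
proof -
  have e: "t (nd t i) = i" "t (nd t (Suc i)) = Suc i" using t i by simp_all
  show "(nd t (Suc i), nd t i) \<notin> Invs s (sperm i \<circ> t)" by (simp add: Invs_def e)
  have ndi: "nd t i \<in> supp t" "nd t (Suc i) \<in> supp t" using t i by simp_all
  have *: "(x, y) \<in> Invs s t \<longleftrightarrow> (x, y) = (nd t (Suc i), nd t i) \<or> (x, y) \<in> Invs s (sperm i \<circ> t)" for x y
  proof -
    consider (1) "t x = i" "t y = Suc i" | (2) "t y = i" "t x = Suc i"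
      | (3) "(t x, t y) \<noteq> (i, Suc i)" "(t y, t x) \<noteq> (i, Suc i)" by auto
    then show ?thesis
    proof cases
      case 1
      then have "x = nd t i" "y = nd t (Suc i)" using nd_eq[OF t, of y "Suc i"] nd_eq[OF t, of x i] i by simp_all
      then show ?thesis using lt e by (auto simp: Invs_def)
    next
      case 2
      then have "y = nd t i" "x = nd t (Suc i)" using nd_eq[OF t, of x "Suc i"] nd_eq[OF t, of y i] i by simp_all
      then show ?thesis using lt e ndi by (simp add: Invs_def)
    next
      case 3
      have "sperm i (t y) < sperm i (t x) \<longleftrightarrow> t y < t x"
        using sperm_less[of "t x" "t y" i, OF _ 3(1)] sperm_less[of "t y" "t x" i, OF _ 3(2)]
        by (cases "t x" "t y" rule: linorder_cases) simp_all
      moreover have "(x, y) \<noteq> (nd t (Suc i), nd t i)" using 3(2) e by auto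
      ultimately show ?thesis unfolding Invs_def swap_supp[OF t i] by auto
    qed
  qed
  show "Invs s t = insert (nd t (Suc i), nd t i) (Invs s (sperm i \<circ> t))"
  proof (rule Set.set_eqI)
    fix p show "p \<in> Invs s t \<longleftrightarrow> p \<in> insert (nd t (Suc i), nd t i) (Invs s (sperm i \<circ> t))"
      using *[of "fst p" "snd p"] by simp
  qed
qed

text \<open>Some pair of neighbouring entries of \<open>t\<close> is out of order relative to \<open>s\<close>. Their nodes are
  incomparable, for otherwise both fillings would order them alike, so they may be exchanged.\<close>
lemma tab_descent:
  assumes t: "t \<in> tabs ell k" and s: "s \<in> tabs ell k" and st: "supp s = supp t" and ne: "s \<noteq> t"
  obtains i where "1 \<le> i" "i < k" "s (nd t (Suc i)) < s (nd t i)" "sperm i \<circ> t \<in> tabs ell k"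
    "card (Invs s t) = Suc (card (Invs s (sperm i \<circ> t)))"
proof -
  have "\<exists>i. 1 \<le> i \<and> i < k \<and> s (nd t (Suc i)) < s (nd t i)"
  proof (rule ccontr)
    assume *: "\<not> ?thesis"
    have "s (nd t m) = m" if "1 \<le> m" "m \<le> k" for m
    proof (rule no_descent_fixes[of k _ m])
      fix i assume i: "1 \<le> i" "i < k"
      have "nd t i \<in> supp s" using nd_supp[OF t, of i] st i by simp
      then have "s (nd t i) \<noteq> 0" by (simp add: supp_def)
      moreover have "nd t i \<noteq> nd t (Suc i)" using nd_inj[OF t, of i "Suc i"] i by simp
      ultimately have "s (nd t i) \<noteq> s (nd t (Suc i))"
        using tabs_eqD[OF s, of "nd t i" "nd t (Suc i)"] by blast
      then show "s (nd t i) < s (nd t (Suc i))" using * i by (meson linorder_neqE_nat)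
    next
      fix l assume "1 \<le> l" "l \<le> k"
      then have "nd t l \<in> supp s" using nd_supp[OF t] st by simp
      then show "1 \<le> s (nd t l) \<and> s (nd t l) \<le> k" using tabs_le[OF s, of "nd t l"] by (simp add: supp_def)
    qed (use that in auto)
    then have "nd s m = nd t m" if "1 \<le> m" "m \<le> k" for m
      using nd_eq[OF s, of "nd t m" m] that by simp
    then show False using tabs_eqI[OF s t] ne by blast
  qed
  then obtain i where i: "1 \<le> i" "i < k" "s (nd t (Suc i)) < s (nd t i)" by blast
  have "\<not> nw_le (nd t i) (nd t (Suc i))"
    using tabs_mono[OF s, of "nd t i" "nd t (Suc i)"] nd_supp[OF t] st i by auto
  then have sw: "sperm i \<circ> t \<in> tabs ell k" using swap_tabs[OF t i(1,2)] by blast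
  have fin: "finite (Invs s (sperm i \<circ> t))"
    using finite_Invs young_finite[OF tabs_young[OF sw]] by blast
  show ?thesis
    using that[OF i sw] Invs_swap[OF t i] card_insert_disjoint[OF fin] by simp
qed

lemma tabs_exist:
  assumes "young ell D" "card D = k"
  shows "\<exists>t\<in>tabs ell k. supp t = D"
  using assms
proof (induction k arbitrary: D)
  case 0
  then show ?case using young_finite[of ell D] by (auto simp: tabs_0 supp_def)
next
  case (Suc k)
  note fin = young_finite[OF Suc.prems(1)]
  have ne: "D \<noteq> {}" using Suc.prems(2) by auto
  define f :: "node \<Rightarrow> nat" where "f = (\<lambda>(i, j, c). i + j)"
  have "Max (f ` D) \<in> f ` D" using fin ne by (intro Max_in) auto
  then obtain x where x: "x \<in> D" "f x = Max (f ` D)" by force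
  have fx: "f y \<le> f x" if "y \<in> D" for y using x fin that by simp
  have max: "y = x" if "y \<in> D" "nw_le x y" for y
    using fx[OF that(1)] that(2) by (cases x; cases y) (auto simp: f_def)
  have yD: "young ell (D - {x})"
    unfolding young_def
  proof (intro conjI ballI impI)
    show "finite (D - {x})" "D - {x} \<subseteq> nodes ell" using fin young_nodes[OF Suc.prems(1)] by auto
    fix y z assume "y \<in> D - {x}" "z \<in> nodes ell" "nw_le z y"
    then show "z \<in> D - {x}" using youngD[OF Suc.prems(1), of y z] max[of y] by auto
  qed
  have "card (D - {x}) = k" using Suc.prems(2) x(1) fin by simp
  then obtain t where t: "t \<in> tabs ell k" "supp t = D - {x}" using Suc.IH[OF yD] by blast
  have xD: "insert x (D - {x}) = D" using x(1) by auto
  have "x \<in> addable ell (supp t)"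
    using x(1) Suc.prems(1) young_nodes[OF Suc.prems(1)] unfolding addable_def t(2) by (simp add: insert_absorb subset_iff)
  from extend_tab(1,2)[OF t(1) this] show ?case unfolding t(2) xD by blast
qed

lemma finite_tabs: "finite (tabs ell k)"
proof -
  let ?B = "{1..k} \<times> {1..k} \<times> {1..ell} :: node set"
  have B: "D \<subseteq> ?B" if "young ell D" "card D = k" for D
  proof
    fix x assume x: "x \<in> D"
    obtain i j c where [simp]: "x = (i, j, c)" by (metis prod_cases3)
    have n: "(i, j, c) \<in> nodes ell" using young_nodes[OF that(1)] x by auto
    have "(\<lambda>a. (a, j, c)) ` {1..i} \<subseteq> D" "(\<lambda>b. (i, b, c)) ` {1..j} \<subseteq> D"
      using youngD[OF that(1) x] n by auto
    from this[THEN card_mono[OF young_finite[OF that(1)]]] that(2)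
    have "i \<le> k" "j \<le> k" by (simp_all add: card_image inj_on_def)
    then show "x \<in> ?B" using n by simp
  qed
  have "tabs ell k \<subseteq> {t. \<forall>x. (x \<in> ?B \<longrightarrow> t x \<in> {..k}) \<and> (x \<notin> ?B \<longrightarrow> t x = 0)}"
  proof (intro subsetI CollectI allI conjI impI)
    fix t x assume t: "t \<in> tabs ell k"
    show "t x \<in> {..k}" using tabs_le[OF t] by simp
    assume "x \<notin> ?B"
    then have "x \<notin> supp t" using B[OF tabs_young[OF t] tabs_card[OF t]] by blast
    then show "t x = 0" by (simp add: supp_def)
  qed
  also have "finite \<dots>" by (rule finite_set_of_finite_funs) auto
  finally (finite_subset) show ?thesis .
qed

section \<open>Separation of residues\<close>

definition content :: "node \<Rightarrow> int" where
  "content x = (case x of (i, j, c) \<Rightarrow> int j - int i)"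

definition comp_of :: "node \<Rightarrow> nat" where
  "comp_of x = snd (snd x)"

definition node_res :: "'k::field \<Rightarrow> (nat \<Rightarrow> 'k) \<Rightarrow> node \<Rightarrow> 'k" where
  "node_res q Q x = q powi content x * Q (comp_of x)"

lemma content_simp [simp]: "content (i, j, c) = int j - int i" and comp_of_simp [simp]: "comp_of (i, j, c) = c"
  by (simp_all add: content_def comp_of_def)

text \<open>The row or the column from the border to \<open>x\<close> already lies in \<open>D\<close>.\<close>
lemma abs_content_le_card:
  assumes "young ell D" "x \<in> addable ell D"
  shows "\<bar>content x\<bar> \<le> int (card {z \<in> D. comp_of z = comp_of x})"
proof -
  obtain i j c where x: "x = (i, j, c)" by (metis prod_cases3)
  note a = addableD[OF assms(2), unfolded x]
  have n: "1 \<le> i" "1 \<le> j" "1 \<le> c" "c \<le> ell" using a(1) by simp_all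
  let ?D = "{z \<in> D. comp_of z = c}"
  have fin: "finite ?D" using young_finite[OF assms(1)] by simp
  have "(\<lambda>b. (i, b, c)) ` {1..<j} \<subseteq> ?D" "(\<lambda>b. (b, j, c)) ` {1..<i} \<subseteq> ?D"
    by (intro image_subsetI CollectI conjI a(4); use n in simp)+
  from this[THEN card_mono[OF fin]] have "j - 1 \<le> card ?D" "i - 1 \<le> card ?D"
    by (simp_all add: card_image inj_on_def)
  then show ?thesis using n by (simp add: x)
qed

lemma addable_content_diff:
  assumes D: "young ell D" and xy: "x \<in> addable ell D" "y \<in> addable ell D" and ne: "comp_of x \<noteq> comp_of y"
  shows "\<bar>content x - content y\<bar> \<le> int (card D)"
proof -
  let ?A = "\<lambda>x. {z \<in> D. comp_of z = comp_of x}"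
  have fin: "finite D" using young_finite[OF D] .
  have "card (?A x) + card (?A y) = card (?A x \<union> ?A y)"
    using fin ne by (intro card_Un_disjoint[symmetric]) auto
  also have "\<dots> \<le> card D" using fin by (intro card_mono) auto
  finally show ?thesis using abs_content_le_card[OF D xy(1)] abs_content_le_card[OF D xy(2)] by linarith
qed

lemma addable_content_same:
  assumes D: "young ell D" and xy: "x \<in> addable ell D" "y \<in> addable ell D" "comp_of x = comp_of y" "x \<noteq> y"
  shows "2 \<le> \<bar>content x - content y\<bar>" "\<bar>content x - content y\<bar> \<le> int (card D) + 1"
proof -
  have main: "2 \<le> \<bar>content x - content y\<bar> \<and> \<bar>content x - content y\<bar> \<le> int (card D) + 1"
    if x: "(i, j, c) \<in> addable ell D" "x = (i, j, c)" and y: "(i', j', c) \<in> addable ell D" "y = (i', j', c)"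
      and lt: "i < i'" for x y i j i' j' c
  proof -
    note ax = addableD[OF x(1)] and ay = addableD[OF y(1)]
    have jj: "j' < j"
    proof (rule ccontr)
      assume "\<not> j' < j"
      then have "(i, j, c) \<in> D" using ay(4)[of "(i, j, c)"] ax(1) lt by simp
      then show False using ax(2) by simp
    qed
    let ?A = "(\<lambda>b. (i, b, c)) ` {j'..<j}" and ?B = "(\<lambda>b. (b, j', c)) ` {Suc i..<i'}"
    have "?A \<subseteq> D" by (intro image_subsetI ax(4)) (use ax(1) ay(1) in auto)
    moreover have "?B \<subseteq> D" by (intro image_subsetI ay(4)) (use ax(1) ay(1) in auto)
    ultimately have "card (?A \<union> ?B) \<le> card D" using young_finite[OF D] by (intro card_mono) auto
    moreover have "card (?A \<union> ?B) = card ?A + card ?B" by (rule card_Un_disjoint) auto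
    moreover have "card ?A = j - j'" "card ?B = i' - Suc i" by (simp_all add: card_image inj_on_def)
    ultimately have "(j - j') + (i' - Suc i) \<le> card D" by simp
    then show ?thesis using lt jj unfolding x y by simp
  qed
  obtain i j c where x: "x = (i, j, c)" by (metis prod_cases3)
  obtain i' j' c' where y': "y = (i', j', c')" by (metis prod_cases3)
  have y: "y = (i', j', c)" using y' xy(3) x by simp
  note ax = addableD[OF xy(1)] and ay = addableD[OF xy(2)]
  have "i \<noteq> i'"
  proof
    assume "i = i'"
    then have "nw_le x y \<or> nw_le y x" using x y by auto
    then show False using ax(4)[of y] ay(4)[of x] ax(1,2) ay(1,2) xy(4) by auto
  qed
  then have "2 \<le> \<bar>content x - content y\<bar> \<and> \<bar>content x - content y\<bar> \<le> int (card D) + 1"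
  proof (cases "i < i'")
    case True then show ?thesis by (rule main[OF xy(1)[unfolded x] x xy(2)[unfolded y] y])
  next
    case False
    then have "i' < i" using \<open>i \<noteq> i'\<close> by simp
    from main[OF xy(2)[unfolded y] y xy(1)[unfolded x] x this] show ?thesis
      by (simp only: abs_minus_commute)
  qed
  then show "2 \<le> \<bar>content x - content y\<bar>" "\<bar>content x - content y\<bar> \<le> int (card D) + 1" by blast+
qed

text \<open>Semisimplicity enters the argument only in the form of the nonvanishing of the factors of
  the Poincare polynomial: \<open>q\<close> has no small order, and no two of the \<open>Q\<^sub>c\<close> are related by a small
  power of \<open>q\<close>.\<close>

locale separated =
  fixes ell n :: nat and q :: "'k::field" and Q :: "nat \<Rightarrow> 'k"
  assumes n1: "1 \<le> n" and q0: "q \<noteq> 0"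
    and Q0: "2 \<le> n \<Longrightarrow> 1 \<le> c \<Longrightarrow> c \<le> ell \<Longrightarrow> Q c \<noteq> 0"
    and q_pow: "1 \<le> d \<Longrightarrow> d \<le> n \<Longrightarrow> q ^ d \<noteq> 1"
    and Q_sep: "1 \<le> c \<Longrightarrow> c \<le> ell \<Longrightarrow> 1 \<le> d \<Longrightarrow> d \<le> ell \<Longrightarrow> c \<noteq> d \<Longrightarrow> \<bar>e\<bar> < int n \<Longrightarrow> q powi e * Q c \<noteq> Q d"
begin

abbreviation nres :: "node \<Rightarrow> 'k" where "nres \<equiv> node_res q Q"

lemma q1: "q \<noteq> 1" using q_pow[of 1] n1 by simp

lemma q_powi_ne_1: "e \<noteq> 0 \<Longrightarrow> \<bar>e\<bar> \<le> int n \<Longrightarrow> q powi e \<noteq> 1"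
  using q_pow[of "nat e"] q_pow[of "nat (- e)"]
  by (cases "0 \<le> e") (auto simp: power_int_def power_inverse)

lemma q_powi_eqD:
  assumes "q powi a * z = q powi b * z'"
  shows "q powi (a - b) * z = z'"
  using assms q0 by (simp add: power_int_diff field_simps)

lemma residues_ne:
  assumes D: "young ell D" and xy: "x \<in> addable ell D" "y \<in> addable ell D" "x \<noteq> y"
    and e: "e \<noteq> 0 \<Longrightarrow> card D + 2 \<le> n" "card D < n" "\<bar>e\<bar> \<le> 1"
  shows "nres x \<noteq> q powi e * nres y"
proof
  assume eq: "nres x = q powi e * nres y"
  have c: "1 \<le> comp_of x" "comp_of x \<le> ell" "1 \<le> comp_of y" "comp_of y \<le> ell"
    using addableD(1)[OF xy(1)] addableD(1)[OF xy(2)] by (auto simp: nodes_def)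
  have "q powi content x * Q (comp_of x) = q powi (content y + e) * Q (comp_of y)"
    using eq q0 by (simp add: node_res_def power_int_add mult_ac)
  then have *: "q powi (content x - (content y + e)) * Q (comp_of x) = Q (comp_of y)"
    by (rule q_powi_eqD)
  show False
  proof (cases "comp_of x = comp_of y")
    case True
    note b = addable_content_same[OF D xy(1,2) True xy(3)]
    have "2 \<le> n" using b e(2) by linarith
    then have "q powi (content x - (content y + e)) = 1" using * True Q0 c by simp
    moreover have "content x - (content y + e) \<noteq> 0" using b e by linarith
    moreover have "\<bar>content x - (content y + e)\<bar> \<le> int n" using b e by (cases "e = 0") (simp, linarith)
    ultimately show False using q_powi_ne_1 by blast
  next
    case False
    have "\<bar>content x - (content y + e)\<bar> < int n"
      using addable_content_diff[OF D xy(1,2) False] e by (cases "e = 0") (simp, linarith)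
    then show False using * Q_sep[OF c False] by blast
  qed
qed

lemma residues_distinct:
  "young ell D \<Longrightarrow> card D < n \<Longrightarrow> x \<in> addable ell D \<Longrightarrow> y \<in> addable ell D \<Longrightarrow> nres x = nres y \<Longrightarrow> x = y"
  using residues_ne[of D x y 0] by auto

lemma nres_0: "2 \<le> n \<Longrightarrow> x \<in> nodes ell \<Longrightarrow> nres x \<noteq> 0"
  using Q0 q0 by (auto simp: node_res_def nodes_def)

lemma residues_not_adjacent:
  assumes "young ell D" "card D + 2 \<le> n" "x \<in> addable ell D" "y \<in> addable ell D"
  shows "nres x \<noteq> q * nres y" "nres x \<noteq> inverse q * nres y"
proof -
  have "nres x \<noteq> q * nres x" "nres x \<noteq> inverse q * nres x"
    using nres_0[OF _ addableD(1)[OF assms(3)]] assms(2) q0 q1 by (auto simp: field_simps)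
  then show "nres x \<noteq> q * nres y" "nres x \<noteq> inverse q * nres y"
    using residues_ne[of D x y 1] residues_ne[of D x y "-1"] assms by (cases "x = y"; auto)+
qed

text \<open>The residue sequence of a filling determines the filling, because the nodes that can be added
  to a Young set have different residues. Even the residue sequence with two entries exchanged
  determines its filling, if it has one.\<close>

abbreviation res_at :: "tab \<Rightarrow> nat \<Rightarrow> 'k" where "res_at t m \<equiv> nres (nd t m)"

lemma nd_eq_of_residues:
  assumes t: "t \<in> tabs ell k" and u: "u \<in> tabs ell k" and k: "k \<le> n" and l: "l \<le> k"
    and eq: "\<And>m. 1 \<le> m \<Longrightarrow> m \<le> l \<Longrightarrow> res_at t m = res_at u m"
  shows "restrict_tab t l = restrict_tab u l"
  using l eq
proof (induction l)
  case 0
  then show ?case using restrict_tab_tabs(1)[OF t, of 0] restrict_tab_tabs(1)[OF u, of 0] by (simp add: tabs_0)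
next
  case (Suc l)
  have IH: "restrict_tab t l = restrict_tab u l" using Suc by simp
  have y: "restrict_tab t l \<in> tabs ell l" using restrict_tab_tabs(1)[OF t] Suc.prems by simp
  have "nd t (Suc l) = nd u (Suc l)"
    using residues_distinct[OF tabs_young[OF y], of "nd t (Suc l)" "nd u (Suc l)"] tabs_card[OF y] k Suc.prems
      restrict_tab_addable[OF t, of l] restrict_tab_addable[OF u, of l] IH by simp
  moreover have tl: "restrict_tab t (Suc l) \<in> tabs ell (Suc l)" and ul: "restrict_tab u (Suc l) \<in> tabs ell (Suc l)"
    using restrict_tab_tabs(1)[OF t] restrict_tab_tabs(1)[OF u] Suc.prems by blast+
  moreover have "restrict_tab (restrict_tab t (Suc l)) l = restrict_tab t l" for t
    by (auto simp: restrict_tab_def)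
  ultimately show ?case
    using extend_restrict(1)[OF tl] extend_restrict(1)[OF ul] IH
      restrict_tab_tabs(3)[OF t Suc.prems(1), of "Suc l"] restrict_tab_tabs(3)[OF u Suc.prems(1), of "Suc l"]
    by simp
qed

lemma restrict_tab_self: "t \<in> tabs ell k \<Longrightarrow> restrict_tab t k = t"
  using tabs_le[of t ell k] by (simp add: restrict_tab_def)

lemma tab_eq_of_residues:
  assumes "t \<in> tabs ell k" "u \<in> tabs ell k" "k \<le> n"
    and "\<And>m. 1 \<le> m \<Longrightarrow> m \<le> k \<Longrightarrow> res_at t m = res_at u m"
  shows "t = u"
  using nd_eq_of_residues[OF assms(1,2,3) order_refl assms(4)] restrict_tab_self[OF assms(1)]
    restrict_tab_self[OF assms(2)] by simp

lemma res_at_neighbours: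
  assumes t: "t \<in> tabs ell k" and i: "1 \<le> i" "i < k" and k: "k \<le> n"
  shows "res_at t i \<noteq> res_at t (Suc i)"
    and "sperm i \<circ> t \<in> tabs ell k \<Longrightarrow> res_at t (Suc i) \<noteq> q * res_at t i"
    and "sperm i \<circ> t \<in> tabs ell k \<Longrightarrow> res_at t i \<noteq> q * res_at t (Suc i)"
    and "sperm i \<circ> t \<notin> tabs ell k \<Longrightarrow> res_at t (Suc i) = q * res_at t i \<and> nd t (Suc i) = (fst (nd t i), Suc (fst (snd (nd t i))), comp_of (nd t i)) \<or>
      res_at t (Suc i) = inverse q * res_at t i \<and> nd t (Suc i) = (Suc (fst (nd t i)), fst (snd (nd t i)), comp_of (nd t i))"
proof -
  let ?D = "supp (restrict_tab t (i - 1))"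
  have i': "i - 1 < k" "Suc (i - 1) = i" "i - 1 \<le> k" using i by simp_all
  have r: "restrict_tab t (i - 1) \<in> tabs ell (i - 1)" using restrict_tab_tabs(1)[OF t i'(3)] .
  have D: "young ell ?D" "card ?D + 2 \<le> n" "card ?D < n" using tabs_young[OF r] tabs_card[OF r] i k by simp_all
  have x: "nd t i \<in> addable ell ?D" using restrict_tab_addable[OF t i'(1)] i'(2) by simp
  have y: "nd t (Suc i) \<in> addable ell ?D" if s: "sperm i \<circ> t \<in> tabs ell k"
  proof -
    have "restrict_tab (sperm i \<circ> t) (i - 1) = restrict_tab t (i - 1)"
    proof
      fix x show "restrict_tab (sperm i \<circ> t) (i - 1) x = restrict_tab t (i - 1) x"
        using i by (cases "t x = i"; cases "t x = Suc i") (auto simp: restrict_tab_def)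
    qed
    moreover have "nd (sperm i \<circ> t) i = nd t (Suc i)" using swap_nd[OF t i s, of i] i by simp
    ultimately show ?thesis using restrict_tab_addable[OF s i'(1)] i'(2) by simp
  qed
  have ne: "nd t i \<noteq> nd t (Suc i)" using nd_inj[OF t, of i "Suc i"] i by simp
  show "res_at t (Suc i) \<noteq> q * res_at t i" "res_at t i \<noteq> q * res_at t (Suc i)" if "sperm i \<circ> t \<in> tabs ell k"
    using residues_not_adjacent(1)[OF D(1,2)] x y[OF that] by blast+
  show adj: "res_at t (Suc i) = q * res_at t i \<and> nd t (Suc i) = (fst (nd t i), Suc (fst (snd (nd t i))), comp_of (nd t i)) \<or>
      res_at t (Suc i) = inverse q * res_at t i \<and> nd t (Suc i) = (Suc (fst (nd t i)), fst (snd (nd t i)), comp_of (nd t i))"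
    if "sperm i \<circ> t \<notin> tabs ell k"
  proof -
    have "nw_le (nd t i) (nd t (Suc i))" using swap_tabs[OF t i] that by blast
    then show ?thesis
    proof (rule adjacent_entries[OF t i])
      fix a b c assume "nd t i = (a, b, c)" "nd t (Suc i) = (a, Suc b, c)"
      then show ?thesis using q0 by (simp add: node_res_def power_int_add power_int_diff)
    next
      fix a b c assume "nd t i = (a, b, c)" "nd t (Suc i) = (Suc a, b, c)"
      then show ?thesis using q0 by (simp add: node_res_def power_int_add power_int_diff field_simps)
    qed
  qed
  have n0: "res_at t i \<noteq> 0" using nres_0[OF _ addableD(1)[OF x]] D(2) by simp
  show "res_at t i \<noteq> res_at t (Suc i)"
  proof (cases "sperm i \<circ> t \<in> tabs ell k")
    case True
    then show ?thesis using residues_distinct[OF D(1,3) x y] ne by blast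
  next
    case False
    then show ?thesis using adj q1 q0 n0 by (auto simp: field_simps)
  qed
qed

lemma swapped_residues:
  assumes t: "t \<in> tabs ell k" and u: "u \<in> tabs ell k" and i: "1 \<le> i" "i < k" and k: "k \<le> n"
    and eq: "\<And>m. 1 \<le> m \<Longrightarrow> m \<le> k \<Longrightarrow> res_at u m = res_at t (sperm i m)"
  shows "sperm i \<circ> t \<in> tabs ell k"
proof (rule ccontr)
  assume n: "sperm i \<circ> t \<notin> tabs ell k"
  have "restrict_tab t (i - 1) = restrict_tab u (i - 1)"
  proof (rule nd_eq_of_residues[OF t u k])
    fix m assume "1 \<le> m" "m \<le> i - 1"
    then show "res_at t m = res_at u m" using eq[of m] i by simp
  qed (use i in simp)
  moreover have i': "i - 1 < k" "Suc (i - 1) = i" "i - 1 \<le> k" using i by simp_all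
  moreover have r: "restrict_tab t (i - 1) \<in> tabs ell (i - 1)" using restrict_tab_tabs(1)[OF t i'(3)] .
  ultimately have "nd t i \<in> addable ell (supp (restrict_tab t (i - 1)))" "nd u i \<in> addable ell (supp (restrict_tab t (i - 1)))"
    using restrict_tab_addable[OF t i'(1)] restrict_tab_addable[OF u i'(1)] by simp_all
  moreover have "res_at u i = res_at t (Suc i)" using eq[of i] i by simp
  ultimately show False
    using residues_not_adjacent[OF tabs_young[OF r], of "nd u i" "nd t i"] tabs_card[OF r] i k
      res_at_neighbours(4)[OF t i k n] by auto
qed

lemma phi_factors:
  assumes t: "t \<in> tabs ell k" and i: "1 \<le> i" "i < k" and k: "k \<le> n" and s: "sperm i \<circ> t \<in> tabs ell k"
  defines "a \<equiv> res_at t i" and "b \<equiv> res_at t (Suc i)"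
  shows "(q * a - b) * (a - q * b) / (a - b)^2 \<noteq> 0"
  using res_at_neighbours[OF t i k] s unfolding a_def b_def by auto

end

section \<open>Jucys-Murphy elements and their joint eigenvectors\<close>

text \<open>The relations of the Hecke algebra in a ring \<open>'a\<close> over the scalars \<open>sc\<close>. The elements of \<open>'a\<close>
  also serve as the vectors of a left module, for which the letter \<open>v\<close> is used.\<close>

locale hecke_ring =
  fixes ell n :: nat and q :: "'k::field" and Q :: "nat \<Rightarrow> 'k"
    and sc :: "'k \<Rightarrow> 'a::ring_1" and T :: "nat \<Rightarrow> 'a"
  assumes q_nz: "q \<noteq> 0"
    and sc_add: "sc (a + b) = sc a + sc b" and sc_mult: "sc (a * b) = sc a * sc b" and sc_1 [simp]: "sc 1 = 1"
    and T_sc: "T i * sc c = sc c * T i"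
    and T_cyc: "prod_list (map (\<lambda>c. T 0 - sc (Q c)) [1..<Suc ell]) = 0"
    and T_0101: "2 \<le> n \<Longrightarrow> T 0 * T 1 * T 0 * T 1 = T 1 * T 0 * T 1 * T 0"
    and T_quad: "1 \<le> i \<Longrightarrow> i < n \<Longrightarrow> (T i - sc q) * (T i + 1) = 0"
    and T_far: "Suc i < j \<Longrightarrow> j < n \<Longrightarrow> T i * T j = T j * T i"
    and T_braid: "1 \<le> i \<Longrightarrow> Suc i < n \<Longrightarrow> T i * T (Suc i) * T i = T (Suc i) * T i * T (Suc i)"

sublocale hecke_ring \<subseteq> braided n T
  by unfold_locales (rule T_far T_braid; assumption)+

context hecke_ring
begin

lemma sc_0 [simp]: "sc 0 = 0"
  using sc_add[of 0 0] by simp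

lemma sc_minus: "sc (- a) = - sc a"
  using sc_add[of a "- a"] by (simp add: eq_neg_iff_add_eq_0 add.commute)

lemma sc_diff: "sc (a - b) = sc a - sc b"
  using sc_add[of a "- b"] by (simp add: sc_minus)

lemma sc_sc [simp]: "sc a * (sc b * v) = sc (a * b) * v"
  by (simp add: sc_mult mult.assoc)

lemma sc_commute: "sc a * sc b = sc b * sc a"
  by (metis sc_mult mult.commute)

lemma sc_sum: "sc (sum f A) = (\<Sum>x\<in>A. sc (f x))"
  by (induction A rule: infinite_finite_induct) (auto simp: sc_add)

lemma sc_plus_v: "sc a * v + sc b * v = sc (a + b) * v"
  and sc_minus_v: "sc a * v - sc b * v = sc (a - b) * v"
  by (simp_all add: sc_add sc_diff distrib_right left_diff_distrib)

lemma sc_cancel: "c \<noteq> 0 \<Longrightarrow> sc c * v = sc c * w \<longleftrightarrow> v = w"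
proof
  assume "c \<noteq> 0" "sc c * v = sc c * w"
  then have "sc (inverse c) * (sc c * v) = sc (inverse c) * (sc c * w)" by simp
  then show "v = w" using \<open>c \<noteq> 0\<close> by simp
qed simp

lemma sc_v_eq_0 [simp]: "sc c * v = 0 \<longleftrightarrow> c = 0 \<or> v = 0"
  using sc_cancel[of c v 0] by auto

lemma T_sc_v [simp]: "T i * (sc c * v) = sc c * (T i * v)"
  by (metis T_sc mult.assoc)

lemma T_sq_v: "1 \<le> i \<Longrightarrow> i < n \<Longrightarrow> T i * (T i * v) = sc (q - 1) * (T i * v) + sc q * v"
proof -
  assume i: "1 \<le> i" "i < n"
  have "T i * T i = sc (q - 1) * T i + sc q"
    using T_quad[OF i] by (simp add: algebra_simps sc_diff)
  then have "T i * T i * v = (sc (q - 1) * T i + sc q) * v" by simp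
  then show ?thesis by (simp add: mult.assoc distrib_right)
qed

definition scal_comm :: "'a \<Rightarrow> bool" where
  "scal_comm x \<longleftrightarrow> (\<forall>c. x * sc c = sc c * x)"

lemma scal_comm_v: "scal_comm x \<Longrightarrow> x * (sc c * v) = sc c * (x * v)"
  by (metis scal_comm_def mult.assoc)

lemma scal_comm_intros [simp, intro]:
  "scal_comm (T i)" "scal_comm (sc c)" "scal_comm 1" "scal_comm x \<Longrightarrow> scal_comm y \<Longrightarrow> scal_comm (x * y)"
  "scal_comm x \<Longrightarrow> scal_comm y \<Longrightarrow> scal_comm (x + y)" "scal_comm x \<Longrightarrow> scal_comm y \<Longrightarrow> scal_comm (x - y)"
proof -
  show "scal_comm x \<Longrightarrow> scal_comm y \<Longrightarrow> scal_comm (x * y)"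
    by (simp add: scal_comm_def mult.assoc) (simp add: mult.assoc[symmetric])
qed (simp_all add: scal_comm_def T_sc sc_commute distrib_left distrib_right right_diff_distrib left_diff_distrib)

lemma scal_comm_prod_list [simp, intro]: "(\<And>x. x \<in> set xs \<Longrightarrow> scal_comm x) \<Longrightarrow> scal_comm (prod_list xs)"
  by (induction xs) auto

lemma scal_comm_sum [simp, intro]: "(\<And>x. x \<in> A \<Longrightarrow> scal_comm (f x)) \<Longrightarrow> scal_comm (sum f A)"
  by (simp add: scal_comm_def sum_distrib_left sum_distrib_right)

lemma scal_comm_word [simp]: "scal_comm (word_prod is)" "scal_comm (T_of w)"
  by (auto simp: word_prod_def T_of_def intro!: scal_comm_prod_list)

definition L :: "nat \<Rightarrow> 'a" where
  "L m = sc (q powi (1 - int m)) * word_prod (rev [1..<m]) * T 0 * word_prod [1..<m]"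

lemma L_1: "L 1 = T 0"
  by (simp add: L_def)

lemma scal_comm_L [simp]: "scal_comm (L m)"
  by (simp add: L_def)

lemma L_sc_v [simp]: "L m * (sc c * v) = sc c * (L m * v)"
  by (simp add: scal_comm_v)

lemma word_sc_v [simp]: "word_prod is * (sc c * v) = sc c * (word_prod is * v)"
  by (simp add: scal_comm_v)

lemma L_Suc: assumes "1 \<le> m" shows "L (Suc m) = sc (inverse q) * (T m * (L m * T m))"
proof -
  have "q powi (1 - int (Suc m)) = inverse q * q powi (1 - int m)"
    using q_nz power_int_add[of q "-1" "1 - int m"] by simp
  then show ?thesis using assms by (simp add: L_def mult.assoc)
qed

lemma T_L_T: "1 \<le> i \<Longrightarrow> T i * (L i * (T i * v)) = sc q * (L (Suc i) * v)"
  using q_nz by (simp add: L_Suc mult.assoc)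

lemma L_T: assumes i: "1 \<le> i" "i < n"
  shows "L i * (T i * v) = T i * (L (Suc i) * v) - sc (q - 1) * (L (Suc i) * v)"
proof -
  have "T i * (L (Suc i) * v) = sc (inverse q) * (T i * (T i * (L i * (T i * v))))"
    by (simp add: L_Suc[OF i(1)] mult.assoc)
  also have "\<dots> = sc ((q - 1) / q) * (T i * (L i * (T i * v))) + L i * (T i * v)"
    using q_nz by (simp add: T_sq_v[OF i] distrib_left divide_inverse mult.commute)
  also have "sc ((q - 1) / q) * (T i * (L i * (T i * v))) = sc (q - 1) * (L (Suc i) * v)"
    using q_nz by (simp add: T_L_T[OF i(1)])
  finally show ?thesis by simp
qed

lemma L_Suc_T: assumes i: "1 \<le> i" "i < n"
  shows "L (Suc i) * (T i * v) = T i * (L i * v) + sc (q - 1) * (L (Suc i) * v)"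
proof -
  have "L (Suc i) * (T i * v) = sc (inverse q) * (T i * (L i * (T i * (T i * v))))"
    by (simp add: L_Suc[OF i(1)] mult.assoc)
  also have "\<dots> = sc ((q - 1) / q) * (T i * (L i * (T i * v))) + T i * (L i * v)"
    using q_nz by (simp add: T_sq_v[OF i] distrib_left divide_inverse mult.commute)
  also have "sc ((q - 1) / q) * (T i * (L i * (T i * v))) = sc (q - 1) * (L (Suc i) * v)"
    using q_nz by (simp add: T_L_T[OF i(1)])
  finally show ?thesis by simp
qed

lemma comm_v: "x * y = y * x \<Longrightarrow> x * (y * v) = y * (x * v)" for x y v :: 'a
  by (metis mult.assoc)

lemma comm_mult: "x * y = y * x \<Longrightarrow> x * z = z * x \<Longrightarrow> x * (y * z) = (y * z) * x" for x y z :: 'a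
  by (metis mult.assoc)

lemma comm_word: "(\<And>j. j \<in> set js \<Longrightarrow> x * T j = T j * x) \<Longrightarrow> x * word_prod js = word_prod js * x"
  by (induction js) (simp_all add: comm_mult del: mult.assoc)

lemma comm_L:
  assumes "scal_comm x" "1 \<le> m" "\<And>j. j < m \<Longrightarrow> x * T j = T j * x"
  shows "x * L m = L m * x"
proof -
  have "x * word_prod (rev [1..<m]) = word_prod (rev [1..<m]) * x" "x * word_prod [1..<m] = word_prod [1..<m] * x"
    "x * T 0 = T 0 * x" using assms by (auto intro!: comm_word)
  then show ?thesis using assms(1) unfolding L_def scal_comm_def by (simp add: comm_mult)
qed

lemma L_comm_T_above: "1 \<le> m \<Longrightarrow> m < i \<Longrightarrow> i < n \<Longrightarrow> T i * L m = L m * T i"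
  by (rule comm_L) (simp_all add: T_far[symmetric])

lemma L_comm_T_below: "1 \<le> i \<Longrightarrow> Suc i < m \<Longrightarrow> m \<le> n \<Longrightarrow> T i * L m = L m * T i"
proof (induction m)
  case (Suc m)
  show ?case
  proof (cases "Suc i = m")
    case True
    let ?a = "T i" and ?b = "T (Suc i)" and ?X = "L i"
    have braid: "?a * (?b * (?a * v)) = ?b * (?a * (?b * v))" for v
      using arg_cong[OF T_braid[of i], of "\<lambda>y. y * v"] Suc.prems True by (simp add: mult.assoc)
    have Xb: "?b * (?X * v) = ?X * (?b * v)" for v
      using L_comm_T_above[of i "Suc i"] Suc.prems True by (intro comm_v) auto
    have m: "L (Suc m) = sc (inverse q * inverse q) * (?b * (?a * (?X * (?a * ?b))))"
      using L_Suc[of "Suc i"] L_Suc[of i] Suc.prems by (simp add: mult.assoc True[symmetric])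
    have "?a * (?b * (?a * (?X * (?a * ?b)))) = ?b * (?a * (?X * (?b * (?a * ?b))))"
      by (simp only: braid Xb)
    also have "\<dots> = ?b * (?a * (?X * (?a * (?b * ?a))))"
      using braid[of 1] by simp
    finally show ?thesis unfolding m by (simp add: mult.assoc)
  next
    case False
    then have m: "1 \<le> m" "Suc i < m" "m < n" using Suc.prems by auto
    have "T i * L m = L m * T i" "T i * T m = T m * T i" using Suc.IH m Suc.prems T_far[of i m] by auto
    then have "T i * (T m * (L m * T m)) = T m * (L m * T m) * T i" by (simp add: comm_mult)
    then show ?thesis unfolding L_Suc[OF m(1)] by (simp add: mult.assoc)
  qed
qed simp

lemma L_comm_T_0: "2 \<le> m \<Longrightarrow> m \<le> n \<Longrightarrow> T 0 * L m = L m * T 0"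
proof (induction m)
  case (Suc m)
  show ?case
  proof (cases "m = 1")
    case True
    have "L (Suc m) = sc (inverse q) * (T 1 * (T 0 * T 1))"
      using True by (simp add: L_Suc L_1[symmetric] One_nat_def)
    then show ?thesis using T_0101 Suc.prems by (simp add: mult.assoc)
  next
    case False
    then have m: "1 \<le> m" "2 \<le> m" "m < n" using Suc.prems by auto
    have "T 0 * L m = L m * T 0" "T 0 * T m = T m * T 0" using Suc.IH m T_far[of 0 m] by auto
    then have "T 0 * (T m * (L m * T m)) = T m * (L m * T m) * T 0" by (simp add: comm_mult)
    then show ?thesis unfolding L_Suc[OF m(1)] by (simp add: mult.assoc)
  qed
qed simp

lemma T_L_comm:
  assumes "1 \<le> i" "i < n" "1 \<le> m" "m \<le> n" "m \<noteq> i" "m \<noteq> Suc i"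
  shows "T i * L m = L m * T i" "T i * (L m * v) = L m * (T i * v)"
proof -
  show "T i * L m = L m * T i"
    using L_comm_T_above[of m i] L_comm_T_below[of i m] assms by (cases "m < i") auto
  then show "T i * (L m * v) = L m * (T i * v)" by (rule comm_v)
qed

lemma L_L_comm:
  assumes "1 \<le> l" "l \<le> n" "1 \<le> m" "m \<le> n"
  shows "L l * L m = L m * L l" "L l * (L m * v) = L m * (L l * v)"
proof -
  have *: "L m * L l = L l * L m" if "1 \<le> l" "l < m" "m \<le> n" for l m
  proof (rule comm_L)
    fix j assume "j < l"
    then show "L m * T j = T j * L m"
      using L_comm_T_below[of j m] L_comm_T_0[of m] that by (cases "j = 0") auto
  qed (use that in auto)
  show "L l * L m = L m * L l"
    using *[of l m] *[of m l] assms by (cases l m rule: linorder_cases) auto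
  then show "L l * (L m * v) = L m * (L l * v)" by (rule comm_v)
qed

text \<open>The elementary symmetric functions of \<open>L\<^sub>i\<close> and \<open>L\<^sub>i\<^sub>+\<^sub>1\<close> commute with \<open>T\<^sub>i\<close>.\<close>
lemma T_comm_L_pair:
  assumes i: "1 \<le> i" "i < n"
  shows "T i * ((L i - sc c) * (L (Suc i) - sc c)) = (L i - sc c) * (L (Suc i) - sc c) * T i"
proof -
  have s: "T i * ((L i + L (Suc i)) * v) = (L i + L (Suc i)) * (T i * v)" for v
    using L_T[OF i, of v] L_Suc_T[OF i, of v] by (simp add: distrib_right distrib_left)
  have p: "T i * (L i * (L (Suc i) * v)) = L i * (L (Suc i) * (T i * v))" for v
  proof -
    have "L i * (L (Suc i) * (T i * v)) = L i * (T i * (L i * v)) + sc (q - 1) * (L i * (L (Suc i) * v))"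
      by (simp add: L_Suc_T[OF i] distrib_left)
    also have "L i * (T i * (L i * v)) = T i * (L i * (L (Suc i) * v)) - sc (q - 1) * (L i * (L (Suc i) * v))"
      using L_L_comm(2)[of i "Suc i" v] i by (simp add: L_T[OF i])
    finally show ?thesis by simp
  qed
  have "(L i - sc c) * (L (Suc i) - sc c) * v = L i * (L (Suc i) * v) - sc c * ((L i + L (Suc i)) * v) + sc (c * c) * v" for v
    by (simp add: mult.assoc left_diff_distrib right_diff_distrib distrib_right distrib_left)
  note expand = this
  have "T i * ((L i - sc c) * (L (Suc i) - sc c) * 1) = (L i - sc c) * (L (Suc i) - sc c) * (T i * 1)"
    unfolding expand by (simp only: right_diff_distrib distrib_left T_sc_v s p)
  then show ?thesis by (simp add: mult.assoc)
qed

definition wt :: "nat \<Rightarrow> (nat \<Rightarrow> 'k) \<Rightarrow> 'a \<Rightarrow> bool" where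
  "wt k c v \<longleftrightarrow> (\<forall>m. 1 \<le> m \<longrightarrow> m \<le> k \<longrightarrow> L m * v = sc (c m) * v)"

lemma wtD: "wt k c v \<Longrightarrow> 1 \<le> m \<Longrightarrow> m \<le> k \<Longrightarrow> L m * v = sc (c m) * v"
  by (simp add: wt_def)

lemma wt_0 [simp]: "wt k c 0" by (simp add: wt_def)

lemma wt_add: "wt k c v \<Longrightarrow> wt k c w \<Longrightarrow> wt k c (v + w)"
  by (simp add: wt_def distrib_left)

lemma wt_sc: "wt k c v \<Longrightarrow> wt k c (sc d * v)"
  by (simp add: wt_def mult.commute)

lemma wt_diff: "wt k c v \<Longrightarrow> wt k c w \<Longrightarrow> wt k c (v - w)"
  by (simp add: wt_def right_diff_distrib)

lemma wt_L: "wt k c v \<Longrightarrow> k \<le> n \<Longrightarrow> 1 \<le> m \<Longrightarrow> m \<le> n \<Longrightarrow> wt k c (L m * v)"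
  using L_L_comm(2)[of _ m] by (simp add: wt_def)

lemma wt_T_far: "wt k c v \<Longrightarrow> k \<le> n \<Longrightarrow> 1 \<le> i \<Longrightarrow> i < n \<Longrightarrow> k < i \<Longrightarrow> wt k c (T i * v)"
  unfolding wt_def using T_L_comm(2)[of i _ v, symmetric] by (auto simp: )

lemma wt_cong: "(\<And>m. 1 \<le> m \<Longrightarrow> m \<le> k \<Longrightarrow> c m = d m) \<Longrightarrow> wt k c v \<longleftrightarrow> wt k d v"
  by (simp add: wt_def)

lemma L_minus_v: "L m * v = sc c * v \<Longrightarrow> (L m - sc d) * v = sc (c - d) * v"
  by (simp add: left_diff_distrib sc_minus_v)

text \<open>The diagonal coefficient of \<open>T\<^sub>i\<close> on a joint eigenvector with eigenvalues \<open>a\<close>, \<open>b\<close> of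
  \<open>L\<^sub>i\<close>, \<open>L\<^sub>i\<^sub>+\<^sub>1\<close>. Subtracting it from \<open>T\<^sub>i\<close> gives an intertwiner, whose square is \<open>phi\<close>.\<close>
definition diag :: "'k \<Rightarrow> 'k \<Rightarrow> 'k" where
  "diag a b = (q - 1) * b / (b - a)"

definition phi :: "'k \<Rightarrow> 'k \<Rightarrow> 'k" where
  "phi a b = (q * a - b) * (a - q * b) / (a - b)^2"

lemma intertwine:
  assumes i: "1 \<le> i" "i < n" and ab: "a \<noteq> b" and v: "L i * v = sc a * v" "L (Suc i) * v = sc b * v"
  defines "v' \<equiv> T i * v - sc (diag a b) * v"
  shows "L i * v' = sc b * v'" "L (Suc i) * v' = sc a * v'" "T i * v' - sc (diag b a) * v' = sc (phi a b) * v"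
proof -
  have e: "a - b \<noteq> 0" "b - a = - (a - b)" using ab by simp_all
  have dd: "diag a b = - ((q - 1) * b / (a - b))" "diag b a = (q - 1) * a / (a - b)"
    by (simp_all only: diag_def e minus_divide_right[symmetric])
  have d: "(q - 1) * b + diag a b * a = b * diag a b" "(q - 1) * b - diag a b * b = - (a * diag a b)"
    using ab by (simp_all add: diag_def field_simps)
  have "L i * v' = sc b * (T i * v) - (sc ((q - 1) * b) * v + sc (diag a b * a) * v)"
    unfolding v'_def using v by (simp add: right_diff_distrib L_T[OF i])
  then show "L i * v' = sc b * v'"
    unfolding v'_def sc_plus_v d by (simp add: right_diff_distrib)
  have "L (Suc i) * v' = sc a * (T i * v) + (sc ((q - 1) * b) * v - sc (diag a b * b) * v)"
    unfolding v'_def using v by (simp add: right_diff_distrib L_Suc_T[OF i])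
  then show "L (Suc i) * v' = sc a * v'"
    unfolding v'_def sc_minus_v d by (simp add: right_diff_distrib sc_minus)
  have "diag a b + diag b a = (q - 1) * (a - b) / (a - b)"
    unfolding dd by (simp add: right_diff_distrib diff_divide_distrib)
  then have "diag a b + diag b a = q - 1" using e(1) by simp
  then have s: "q - 1 - diag a b - diag b a = 0" by (metis diff_diff_eq diff_self)
  have "diag b a * diag a b = - ((q - 1)^2 * a * b / (a - b)^2)"
    unfolding dd by (simp add: power2_eq_square mult_ac)
  moreover have "(q * a - b) * (a - q * b) = q * (a - b)^2 - (q - 1)^2 * a * b"
    by (simp add: power2_eq_square algebra_simps)
  ultimately have p: "q + diag b a * diag a b = phi a b"
    using e(1) by (simp add: phi_def diff_divide_distrib)
  have "T i * v' - sc (diag b a) * v' = (sc (q - 1) * (T i * v) - sc (diag a b) * (T i * v) - sc (diag b a) * (T i * v))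
      + (sc q * v + sc (diag b a * diag a b) * v)"
    unfolding v'_def by (simp add: right_diff_distrib T_sq_v[OF i])
  then show "T i * v' - sc (diag b a) * v' = sc (phi a b) * v"
    unfolding sc_minus_v sc_plus_v s p by simp
qed

end

section \<open>Decomposition into joint eigenvectors of standard fillings\<close>

locale seminormal = separated ell n q Q + hecke_ring ell n q Q sc T
  for ell n :: nat and q :: "'k::field" and Q :: "nat \<Rightarrow> 'k"
    and sc :: "'k \<Rightarrow> 'a::ring_1" and T :: "nat \<Rightarrow> 'a"
begin

definition decomposes :: "nat \<Rightarrow> bool" where
  "decomposes k \<longleftrightarrow> (\<forall>v. \<exists>f. v = (\<Sum>t\<in>tabs ell k. f t) \<and> (\<forall>t\<in>tabs ell k. wt k (res_at t) (f t)))"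

lemma wt_sum_eq_0:
  assumes "finite S" "k \<le> n" "\<forall>t\<in>S. \<exists>m. 1 \<le> m \<and> m \<le> k \<and> c m \<noteq> d t m"
    and "\<forall>t\<in>S. wt k (d t) (f t)" "wt k c (\<Sum>t\<in>S. f t)"
  shows "(\<Sum>t\<in>S. f t) = 0"
  using assms
proof (induction S arbitrary: f rule: finite_induct)
  case (insert t S)
  obtain m where m: "1 \<le> m" "m \<le> k" "c m \<noteq> d t m" using insert.prems by auto
  let ?v = "\<Sum>t\<in>insert t S. f t" and ?g = "\<lambda>s. (L m - sc (d t m)) * f s"
  have wtg: "wt k e (?g s)" if "wt k e (f s)" for e s
    using that m insert.prems(1) by (simp add: left_diff_distrib wt_diff wt_L wt_sc)
  have "(L m - sc (d t m)) * f t = 0"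
    using L_minus_v[OF wtD[of k "d t" "f t" m], of "d t m"] insert.prems m by simp
  then have eq: "(\<Sum>s\<in>S. ?g s) = (L m - sc (d t m)) * ?v"
    using insert.hyps by (simp add: distrib_left sum_distrib_left)
  also have "\<dots> = sc (c m - d t m) * ?v"
    using L_minus_v[OF wtD[OF insert.prems(4) m(1,2)], of "d t m"] .
  finally have s: "(\<Sum>s\<in>S. ?g s) = sc (c m - d t m) * ?v" .
  have "(\<Sum>s\<in>S. ?g s) = 0"
  proof (rule insert.IH)
    show "wt k c (\<Sum>s\<in>S. ?g s)" unfolding s using insert.prems(4) by (rule wt_sc)
  qed (use insert.prems wtg in auto)
  then show ?case using s m(3) by simp
qed simp

lemma wt_eq_0:
  assumes "decomposes k" "k \<le> n" "wt k c v"
    and "\<And>t. t \<in> tabs ell k \<Longrightarrow> \<exists>m. 1 \<le> m \<and> m \<le> k \<and> c m \<noteq> res_at t m"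
  shows "v = 0"
proof -
  obtain f where f: "v = (\<Sum>t\<in>tabs ell k. f t)" "\<forall>t\<in>tabs ell k. wt k (res_at t) (f t)"
    using assms(1) unfolding decomposes_def by blast
  show ?thesis unfolding f(1)
    by (rule wt_sum_eq_0[where d = res_at and c = c and k = k])
      (use f(2) assms(2,4) assms(3)[unfolded f(1)] finite_tabs in auto)
qed

abbreviation dg :: "nat \<Rightarrow> tab \<Rightarrow> 'k" where
  "dg i t \<equiv> diag (res_at t i) (res_at t (Suc i))"

lemma swap_wt:
  assumes t: "t \<in> tabs ell k" and i: "1 \<le> i" "i < k" and k: "k \<le> n" and v: "wt k (res_at t) v"
  defines "v' \<equiv> T i * v - sc (dg i t) * v"
  shows swap_wt_perm: "wt k (\<lambda>m. res_at t (sperm i m)) v'"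
    and swap_wt_tab: "sperm i \<circ> t \<in> tabs ell k \<Longrightarrow> wt k (res_at (sperm i \<circ> t)) v'"
    and swap_wt_0: "sperm i \<circ> t \<notin> tabs ell k \<Longrightarrow> decomposes k \<Longrightarrow> T i * v = sc (dg i t) * v"
    and swap_wt_back: "T i * v' - sc (diag (res_at t (Suc i)) (res_at t i)) * v' = sc (phi (res_at t i) (res_at t (Suc i))) * v"
proof -
  have i': "1 \<le> i" "i < n" using i k by auto
  note inter = intertwine[OF i' res_at_neighbours(1)[OF t i k], OF wtD[OF v] wtD[OF v]]
  show 1: "wt k (\<lambda>m. res_at t (sperm i m)) v'"
    unfolding wt_def
  proof (intro allI impI)
    fix m assume m: "1 \<le> m" "m \<le> k"
    consider "m = i" | "m = Suc i" | "m \<noteq> i" "m \<noteq> Suc i" by blast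
    then show "L m * v' = sc (res_at t (sperm i m)) * v'"
    proof cases
      case 1 then show ?thesis using inter(1) i unfolding v'_def by simp
    next
      case 2 then show ?thesis using inter(2) i unfolding v'_def by simp
    next
      case 3
      then show ?thesis using T_L_comm(2)[OF i', of m v, symmetric] wtD[OF v m] m k
        unfolding v'_def by (simp add: right_diff_distrib mult.commute)
    qed
  qed
  show "wt k (res_at (sperm i \<circ> t)) v'" if "sperm i \<circ> t \<in> tabs ell k"
    using 1 by (subst wt_cong[where d = "\<lambda>m. res_at t (sperm i m)"]) (simp_all add: swap_nd[OF t i that])
  show "T i * v' - sc (diag (res_at t (Suc i)) (res_at t i)) * v' = sc (phi (res_at t i) (res_at t (Suc i))) * v"
    using inter(3) i unfolding v'_def by simp
  assume s: "sperm i \<circ> t \<notin> tabs ell k" and dec: "decomposes k"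
  have "v' = 0"
  proof (rule wt_eq_0[OF dec k 1], rule ccontr)
    fix u assume u: "u \<in> tabs ell k" "\<not> (\<exists>m. 1 \<le> m \<and> m \<le> k \<and> res_at t (sperm i m) \<noteq> res_at u m)"
    have "sperm i \<circ> t \<in> tabs ell k"
      by (rule swapped_residues[OF t u(1) i k]) (use u(2) in metis)
    then show False using s by blast
  qed
  then show "T i * v = sc (dg i t) * v" unfolding v'_def by simp
qed

lemma eigen_decomp:
  assumes X: "scal_comm X"
    and V: "\<And>v w. v \<in> V \<Longrightarrow> w \<in> V \<Longrightarrow> v - w \<in> V" "\<And>v c. v \<in> V \<Longrightarrow> sc c * v \<in> V" "\<And>v. v \<in> V \<Longrightarrow> X * v \<in> V"
      "0 \<in> V"
  shows "distinct cs \<Longrightarrow> v \<in> V \<Longrightarrow> prod_list (map (\<lambda>c. X - sc c) cs) * v = 0 \<Longrightarrow>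
    \<exists>f. v = (\<Sum>c\<in>set cs. f c) \<and> (\<forall>c. f c \<in> V \<and> X * f c = sc c * f c)"
proof (induction cs arbitrary: v)
  case Nil
  then show ?case using V by (intro exI[of _ "\<lambda>_. 0"]) simp
next
  case (Cons d cs)
  let ?P = "prod_list (map (\<lambda>c. X - sc c) cs)"
  have comm: "(X - sc d) * prod_list (map (\<lambda>c. X - sc c) cs) = prod_list (map (\<lambda>c. X - sc c) cs) * (X - sc d)" for cs
  proof (induction cs)
    case (Cons c cs)
    have "(X - sc d) * (X - sc c) = (X - sc c) * (X - sc d)"
      using X sc_commute[of c d] by (simp add: left_diff_distrib right_diff_distrib scal_comm_def)
    then show ?case using Cons by (simp add: comm_mult)
  qed simp
  have "?P * ((X - sc d) * v) = 0" using Cons.prems(3) comm[of cs] by (simp add: mult.assoc[symmetric])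
  moreover have "(X - sc d) * v \<in> V" using V Cons.prems by (simp add: left_diff_distrib)
  ultimately obtain f where f: "(X - sc d) * v = (\<Sum>c\<in>set cs. f c)" "\<And>c. f c \<in> V \<and> X * f c = sc c * f c"
    using Cons.IH Cons.prems(1) by force
  define g where "g c = sc (inverse (c - d)) * f c" for c
  have g: "g c \<in> V" "X * g c = sc c * g c" for c
    using f(2)[of c] V by (simp_all add: g_def scal_comm_v[OF X] mult.commute)
  have VS: "(\<Sum>c\<in>S. g c) \<in> V" if "finite S" for S
    using that
  proof induction
    case (insert c S)
    have "- (\<Sum>c\<in>S. g c) \<in> V" using V(1)[OF V(4) insert.IH] by simp
    then have "g c - (- (\<Sum>c\<in>S. g c)) \<in> V" using V(1)[OF g(1)] by blast
    then show ?case using insert by simp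
  qed (simp add: V)
  let ?w = "v - (\<Sum>c\<in>set cs. g c)"
  have "(X - sc d) * g c = f c" if "c \<in> set cs" for c
  proof -
    have "(X - sc d) * g c = sc (c - d) * g c" using g(2)[of c] by (simp add: left_diff_distrib sc_minus_v)
    moreover have "c - d \<noteq> 0" using that Cons.prems(1) by auto
    ultimately show ?thesis by (simp add: g_def)
  qed
  then have "(X - sc d) * ?w = 0"
    by (simp add: right_diff_distrib sum_distrib_left f(1))
  then have w: "X * ?w = sc d * ?w" by (simp add: left_diff_distrib)
  have "?w \<in> V" using V(1)[OF Cons.prems(2) VS] by simp
  moreover have "v = (\<Sum>c\<in>set (d # cs). if c = d then ?w else g c)"
  proof -
    have "(\<Sum>c\<in>set cs. if c = d then ?w else g c) = (\<Sum>c\<in>set cs. g c)"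
      using Cons.prems(1) by (intro sum.cong) auto
    then show ?thesis using Cons.prems(1) by simp
  qed
  ultimately show ?case using g w by (intro exI[of _ "\<lambda>c. if c = d then ?w else g c"]) auto
qed

definition Lprod :: "nat \<Rightarrow> node list \<Rightarrow> 'a" where
  "Lprod m xs = prod_list (map (\<lambda>x. L m - sc (nres x)) xs)"

lemma Lprod_simps [simp]: "Lprod m [] = 1" "Lprod m (x # xs) = (L m - sc (nres x)) * Lprod m xs"
  "Lprod m (xs @ ys) = Lprod m xs * Lprod m ys"
  by (simp_all add: Lprod_def)

lemma scal_comm_Lprod [simp]: "scal_comm (Lprod m xs)"
  by (auto simp: Lprod_def intro!: scal_comm_prod_list)

lemma comm_Lprod: "scal_comm y \<Longrightarrow> y * L m = L m * y \<Longrightarrow> y * Lprod m xs = Lprod m xs * y"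
proof (induction xs)
  case (Cons x xs)
  have "y * (L m - sc (nres x)) = (L m - sc (nres x)) * y"
    using Cons.prems by (simp add: left_diff_distrib right_diff_distrib scal_comm_def)
  then show ?case using Cons by (simp add: comm_mult)
qed simp

lemma wt_Lprod: "wt k c v \<Longrightarrow> k \<le> n \<Longrightarrow> 1 \<le> m \<Longrightarrow> m \<le> n \<Longrightarrow> wt k c (Lprod m xs * v)"
  by (induction xs) (simp_all add: mult.assoc left_diff_distrib wt_diff wt_L wt_sc)

lemma Lprod_remove1: "x \<in> set xs \<Longrightarrow> Lprod m xs = (L m - sc (nres x)) * Lprod m (remove1 x xs)"
proof (induction xs)
  case (Cons y xs)
  have "(L m - sc (nres y)) * (L m - sc (nres x)) = (L m - sc (nres x)) * (L m - sc (nres y))"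
    using sc_commute[of "nres x" "nres y"] scal_comm_L[of m]
    by (simp add: left_diff_distrib right_diff_distrib scal_comm_def)
  then show ?case using Cons by (auto simp: comm_v)
qed simp

text \<open>The affine Hecke algebra of rank two. Moving the polynomial in \<open>L\<^sub>i\<close> that annihilates the
  module past \<open>T\<^sub>i\<close> expresses \<open>T\<^sub>i\<close> on the \<open>a\<close>-eigenspace through \<open>L\<^sub>i\<^sub>+\<^sub>1\<close>. The quadratic relation
  then leaves an equation for \<open>L\<^sub>i\<^sub>+\<^sub>1\<close>, with the roots \<open>q a\<close> and \<open>q\<^sup>-\<^sup>1 a\<close> in place of \<open>a\<close>.\<close>
lemma rank_two:
  assumes i: "1 \<le> i" "i < n" and a: "a \<noteq> 0"
    and W: "\<And>w. w \<in> W \<Longrightarrow> T i * w \<in> W" "\<And>w. w \<in> W \<Longrightarrow> (L (Suc i) - sc a) * w \<in> W"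
    and kill: "\<And>w. w \<in> W \<Longrightarrow> (L i - sc a) * (Lprod i ys * w) = 0"
    and v: "v \<in> W" "L i * v = sc a * v"
  shows "(L (Suc i) - sc (q * a)) * ((L (Suc i) - sc (inverse q * a)) * (Lprod (Suc i) ys * v)) = 0"
proof -
  let ?X = "L i" and ?Y = "L (Suc i)"
  have XY: "?X * (?Y * w) = ?Y * (?X * w)" for w using L_L_comm(2)[of i "Suc i" w] i by simp
  have XP: "?X * (Lprod (Suc i) ys * w) = Lprod (Suc i) ys * (?X * w)" for ys w
    using comm_Lprod[of ?X "Suc i" ys] L_L_comm(1)[of i "Suc i"] i by (simp add: comm_v)
  have YP: "(?Y - sc a) * (Lprod (Suc i) ys * w) = Lprod (Suc i) ys * ((?Y - sc a) * w)" for ys w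
    by (intro comm_v comm_Lprod)
      (simp_all add: left_diff_distrib right_diff_distrib scal_comm_L[unfolded scal_comm_def])
  have A: "\<exists>u. ?X * u = sc a * u \<and> Lprod i ys * (T i * w) = T i * (Lprod (Suc i) ys * w) - u"
    if w: "?X * w = sc a * w" for w ys
  proof (induction ys)
    case Nil then show ?case by (intro exI[of _ 0]) simp
  next
    case (Cons y ys)
    then obtain u where u: "?X * u = sc a * u" "Lprod i ys * (T i * w) = T i * (Lprod (Suc i) ys * w) - u" by blast
    let ?z = "Lprod (Suc i) ys * w" and ?c = "nres y"
    let ?u = "sc (q - 1) * (?Y * ?z) + sc (a - ?c) * u"
    have z: "?X * ?z = sc a * ?z" by (simp add: XP w scal_comm_v)
    have "Lprod i (y # ys) * (T i * w) = (?X - sc ?c) * (T i * ?z - u)"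
      by (simp add: mult.assoc u(2))
    also have "\<dots> = ?X * (T i * ?z) - sc ?c * (T i * ?z) - sc (a - ?c) * u"
      by (simp add: left_diff_distrib right_diff_distrib u(1) sc_diff)
    also have "\<dots> = T i * ((?Y - sc ?c) * ?z) - ?u"
      by (simp add: L_T[OF i] left_diff_distrib right_diff_distrib)
    finally have "Lprod i (y # ys) * (T i * w) = T i * (Lprod (Suc i) (y # ys) * w) - ?u"
      by (simp add: mult.assoc)
    moreover have "?X * ?u = sc a * ?u"
      by (simp add: distrib_left XY z u(1) mult.commute)
    ultimately show ?case by blast
  qed
  have XTz: "?X * (T i * (Lprod (Suc i) ys * w)) = sc a * (T i * (Lprod (Suc i) ys * w))"
    if w: "w \<in> W" "?X * w = sc a * w" for w
  proof -
    obtain u where u: "?X * u = sc a * u" "Lprod i ys * (T i * w) = T i * (Lprod (Suc i) ys * w) - u"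
      using A[OF w(2), of ys] by blast
    have "(?X - sc a) * (T i * (Lprod (Suc i) ys * w) - u) = 0"
      using kill[OF W(1)[OF w(1)]] u(2) by simp
    then show ?thesis using u(1) by (simp add: left_diff_distrib right_diff_distrib)
  qed
  have E1: "sc (a * (q - 1)) * (T i * (Lprod (Suc i) ys * w)) = sc q * ((?Y - sc a) * (Lprod (Suc i) ys * w))"
    if w: "w \<in> W" "?X * w = sc a * w" for w
  proof -
    let ?z = "Lprod (Suc i) ys * w"
    have "sc q * (?Y * ?z) = T i * (?X * (T i * ?z))" by (simp only: T_L_T[OF i(1)])
    also have "\<dots> = sc a * (T i * (T i * ?z))" using XTz[OF w] by simp
    also have "\<dots> = sc (a * (q - 1)) * (T i * ?z) + sc (q * a) * ?z"
      by (simp add: T_sq_v[OF i] distrib_left mult.commute)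
    finally show ?thesis by (simp add: left_diff_distrib right_diff_distrib)
  qed
  let ?z = "Lprod (Suc i) ys * v"
  let ?v1 = "(?Y - sc a) * v"
  have v1: "?v1 \<in> W" "?X * ?v1 = sc a * ?v1"
    using W(2)[OF v(1)] v(2) by (simp_all add: left_diff_distrib right_diff_distrib XY)
  have z1: "Lprod (Suc i) ys * ?v1 = (?Y - sc a) * ?z" using YP by simp
  have "T i * ((?Y - sc a) * ?z) = sc (q - 1) * (?Y * ?z)"
    using XTz[OF v] unfolding L_T[OF i]
    by (simp add: left_diff_distrib right_diff_distrib diff_eq_eq add.commute)
  with E1[OF v1] have "sc (a * (q - 1) * (q - 1)) * (?Y * ?z) = sc q * ((?Y - sc a) * ((?Y - sc a) * ?z))"
    unfolding z1 by simp
  also have "(?Y - sc a) * ((?Y - sc a) * ?z) = ?Y * (?Y * ?z) - sc (2 * a) * (?Y * ?z) + sc (a * a) * ?z"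
  proof -
    have "sc (2 * a) * (?Y * ?z) = sc a * (?Y * ?z) + sc a * (?Y * ?z)" by (simp only: sc_plus_v mult_2)
    then show ?thesis by (simp add: left_diff_distrib right_diff_distrib)
  qed
  finally have *: "sc q * (?Y * (?Y * ?z)) + sc (q * (a * a)) * ?z = sc (a * (q - 1) * (q - 1)) * (?Y * ?z) + sc (q * (2 * a)) * (?Y * ?z)"
    by (simp add: right_diff_distrib distrib_left)
  have "sc q * ((?Y - sc (q * a)) * ((?Y - sc (inverse q * a)) * ?z)) =
      (sc q * (?Y * (?Y * ?z)) + sc (q * (a * a)) * ?z) - (sc a * (?Y * ?z) + sc (q * (q * a)) * (?Y * ?z))"
    using q0 by (simp add: left_diff_distrib right_diff_distrib mult_ac)
  also have "\<dots> = 0"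
    unfolding * sc_plus_v by (simp add: sc_minus_v algebra_simps)
  finally show ?thesis using q0 by simp
qed

text \<open>On vectors whose residue sequence is that of \<open>t\<close>, the next \<open>L\<close> is diagonalisable with
  eigenvalues among the residues of addable nodes.\<close>
definition step_holds :: "nat \<Rightarrow> bool" where
  "step_holds k \<longleftrightarrow> (\<forall>t\<in>tabs ell k. \<exists>xs. distinct xs \<and> set xs \<subseteq> addable ell (supp t) \<and>
     (\<forall>v. wt k (res_at t) v \<longrightarrow> Lprod (Suc k) xs * v = 0))"

text \<open>The residues \<open>b, a, b\<close> with adjacent nodes for \<open>b, a\<close> would force \<open>T\<^sub>k\<close> and \<open>T\<^sub>k\<^sub>+\<^sub>1\<close> to act by
  the two different eigenvalues, which the braid relation forbids.\<close>
lemma no_repeat: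
  assumes t: "t \<in> tabs ell (Suc k)" and k: "1 \<le> k" "Suc k < n" and dec: "decomposes (Suc k)"
    and s: "sperm k \<circ> t \<notin> tabs ell (Suc k)"
    and v: "wt (Suc k) (res_at t) v" "L (Suc (Suc k)) * v = sc (res_at t k) * v"
  shows "v = 0"
proof -
  let ?b = "res_at t k" and ?a = "res_at t (Suc k)"
  have kn: "Suc k \<le> n" "k < Suc k" "1 \<le> Suc k" "k \<le> Suc k" using k by simp_all
  have ab: "?a = q * ?b \<or> ?a = inverse q * ?b"
    using res_at_neighbours(4)[OF t k(1) kn(2,1) s] by blast
  have ne: "?b \<noteq> ?a" using res_at_neighbours(1)[OF t k(1) kn(2,1)] .
  have b0: "?b \<noteq> 0" using ab ne by auto
  let ?al = "diag ?b ?a" and ?be = "diag ?a ?b"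
  have Tk: "T k * v = sc ?al * v"
    using swap_wt_0[OF t k(1) kn(2,1) v(1) s dec] .
  let ?v' = "T (Suc k) * v - sc ?be * v"
  have "L (Suc k) * ?v' = sc ?b * ?v'"
    using intertwine(1)[OF kn(3) k(2) ne[symmetric] wtD[OF v(1) kn(3)] v(2)] by simp
  moreover have "wt k (res_at t) ?v'"
    using v(1) k by (intro wt_diff wt_sc wt_T_far) (simp_all add: wt_def)
  ultimately have w: "wt (Suc k) (\<lambda>m. if m = Suc k then ?b else res_at t m) ?v'"
    by (auto simp: wt_def le_Suc_eq)
  have "?v' = 0"
  proof (rule wt_eq_0[OF dec kn(1) w], rule ccontr)
    fix u assume u: "u \<in> tabs ell (Suc k)"
      "\<not> (\<exists>m. 1 \<le> m \<and> m \<le> Suc k \<and> (if m = Suc k then ?b else res_at t m) \<noteq> res_at u m)"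
    have r: "restrict_tab t k = restrict_tab u k"
    proof (rule nd_eq_of_residues[OF t u(1) kn(1,4)])
      fix m assume "1 \<le> m" "m \<le> k"
      then show "res_at t m = res_at u m" using u(2)[simplified, rule_format, of m] by simp
    qed
    have ub: "res_at u (Suc k) = ?b" using u(2)[simplified, rule_format, of "Suc k"] by simp
    have r': "restrict_tab t k \<in> tabs ell k" using restrict_tab_tabs(1)[OF t kn(4)] .
    show False
      using residues_not_adjacent[OF tabs_young[OF r'], of "nd t (Suc k)" "nd u (Suc k)"] tabs_card[OF r'] k
        restrict_tab_addable[OF t kn(2)] restrict_tab_addable[OF u(1) kn(2)] r ub ab by simp
  qed
  then have Tk1: "T (Suc k) * v = sc ?be * v" by simp
  have "T k * T (Suc k) * T k * v = T (Suc k) * T k * T (Suc k) * v" using T_braid[of k] k by simp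
  then have "sc (?al * ?be * ?al) * v = sc (?be * ?al * ?be) * v"
    by (simp add: mult.assoc Tk Tk1 mult.commute mult.left_commute)
  then have "sc (?al * ?be * (?al - ?be)) * v = 0" by (simp add: right_diff_distrib sc_diff left_diff_distrib mult_ac)
  moreover have "?al = q \<and> ?be = -1 \<or> ?al = -1 \<and> ?be = q"
  proof -
    have q1': "q - 1 \<noteq> 0" "1 - q \<noteq> 0" using q1 by auto
    show ?thesis using ab
    proof
      assume a: "?a = q * ?b"
      have "?al = q * ((q - 1) * ?b) / ((q - 1) * ?b)" unfolding diag_def a by (simp add: algebra_simps)
      moreover have "?be = - ((q - 1) * ?b) / ((q - 1) * ?b)" unfolding diag_def a
        by (metis (no_types, lifting) left_diff_distrib minus_diff_eq minus_divide_left minus_divide_right mult_1)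
      ultimately show ?thesis using q1' b0 by simp
    next
      assume "?a = inverse q * ?b"
      then have a: "?b = q * ?a" using q0 by simp
      have a0: "?a \<noteq> 0" using b0 a by auto
      have "?be = q * ((q - 1) * ?a) / ((q - 1) * ?a)" unfolding diag_def a by (simp add: algebra_simps)
      moreover have "?al = - ((q - 1) * ?a) / ((q - 1) * ?a)" unfolding diag_def a
        by (metis (no_types, lifting) left_diff_distrib minus_diff_eq minus_divide_left minus_divide_right mult_1)
      ultimately show ?thesis using q1' a0 by simp
    qed
  qed
  moreover have "q + 1 \<noteq> 0"
  proof
    assume "q + 1 = 0"
    then have "q = -1" by (simp add: eq_neg_iff_add_eq_0)
    then show False using q_pow[of 2] k by simp
  qed
  ultimately show ?thesis using q0 by (auto simp: eq_neg_iff_add_eq_0 minus_diff_commute)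
qed

text \<open>The intertwiners that lead from one filling of a shape to another are invertible and commute with
  \<open>L\<^sub>k\<^sub>+\<^sub>1\<close>.\<close>
lemma transport:
  assumes u: "u \<in> tabs ell k" and kn: "k < n"
    and good: "\<And>v. wt k (res_at u) v \<Longrightarrow> L (Suc k) * v = sc e * v \<Longrightarrow> v = 0"
  shows "t \<in> tabs ell k \<Longrightarrow> supp u = supp t \<Longrightarrow> nd t k = nd u k \<Longrightarrow> wt k (res_at t) v \<Longrightarrow>
    L (Suc k) * v = sc e * v \<Longrightarrow> v = 0"
proof (induction "card (Invs u t)" arbitrary: t v)
  case less: (Suc m)
  note t = less.prems(1)
  have "u \<noteq> t" using less.hyps(2) by auto
  then obtain i where i: "1 \<le> i" "i < k" "u (nd t (Suc i)) < u (nd t i)" and s: "sperm i \<circ> t \<in> tabs ell k"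
    and card: "card (Invs u t) = Suc (card (Invs u (sperm i \<circ> t)))"
    using tab_descent[OF t u less.prems(2)] by blast
  have k1: "1 \<le> k" "k \<le> n" "i \<le> k" using i kn by auto
  have "Suc i \<noteq> k"
  proof
    assume "Suc i = k"
    then have "u (nd t (Suc i)) = k" using less.prems(3) nd_entry[OF u k1(1)] by simp
    then show False using i(3) tabs_le[OF u, of "nd t i"] by simp
  qed
  then have ik: "Suc i < k" using i by simp
  let ?v' = "T i * v - sc (dg i t) * v"
  note sw = swap_wt[OF t i(1,2) k1(2) less.prems(4)]
  have "L (Suc k) * (T i * v) = T i * (L (Suc k) * v)"
    using T_L_comm(2)[of i "Suc k" v] i ik kn by simp
  then have Lv': "L (Suc k) * ?v' = sc e * ?v'"
    using less.prems(5) by (simp add: right_diff_distrib mult.commute)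
  have "?v' = 0"
  proof (rule less.hyps(1)[OF _ s])
    show "m = card (Invs u (sperm i \<circ> t))" using less.hyps(2) card by simp
    show "supp u = supp (sperm i \<circ> t)" using less.prems(2) swap_supp[OF t i(1,2)] by simp
    show "nd (sperm i \<circ> t) k = nd u k"
      using swap_nd[OF t i(1,2) s k1(1)] less.prems(3) ik by simp
  qed (use sw(2)[OF s] Lv' in auto)
  then have "sc (phi (res_at t i) (res_at t (Suc i))) * v = 0" using sw(4) by simp
  then show ?case using phi_factors[OF t i(1,2) k1(2) s] by (simp add: phi_def)
next
  case less: 0
  have "u = t"
  proof (rule ccontr)
    assume "u \<noteq> t"
    then obtain i where "card (Invs u t) = Suc (card (Invs u (sperm i \<circ> t)))"
      using tab_descent[OF less.prems(1) u less.prems(2)] by blast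
    then show False using less.hyps by simp
  qed
  then show ?case using good less.prems by blast
qed

lemma young_remove:
  assumes "young ell D" "B \<in> D" "\<And>y. y \<in> D \<Longrightarrow> nw_le B y \<Longrightarrow> y = B"
  shows "young ell (D - {B})" "B \<in> addable ell (D - {B})"
proof -
  show "young ell (D - {B})" unfolding young_def
  proof (intro conjI ballI impI)
    fix y x assume "y \<in> D - {B}" "x \<in> nodes ell" "nw_le x y"
    then show "x \<in> D - {B}" using youngD[OF assms(1), of y x] assms(3)[of y] by auto
  qed (use young_finite[OF assms(1)] young_nodes[OF assms(1)] in auto)
  show "B \<in> addable ell (D - {B})"
    using assms young_nodes[OF assms(1)] by (simp add: addable_def insert_absorb subset_iff)
qed

text \<open>A corner \<open>B\<close> that the last entry covers cannot supply the next residue: refilling the shape so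
  that \<open>B\<close> receives the entry just before the last leads to the case excluded by \<open>no_repeat\<close>.\<close>
lemma no_eigenvector:
  assumes t: "t \<in> tabs ell (Suc k)" and kn: "Suc k < n" and dec: "decomposes (Suc k)"
    and B: "B \<in> supp (restrict_tab t k)" "nw_le B (nd t (Suc k))"
      "\<And>y. y \<in> supp (restrict_tab t k) \<Longrightarrow> nw_le B y \<Longrightarrow> y = B"
    and v: "wt (Suc k) (res_at t) v" "L (Suc (Suc k)) * v = sc (nres B) * v"
  shows "v = 0"
proof -
  let ?D = "supp (restrict_tab t k)" and ?x = "nd t (Suc k)"
  have r: "restrict_tab t k \<in> tabs ell k" using restrict_tab_tabs(1)[OF t] by simp
  note y = tabs_young[OF r]
  have rem: "young ell (?D - {B})" "B \<in> addable ell (?D - {B})"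
    using young_remove[OF y B(1)] B(3) by blast+
  have k: "1 \<le> k" using tabs_card[OF r] B(1) young_finite[OF y] by (cases k) auto
  then obtain l where l: "k = Suc l" by (cases k) auto
  have "card (?D - {B}) = l" using tabs_card[OF r] l B(1) young_finite[OF y] by simp
  then obtain u0 where u0: "u0 \<in> tabs ell l" "supp u0 = ?D - {B}" using tabs_exist[OF rem(1)] by blast
  note u1 = extend_tab[OF u0(1), of B, unfolded u0(2), OF rem(2)]
  have ins: "insert B (?D - {B}) = ?D" using B(1) by auto
  have x: "?x \<in> addable ell ?D" using restrict_tab_addable[OF t] by simp
  note u2 = extend_tab[OF u1(1), of ?x, unfolded u1(2) ins, OF x]
  let ?u = "(u0(B := Suc l))(?x := Suc (Suc l))"
  have u: "?u \<in> tabs ell (Suc k)" "supp ?u = supp t" "nd ?u (Suc k) = ?x" "nd ?u k = B"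
    using u2 u1(4) extend_restrict(2)[OF t] k by (simp_all add: l)
  have su: "sperm k \<circ> ?u \<notin> tabs ell (Suc k)"
    using swap_tabsD[OF u(1) k, of] B(2) u(3,4) by auto
  show ?thesis
  proof (rule transport[OF u(1) kn _ t u(2) u(3)[symmetric] v])
    fix w assume "wt (Suc k) (res_at ?u) w" "L (Suc (Suc k)) * w = sc (nres B) * w"
    then show "w = 0" using no_repeat[OF u(1) k kn dec su, of w] u(4) by simp
  qed
qed

lemma young_insertI:
  assumes "young ell D" "x \<in> nodes ell" "\<And>z. z \<in> nodes ell \<Longrightarrow> nw_le z x \<Longrightarrow> z \<noteq> x \<Longrightarrow> z \<in> D"
  shows "young ell (insert x D)"
  unfolding young_def
proof (intro conjI ballI impI)
  fix y z assume "y \<in> insert x D" "z \<in> nodes ell" "nw_le z y"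
  then show "z \<in> insert x D" using youngD[OF assms(1), of y z] assms(3)[of z] by auto
qed (use young_finite[OF assms(1)] young_nodes[OF assms(1)] assms(2) in auto)

lemma step_holds_0: "step_holds 0"
  unfolding step_holds_def tabs_0
proof (clarify, intro exI conjI allI impI)
  let ?xs = "map (\<lambda>c. (1, 1, c)) [1..<Suc ell] :: node list"
  have s: "supp (\<lambda>_. 0) = {}" by (simp add: supp_def)
  show "distinct ?xs" by (simp add: distinct_map inj_on_def)
  show "set ?xs \<subseteq> addable ell (supp (\<lambda>_. 0))"
  proof
    fix x assume "x \<in> set ?xs"
    then obtain c where c: "x = (1, 1, c)" "1 \<le> c" "c \<le> ell" by auto
    have "young ell (insert x {})"
    proof (rule young_insertI)
      fix z assume "z \<in> nodes ell" "nw_le z x" "z \<noteq> x"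
      then show "z \<in> {}" using c by (cases z) auto
    qed (use c in \<open>simp_all add: young_def\<close>)
    then show "x \<in> addable ell (supp (\<lambda>_. 0))" using c by (simp add: addable_def s)
  qed
  have "Lprod (Suc 0) ?xs = prod_list (map (\<lambda>c. T 0 - sc (Q c)) [1..<Suc ell])"
    by (simp add: Lprod_def o_def node_res_def L_1[unfolded One_nat_def] del: upt_Suc)
  then show "Lprod (Suc 0) ?xs * v = 0" for v using T_cyc by simp
qed

lemma step_holds_Suc:
  assumes dec: "decomposes (Suc k)" and kn: "Suc k < n" and prev: "step_holds k"
  shows "step_holds (Suc k)"
  unfolding step_holds_def
proof
  fix t assume t: "t \<in> tabs ell (Suc k)"
  let ?t' = "restrict_tab t k" and ?Y = "L (Suc (Suc k))"
  let ?D' = "supp ?t'" and ?D = "supp t"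
  have t': "?t' \<in> tabs ell k" using restrict_tab_tabs(1)[OF t] by simp
  note y' = tabs_young[OF t'] and y = tabs_young[OF t]
  obtain i j c where x: "nd t (Suc k) = (i, j, c)" by (metis prod_cases3)
  let ?x = "(i, j, c)" let ?a = "nres ?x"
  have xa: "?x \<in> addable ell ?D'" using restrict_tab_addable[OF t, of k] x by simp
  note xa' = addableD[OF xa]
  have D: "?D = insert ?x ?D'" using extend_restrict(2)[OF t] x by simp
  have n: "1 \<le> i" "1 \<le> j" "1 \<le> c" "c \<le> ell" using xa'(1) by simp_all
  obtain xs where xs: "distinct xs" "set xs \<subseteq> addable ell ?D'" "\<And>v. wt k (res_at ?t') v \<Longrightarrow> Lprod (Suc k) xs * v = 0"
    using prev t' unfolding step_holds_def by blast
  define ys where "ys = remove1 ?x xs"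
  have ys: "distinct ys" "set ys \<subseteq> addable ell ?D' - {?x}" using xs by (auto simp: ys_def)
  let ?r = "(i, Suc j, c)" and ?b = "(Suc i, j, c)"
  have res: "nres ?r = q * ?a" "nres ?b = inverse q * ?a"
    using q0 by (simp_all add: node_res_def power_int_add power_int_diff field_simps)
  have a0: "?a \<noteq> 0" using nres_0[OF _ xa'(1)] kn by simp
  have R2: "(?Y - sc (q * ?a)) * ((?Y - sc (inverse q * ?a)) * (Lprod (Suc (Suc k)) ys * v)) = 0"
    if v: "wt (Suc k) (res_at t) v" for v
  proof (rule rank_two[OF _ kn a0, where W = "{w. wt k (res_at ?t') w}"])
    show "T (Suc k) * w \<in> {w. wt k (res_at ?t') w}" if "w \<in> {w. wt k (res_at ?t') w}" for w
      using that kn by (auto intro: wt_T_far)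
    show "(?Y - sc ?a) * w \<in> {w. wt k (res_at ?t') w}" if "w \<in> {w. wt k (res_at ?t') w}" for w
      using that kn by (simp add: left_diff_distrib wt_L wt_diff wt_sc)
    show "(L (Suc k) - sc ?a) * (Lprod (Suc k) ys * w) = 0" if "w \<in> {w. wt k (res_at ?t') w}" for w
    proof (cases "?x \<in> set xs")
      case True
      then show ?thesis using Lprod_remove1[OF True, of "Suc k"] xs(3)[of w] that
        by (simp add: ys_def mult.assoc)
    next
      case False
      then have "ys = xs" by (simp add: ys_def remove1_idem)
      then show ?thesis using xs(3)[of w] that by simp
    qed
    have "wt k (res_at ?t') v \<longleftrightarrow> wt k (res_at t) v"
      by (rule wt_cong) (simp add: restrict_tab_tabs(3)[OF t])
    then show "v \<in> {w. wt k (res_at ?t') w}" using v by (simp add: wt_def)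
    show "L (Suc k) * v = sc ?a * v" using wtD[OF v, of "Suc k"] x by simp
  qed simp
  have killr: "w = 0" if r: "?r \<notin> addable ell ?D" and w: "wt (Suc k) (res_at t) w" "(?Y - sc (q * ?a)) * w = 0" for w
  proof -
    have rD: "?r \<notin> ?D'" using youngD[OF y', of ?r ?x] xa'(1,2) by auto
    have "\<not> young ell (insert ?r ?D)" using r rD n by (simp add: addable_def D)
    then obtain z where z: "z \<in> nodes ell" "nw_le z ?r" "z \<noteq> ?r" "z \<notin> ?D"
      using young_insertI[OF y, of ?r] n by force
    obtain i1 j1 c1 where z1: "z = (i1, j1, c1)" by (metis prod_cases3)
    have "\<not> nw_le z ?x" using z(1,4) xa'(4)[of z] D by auto
    then have zz: "j1 = Suc j" "i1 < i" "c1 = c" "1 \<le> i1" using z z1 by auto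
    then have le: "i1 \<le> i - 1" "1 \<le> i - 1" by simp_all
    have up: "(i - 1, Suc j, c) \<notin> ?D"
      using youngD[OF y, of "(i - 1, Suc j, c)" z] z(1,4) zz z1 le by auto
    let ?B = "(i - 1, j, c)"
    show ?thesis
    proof (rule no_eigenvector[OF t kn dec, of ?B])
      show "?B \<in> ?D'" using xa'(4)[of ?B] n zz by auto
      show "nw_le ?B (nd t (Suc k))" using x by simp
      fix y assume yy: "y \<in> ?D'" "nw_le ?B y"
      obtain i2 j2 c2 where y2: "y = (i2, j2, c2)" by (metis prod_cases3)
      have "\<not> nw_le ?x y" using youngD[OF y' yy(1) xa'(1)] xa'(2) by blast
      moreover have "\<not> nw_le (i - 1, Suc j, c) y"
        using youngD[OF y, of y "(i - 1, Suc j, c)"] up yy(1) D n zz le by auto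
      ultimately show "y = ?B" using yy(2) y2 zz by auto
    next
      have "nres ?B = q * ?a" using q0 zz by (simp add: node_res_def power_int_add power_int_diff of_nat_diff field_simps)
      then show "?Y * w = sc (nres ?B) * w" using w(2) by (simp add: left_diff_distrib)
    qed (use w in auto)
  qed
  have killb: "w = 0" if b: "?b \<notin> addable ell ?D" and w: "wt (Suc k) (res_at t) w" "(?Y - sc (inverse q * ?a)) * w = 0" for w
  proof -
    have bD: "?b \<notin> ?D'" using youngD[OF y', of ?b ?x] xa'(1,2) by auto
    have "\<not> young ell (insert ?b ?D)" using b bD n by (simp add: addable_def D)
    then obtain z where z: "z \<in> nodes ell" "nw_le z ?b" "z \<noteq> ?b" "z \<notin> ?D"
      using young_insertI[OF y, of ?b] n by force
    obtain i1 j1 c1 where z1: "z = (i1, j1, c1)" by (metis prod_cases3)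
    have "\<not> nw_le z ?x" using z(1,4) xa'(4)[of z] D by auto
    then have zz: "i1 = Suc i" "j1 < j" "c1 = c" "1 \<le> j1" using z z1 by auto
    then have le: "j1 \<le> j - 1" "1 \<le> j - 1" by simp_all
    have left: "(Suc i, j - 1, c) \<notin> ?D"
      using youngD[OF y, of "(Suc i, j - 1, c)" z] z(1,4) zz z1 le by auto
    let ?B = "(i, j - 1, c)"
    show ?thesis
    proof (rule no_eigenvector[OF t kn dec, of ?B])
      show "?B \<in> ?D'" using xa'(4)[of ?B] n zz by auto
      show "nw_le ?B (nd t (Suc k))" using x by simp
      fix y assume yy: "y \<in> ?D'" "nw_le ?B y"
      obtain i2 j2 c2 where y2: "y = (i2, j2, c2)" by (metis prod_cases3)
      have "\<not> nw_le ?x y" using youngD[OF y' yy(1) xa'(1)] xa'(2) by blast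
      moreover have "\<not> nw_le (Suc i, j - 1, c) y"
        using youngD[OF y, of y "(Suc i, j - 1, c)"] left yy(1) D n zz le by auto
      ultimately show "y = ?B" using yy(2) y2 zz by auto
    next
      have "nres ?B = inverse q * ?a" using q0 zz by (simp add: node_res_def power_int_add power_int_diff of_nat_diff field_simps)
      then show "?Y * w = sc (nres ?B) * w" using w(2) by (simp add: left_diff_distrib)
    qed (use w in auto)
  qed
  let ?zs = "(if ?r \<in> addable ell ?D then [?r] else []) @ (if ?b \<in> addable ell ?D then [?b] else []) @ ys"
  have nor: "?r \<notin> addable ell ?D'" "?b \<notin> addable ell ?D'"
    using addableD(4)[of ?r ell ?D' ?x] addableD(4)[of ?b ell ?D' ?x] xa'(1,2) by auto
  have "set ys \<subseteq> addable ell ?D"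
  proof
    fix z assume "z \<in> set ys"
    then have z: "z \<in> addable ell ?D'" "z \<noteq> ?x" using ys(2) by auto
    note za = addableD[OF z(1)]
    have "young ell (insert z ?D)"
      by (rule young_insertI[OF y za(1)]) (use za(4) D in auto)
    then show "z \<in> addable ell ?D" using za(1,2) z(2) by (simp add: addable_def D)
  qed
  then have 1: "set ?zs \<subseteq> addable ell ?D" by auto
  have 2: "distinct ?zs" using ys nor by auto
  have 3: "Lprod (Suc (Suc k)) ?zs * v = 0" if v: "wt (Suc k) (res_at t) v" for v
  proof -
    let ?w = "Lprod (Suc (Suc k)) ys * v"
    let ?A = "?Y - sc (q * ?a)" and ?B = "?Y - sc (inverse q * ?a)"
    have w: "wt (Suc k) (res_at t) ?w" using v kn by (intro wt_Lprod) simp_all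
    have wY: "wt (Suc k) (res_at t) ((?Y - sc d) * u)" if "wt (Suc k) (res_at t) u" for d u
      using that kn by (simp add: left_diff_distrib wt_diff wt_L wt_sc)
    have AB: "?A * (?B * ?w) = 0" by (rule R2[OF v])
    have "?A * ?B = ?B * ?A"
      using scal_comm_L[of "Suc (Suc k)"] sc_commute[of "q * ?a" "inverse q * ?a"]
      by (simp add: left_diff_distrib right_diff_distrib scal_comm_def)
    then have BA: "?B * (?A * ?w) = 0" using AB by (simp add: mult.assoc[symmetric])
    show ?thesis
      using AB killr[OF _ wY[OF w], of "inverse q * ?a"] killb[OF _ wY[OF w], of "q * ?a"] killb[OF _ w] BA
      by (auto simp: mult.assoc res)
  qed
  show "\<exists>xs. distinct xs \<and> set xs \<subseteq> addable ell ?D \<and> (\<forall>v. wt (Suc k) (res_at t) v \<longrightarrow> Lprod (Suc (Suc k)) xs * v = 0)"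
    using 1 2 3 by blast
qed

lemma decomposes_Suc:
  assumes dec: "decomposes k" and st: "step_holds k" and kn: "k < n"
  shows "decomposes (Suc k)"
  unfolding decomposes_def
proof
  fix v
  obtain f where f: "v = (\<Sum>t\<in>tabs ell k. f t)" "\<And>t. t \<in> tabs ell k \<Longrightarrow> wt k (res_at t) (f t)"
    using dec unfolding decomposes_def by blast
  have "\<forall>t\<in>tabs ell k. \<exists>p. distinct (fst p) \<and> set (fst p) \<subseteq> addable ell (supp t) \<and>
      f t = (\<Sum>x\<in>set (fst p). snd p x) \<and>
      (\<forall>x. wt k (res_at t) (snd p x) \<and> L (Suc k) * snd p x = sc (nres x) * snd p x)"
  proof
    fix t assume t: "t \<in> tabs ell k"
    obtain xs where xs: "distinct xs" "set xs \<subseteq> addable ell (supp t)" "\<And>v. wt k (res_at t) v \<Longrightarrow> Lprod (Suc k) xs * v = 0"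
      using st t unfolding step_holds_def by blast
    have inj: "inj_on nres (set xs)"
    proof (rule inj_onI)
      fix x y assume "x \<in> set xs" "y \<in> set xs" "nres x = nres y"
      then show "x = y"
        using residues_distinct[OF tabs_young[OF t], of x y] tabs_card[OF t] kn xs(2) by blast
    qed
    have "prod_list (map (\<lambda>c. L (Suc k) - sc c) (map nres xs)) * f t = 0"
      using xs(3)[OF f(2)[OF t]] by (simp add: Lprod_def o_def)
    moreover have "distinct (map nres xs)" using xs(1) inj by (simp add: distinct_map)
    ultimately have "\<exists>h. f t = (\<Sum>c\<in>set (map nres xs). h c) \<and>
        (\<forall>c. h c \<in> {w. wt k (res_at t) w} \<and> L (Suc k) * h c = sc c * h c)"
      by (intro eigen_decomp) (use f(2)[OF t] kn in \<open>simp_all add: wt_diff wt_sc wt_L\<close>)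
    then obtain h where h: "f t = (\<Sum>c\<in>nres ` set xs. h c)" "\<And>c. wt k (res_at t) (h c)" "\<And>c. L (Suc k) * h c = sc c * h c"
      by auto
    show "\<exists>p. distinct (fst p) \<and> set (fst p) \<subseteq> addable ell (supp t) \<and>
      f t = (\<Sum>x\<in>set (fst p). snd p x) \<and>
      (\<forall>x. wt k (res_at t) (snd p x) \<and> L (Suc k) * snd p x = sc (nres x) * snd p x)"
      using xs(1,2) h inj by (intro exI[of _ "(xs, h \<circ> nres)"]) (simp add: sum.reindex)
  qed
  from bchoice[OF this] obtain p where p: "\<forall>t\<in>tabs ell k. distinct (fst (p t)) \<and> set (fst (p t)) \<subseteq> addable ell (supp t) \<and>
      f t = (\<Sum>x\<in>set (fst (p t)). snd (p t) x) \<and>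
      (\<forall>x. wt k (res_at t) (snd (p t) x) \<and> L (Suc k) * snd (p t) x = sc (nres x) * snd (p t) x)" ..
  define xs where "xs t = fst (p t)" for t
  define g where "g t = snd (p t)" for t
  have xs: "distinct (xs t) \<and> set (xs t) \<subseteq> addable ell (supp t)" and g: "f t = (\<Sum>x\<in>set (xs t). g t x)"
    and gw: "wt k (res_at t) (g t x) \<and> L (Suc k) * g t x = sc (nres x) * g t x"
    if "t \<in> tabs ell k" for t x
    using p that by (simp_all add: xs_def g_def)
  define h where "h u = (if nd u (Suc k) \<in> set (xs (restrict_tab u k)) then g (restrict_tab u k) (nd u (Suc k)) else 0)" for u
  let ?S = "SIGMA t:tabs ell k. set (xs t)" and ?e = "\<lambda>(t, x). t(x := Suc k)"
  have e: "t(x := Suc k) \<in> tabs ell (Suc k) \<and> restrict_tab (t(x := Suc k)) k = t \<and> nd (t(x := Suc k)) (Suc k) = x"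
    if "t \<in> tabs ell k" "x \<in> set (xs t)" for t x
  proof -
    have xa: "x \<in> addable ell (supp t)" using xs that by blast
    have "t x = 0" using addableD(2)[OF xa] by (simp add: supp_def)
    have "restrict_tab (t(x := Suc k)) k = t"
    proof
      fix y show "restrict_tab (t(x := Suc k)) k y = t y"
        using \<open>t x = 0\<close> tabs_le[OF that(1), of y] by (cases "y = x") (simp_all add: restrict_tab_def)
    qed
    then show ?thesis using extend_tab[OF that(1) xa] by simp
  qed
  have inj: "inj_on ?e ?S"
  proof (rule inj_onI)
    fix p p' assume p: "p \<in> ?S" "p' \<in> ?S" "?e p = ?e p'"
    obtain t x where tx: "p = (t, x)" by (cases p)
    obtain t' x' where tx': "p' = (t', x')" by (cases p')
    have "t \<in> tabs ell k" "x \<in> set (xs t)" "t' \<in> tabs ell k" "x' \<in> set (xs t')"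
      using p(1,2) unfolding tx tx' by simp_all
    note E = e[OF this(1,2)] e[OF this(3,4)]
    have eq: "t(x := Suc k) = t'(x' := Suc k)" using p(3) unfolding tx tx' prod.case .
    show "p = p'" using E(1)[unfolded eq] E(2) unfolding tx tx' by blast
  qed
  have "v = (\<Sum>t\<in>tabs ell k. \<Sum>x\<in>set (xs t). g t x)" using f(1) g by simp
  also have "\<dots> = (\<Sum>(t, x)\<in>?S. g t x)" by (rule sum.Sigma) (auto simp: finite_tabs)
  also have "\<dots> = (\<Sum>p\<in>?S. h (?e p))"
  proof (rule sum.cong)
    fix p assume p: "p \<in> ?S"
    obtain t x where [simp]: "p = (t, x)" by (cases p)
    show "(case p of (t, x) \<Rightarrow> g t x) = h (?e p)" using p e[of t x] by (simp add: h_def)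
  qed simp
  also have "\<dots> = (\<Sum>u\<in>?e ` ?S. h u)" using inj by (simp add: sum.reindex)
  also have "\<dots> = (\<Sum>u\<in>tabs ell (Suc k). h u)"
  proof (rule sum.mono_neutral_left[OF finite_tabs])
    show "?e ` ?S \<subseteq> tabs ell (Suc k)"
    proof (rule image_subsetI)
      fix p assume p: "p \<in> ?S"
      obtain t x where [simp]: "p = (t, x)" by (cases p)
      show "?e p \<in> tabs ell (Suc k)" using p e[of t x] by simp
    qed
    show "\<forall>u\<in>tabs ell (Suc k) - ?e ` ?S. h u = 0"
    proof
      fix u assume u: "u \<in> tabs ell (Suc k) - ?e ` ?S"
      then have ut: "u \<in> tabs ell (Suc k)" by blast
      have "restrict_tab u k \<in> tabs ell k" using restrict_tab_tabs(1)[OF ut] by simp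
      moreover have "u = ?e (restrict_tab u k, nd u (Suc k))" using extend_restrict(1)[OF ut] by simp
      ultimately have "nd u (Suc k) \<notin> set (xs (restrict_tab u k))" using u by blast
      then show "h u = 0" by (simp add: h_def)
    qed
  qed
  finally have "v = (\<Sum>u\<in>tabs ell (Suc k). h u)" .
  moreover have "wt (Suc k) (res_at u) (h u)" if u: "u \<in> tabs ell (Suc k)" for u
  proof -
    have r: "restrict_tab u k \<in> tabs ell k" using restrict_tab_tabs(1)[OF u] by simp
    note G = gw[OF r, of "nd u (Suc k)"]
    have "wt k (res_at (restrict_tab u k)) (g (restrict_tab u k) (nd u (Suc k))) \<longleftrightarrow> wt k (res_at u) (g (restrict_tab u k) (nd u (Suc k)))"
      by (rule wt_cong) (simp add: restrict_tab_tabs(3)[OF u])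
    with G show ?thesis by (auto simp: h_def wt_def le_Suc_eq)
  qed
  ultimately show "\<exists>f. v = sum f (tabs ell (Suc k)) \<and> (\<forall>t\<in>tabs ell (Suc k). wt (Suc k) (res_at t) (f t))" by blast
qed

theorem decomposes_n: "decomposes n"
proof -
  have "k < n \<Longrightarrow> decomposes k \<and> step_holds k" for k
  proof (induction k)
    case 0
    have "decomposes 0" unfolding decomposes_def
    proof
      fix v show "\<exists>f. v = (\<Sum>t\<in>tabs ell 0. f t) \<and> (\<forall>t\<in>tabs ell 0. wt 0 (res_at t) (f t))"
        by (intro exI[of _ "\<lambda>_. v"]) (simp add: tabs_0 wt_def)
    qed
    then show ?case using step_holds_0 by blast
  next
    case (Suc k)
    then have "decomposes (Suc k)" using decomposes_Suc by simp
    then show ?case using step_holds_Suc Suc by simp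
  qed
  from this[of "n - 1"] decomposes_Suc[of "n - 1"] n1 show ?thesis by simp
qed

end

section \<open>Seminormal idempotents and their matrix units\<close>

definition dp :: "nat \<Rightarrow> tab \<Rightarrow> tab \<Rightarrow> nat \<Rightarrow> nat" where
  "dp n s t k = (if k \<in> {1..n} then t (nd s k) else k)"

lemma dp_tabs:
  assumes s: "s \<in> tabs ell n" and t: "t \<in> tabs ell n" and st: "supp s = supp t"
  shows dp_permutes: "dp n s t permutes {1..n}" and dp_comp: "dp n s t \<circ> s = t"
    and dp_unique: "w permutes {1..n} \<Longrightarrow> w \<circ> s = t \<Longrightarrow> w = dp n s t"
    and dp_inv_count: "inv_count n (dp n s t) = card (Invs s t)"
proof -
  have "bij_betw (nd s) {1..n} (supp s)"
  proof (rule bij_betwI[where g = s])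
    show "nd s \<in> {1..n} \<rightarrow> supp s" using s by auto
    show "s \<in> supp s \<rightarrow> {1..n}" using bij_betw_imp_funcset[OF tabs_bij[OF s]] .
    show "s (nd s m) = m" if "m \<in> {1..n}" for m using s that by simp
    show "nd s (s x) = x" if "x \<in> supp s" for x using nd_eq[OF s refl, of x] that by (simp add: supp_def)
  qed
  from bij_betw_trans[OF this tabs_bij[OF t, folded st]] have b: "bij_betw (t \<circ> nd s) {1..n} {1..n}" .
  show p: "dp n s t permutes {1..n}"
  proof (rule bij_imp_permutes)
    show "bij_betw (dp n s t) {1..n} {1..n}"
      using b by (subst bij_betw_cong[where g = "t \<circ> nd s"]) (simp_all add: dp_def)
  qed (auto simp: dp_def)
  show c: "dp n s t \<circ> s = t"
  proof
    fix x show "(dp n s t \<circ> s) x = t x"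
    proof (cases "s x = 0")
      case True
      then have "x \<notin> supp t" unfolding st[symmetric] by (simp add: supp_def)
      then have "t x = 0" by (simp add: supp_def)
      then show ?thesis using True by (simp add: dp_def)
    next
      case False
      then show ?thesis using nd_eq[OF s refl False] tabs_le[OF s, of x] by (simp add: dp_def)
    qed
  qed
  show "w = dp n s t" if w: "w permutes {1..n}" "w \<circ> s = t"
  proof
    fix k show "w k = dp n s t k"
    proof (cases "k \<in> {1..n}")
      case True
      then have "w k = (w \<circ> s) (nd s k)" using s by simp
      then show ?thesis using True w(2) by (simp add: dp_def)
    next
      case False then show ?thesis using permutes_not_in[OF w(1) False] by (auto simp: dp_def)
    qed
  qed
  have "bij_betw (\<lambda>(x, y). (s x, s y)) (Invs s t) (inversions n (dp n s t))"
  proof (rule bij_betw_byWitness[where f' = "\<lambda>(a, b). (nd s a, nd s b)"])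
    show "\<forall>p\<in>Invs s t. (\<lambda>(a, b). (nd s a, nd s b)) ((\<lambda>(x, y). (s x, s y)) p) = p"
    proof
      fix p assume p: "p \<in> Invs s t"
      obtain x y where [simp]: "p = (x, y)" by (cases p)
      have "x \<in> supp s" "y \<in> supp s" using p st by (simp_all add: Invs_def)
      then have "s x \<noteq> 0" "s y \<noteq> 0" by (simp_all add: supp_def)
      then show "(\<lambda>(a, b). (nd s a, nd s b)) ((\<lambda>(x, y). (s x, s y)) p) = p"
        using nd_eq[OF s refl, of x] nd_eq[OF s refl, of y] by simp
    qed
    show "\<forall>p\<in>inversions n (dp n s t). (\<lambda>(x, y). (s x, s y)) ((\<lambda>(a, b). (nd s a, nd s b)) p) = p"
      using s by (auto simp: inversions_def)
    show "(\<lambda>(x, y). (s x, s y)) ` Invs s t \<subseteq> inversions n (dp n s t)"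
    proof (rule image_subsetI)
      fix p assume p: "p \<in> Invs s t"
      obtain x y where [simp]: "p = (x, y)" by (cases p)
      have "x \<in> supp s" "y \<in> supp s" using p st by (simp_all add: Invs_def)
      then have "s x \<noteq> 0" "s y \<noteq> 0" by (simp_all add: supp_def)
      then show "(\<lambda>(x, y). (s x, s y)) p \<in> inversions n (dp n s t)"
        using p fun_cong[OF c, of x] fun_cong[OF c, of y] tabs_le[OF s, of y]
        by (simp add: Invs_def inversions_def)
    qed
    show "(\<lambda>(a, b). (nd s a, nd s b)) ` inversions n (dp n s t) \<subseteq> Invs s t"
    proof (rule image_subsetI)
      fix p assume p: "p \<in> inversions n (dp n s t)"
      obtain a b where [simp]: "p = (a, b)" by (cases p)
      have ab: "1 \<le> a" "a < b" "b \<le> n" "dp n s t b < dp n s t a" using p by (auto simp: inversions_def)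
      then show "(\<lambda>(a, b). (nd s a, nd s b)) p \<in> Invs s t"
        using nd_supp[OF s, of a] nd_supp[OF s, of b] st s by (simp add: Invs_def dp_def)
    qed
  qed
  from bij_betw_same_card[OF this] show "inv_count n (dp n s t) = card (Invs s t)" by simp
qed

lemma dp_dp:
  assumes "s \<in> tabs ell n" "t \<in> tabs ell n" "u \<in> tabs ell n" "supp s = supp t" "supp t = supp u"
  shows "dp n t u \<circ> dp n s t = dp n s u"
  using assms dp_comp[of s ell n t] dp_comp[of t ell n u]
  by (intro dp_unique[of s ell n u]) (auto intro: permutes_compose dp_permutes simp: comp_assoc)

lemma dp_self: "s \<in> tabs ell n \<Longrightarrow> dp n s s = id"
  using dp_unique[of s ell n s id] by (simp add: permutes_id)

lemma card_Invs_commute: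
  assumes "supp s = supp t" shows "card (Invs s t) = card (Invs t s)"
proof -
  have "Invs t s = (Invs s t)\<inverse>" using assms by (auto simp: Invs_def)
  then show ?thesis by (metis card_inverse)
qed

lemma card_Invs_swap_le:
  assumes t: "t \<in> tabs ell k" and s: "sperm i \<circ> t \<in> tabs ell k" and i: "1 \<le> i" "i < k"
  shows "card (Invs b (sperm i \<circ> t)) \<le> Suc (card (Invs b t))"
proof -
  have fin: "finite (Invs b t)" "finite (Invs b (sperm i \<circ> t))"
    using finite_Invs young_finite[OF tabs_young] s t by blast+
  consider "b (nd t (Suc i)) < b (nd t i)" | "b (nd t i) < b (nd t (Suc i))" | "b (nd t i) = b (nd t (Suc i))" by linarith
  then show ?thesis
  proof cases
    case 1
    then have "Invs b (sperm i \<circ> t) \<subseteq> Invs b t" using Invs_swap(1)[OF t i 1] by auto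
    then show ?thesis using card_mono[OF fin(1)] by (simp add: le_SucI)
  next
    case 2
    have nds: "nd (sperm i \<circ> t) i = nd t (Suc i)" "nd (sperm i \<circ> t) (Suc i) = nd t i"
      using swap_nd[OF t i s] i by simp_all
    show ?thesis using Invs_swap(1)[OF s i, of b] 2 nds card_insert_le_m1 fin(1)
      by (simp add: card_insert_if)
  next
    case 3
    have "Invs b (sperm i \<circ> t) \<subseteq> Invs b t"
    proof
      fix p assume p: "p \<in> Invs b (sperm i \<circ> t)"
      obtain x y where xy: "p = (x, y)" by (cases p)
      have q: "x \<in> supp t" "y \<in> supp t" "b x < b y" "sperm i (t y) < sperm i (t x)"
        using p swap_supp[OF t i] by (auto simp: Invs_def xy)
      have "\<not> (t x = i \<and> t y = Suc i)"
        using nd_eq[OF t, of x i] nd_eq[OF t, of y "Suc i"] 3 q(3) i by auto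
      then have "t y < t x"
        using q(4) sperm_less[of "t x" "t y" i] by (cases "t x" "t y" rule: linorder_cases) auto
      then show "p \<in> Invs b t" using q xy by (simp add: Invs_def)
    qed
    then show ?thesis using card_mono[OF fin(1)] by (simp add: le_SucI)
  qed
qed

context seminormal
begin

definition Rset :: "nat \<Rightarrow> 'k set" where
  "Rset k = {res_at t k | t. t \<in> tabs ell n}"

lemma finite_Rset: "finite (Rset k)"
  using finite_tabs[of ell n] by (simp add: Rset_def Setcompr_eq_image)

lemma set_enum_set: "finite A \<Longrightarrow> set (enum_set A) = A"
  unfolding enum_set_def using finite_distinct_list[of A] by (metis (mono_tags, lifting) someI_ex)

text \<open>The product of Lagrange interpolation factors, which is \<open>1\<close> on the joint eigenspace of \<open>t\<close> and
  \<open>0\<close> on the others.\<close>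
definition F :: "tab \<Rightarrow> 'a" where
  "F t = prod_list [sc (inverse (res_at t k - c)) * (L k - sc c).
     k \<leftarrow> [1..<Suc n], c \<leftarrow> enum_set (Rset k - {res_at t k})]"

lemma prod_list_eigen:
  assumes "\<And>x. x \<in> set xs \<Longrightarrow> f x * v = sc (g x) * v" "\<And>x. x \<in> set xs \<Longrightarrow> scal_comm (f x)"
  shows "prod_list (map f xs) * v = sc (prod_list (map g xs)) * v"
  using assms by (induction xs) (simp_all add: mult.assoc scal_comm_v mult.commute)

lemma prod_list_eq_1: "(\<And>x. x \<in> set xs \<Longrightarrow> f x = 1) \<Longrightarrow> prod_list (map f xs) = 1" for f :: "'b \<Rightarrow> 'k"
  by (induction xs) simp_all

lemma F_wt:
  assumes t: "t \<in> tabs ell n" and u: "u \<in> tabs ell n" and v: "wt n (res_at u) v"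
  shows "F t * v = (if u = t then v else 0)"
proof -
  define ps where "ps = [(k, c). k \<leftarrow> [1..<Suc n], c \<leftarrow> enum_set (Rset k - {res_at t k})]"
  let ?f = "\<lambda>(k, c). sc (inverse (res_at t k - c)) * (L k - sc c)"
  let ?g = "\<lambda>(k, c). inverse (res_at t k - c) * (res_at u k - c)"
  have F: "F t = prod_list (map ?f ps)"
    unfolding F_def ps_def by (simp add: map_concat o_def del: upt_Suc)
  have "set ps = (\<Union>k\<in>{1..<Suc n}. Pair k ` (Rset k - {res_at t k}))"
    by (simp add: ps_def set_enum_set finite_Rset del: upt_Suc)
  then have mem: "(k, c) \<in> set ps \<longleftrightarrow> 1 \<le> k \<and> k \<le> n \<and> c \<in> Rset k \<and> c \<noteq> res_at t k" for k c
    by (simp only: UN_iff image_iff Bex_def Diff_iff singleton_iff atLeastLessThan_iff less_Suc_eq_le prod.inject) blast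
  have "F t * v = sc (prod_list (map ?g ps)) * v"
    unfolding F
  proof (rule prod_list_eigen)
    fix p assume p: "p \<in> set ps"
    obtain k c where kc: "p = (k, c)" by (cases p)
    have k: "1 \<le> k" "k \<le> n" using p mem[of k c] unfolding kc by simp_all
    show "?f p * v = sc (?g p) * v"
      using L_minus_v[OF wtD[OF v k], of c] by (simp add: kc mult.assoc)
    show "scal_comm (?f p)" unfolding kc by simp
  qed
  also have "prod_list (map ?g ps) = (if u = t then 1 else 0)"
  proof (cases "u = t")
    case True
    have "?g p = 1" if p: "p \<in> set ps" for p
    proof -
      obtain k c where kc: "p = (k, c)" by (cases p)
      have "c \<noteq> res_at t k" using p mem[of k c] unfolding kc by simp
      then show ?thesis using True by (simp add: kc)
    qed
    then have "prod_list (map ?g ps) = 1" by (rule prod_list_eq_1)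
    then show ?thesis using True by simp
  next
    case False
    then obtain k where k: "1 \<le> k" "k \<le> n" "res_at u k \<noteq> res_at t k"
      using tab_eq_of_residues[OF u t order_refl] by metis
    have "res_at u k \<in> Rset k" unfolding Rset_def using u by blast
    then have "(k, res_at u k) \<in> set ps" using k mem[of k "res_at u k"] by simp
    then have "?g (k, res_at u k) \<in> ?g ` set ps" by (rule imageI)
    then have "0 \<in> set (map ?g ps)" by simp
    then show ?thesis using False by (simp add: prod_list_zero_iff)
  qed
  finally show ?thesis by simp
qed

lemma F_sum_v: "(\<Sum>t\<in>tabs ell n. F t * v) = v" and wt_F_v: "t \<in> tabs ell n \<Longrightarrow> wt n (res_at t) (F t * v)"
proof -
  obtain f where f: "v = (\<Sum>t\<in>tabs ell n. f t)" "\<And>t. t \<in> tabs ell n \<Longrightarrow> wt n (res_at t) (f t)"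
    using decomposes_n unfolding decomposes_def by blast
  have Fv: "F t * v = f t" if t: "t \<in> tabs ell n" for t
  proof -
    have "F t * v = (\<Sum>u\<in>tabs ell n. if u = t then f u else 0)"
      unfolding f(1) sum_distrib_left
    proof (rule sum.cong[OF refl])
      fix u assume u: "u \<in> tabs ell n"
      show "F t * f u = (if u = t then f u else 0)" by (rule F_wt[OF t u f(2)[OF u]])
    qed
    then show ?thesis using t finite_tabs by simp
  qed
  show "(\<Sum>t\<in>tabs ell n. F t * v) = v" using Fv f(1) by simp
  show "wt n (res_at t) (F t * v)" if "t \<in> tabs ell n" using Fv[OF that] f(2)[OF that] by simp
qed

lemma F_F: "s \<in> tabs ell n \<Longrightarrow> t \<in> tabs ell n \<Longrightarrow> F s * (F t * v) = (if s = t then F t * v else 0)"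
  using F_wt[of s t "F t * v"] wt_F_v[of t v] by (cases "s = t") simp_all

lemma F_idem: "t \<in> tabs ell n \<Longrightarrow> F t * F t = F t"
  using F_F[of t t 1] by simp

lemma scal_comm_F [simp]: "scal_comm (F t)"
  unfolding F_def by (rule scal_comm_prod_list) (auto simp del: upt_Suc)

lemma F_sc_v [simp]: "F t * (sc c * v) = sc c * (F t * v)"
  by (simp add: scal_comm_v)

lemma F_L: assumes t: "t \<in> tabs ell n" and m: "1 \<le> m" "m \<le> n"
  shows "F t * (L m * v) = sc (res_at t m) * (F t * v)"
proof -
  have "F t * (L m * (F u * v)) = sc (res_at t m) * (F t * (F u * v))" if u: "u \<in> tabs ell n" for u
    using wtD[OF wt_F_v[OF u] m] F_F[OF t u] by (cases "t = u") simp_all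
  then have "(\<Sum>u\<in>tabs ell n. F t * (L m * (F u * v))) = (\<Sum>u\<in>tabs ell n. sc (res_at t m) * (F t * (F u * v)))"
    by simp
  then show ?thesis by (simp add: F_sum_v flip: sum_distrib_left)
qed

lemma T_F:
  assumes t: "t \<in> tabs ell n" and i: "1 \<le> i" "i < n"
  shows T_F_swap: "sperm i \<circ> t \<in> tabs ell n \<Longrightarrow> T i * (F t * v) = sc (dg i t) * (F t * v) + F (sperm i \<circ> t) * (T i * (F t * v))"
    and T_F_fix: "sperm i \<circ> t \<notin> tabs ell n \<Longrightarrow> T i * (F t * v) = sc (dg i t) * (F t * v)"
    and F_T_F_phi: "sperm i \<circ> t \<in> tabs ell n \<Longrightarrow> F t * (T i * (F (sperm i \<circ> t) * (T i * (F t * v)))) =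
      sc (phi (res_at t i) (res_at t (Suc i))) * (F t * v)"
proof -
  let ?s = "sperm i \<circ> t"
  let ?x = "T i * (F t * v) - sc (dg i t) * (F t * v)"
  note sw = swap_wt[OF t i order_refl wt_F_v[OF t, of v]]
  show "T i * (F t * v) = sc (dg i t) * (F t * v)" if "?s \<notin> tabs ell n"
    using sw(3)[OF that decomposes_n] .
  assume s: "?s \<in> tabs ell n"
  have ne: "?s \<noteq> t"
    using swap_nd[OF t i s, of i] nd_inj[OF t, of i "Suc i"] i by auto
  have "F ?s * ?x = ?x" using F_wt[OF s s sw(2)[OF s]] by simp
  moreover have "F ?s * ?x = F ?s * (T i * (F t * v))"
    using F_F[OF s t] ne by (simp add: right_diff_distrib)
  ultimately have x: "F ?s * (T i * (F t * v)) = ?x" by simp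
  then show "T i * (F t * v) = sc (dg i t) * (F t * v) + F ?s * (T i * (F t * v))" by simp
  have "T i * ?x = sc (diag (res_at t (Suc i)) (res_at t i)) * ?x + sc (phi (res_at t i) (res_at t (Suc i))) * (F t * v)"
    using sw(4) by (simp add: algebra_simps)
  moreover have "F t * ?x = 0" using F_wt[OF t s sw(2)[OF s]] ne by simp
  ultimately show "F t * (T i * (F ?s * (T i * (F t * v)))) = sc (phi (res_at t i) (res_at t (Suc i))) * (F t * v)"
    unfolding x by (simp add: distrib_left F_F[OF t t])
qed

lemma F_T_F:
  assumes t: "t \<in> tabs ell n" and s: "s \<in> tabs ell n" and i: "1 \<le> i" "i < n"
  shows "F s * (T i * (F t * v)) = (if s = t then sc (dg i t) * (F t * v) else if s = sperm i \<circ> t then F s * (T i * (F t * v)) else 0)"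
proof (cases "sperm i \<circ> t \<in> tabs ell n")
  case True
  have "F s * (T i * (F t * v)) = F s * (sc (dg i t) * (F t * v) + F (sperm i \<circ> t) * (T i * (F t * v)))"
    using T_F_swap[OF t i True] by metis
  also have "\<dots> = sc (dg i t) * (F s * (F t * v)) + F s * (F (sperm i \<circ> t) * (T i * (F t * v)))"
    by (simp add: distrib_left)
  finally have e: "F s * (T i * (F t * v)) = sc (dg i t) * (F s * (F t * v)) + F s * (F (sperm i \<circ> t) * (T i * (F t * v)))" .
  have "sperm i \<circ> t \<noteq> t"
    using swap_nd[OF t i True, of i] nd_inj[OF t, of i "Suc i"] i by auto
  then show ?thesis using e F_F[OF s t] F_F[OF s True] by auto
next
  case False
  then show ?thesis using T_F_fix[OF t i False] F_F[OF s t] s by auto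
qed

text \<open>Each \<open>T\<^sub>i\<close> maps an eigenspace to itself and its neighbour under \<open>s\<^sub>i\<close>. So a word of length \<open>l\<close>
  connects only fillings at distance at most \<open>l\<close>, and at distance \<open>l\<close> along one path.\<close>
lemma F_word_F:
  assumes "s \<in> tabs ell n" "t \<in> tabs ell n" "set is \<subseteq> {1..<n}" "F s * (word_prod is * (F t * v)) \<noteq> 0"
  shows "supp s = supp t \<and> card (Invs b t) \<le> card (Invs b s) + length is \<and>
    (card (Invs b t) = card (Invs b s) + length is \<longrightarrow> t = word_perm is \<circ> s)"
  using assms
proof (induction "is" arbitrary: s)
  case Nil
  then have "s = t" using F_F[of s t v] by (auto split: if_splits)
  then show ?case by simp
next
  case (Cons i js)
  have i: "1 \<le> i" "i < n" and js: "set js \<subseteq> {1..<n}" using Cons.prems(3) by auto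
  have "F s * (T i * (\<Sum>u\<in>tabs ell n. F u * (word_prod js * (F t * v)))) \<noteq> 0"
    using Cons.prems(4) by (simp add: F_sum_v mult.assoc)
  then have "(\<Sum>u\<in>tabs ell n. F s * (T i * (F u * (word_prod js * (F t * v))))) \<noteq> 0"
    by (simp add: sum_distrib_left)
  then obtain u where u: "u \<in> tabs ell n" "F s * (T i * (F u * (word_prod js * (F t * v)))) \<noteq> 0"
    by (meson sum.not_neutral_contains_not_neutral)
  have "F u * (word_prod js * (F t * v)) \<noteq> 0" using u(2) by auto
  note IH = Cons.IH[OF u(1) Cons.prems(2) js this]
  have "s = u \<or> s = sperm i \<circ> u"
    using F_T_F[OF u(1) Cons.prems(1) i] u(2) by metis
  then show ?case
  proof
    assume "s = u"
    then show ?thesis using IH by auto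
  next
    assume su: "s = sperm i \<circ> u"
    then have us: "u = sperm i \<circ> s" by simp
    have "card (Invs b u) \<le> Suc (card (Invs b s))"
      using card_Invs_swap_le[OF Cons.prems(1) _ i, of b] us u(1) by simp
    moreover have "supp s = supp u" using swap_supp[OF u(1) i] su by simp
    moreover have w: "word_perm (i # js) \<circ> s = word_perm js \<circ> u"
      by (simp only: us word_perm_Cons comp_assoc)
    ultimately show ?thesis
    proof (intro conjI impI)
      assume "card (Invs b t) = card (Invs b s) + length (i # js)"
      then have "card (Invs b t) = card (Invs b u) + length js"
        using IH \<open>card (Invs b u) \<le> Suc (card (Invs b s))\<close> by simp
      then show "t = word_perm (i # js) \<circ> s" using IH unfolding w by blast
    qed (use IH in auto)
  qed
qed

lemma F_T_of_F_0:
  assumes "s \<in> tabs ell n" "t \<in> tabs ell n" "w permutes {1..n}" "supp s \<noteq> supp t"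
  shows "F s * (T_of w * (F t * v)) = 0"
proof -
  obtain "is" where "is": "is \<in> reduced_words n w" using reduced_words_exist[OF assms(3)] by blast
  then have "set is \<subseteq> {1..<n}" by (auto simp: reduced_words_iff)
  from F_word_F[OF assms(1,2) this, of v s] show ?thesis using T_of_reduced[OF "is"] assms(4) by auto
qed

definition Psi :: "tab \<Rightarrow> tab \<Rightarrow> 'a" where
  "Psi s t = F s * (T_of (dp n s t) * F t)"

lemma F_Psi: "s \<in> tabs ell n \<Longrightarrow> F s * (Psi s t * v) = Psi s t * v"
  and Psi_F: "t \<in> tabs ell n \<Longrightarrow> Psi s t * (F t * v) = Psi s t * v"
  using F_F[of s s] F_F[of t t] by (simp_all add: Psi_def mult.assoc)

text \<open>When lengths add, a path of standard fillings from \<open>b\<close> to \<open>t\<close> along a reduced word has no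
  choice but to pass through \<open>u\<close>.\<close>
lemma Psi_Psi:
  assumes b: "b \<in> tabs ell n" and u: "u \<in> tabs ell n" and t: "t \<in> tabs ell n"
    and sp: "supp b = supp u" "supp u = supp t"
    and len: "card (Invs b t) = card (Invs b u) + card (Invs u t)"
  shows "Psi b t = Psi b u * Psi u t"
proof -
  obtain is1 where is1: "is1 \<in> reduced_words n (dp n b u)" using reduced_words_exist dp_permutes[OF b u sp(1)] by blast
  obtain is2 where is2: "is2 \<in> reduced_words n (dp n u t)" using reduced_words_exist dp_permutes[OF u t sp(2)] by blast
  have r1: "set is1 \<subseteq> {1..<n}" "word_perm is1 = dp n b u" "length is1 = card (Invs b u)"
    using is1 dp_inv_count[OF b u sp(1)] by (simp_all add: reduced_words_iff)
  have r2: "set is2 \<subseteq> {1..<n}" "word_perm is2 = dp n u t" "length is2 = card (Invs u t)"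
    using is2 dp_inv_count[OF u t sp(2)] by (simp_all add: reduced_words_iff)
  have "is1 @ is2 \<in> reduced_words n (dp n b t)"
    using r1 r2 len dp_dp[OF b u t sp] dp_inv_count[OF b t] sp by (simp add: reduced_words_iff)
  then have Tbt: "T_of (dp n b t) = word_prod is1 * word_prod is2" using T_of_reduced by force
  have "F y * (word_prod is2 * F t) = 0 \<or> F b * (word_prod is1 * (F y * (word_prod is2 * F t))) = 0"
    if y: "y \<in> tabs ell n" "y \<noteq> u" for y
  proof (rule ccontr)
    assume "\<not> ?thesis"
    then have n2: "F y * (word_prod is2 * (F t * 1)) \<noteq> 0" and n1: "F b * (word_prod is1 * (F y * (word_prod is2 * F t))) \<noteq> 0"
      by auto
    note w1 = F_word_F[OF b y(1) r1(1) n1, of b] and w2 = F_word_F[OF y(1) t r2(1) n2, of b]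
    have "y = word_perm is1 \<circ> b" using w1 w2 len r1(3) r2(3) by simp
    also have "\<dots> = u" using r1(2) dp_comp[OF b u sp(1)] by simp
    finally show False using y(2) by simp
  qed
  then have z: "F b * (word_prod is1 * (F y * (word_prod is2 * F t))) = 0" if "y \<in> tabs ell n" "y \<noteq> u" for y
    using that by force
  have "Psi b t = (\<Sum>y\<in>tabs ell n. F b * (word_prod is1 * (F y * (word_prod is2 * F t))))"
    unfolding Psi_def Tbt by (simp add: F_sum_v mult.assoc flip: sum_distrib_left)
  also have "\<dots> = (\<Sum>y\<in>tabs ell n. if y = u then F b * (word_prod is1 * (F y * (word_prod is2 * F t))) else 0)"
    using z by (intro sum.cong) auto
  also have "\<dots> = F b * (word_prod is1 * (F u * (word_prod is2 * F t)))"
    using u finite_tabs by simp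
  also have "\<dots> = Psi b u * Psi u t"
    using T_of_reduced[OF is1] T_of_reduced[OF is2] F_F[OF u u] by (simp add: Psi_def mult.assoc)
  finally show ?thesis .
qed

definition gam :: "tab \<Rightarrow> tab \<Rightarrow> 'k" where
  "gam b t = (\<Prod>(x, y)\<in>Invs b t. phi (nres x) (nres y))"

lemma phi_commute: "phi a b = phi b a"
  by (simp add: phi_def power2_commute[of a b]) (simp add: algebra_simps)

lemma gam_descent:
  assumes t: "t \<in> tabs ell n" and i: "1 \<le> i" "i < n" and lt: "b (nd t (Suc i)) < b (nd t i)"
  shows "gam b t = phi (res_at t i) (res_at t (Suc i)) * gam b (sperm i \<circ> t)"
proof -
  have "finite (Invs b (sperm i \<circ> t))"
    using finite_Invs young_finite[OF tabs_young[OF t]] swap_supp[OF t i] by metis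
  then show ?thesis
    using Invs_swap[OF t i lt] phi_commute by (simp add: gam_def)
qed

text \<open>By induction along descents; each step contributes the square of one intertwiner.\<close>
lemma Psi_Psi_gam:
  assumes b: "b \<in> tabs ell n"
  shows "t \<in> tabs ell n \<Longrightarrow> supp b = supp t \<Longrightarrow>
    Psi t b * Psi b t = sc (gam b t) * F t \<and> Psi b t * Psi t b = sc (gam b t) * F b \<and> gam b t \<noteq> 0"
proof (induction "card (Invs b t)" arbitrary: t rule: less_induct)
  case less
  note t = less.prems(1)
  show ?case
  proof (cases "b = t")
    case True
    then show ?thesis using F_F[OF t t] F_idem[OF t] by (simp add: Psi_def dp_self[OF t] gam_def)
  next
    case False
    then obtain i where i: "1 \<le> i" "i < n" "b (nd t (Suc i)) < b (nd t i)" and u: "sperm i \<circ> t \<in> tabs ell n"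
      and card: "card (Invs b t) = Suc (card (Invs b (sperm i \<circ> t)))"
      using tab_descent[OF t b less.prems(2)] by blast
    let ?u = "sperm i \<circ> t"
    have su: "supp ?u = supp t" using swap_supp[OF t i(1,2)] .
    have nds: "nd ?u i = nd t (Suc i)" "nd ?u (Suc i) = nd t i"
      using swap_nd[OF t i(1,2) u] i by simp_all
    have "card (Invs ?u t) = 1"
    proof -
      have ul: "?u (nd t (Suc i)) < ?u (nd t i)" using t i by simp
      have "Invs ?u t = {(nd t (Suc i), nd t i)}" by (simp only: Invs_swap(1)[OF t i(1,2) ul] Invs_self)
      then show ?thesis by simp
    qed
    then have len: "card (Invs b t) = card (Invs b ?u) + card (Invs ?u t)"
      "card (Invs t b) = card (Invs t ?u) + card (Invs ?u b)"
      using card card_Invs_commute[of b t] card_Invs_commute[of b ?u] card_Invs_commute[of ?u t] su less.prems(2) by simp_all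
    have p: "Psi b t = Psi b ?u * Psi ?u t" "Psi t b = Psi t ?u * Psi ?u b"
      using Psi_Psi[OF b u t _ _ len(1)] Psi_Psi[OF t u b _ _ len(2)] su less.prems(2) by simp_all
    have dps: "dp n ?u t = sperm i" "dp n t ?u = sperm i"
      using dp_unique[OF u t su sperm_permutes[OF i(1,2)]] dp_unique[OF t u su[symmetric] sperm_permutes[OF i(1,2)]] by simp_all
    have "[i] \<in> reduced_words n (sperm i)"
      using dp_inv_count[OF u t su] dps \<open>card (Invs ?u t) = 1\<close> i by (simp add: reduced_words_iff)
    then have Ti: "T_of (sperm i) = T i" using T_of_reduced by force
    have e1: "Psi t ?u * Psi ?u t = sc (phi (res_at t i) (res_at t (Suc i))) * F t"
      using F_T_F_phi[OF t i(1,2) u, of 1] F_F[OF u u] by (simp add: Psi_def dps Ti mult.assoc)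
    have e2: "Psi ?u t * Psi t ?u = sc (phi (res_at t i) (res_at t (Suc i))) * F ?u"
      using F_T_F_phi[OF u i(1,2), of 1] F_F[OF t t] t nds phi_commute by (simp add: Psi_def dps Ti mult.assoc)
    have IH: "Psi ?u b * Psi b ?u = sc (gam b ?u) * F ?u" "Psi b ?u * Psi ?u b = sc (gam b ?u) * F b" "gam b ?u \<noteq> 0"
      using less.hyps[of ?u] u card su less.prems(2) by simp_all
    have scp: "Psi s t' * (sc c * v) = sc c * (Psi s t' * v)" for s t' c v
      by (simp add: scal_comm_v Psi_def)
    note g = gam_descent[where b = b, OF t i]
    have "Psi t b * Psi b t = Psi t ?u * (Psi ?u b * Psi b ?u * Psi ?u t)" by (simp add: p mult.assoc)
    also have "\<dots> = sc (gam b ?u) * (Psi t ?u * Psi ?u t)"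
      by (simp add: IH(1) mult.assoc scp F_Psi[OF u, of t 1, simplified])
    finally have 1: "Psi t b * Psi b t = sc (gam b t) * F t" by (simp add: e1 g mult.commute)
    have "Psi b t * Psi t b = Psi b ?u * (Psi ?u t * Psi t ?u * Psi ?u b)" by (simp add: p mult.assoc)
    also have "\<dots> = sc (phi (res_at t i) (res_at t (Suc i))) * (Psi b ?u * Psi ?u b)"
      by (simp add: e2 mult.assoc scp F_Psi[OF u, of b 1, simplified])
    finally have 2: "Psi b t * Psi t b = sc (gam b t) * F b" by (simp add: IH(2) g mult.commute)
    have "phi (res_at t i) (res_at t (Suc i)) \<noteq> 0"
      using phi_factors[OF t i(1,2) order_refl u] by (simp add: phi_def)
    then show ?thesis using 1 2 IH(3) g by simp
  qed
qed

text \<open>Comparison of the matrix units based at \<open>a\<close> with those based at \<open>z\<close>, if every filling lies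
  between \<open>a\<close> and \<open>z\<close> in the weak order.\<close>
theorem Psi_base_change:
  assumes a: "a \<in> tabs ell n" and z: "z \<in> tabs ell n" and s: "s \<in> tabs ell n" and t: "t \<in> tabs ell n"
    and sp: "supp a = supp t" "supp z = supp t" "supp s = supp t"
    and len: "\<And>u. u \<in> tabs ell n \<Longrightarrow> supp u = supp a \<Longrightarrow> card (Invs a z) = card (Invs a u) + card (Invs u z)"
  shows "Psi s z * Psi z t = sc (gam a z / (gam a s * gam a t)) * (Psi s a * Psi a t)"
proof -
  have len': "card (Invs z a) = card (Invs z u) + card (Invs u a)" if "u \<in> tabs ell n" "supp u = supp a" for u
  proof -
    have "supp a = supp z" "supp a = supp u" "supp u = supp z" using that(2) sp by simp_all
    then show ?thesis
      using len[OF that] card_Invs_commute[of a z] card_Invs_commute[of a u] card_Invs_commute[of u z] by linarith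
  qed
  have G: "Psi u a * Psi a u = sc (gam a u) * F u" "Psi a u * Psi u a = sc (gam a u) * F a" "gam a u \<noteq> 0"
    if "u \<in> tabs ell n" "supp u = supp t" for u
    using Psi_Psi_gam[OF a that(1)] sp that(2) by auto
  note Gs = G[OF s sp(3)] and Gt = G[OF t refl] and Gz = G[OF z sp(2)]
  have scp: "Psi s t' * (sc c * v) = sc c * (Psi s t' * v)" for s t' c v
    by (simp add: scal_comm_v Psi_def)
  have "Psi s a * Psi a z = Psi s a * (Psi a s * Psi s z)"
    by (simp only: Psi_Psi[OF a s z trans[OF sp(1) sp(3)[symmetric]] trans[OF sp(3) sp(2)[symmetric]]
      len[OF s trans[OF sp(3) sp(1)[symmetric]]]])
  also have "\<dots> = sc (gam a s) * F s * Psi s z" by (simp only: mult.assoc[symmetric] Gs(1))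
  also have "\<dots> = sc (gam a s) * Psi s z" using F_Psi[OF s, of z 1] by (simp add: mult.assoc)
  finally have 1: "Psi s a * Psi a z = sc (gam a s) * Psi s z" .
  have "Psi z a * Psi a t = Psi z t * (Psi t a * Psi a t)"
    by (simp only: Psi_Psi[OF z t a sp(2) sp(1)[symmetric] len'[OF t sp(1)[symmetric]]] mult.assoc)
  also have "\<dots> = sc (gam a t) * Psi z t"
    unfolding Gt(1) scp using Psi_F[OF t, of z 1] by (simp only: mult_1_right)
  finally have 2: "Psi z a * Psi a t = sc (gam a t) * Psi z t" .
  have nz: "gam a s * gam a t \<noteq> 0" using Gs(3) Gt(3) by simp
  have "sc (gam a s * gam a t) * (Psi s z * Psi z t) = (Psi s a * Psi a z) * (Psi z a * Psi a t)"
    unfolding 1 2 by (simp add: mult.assoc scp)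
  also have "\<dots> = Psi s a * (Psi a z * Psi z a * Psi a t)" by (simp add: mult.assoc)
  also have "\<dots> = sc (gam a z) * (Psi s a * Psi a t)"
    unfolding Gz(2) using F_Psi[OF a, of t 1] by (simp add: mult.assoc scp)
  also have "\<dots> = sc (gam a s * gam a t) * (sc (gam a z / (gam a s * gam a t)) * (Psi s a * Psi a t))"
    using nz by simp
  finally show ?thesis by (simp only: sc_cancel[OF nz])
qed

end

section \<open>Symmetrisers of Young subgroups\<close>

text \<open>The permutations that preserve the level sets of \<open>blk\<close>. The blocks are intervals when
  \<open>blk\<close> is monotone, and then this is a Young subgroup.\<close>
definition block_perms :: "nat \<Rightarrow> (nat \<Rightarrow> 'b) \<Rightarrow> (nat \<Rightarrow> nat) set" where
  "block_perms n blk = {w. w permutes {1..n} \<and> (\<forall>k. blk (w k) = blk k)}"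

lemma finite_block_perms [simp]: "finite (block_perms n blk)"
  by (rule finite_subset[OF _ finite_permutations[of "{1..n}"]]) (auto simp: block_perms_def)

lemma id_block_perms: "id \<in> block_perms n blk"
  unfolding block_perms_def by (intro CollectI conjI allI permutes_id) simp

lemma block_perms_comp: "v \<in> block_perms n blk \<Longrightarrow> w \<in> block_perms n blk \<Longrightarrow> v \<circ> w \<in> block_perms n blk"
  by (auto simp: block_perms_def intro: permutes_compose)

lemma block_perms_inv: "w \<in> block_perms n blk \<Longrightarrow> pinv w \<in> block_perms n blk"
proof -
  assume w: "w \<in> block_perms n blk"
  then have p: "w permutes {1..n}" by (simp add: block_perms_def)
  have "blk (pinv w k) = blk k" for k
  proof -
    have "blk (w (pinv w k)) = blk (pinv w k)" using w by (simp add: block_perms_def)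
    then show ?thesis using permutes_inverses(1)[OF p, of k] by simp
  qed
  then show ?thesis using permutes_inv[OF p] by (simp add: block_perms_def)
qed

lemma sperm_block_perms: "1 \<le> i \<Longrightarrow> i < n \<Longrightarrow> blk i = blk (Suc i) \<Longrightarrow> sperm i \<in> block_perms n blk"
proof -
  assume i: "1 \<le> i" "i < n" "blk i = blk (Suc i)"
  have "blk (sperm i k) = blk k" for k using i(3) by (cases "k = i"; cases "k = Suc i") simp_all
  then show ?thesis using sperm_permutes[OF i(1,2)] by (simp add: block_perms_def)
qed

lemma block_perms_descent:
  fixes blk :: "nat \<Rightarrow> nat"
  assumes w: "w \<in> block_perms n blk" and mono: "\<And>a b. 1 \<le> a \<Longrightarrow> a \<le> b \<Longrightarrow> b \<le> n \<Longrightarrow> blk a \<le> blk b"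
    and i: "1 \<le> i" "i < n" "w (Suc i) < w i"
  shows "blk i = blk (Suc i)" "w \<circ> sperm i \<in> block_perms n blk"
proof -
  have w': "w permutes {1..n}" "\<And>k. blk (w k) = blk k" using w by (auto simp: block_perms_def)
  have "blk (w (Suc i)) \<le> blk (w i)"
    using mono[of "w (Suc i)" "w i"] permutes_range[OF w'(1), of i] permutes_range[OF w'(1), of "Suc i"] i by simp
  then show e: "blk i = blk (Suc i)" using w'(2) mono[of i "Suc i"] i by simp
  show "w \<circ> sperm i \<in> block_perms n blk" using block_perms_comp[OF w sperm_block_perms[OF i(1,2) e]] .
qed

lemma block_perms_induct:
  fixes blk :: "nat \<Rightarrow> nat"
  assumes "w \<in> block_perms n blk" and mono: "\<And>a b. 1 \<le> a \<Longrightarrow> a \<le> b \<Longrightarrow> b \<le> n \<Longrightarrow> blk a \<le> blk b"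
    and id: "P id"
    and step: "\<And>w i. w \<in> block_perms n blk \<Longrightarrow> 1 \<le> i \<Longrightarrow> i < n \<Longrightarrow> blk i = blk (Suc i) \<Longrightarrow> w i < w (Suc i) \<Longrightarrow>
      P w \<Longrightarrow> P (w \<circ> sperm i)"
  shows "P w"
  using assms(1)
proof (induction "inv_count n w" arbitrary: w rule: less_induct)
  case less
  have p: "w permutes {1..n}" using less.prems by (simp add: block_perms_def)
  show ?case using p
  proof (cases rule: permutes_eq_id_or_descent)
    case (2 i)
    note d = block_perms_descent[OF less.prems mono 2]
    have "P (w \<circ> sperm i)" using less.hyps[of "w \<circ> sperm i"] d(2) inv_count_comp_sperm_descent[OF 2] by simp
    moreover have "(w \<circ> sperm i) i < (w \<circ> sperm i) (Suc i)" using 2(3) by simp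
    ultimately have "P ((w \<circ> sperm i) \<circ> sperm i)" using step[OF d(2) 2(1,2) d(1)] by blast
    then show ?thesis by simp
  qed (simp add: id)
qed

text \<open>The cycle that carries position \<open>n + 1 - m\<close> to \<open>n + 1\<close>. Composing a permutation of \<open>{1..n}\<close>
  with these cycles gives every permutation of \<open>{1..n + 1}\<close> once and adds \<open>m\<close> inversions.\<close>
primrec last_cycle :: "nat \<Rightarrow> nat \<Rightarrow> nat \<Rightarrow> nat" where
  "last_cycle n 0 = id"
| "last_cycle n (Suc m) = last_cycle n m \<circ> sperm (n - m)"

lemma last_cycle_props:
  "m \<le> n \<Longrightarrow> last_cycle n m (Suc n - m) = Suc n \<and> (\<forall>k < Suc n - m. last_cycle n m k = k)"
proof (induction m)
  case (Suc m)
  then have e: "Suc n - m = Suc (n - m)" "Suc n - Suc m = n - m" by simp_all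
  show ?case using Suc unfolding e by simp
qed simp

lemma last_cycle_inv_count:
  assumes u: "u permutes {1..n}" and m: "m \<le> n"
  shows "inv_count (Suc n) (u \<circ> last_cycle n m) = inv_count n u + m"
  using m
proof (induction m)
  case 0
  have "inversions (Suc n) u = inversions n u"
  proof -
    have un: "u (Suc n) = Suc n" using u by (simp add: permutes_not_in)
    have "b \<noteq> Suc n" if "1 \<le> a" "a < b" "b \<le> Suc n" "u b < u a" for a b
      using that permutes_range[OF u, of a] un by auto
    then show ?thesis by (auto simp: inversions_def le_Suc_eq)
  qed
  then show ?case by simp
next
  case (Suc m)
  let ?i = "n - m" and ?w = "u \<circ> last_cycle n m"
  have i: "1 \<le> ?i" "?i < Suc n" "Suc n - m = Suc ?i" "?i < Suc n - m" using Suc.prems by auto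
  have "?w (Suc ?i) = Suc n" using last_cycle_props[of m n] Suc.prems i(3) permutes_not_in[OF u] by simp
  moreover have "?w ?i = u ?i" using last_cycle_props[of m n] Suc.prems i(4) by simp
  moreover have "u ?i \<le> n" using permutes_range[OF u, of ?i] i(1) by simp
  ultimately have "?w ?i < ?w (Suc ?i)" by simp
  from inv_count_comp_sperm[OF i(1,2) this] Suc show ?case
    unfolding last_cycle.simps comp_assoc[symmetric] by linarith
qed

lemma last_cycle_block_perms:
  fixes blk :: "nat \<Rightarrow> nat"
  assumes mono: "\<And>a b. 1 \<le> a \<Longrightarrow> a \<le> b \<Longrightarrow> b \<le> Suc n \<Longrightarrow> blk a \<le> blk b"
  shows "m \<le> n \<Longrightarrow> blk (Suc n - m) = blk (Suc n) \<Longrightarrow> last_cycle n m \<in> block_perms (Suc n) blk"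
proof (induction m)
  case 0 then show ?case unfolding last_cycle.simps by (intro id_block_perms)
next
  case (Suc m)
  have e: "Suc n - Suc m = n - m" "Suc n - m = Suc (n - m)" using Suc.prems by simp_all
  have "blk (n - m) \<le> blk (Suc (n - m))" "blk (Suc (n - m)) \<le> blk (Suc n)"
    using mono[of "n - m" "Suc (n - m)"] mono[of "Suc (n - m)" "Suc n"] Suc.prems by simp_all
  then have b: "blk (n - m) = blk (Suc (n - m))" "blk (Suc (n - m)) = blk (Suc n)" using Suc.prems unfolding e by simp_all
  have "last_cycle n m \<in> block_perms (Suc n) blk" using Suc b unfolding e by simp
  moreover have "sperm (n - m) \<in> block_perms (Suc n) blk"
    using Suc.prems b by (intro sperm_block_perms) simp_all
  ultimately show ?case unfolding last_cycle.simps by (rule block_perms_comp)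
qed

text \<open>The last position can be filled from each place of its block, and a shift over \<open>m\<close> places adds \<open>m\<close>
  inversions. This splits off the last factor.\<close>
lemma poincare_block_perms:
  fixes blk :: "nat \<Rightarrow> nat" and z :: "'k::field"
  shows "(\<And>a b. 1 \<le> a \<Longrightarrow> a \<le> b \<Longrightarrow> b \<le> n \<Longrightarrow> blk a \<le> blk b) \<Longrightarrow>
    (\<Sum>w\<in>block_perms n blk. z ^ inv_count n w) = (\<Prod>k=1..n. qint z (card {j\<in>{1..k}. blk j = blk k}))"
proof (induction n)
  case 0
  have "block_perms 0 blk = {id}" by (auto simp: block_perms_def)
  moreover have "inversions 0 w = {}" for w by (auto simp: inversions_def)
  ultimately show ?case by simp
next
  case (Suc n)
  let ?J = "{j\<in>{1..Suc n}. blk j = blk (Suc n)}"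
  define b where b_card: "b = card ?J"
  have same: "blk j = blk (Suc n) \<longleftrightarrow> Suc n - b < j" if "1 \<le> j" "j \<le> Suc n" for j
  proof -
    have up: "k \<in> ?J" if "l \<in> ?J" "l \<le> k" "k \<le> Suc n" for k l
      using that Suc.prems[of l k] Suc.prems[of k "Suc n"] by simp
    define l where "l = Min ?J"
    have ne: "Suc n \<in> ?J" by simp
    have l: "l \<in> ?J" "\<And>j. j \<in> ?J \<Longrightarrow> l \<le> j"
      unfolding l_def by (rule Min_in, simp, use ne in blast, rule Min_le, simp)
    have J: "?J = {l..Suc n}"
    proof (rule Set.set_eqI)
      fix k show "k \<in> ?J \<longleftrightarrow> k \<in> {l..Suc n}"
      proof
        assume k: "k \<in> ?J"
        then have "k \<le> Suc n" by simp
        with l(2)[OF k] show "k \<in> {l..Suc n}" unfolding atLeastAtMost_iff by (rule conjI)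
      next
        assume "k \<in> {l..Suc n}"
        then have "l \<le> k" "k \<le> Suc n" unfolding atLeastAtMost_iff by (rule conjunct1, rule conjunct2)
        then show "k \<in> ?J" by (rule up[OF l(1)])
      qed
    qed
    then have b: "b = Suc (Suc n) - l" unfolding b_card by simp
    have "j \<in> ?J \<longleftrightarrow> j \<in> {l..Suc n}" by (simp only: J)
    then have "blk j = blk (Suc n) \<longleftrightarrow> l \<le> j" using that by simp
    moreover have "1 \<le> l" "l \<le> Suc n" using l(1) by auto
    ultimately show ?thesis unfolding b by linarith
  qed
  have bn: "1 \<le> b" "b \<le> Suc n"
  proof -
    have "card {Suc n} \<le> b" unfolding b_card by (rule card_mono) auto
    then show "1 \<le> b" by simp
    have "b \<le> card {1..Suc n}" unfolding b_card by (rule card_mono) auto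
    then show "b \<le> Suc n" by simp
  qed
  have mono: "\<And>a b. 1 \<le> a \<Longrightarrow> a \<le> b \<Longrightarrow> b \<le> n \<Longrightarrow> blk a \<le> blk b" using Suc.prems by simp
  let ?f = "\<lambda>(u, m). u \<circ> last_cycle n m"
  let ?S = "block_perms n blk \<times> {..<b}"
  have cyc: "last_cycle n m \<in> block_perms (Suc n) blk" if "m < b" for m
  proof -
    have "1 \<le> Suc n - m" "Suc n - m \<le> Suc n" "Suc n - b < Suc n - m" "m \<le> n" using that bn by arith+
    with same[OF this(1,2)] show ?thesis by (intro last_cycle_block_perms[OF Suc.prems]) simp_all
  qed
  have sub: "u \<in> block_perms (Suc n) blk" if "u \<in> block_perms n blk" for u
  proof -
    have u: "u permutes {1..n}" "\<forall>k. blk (u k) = blk k" using that unfolding block_perms_def by blast+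
    have "{1..n} \<subseteq> {1..Suc n}" by simp
    from permutes_subset[OF u(1) this] u(2) show ?thesis unfolding block_perms_def by blast
  qed
  have bij: "bij_betw ?f ?S (block_perms (Suc n) blk)"
  proof (rule bij_betw_imageI)
    have "u = u' \<and> m = m'" if u: "u \<in> block_perms n blk" "u' \<in> block_perms n blk" and m: "m < b" "m' < b"
      and eq: "u \<circ> last_cycle n m = u' \<circ> last_cycle n m'" for u u' m m'
    proof -
      have c: "last_cycle n m permutes {1..Suc n}" using cyc[OF m(1)] by (simp add: block_perms_def)
      have pu: "u permutes {1..n}" "u' permutes {1..n}" using u by (simp_all add: block_perms_def)
      have up: "u permutes {1..Suc n}" "u' permutes {1..Suc n}" using sub[OF u(1)] sub[OF u(2)] by (simp_all add: block_perms_def)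
      have e1: "(u \<circ> last_cycle n m) (Suc n - m) = Suc n"
        using last_cycle_props[of m n] m bn permutes_not_in[OF pu(1)] by simp
      have e2: "(u' \<circ> last_cycle n m') (Suc n - m') = Suc n"
        using last_cycle_props[of m' n] m bn permutes_not_in[OF pu(2)] by simp
      have "inj (u \<circ> last_cycle n m)" using permutes_inj[OF permutes_compose[OF c up(1)]] .
      then have "Suc n - m = Suc n - m'"
        by (rule injD) (rule trans[OF e1 trans[OF e2[symmetric] fun_cong[OF eq[symmetric]]]])
      then have mm: "m = m'" using m bn by arith
      have "(u \<circ> last_cycle n m) \<circ> pinv (last_cycle n m) = (u' \<circ> last_cycle n m) \<circ> pinv (last_cycle n m)"
        using eq unfolding mm by (simp only:)
      then have "u = u'" unfolding comp_assoc permutes_inv_o(1)[OF c] comp_id .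
      with mm show ?thesis by simp
    qed
    note inj = this
    show "inj_on ?f ?S"
    proof (rule inj_onI)
      fix p p' assume p: "p \<in> ?S" "p' \<in> ?S" "?f p = ?f p'"
      obtain u m where um: "p = (u, m)" by (cases p)
      obtain u' m' where um': "p' = (u', m')" by (cases p')
      from p have h: "u \<in> block_perms n blk" "m < b" "u' \<in> block_perms n blk" "m' < b"
        unfolding um um' mem_Times_iff lessThan_iff fst_conv snd_conv by simp_all
      have "u \<circ> last_cycle n m = u' \<circ> last_cycle n m'" using p(3) unfolding um um' prod.case .
      from inj[OF h(1,3,2,4) this] show "p = p'" unfolding um um' by (elim conjE) (simp only:)
    qed
    have "w \<in> ?f ` ?S" if w: "w \<in> block_perms (Suc n) blk" for w
    proof -
      have pw: "w permutes {1..Suc n}" "\<And>k. blk (w k) = blk k" using w by (simp_all add: block_perms_def)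
      define j where "j = pinv w (Suc n)"
      have wj: "w j = Suc n" using permutes_inverses(1)[OF pw(1)] by (simp add: j_def)
      have j: "1 \<le> j" "j \<le> Suc n" using permutes_range[OF permutes_inv[OF pw(1)], of "Suc n"] by (simp_all add: j_def)
      have "blk j = blk (Suc n)" using pw(2)[of j] wj by simp
      then have "Suc n - b < j" using same[OF j] by (simp only:)
      then have mb: "Suc n - j < b" using j bn by arith
      let ?m = "Suc n - j"
      have c: "last_cycle n ?m \<in> block_perms (Suc n) blk" using cyc[OF mb] .
      then have pc: "last_cycle n ?m permutes {1..Suc n}" by (simp add: block_perms_def)
      let ?u = "w \<circ> pinv (last_cycle n ?m)"
      have u: "?u \<in> block_perms (Suc n) blk" using block_perms_comp[OF w block_perms_inv[OF c]] .
      have "last_cycle n ?m j = Suc n" using last_cycle_props[of ?m n] j by simp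
      then have "pinv (last_cycle n ?m) (Suc n) = j" using permutes_inverses(2)[OF pc, of j] by simp
      then have "?u (Suc n) = Suc n" using wj by simp
      have "?u permutes {1..n}"
      proof (rule permutes_superset)
        show "?u permutes {1..Suc n}" using u unfolding block_perms_def by blast
        fix x assume "x \<in> {1..Suc n} - {1..n}"
        then have "x = Suc n" by (simp only: Diff_iff atLeastAtMost_iff) arith
        then show "?u x = x" using \<open>?u (Suc n) = Suc n\<close> by (simp only:)
      qed
      then have un: "?u \<in> block_perms n blk" using u unfolding block_perms_def by blast
      have "?f (?u, ?m) = w" unfolding prod.case comp_assoc permutes_inv_o(2)[OF pc] comp_id ..
      moreover have "(?u, ?m) \<in> ?S" using un mb by (intro SigmaI) (simp_all only: lessThan_iff)
      ultimately show ?thesis by (rule image_eqI[OF sym])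
    qed
    note onto = this
    have "?f p \<in> block_perms (Suc n) blk" if "p \<in> ?S" for p
    proof -
      obtain u m where p: "p = (u, m)" by (cases p)
      have h: "u \<in> block_perms n blk" "m < b" using that unfolding p mem_Times_iff lessThan_iff fst_conv snd_conv by blast+
      show ?thesis unfolding p prod.case by (rule block_perms_comp[OF sub[OF h(1)] cyc[OF h(2)]])
    qed
    note range = this
    show "?f ` ?S = block_perms (Suc n) blk"
    proof (rule equalityI)
      show "?f ` ?S \<subseteq> block_perms (Suc n) blk" by (rule image_subsetI, rule range)
      show "block_perms (Suc n) blk \<subseteq> ?f ` ?S" by (rule subsetI, rule onto)
    qed
  qed
  have "(\<Sum>w\<in>block_perms (Suc n) blk. z ^ inv_count (Suc n) w) = (\<Sum>p\<in>?S. z ^ inv_count (Suc n) (?f p))"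
    by (rule sum.reindex_bij_betw[OF bij, symmetric])
  also have "\<dots> = (\<Sum>(u, m)\<in>?S. z ^ inv_count n u * z ^ m)"
  proof (rule sum.cong[OF refl])
    fix p assume p: "p \<in> ?S"
    obtain u m where um: "p = (u, m)" by (cases p)
    have h: "u \<in> block_perms n blk" "m < b" using p unfolding um mem_Times_iff lessThan_iff fst_conv snd_conv by blast+
    have "u permutes {1..n}" using h(1) unfolding block_perms_def by blast
    moreover have "m \<le> n" using h(2) bn by arith
    ultimately have "inv_count (Suc n) (u \<circ> last_cycle n m) = inv_count n u + m" by (rule last_cycle_inv_count)
    then show "z ^ inv_count (Suc n) (?f p) = (case p of (u, m) \<Rightarrow> z ^ inv_count n u * z ^ m)"
      unfolding um prod.case by (simp only: power_add)
  qed
  also have "\<dots> = (\<Sum>u\<in>block_perms n blk. \<Sum>m<b. z ^ inv_count n u * z ^ m)"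
    by (simp only: sum.cartesian_product)
  also have "\<dots> = (\<Sum>u\<in>block_perms n blk. z ^ inv_count n u) * qint z b"
    unfolding qint_def sum_product ..
  also have "\<dots> = (\<Prod>k=1..Suc n. qint z (card {j\<in>{1..k}. blk j = blk k}))"
  proof -
    have "(\<Sum>w\<in>block_perms n blk. z ^ inv_count n w) = (\<Prod>k=1..n. qint z (card {j\<in>{1..k}. blk j = blk k}))"
      by (rule Suc.IH) (rule mono)
    moreover have "(\<Prod>k=1..Suc n. qint z (card {j\<in>{1..k}. blk j = blk k}))
      = (\<Prod>k=1..n. qint z (card {j\<in>{1..k}. blk j = blk k})) * qint z b"
      unfolding b_card by (subst prod.nat_ivl_Suc') simp_all
    ultimately show ?thesis by (simp only:)
  qed
  finally show ?case .
qed

context hecke_ring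
begin

lemma right_eigen_T_of:
  fixes blk :: "nat \<Rightarrow> nat"
  assumes w: "w \<in> block_perms n blk" and mono: "\<And>a b. 1 \<le> a \<Longrightarrow> a \<le> b \<Longrightarrow> b \<le> n \<Longrightarrow> blk a \<le> blk b"
    and y: "\<And>i. 1 \<le> i \<Longrightarrow> i < n \<Longrightarrow> blk i = blk (Suc i) \<Longrightarrow> y * T i = sc z * y"
  shows "y * T_of w = sc (z ^ inv_count n w) * y"
proof (rule block_perms_induct[OF w mono])
  show "y * T_of id = sc (z ^ inv_count n id) * y" by simp
next
  fix w i assume hyps: "w \<in> block_perms n blk" "1 \<le> i" "i < n" "blk i = blk (Suc i)" "w i < w (Suc i)"
    and IH: "y * T_of w = sc (z ^ inv_count n w) * y"
  have p: "w permutes {1..n}" using hyps by (simp add: block_perms_def)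
  have "y * T_of (w \<circ> sperm i) = sc z * (y * T_of w)"
    using T_of_comp_sperm[OF p hyps(2,3,5)] y[OF hyps(2,3,4)] by (simp add: mult.assoc[symmetric])
  then show "y * T_of (w \<circ> sperm i) = sc (z ^ inv_count n (w \<circ> sperm i)) * y" using IH inv_count_comp_sperm[OF hyps(2,3,5)] by simp
qed

lemma left_eigen_T_of:
  fixes blk :: "nat \<Rightarrow> nat"
  assumes w: "w \<in> block_perms n blk" and mono: "\<And>a b. 1 \<le> a \<Longrightarrow> a \<le> b \<Longrightarrow> b \<le> n \<Longrightarrow> blk a \<le> blk b"
    and y: "\<And>i. 1 \<le> i \<Longrightarrow> i < n \<Longrightarrow> blk i = blk (Suc i) \<Longrightarrow> T i * v = sc z * v"
  shows "T_of w * v = sc (z ^ inv_count n w) * v"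
proof (rule block_perms_induct[OF w mono])
  show "T_of id * v = sc (z ^ inv_count n id) * v" by simp
next
  fix w i assume hyps: "w \<in> block_perms n blk" "1 \<le> i" "i < n" "blk i = blk (Suc i)" "w i < w (Suc i)"
    and IH: "T_of w * v = sc (z ^ inv_count n w) * v"
  have p: "w permutes {1..n}" using hyps by (simp add: block_perms_def)
  have "T_of (w \<circ> sperm i) * v = T i * (sc (z ^ inv_count n w) * v)"
    unfolding T_of_comp_sperm[OF p hyps(2,3,5)] mult.assoc IH ..
  also have "\<dots> = sc (z ^ inv_count n w) * (T i * v)"
    by (simp only: mult.assoc[symmetric] T_sc)
  also have "\<dots> = sc (z ^ inv_count n (w \<circ> sperm i)) * v"
    unfolding y[OF hyps(2,3,4)] inv_count_comp_sperm[OF hyps(2,3,5)] power_Suc2 sc_mult mult.assoc ..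
  finally show "T_of (w \<circ> sperm i) * v = sc (z ^ inv_count n (w \<circ> sperm i)) * v" .
qed

lemma comm_T_of:
  fixes blk :: "nat \<Rightarrow> nat"
  assumes w: "w \<in> block_perms n blk" and mono: "\<And>a b. 1 \<le> a \<Longrightarrow> a \<le> b \<Longrightarrow> b \<le> n \<Longrightarrow> blk a \<le> blk b"
    and y: "\<And>i. 1 \<le> i \<Longrightarrow> i < n \<Longrightarrow> blk i = blk (Suc i) \<Longrightarrow> y * T i = T i * y"
  shows "y * T_of w = T_of w * y"
proof (rule block_perms_induct[OF w mono])
  show "y * T_of id = T_of id * y" by simp
next
  fix w i assume hyps: "w \<in> block_perms n blk" "1 \<le> i" "i < n" "blk i = blk (Suc i)" "w i < w (Suc i)"
    and IH: "y * T_of w = T_of w * y"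
  have p: "w permutes {1..n}" using hyps by (simp add: block_perms_def)
  show "y * T_of (w \<circ> sperm i) = T_of (w \<circ> sperm i) * y"
    unfolding T_of_comp_sperm[OF p hyps(2,3,5)] mult.assoc IH[symmetric]
    unfolding mult.assoc[symmetric] y[OF hyps(2,3,4)] ..
qed

definition sym :: "(nat \<Rightarrow> nat) \<Rightarrow> 'a" where
  "sym blk = (\<Sum>w\<in>block_perms n blk. T_of w)"

text \<open>Left multiplication by \<open>T\<^sub>i\<close> permutes the pairs \<open>T\<^sub>w\<close>, \<open>T\<^sub>i T\<^sub>w\<close> of summands, and on each of them
  it is the quadratic relation.\<close>
lemma T_sym:
  assumes i: "1 \<le> i" "i < n" and b: "blk i = blk (Suc i)"
  shows "T i * sym blk = sc q * sym blk"
proof -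
  let ?B1 = "{w \<in> block_perms n blk. w i < w (Suc i)}" and ?B2 = "{w \<in> block_perms n blk. w (Suc i) < w i}"
  have ne: "w i \<noteq> w (Suc i)" if "w \<in> block_perms n blk" for w
    using inj_eq[OF permutes_inj, of w "{1..n}" i "Suc i"] that by (simp add: block_perms_def)
  have un: "block_perms n blk = ?B1 \<union> ?B2"
  proof (rule Set.set_eqI)
    fix w show "w \<in> block_perms n blk \<longleftrightarrow> w \<in> ?B1 \<union> ?B2"
      using ne[of w] linorder_neq_iff[of "w i" "w (Suc i)"] by blast
  qed
  have sp: "w \<circ> sperm i \<in> block_perms n blk" if "w \<in> block_perms n blk" for w
    using block_perms_comp[OF that sperm_block_perms[of i n blk, OF i b]] .
  have bij: "bij_betw (\<lambda>w. w \<circ> sperm i) ?B1 ?B2"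
    by (rule bij_betw_byWitness[where f' = "\<lambda>w. w \<circ> sperm i"]) (use sp in \<open>auto simp: comp_assoc\<close>)
  have s2: "(\<Sum>w\<in>?B2. g w) = (\<Sum>w\<in>?B1. g (w \<circ> sperm i))" for g :: "_ \<Rightarrow> 'a"
    using sum.reindex_bij_betw[OF bij, of g] by simp
  have split: "(\<Sum>w\<in>block_perms n blk. g w) = (\<Sum>w\<in>?B1. g w + g (w \<circ> sperm i))" for g :: "_ \<Rightarrow> 'a"
  proof -
    have "(\<Sum>w\<in>?B1 \<union> ?B2. g w) = (\<Sum>w\<in>?B1. g w) + (\<Sum>w\<in>?B2. g w)"
      by (rule sum.union_disjoint) auto
    then show ?thesis unfolding un[symmetric] sum.distrib s2[of g] .
  qed
  have "T i * (T_of w + T_of (w \<circ> sperm i)) = sc q * (T_of w + T_of (w \<circ> sperm i))" if w: "w \<in> ?B1" for w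
  proof -
    have "w permutes {1..n}" using w by (simp add: block_perms_def)
    from T_of_comp_sperm[OF this i] w have e: "T_of (w \<circ> sperm i) = T i * T_of w" by simp
    show ?thesis unfolding e using T_sq_v[OF i, of "T_of w"] by (simp add: distrib_left sc_diff left_diff_distrib)
  qed
  then show ?thesis
    unfolding sym_def split by (simp add: sum_distrib_left)
qed

end

section \<open>Multipartitions and their standard tableaux\<close>

definition shape_of :: "node set \<Rightarrow> mpart" where
  "shape_of D = (\<lambda>c i. card {j. (i, j, c) \<in> D})"

text \<open>The nodes in rows up to \<open>r\<close> of component \<open>c\<close> or in earlier components.\<close>
definition upto_row :: "nat \<Rightarrow> nat \<Rightarrow> node \<Rightarrow> bool" where
  "upto_row c r x \<longleftrightarrow> (case x of (i, j, d) \<Rightarrow> d < c \<or> d = c \<and> i \<le> r)"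

lemma upto_row_simp [simp]: "upto_row c r (i, j, d) \<longleftrightarrow> d < c \<or> d = c \<and> i \<le> r"
  by (simp add: upto_row_def)

lemma in_diagram [simp]: "(i, j, c) \<in> diagram ell lam \<longleftrightarrow> 1 \<le> c \<and> c \<le> ell \<and> 1 \<le> i \<and> 1 \<le> j \<and> j \<le> lam c i"
  by (simp add: diagram_def)

lemma multipartitionsD:
  assumes "lam \<in> multipartitions ell n"
  shows "1 \<le> c \<Longrightarrow> c \<le> ell \<Longrightarrow> is_partition (lam c)" "\<not> (1 \<le> c \<and> c \<le> ell) \<Longrightarrow> lam c = (\<lambda>_. 0)"
    "(\<Sum>c=1..ell. psize (lam c)) = n"
  using assms by (auto simp: multipartitions_def)

lemma partition_antimono:
  assumes "is_partition p" "1 \<le> i"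
  shows "i \<le> i' \<Longrightarrow> p i' \<le> p i"
proof (induction rule: dec_induct)
  case (step m)
  then have "p (Suc m) \<le> p m" using assms by (auto simp: is_partition_def)
  then show ?case using step by simp
qed simp

lemma card_rows:
  assumes p: "is_partition p"
  shows "finite {(i, j). 1 \<le> i \<and> 1 \<le> j \<and> j \<le> p i}" "card {(i, j). 1 \<le> i \<and> 1 \<le> j \<and> j \<le> p i} = psize p"
    "card {(i, j). 1 \<le> i \<and> i \<le> r \<and> 1 \<le> j \<and> j \<le> p i} = (\<Sum>i=1..r. p i)"
proof -
  have p': "p 0 = 0" "finite {i. p i \<noteq> 0}" using p by (auto simp: is_partition_def)
  have "1 \<le> i" if "p i \<noteq> 0" for i using that p'(1) by (cases i) auto
  then have e: "{(i, j). 1 \<le> i \<and> 1 \<le> j \<and> j \<le> p i} = (SIGMA i:{i. p i \<noteq> 0}. {1..p i})" by auto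
  show "finite {(i, j). 1 \<le> i \<and> 1 \<le> j \<and> j \<le> p i}" unfolding e using p'(2) by simp
  show "card {(i, j). 1 \<le> i \<and> 1 \<le> j \<and> j \<le> p i} = psize p"
    unfolding e using p'(2) by (simp add: psize_def)
  have e: "{(i, j). 1 \<le> i \<and> i \<le> r \<and> 1 \<le> j \<and> j \<le> p i} = (SIGMA i:{1..r}. {1..p i})" by auto
  show "card {(i, j). 1 \<le> i \<and> i \<le> r \<and> 1 \<le> j \<and> j \<le> p i} = (\<Sum>i=1..r. p i)"
    unfolding e by simp
qed

lemma card_diagram_comp:
  assumes "lam \<in> multipartitions ell n" "1 \<le> c" "c \<le> ell"
  shows "finite {x \<in> diagram ell lam. comp_of x = c}" "card {x \<in> diagram ell lam. comp_of x = c} = psize (lam c)"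
    "card {x \<in> diagram ell lam. comp_of x = c \<and> upto_row c r x} = (\<Sum>i=1..r. lam c i)"
proof -
  let ?f = "\<lambda>(i, j). (i, j, c)"
  note p = card_rows[OF multipartitionsD(1)[OF assms]]
  have inj: "inj_on ?f A" for A by (auto simp: inj_on_def)
  have e: "{x \<in> diagram ell lam. comp_of x = c} = ?f ` {(i, j). 1 \<le> i \<and> 1 \<le> j \<and> j \<le> lam c i}"
    using assms by (auto simp: diagram_def)
  show "finite {x \<in> diagram ell lam. comp_of x = c}" unfolding e using p(1) by blast
  show "card {x \<in> diagram ell lam. comp_of x = c} = psize (lam c)"
    unfolding e by (simp add: card_image[OF inj] p(2))
  have e: "{x \<in> diagram ell lam. comp_of x = c \<and> upto_row c r x} = ?f ` {(i, j). 1 \<le> i \<and> i \<le> r \<and> 1 \<le> j \<and> j \<le> lam c i}"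
    using assms by (auto simp: diagram_def)
  show "card {x \<in> diagram ell lam. comp_of x = c \<and> upto_row c r x} = (\<Sum>i=1..r. lam c i)"
    unfolding e by (simp add: card_image[OF inj] p(3))
qed

lemma card_diagram_less:
  assumes lam: "lam \<in> multipartitions ell n" and c: "c \<le> Suc ell"
  shows "finite {x \<in> diagram ell lam. comp_of x < c}"
    "card {x \<in> diagram ell lam. comp_of x < c} = (\<Sum>b=1..<c. psize (lam b))"
proof -
  have e: "{x \<in> diagram ell lam. comp_of x < c} = (\<Union>b\<in>{1..<c}. {x \<in> diagram ell lam. comp_of x = b})"
    by (auto simp: diagram_def)
  show "finite {x \<in> diagram ell lam. comp_of x < c}"
    unfolding e using card_diagram_comp(1)[OF lam] c by auto
  have "card {x \<in> diagram ell lam. comp_of x < c} = (\<Sum>b\<in>{1..<c}. card {x \<in> diagram ell lam. comp_of x = b})"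
    unfolding e using card_diagram_comp(1)[OF lam] c by (intro card_UN_disjoint) auto
  also have "\<dots> = (\<Sum>b=1..<c. psize (lam b))"
    using card_diagram_comp(2)[OF lam] c by (intro sum.cong) auto
  finally show "card {x \<in> diagram ell lam. comp_of x < c} = (\<Sum>b=1..<c. psize (lam b))" .
qed

lemma card_upto_row:
  assumes lam: "lam \<in> multipartitions ell n" and c: "1 \<le> c" "c \<le> ell"
  shows "card {x \<in> diagram ell lam. upto_row c r x} = (\<Sum>b=1..<c. psize (lam b)) + (\<Sum>i=1..r. lam c i)"
proof -
  let ?A = "{x \<in> diagram ell lam. comp_of x < c}" and ?B = "{x \<in> diagram ell lam. comp_of x = c \<and> upto_row c r x}"
  have "upto_row c r x \<longleftrightarrow> comp_of x < c \<or> comp_of x = c \<and> upto_row c r x" for x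
    by (cases x) auto
  then have "{x \<in> diagram ell lam. upto_row c r x} = ?A \<union> ?B" by blast
  moreover have "finite ?B" by (rule finite_subset[OF _ card_diagram_comp(1)[OF lam c]]) blast
  then have "card (?A \<union> ?B) = card ?A + card ?B"
    using card_diagram_less(1)[OF lam] c by (intro card_Un_disjoint) auto
  ultimately show ?thesis using card_diagram_less(2)[OF lam, of c] card_diagram_comp(3)[OF lam c, of r] c by simp
qed

lemma young_diagram:
  assumes lam: "lam \<in> multipartitions ell n"
  shows "young ell (diagram ell lam)" "card (diagram ell lam) = n"
proof -
  have e: "{x \<in> diagram ell lam. comp_of x < Suc ell} = diagram ell lam" by (auto simp: diagram_def)
  have "x \<in> diagram ell lam" if "y \<in> diagram ell lam" "x \<in> nodes ell" "nw_le x y" for x y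
  proof -
    obtain i j c where x: "x = (i, j, c)" by (metis prod_cases3)
    obtain i' j' c' where y: "y = (i', j', c')" by (metis prod_cases3)
    have "lam c i' \<le> lam c i" using that partition_antimono[OF multipartitionsD(1)[OF lam]] x y by simp
    then show ?thesis using that x y by simp
  qed
  moreover have "diagram ell lam \<subseteq> nodes ell" by (auto simp: diagram_def)
  ultimately show "young ell (diagram ell lam)"
    using card_diagram_less(1)[OF lam, of "Suc ell"] unfolding e young_def by blast
  show "card (diagram ell lam) = n"
    using card_diagram_less(2)[OF lam, of "Suc ell"] multipartitionsD(3)[OF lam] unfolding e
    by (simp add: atLeastLessThanSuc_atLeastAtMost)
qed

lemma initial_segment:
  assumes "finite S" "\<And>j. j \<in> S \<Longrightarrow> 1 \<le> j" "\<And>j j'. j \<in> S \<Longrightarrow> 1 \<le> j' \<Longrightarrow> j' \<le> j \<Longrightarrow> j' \<in> S"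
  shows "S = {1..card S}"
proof (cases "S = {}")
  case False
  then have "Max S \<in> S" using assms(1) by simp
  have m: "S = {1..Max S}"
  proof (rule Set.set_eqI)
    fix j show "j \<in> S \<longleftrightarrow> j \<in> {1..Max S}"
      using assms(2)[of j] assms(3)[OF \<open>Max S \<in> S\<close>, of j] Max_ge[OF assms(1), of j] by auto
  qed
  have "card S = Max S" by (subst m) simp
  then show ?thesis using m by simp
qed simp

lemma shape_of_young:
  assumes D: "young ell D"
  shows "diagram ell (shape_of D) = D" "shape_of D \<in> multipartitions ell (card D)"
proof -
  note nD = young_nodes[OF D] and fD = young_finite[OF D]
  have fin: "finite {j. (i, j, c) \<in> D}" for i c
    by (rule finite_subset[OF _ finite_imageI[OF fD, of "\<lambda>x. fst (snd x)"]]) force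
  have seg: "{j. (i, j, c) \<in> D} = {1..shape_of D c i}" for i c
    unfolding shape_of_def
  proof (rule initial_segment[OF fin])
    fix j assume "j \<in> {j. (i, j, c) \<in> D}"
    then have j: "(i, j, c) \<in> D" "(i, j, c) \<in> nodes ell" using nD by auto
    then show "1 \<le> j" by simp
    show "j' \<in> {j. (i, j, c) \<in> D}" if "1 \<le> j'" "j' \<le> j" for j'
      using youngD[OF D j(1), of "(i, j', c)"] j(2) that by simp
  qed
  have mem: "(i, j, c) \<in> D \<longleftrightarrow> 1 \<le> j \<and> j \<le> shape_of D c i" for i j c
    using seg[of i c] by (metis atLeastAtMost_iff mem_Collect_eq)
  show dg: "diagram ell (shape_of D) = D"
  proof (rule Set.set_eqI)
    fix x :: node obtain i j c where x: "x = (i, j, c)" by (metis prod_cases3)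
    show "x \<in> diagram ell (shape_of D) \<longleftrightarrow> x \<in> D"
      using mem[of i j c] subsetD[OF nD, of "(i, j, c)"] unfolding x by auto
  qed
  have zero: "shape_of D c i = 0" if "\<not> (1 \<le> c \<and> c \<le> ell \<and> 1 \<le> i)" for c i
  proof (rule ccontr)
    assume "shape_of D c i \<noteq> 0"
    then have "(i, 1, c) \<in> D" using mem by simp
    then have "(i, 1, c) \<in> nodes ell" using nD by blast
    then show False using that by simp
  qed
  have part: "is_partition (shape_of D c)" for c
    unfolding is_partition_def
  proof (intro conjI allI impI)
    show "shape_of D c 0 = 0" by (rule zero) simp
    fix i :: nat assume i: "1 \<le> i"
    have "{j. (Suc i, j, c) \<in> D} \<subseteq> {j. (i, j, c) \<in> D}"
    proof
      fix j assume "j \<in> {j. (Suc i, j, c) \<in> D}"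
      then have j: "(Suc i, j, c) \<in> D" "(Suc i, j, c) \<in> nodes ell" using nD by auto
      then show "j \<in> {j. (i, j, c) \<in> D}" using youngD[OF D j(1), of "(i, j, c)"] i by simp
    qed
    then show "shape_of D c (Suc i) \<le> shape_of D c i" unfolding shape_of_def by (rule card_mono[OF fin])
  next
    have "{i. shape_of D c i \<noteq> 0} \<subseteq> fst ` D"
    proof
      fix i assume "i \<in> {i. shape_of D c i \<noteq> 0}"
      then have "(i, 1, c) \<in> D" using mem by simp
      then show "i \<in> fst ` D" by force
    qed
    then show "finite {i. shape_of D c i \<noteq> 0}" using fD finite_subset by blast
  qed
  have m: "shape_of D \<in> multipartitions ell (\<Sum>c=1..ell. psize (shape_of D c))"
    using part zero by (auto simp: multipartitions_def fun_eq_iff)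
  from young_diagram(2)[OF m] m show "shape_of D \<in> multipartitions ell (card D)" unfolding dg by simp
qed

lemma Std_eq_tabs:
  assumes lam: "lam \<in> multipartitions ell n"
  shows "Std ell n lam = {t \<in> tabs ell n. supp t = diagram ell lam}"
proof (intro Set.set_eqI iffI)
  let ?D = "diagram ell lam"
  note y = young_diagram(1)[OF lam]
  fix t
  {
    assume t: "t \<in> Std ell n lam"
    then have b: "bij_betw t ?D {1..n}" and z: "\<And>x. x \<notin> ?D \<Longrightarrow> t x = 0"
      and row: "\<And>i j c. (i, j, c) \<in> ?D \<Longrightarrow> (i, j + 1, c) \<in> ?D \<Longrightarrow> t (i, j, c) < t (i, j + 1, c)"
      and col: "\<And>i j c. (i, j, c) \<in> ?D \<Longrightarrow> (i + 1, j, c) \<in> ?D \<Longrightarrow> t (i, j, c) < t (i + 1, j, c)"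
      unfolding Std_def tableaux_def by blast+
    have nz: "t x \<noteq> 0" if "x \<in> ?D" for x using bij_betw_apply[OF b that] by simp
    have s: "supp t = ?D"
    proof (rule Set.set_eqI)
      fix x show "x \<in> supp t \<longleftrightarrow> x \<in> ?D" using nz[of x] z[of x] by (cases "x \<in> ?D") (simp_all add: supp_def)
    qed
    have rows: "(i, j + d, c) \<in> ?D \<longrightarrow> t (i, j, c) \<le> t (i, j + d, c)" if ij: "1 \<le> i" "1 \<le> j" for i j c d
    proof (induction d)
      case (Suc d)
      show ?case
      proof
        assume a: "(i, j + Suc d, c) \<in> ?D"
        then have a': "(i, j + d, c) \<in> ?D" using ij by simp
        show "t (i, j, c) \<le> t (i, j + Suc d, c)" using Suc a' row[OF a'] a by (simp add: add.assoc Suc_eq_plus1)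
      qed
    qed simp
    have cols: "(i + d, j, c) \<in> ?D \<longrightarrow> t (i, j, c) \<le> t (i + d, j, c)" if ij: "1 \<le> i" "1 \<le> j" for i j c d
    proof (induction d)
      case (Suc d)
      show ?case
      proof
        assume a: "(i + Suc d, j, c) \<in> ?D"
        then have a': "(i + d, j, c) \<in> ?D" using youngD[OF y a, of "(i + d, j, c)"] ij a by simp
        show "t (i, j, c) \<le> t (i + Suc d, j, c)" using Suc a' col[OF a'] a by (simp add: add.assoc Suc_eq_plus1)
      qed
    qed simp
    have "t x \<le> t y" if "x \<in> ?D" "y \<in> ?D" "nw_le x y" for x y
    proof -
      obtain i j c where x: "x = (i, j, c)" by (metis prod_cases3)
      obtain i' j' c' where y': "y = (i', j', c')" by (metis prod_cases3)
      have le: "c' = c" "i \<le> i'" "j \<le> j'" "1 \<le> i" "1 \<le> j" using that x y' by auto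
      have m: "(i, j', c) \<in> ?D" using youngD[OF y that(2), of "(i, j', c)"] that x y' by simp
      have "t (i, j, c) \<le> t (i, j', c)" using rows[of i j "j' - j" c] le m by simp
      also have "\<dots> \<le> t (i', j', c)" using cols[of i j' "i' - i" c] le that(2) y' by simp
      finally show ?thesis using x y' le by simp
    qed
    then show "t \<in> {t \<in> tabs ell n. supp t = ?D}" using y b s by (simp add: tabs_def)
  }
  {
    assume "t \<in> {t \<in> tabs ell n. supp t = ?D}"
    then have t: "t \<in> tabs ell n" "supp t = ?D" by auto
    have lt: "t x < t y" if "x \<in> ?D" "y \<in> ?D" "nw_le x y" "x \<noteq> y" for x y
    proof -
      have "t x \<le> t y" using tabs_mono[OF t(1)] that t(2) by blast
      moreover have "t x \<noteq> 0" using that(1) t(2) by (auto simp: supp_def)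
      moreover have "t x \<noteq> t y" using tabs_eqD[OF t(1), of x y] \<open>t x \<noteq> 0\<close> that(4) by blast
      ultimately show ?thesis by linarith
    qed
    have "t x = 0" if "x \<notin> ?D" for x
    proof -
      have "x \<notin> supp t" using that unfolding t(2) .
      then show ?thesis by (simp add: supp_def)
    qed
    then have "t \<in> tableaux ell n lam" using tabs_bij[OF t(1)] unfolding tableaux_def t(2) by (intro CollectI conjI allI impI)
    then show "t \<in> Std ell n lam" unfolding Std_def
    proof (intro CollectI conjI allI impI)
      fix i j c
      show "t (i, j, c) < t (i, j + 1, c)" if "(i, j, c) \<in> ?D \<and> (i, j + 1, c) \<in> ?D"
        by (rule lt) (use that in simp_all)
      show "t (i, j, c) < t (i + 1, j, c)" if "(i, j, c) \<in> ?D \<and> (i + 1, j, c) \<in> ?D"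
        by (rule lt) (use that in simp_all)
    qed
  }
qed

lemma residue_eq:
  assumes "t \<in> tabs ell n" "1 \<le> k" "k \<le> n"
  shows "residue q Q t k = node_res q Q (nd t k)"
  unfolding residue_def
proof (rule the_equality)
  obtain i j c where x: "nd t k = (i, j, c)" by (metis prod_cases3)
  have "t (i, j, c) = k" using nd_entry[OF assms] x by simp
  then show "\<exists>i j c. t (i, j, c) = k \<and> node_res q Q (nd t k) = q powi (int j - int i) * Q c"
    unfolding x by (intro exI[of _ i] exI[of _ j] exI[of _ c]) (simp add: node_res_def)
  fix r assume "\<exists>i j c. t (i, j, c) = k \<and> r = q powi (int j - int i) * Q c"
  then obtain i' j' c' where "t (i', j', c') = k" and r: "r = q powi (int j' - int i') * Q c'" by blast
  then have "nd t k = (i', j', c')" using nd_eq[OF assms(1), of "(i', j', c')" k] assms(2) by simp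
  then show "r = node_res q Q (nd t k)" using r by (simp add: node_res_def)
qed

lemma residue_set_eq:
  assumes k: "1 \<le> k" "k \<le> n"
  shows "residue_set ell n q Q k = {node_res q Q (nd t k) | t. t \<in> tabs ell n}"
proof (intro Set.set_eqI iffI)
  fix r assume "r \<in> residue_set ell n q Q k"
  then obtain t lam where "lam \<in> multipartitions ell n" "t \<in> Std ell n lam" and r: "r = residue q Q t k"
    unfolding residue_set_def by blast
  then have "t \<in> tabs ell n" using Std_eq_tabs by blast
  then show "r \<in> {node_res q Q (nd t k) | t. t \<in> tabs ell n}" using residue_eq[OF _ k] r by blast
next
  fix r assume "r \<in> {node_res q Q (nd t k) | t. t \<in> tabs ell n}"
  then obtain t where t: "t \<in> tabs ell n" and r: "r = node_res q Q (nd t k)" by blast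
  note s = shape_of_young[OF tabs_young[OF t], unfolded tabs_card[OF t]]
  have "t \<in> Std ell n (shape_of (supp t))" using Std_eq_tabs[OF s(2)] t s(1) by simp
  then show "r \<in> residue_set ell n q Q k" unfolding residue_set_def using s(2) residue_eq[OF t k, of q Q] r by (intro CollectI exI[of _ t] exI[of _ "shape_of (supp t)"]) simp
qed

subsection \<open>The reading order\<close>

definition rd_less :: "node \<Rightarrow> node \<Rightarrow> bool" where
  "rd_less x y \<longleftrightarrow> (case x of (i, j, c) \<Rightarrow> case y of (i', j', c') \<Rightarrow>
     c < c' \<or> c = c' \<and> (i < i' \<or> i = i' \<and> j < j'))"

lemma rd_less_simp [simp]: "rd_less (i, j, c) (i', j', c') \<longleftrightarrow> c < c' \<or> c = c' \<and> (i < i' \<or> i = i' \<and> j < j')"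
  by (simp add: rd_less_def)

lemma rd_less_trans: "rd_less x y \<Longrightarrow> rd_less y z \<Longrightarrow> rd_less x z"
  by (cases x; cases y; cases z) auto

lemma rd_less_irrefl [simp]: "\<not> rd_less x x"
  by (cases x) auto

lemma rd_less_total: "x \<noteq> y \<Longrightarrow> rd_less x y \<or> rd_less y x"
  by (cases x; cases y) auto

lemma nw_le_rd_less: "nw_le x y \<Longrightarrow> x \<noteq> y \<Longrightarrow> rd_less x y"
  by (cases x; cases y) auto

lemma init_tab_eq_card:
  assumes lam: "lam \<in> multipartitions ell n" and x: "x \<in> diagram ell lam"
  shows "init_tab ell lam x = card {z \<in> diagram ell lam. rd_less z x \<or> z = x}"
proof -
  obtain i j c where e: "x = (i, j, c)" by (metis prod_cases3)
  have c: "1 \<le> c" "c \<le> ell" "1 \<le> i" "1 \<le> j" "j \<le> lam c i" using x e by auto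
  let ?A = "{z \<in> diagram ell lam. upto_row c (i - 1) z}" and ?B = "(\<lambda>b. (i, b, c)) ` {1..j}"
  have "{z \<in> diagram ell lam. rd_less z x \<or> z = x} = ?A \<union> ?B"
    using c by (auto simp: diagram_def e)
  moreover have "card (?A \<union> ?B) = card ?A + card ?B"
    using young_finite[OF young_diagram(1)[OF lam]] c by (intro card_Un_disjoint) auto
  moreover have "card ?B = j" by (simp add: card_image inj_on_def)
  moreover have "{1..i - 1} = {1..<i}" using c by auto
  ultimately show ?thesis
    using x card_upto_row[OF lam c(1,2), of "i - 1"] by (simp add: init_tab_def e)
qed

lemma init_tab:
  assumes lam: "lam \<in> multipartitions ell n"
  shows init_tab_tabs: "init_tab ell lam \<in> tabs ell n" and supp_init_tab: "supp (init_tab ell lam) = diagram ell lam"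
    and init_tab_less_iff: "x \<in> diagram ell lam \<Longrightarrow> y \<in> diagram ell lam \<Longrightarrow> init_tab ell lam x < init_tab ell lam y \<longleftrightarrow> rd_less x y"
proof -
  let ?D = "diagram ell lam" and ?t = "init_tab ell lam"
  note y = young_diagram[OF lam] and fin = young_finite[OF young_diagram(1)[OF lam]]
  have less: "?t x < ?t y" if "x \<in> ?D" "y \<in> ?D" "rd_less x y" for x y
    unfolding init_tab_eq_card[OF lam that(1)] init_tab_eq_card[OF lam that(2)]
  proof (rule psubset_card_mono)
    show "finite {z \<in> ?D. rd_less z y \<or> z = y}" using fin by simp
    have "\<not> rd_less y x" "y \<noteq> x" using rd_less_trans[OF that(3), of x] that(3) by auto
    then show "{z \<in> ?D. rd_less z x \<or> z = x} \<subset> {z \<in> ?D. rd_less z y \<or> z = y}"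
      using that rd_less_trans[OF _ that(3)] by blast
  qed
  show iff: "?t x < ?t y \<longleftrightarrow> rd_less x y" if "x \<in> ?D" "y \<in> ?D" for x y
    using less[OF that] less[OF that(2,1)] rd_less_total[of x y] by (cases "x = y") auto
  have pos: "?t x \<in> {1..n}" if "x \<in> ?D" for x
  proof -
    have "{z \<in> ?D. rd_less z x \<or> z = x} \<subseteq> ?D" by blast
    from card_mono[OF fin this] have "?t x \<le> n" unfolding init_tab_eq_card[OF lam that] y(2) .
    moreover have "card {x} \<le> ?t x"
      unfolding init_tab_eq_card[OF lam that] by (rule card_mono) (use fin that in auto)
    ultimately show ?thesis by simp
  qed
  show s: "supp ?t = ?D"
  proof (rule Set.set_eqI)
    fix x :: node obtain i j c where e: "x = (i, j, c)" by (metis prod_cases3)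
    show "x \<in> supp ?t \<longleftrightarrow> x \<in> ?D"
      using pos[of x] by (cases "x \<in> ?D") (simp_all add: supp_def, simp add: init_tab_def e)
  qed
  have inj: "inj_on ?t ?D"
  proof (rule inj_onI)
    fix x y assume "x \<in> ?D" "y \<in> ?D" "?t x = ?t y"
    then show "x = y" using less[of x y] less[of y x] rd_less_total[of x y] by auto
  qed
  have "?t ` ?D = {1..n}"
    by (rule card_subset_eq) (use pos card_image[OF inj] y(2) in auto)
  then have "bij_betw ?t ?D {1..n}" using inj by (simp add: bij_betw_def)
  moreover have "?t x \<le> ?t y" if "x \<in> ?D" "y \<in> ?D" "nw_le x y" for x y
    using less[OF that(1,2)] nw_le_rd_less[OF that(3)] by (cases "x = y") auto
  ultimately show "?t \<in> tabs ell n" using y(1) by (simp add: tabs_def s)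
qed

subsection \<open>Conjugation\<close>

definition conj_node :: "nat \<Rightarrow> node \<Rightarrow> node" where
  "conj_node ell x = (case x of (i, j, c) \<Rightarrow> (j, i, ell + 1 - c))"

lemma conj_node_simp [simp]: "conj_node ell (i, j, c) = (j, i, ell + 1 - c)"
  by (simp add: conj_node_def)

lemma conj_node_nodes:
  assumes "x \<in> nodes ell"
  shows "conj_node ell x \<in> nodes ell" "conj_node ell (conj_node ell x) = x"
    "y \<in> nodes ell \<Longrightarrow> nw_le (conj_node ell x) (conj_node ell y) \<longleftrightarrow> nw_le x y"
proof -
  obtain i j c where x: "x = (i, j, c)" by (metis prod_cases3)
  show "conj_node ell x \<in> nodes ell" "conj_node ell (conj_node ell x) = x" using assms x by auto
  assume y: "y \<in> nodes ell"
  obtain i' j' c' where y': "y = (i', j', c')" by (metis prod_cases3)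
  show "nw_le (conj_node ell x) (conj_node ell y) \<longleftrightarrow> nw_le x y" using assms x y y' by auto
qed

lemma conj_node_eq_iff: "x \<in> nodes ell \<Longrightarrow> y \<in> nodes ell \<Longrightarrow> conj_node ell x = conj_node ell y \<longleftrightarrow> x = y"
  using conj_node_nodes(2) by metis

lemma node_res_conj:
  assumes "x \<in> nodes ell"
  shows "node_res (inverse q) (\<lambda>j. Q (ell + 1 - j)) (conj_node ell x) = node_res q Q x"
proof -
  obtain i j c where x: "x = (i, j, c)" by (metis prod_cases3)
  have "inverse q powi (int i - int j) = q powi (int j - int i)"
    by (metis minus_diff_eq power_int_inverse power_int_minus)
  then show ?thesis using assms x by (simp add: node_res_def)
qed

lemma conj_tab_eq: "x \<in> nodes ell \<Longrightarrow> conj_tab ell t x = t (conj_node ell x)"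
  by (cases x) (simp add: conj_tab_def)

lemma conj_tab:
  assumes t: "t \<in> tabs ell n"
  shows conj_tab_tabs: "conj_tab ell t \<in> tabs ell n" and supp_conj_tab: "supp (conj_tab ell t) = conj_node ell ` supp t"
    and conj_conj_tab: "conj_tab ell (conj_tab ell t) = t"
    and nd_conj_tab: "1 \<le> m \<Longrightarrow> m \<le> n \<Longrightarrow> nd (conj_tab ell t) m = conj_node ell (nd t m)"
proof -
  let ?u = "conj_tab ell t"
  note y = tabs_young[OF t] and nD = young_nodes[OF tabs_young[OF t]]
  have out: "conj_tab ell t x = 0" if "x \<notin> nodes ell" for x
  proof -
    obtain i j c where x: "x = (i, j, c)" by (metis prod_cases3)
    have "(j, i, ell + 1 - c) \<notin> supp t" if "1 \<le> c" "c \<le> ell"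
      using that \<open>x \<notin> nodes ell\<close> x nD by auto
    then show ?thesis by (auto simp: conj_tab_def x supp_def)
  qed
  show s: "supp ?u = conj_node ell ` supp t"
  proof (intro Set.set_eqI iffI)
    fix x assume x: "x \<in> supp ?u"
    then have n: "x \<in> nodes ell" using out[of x] by (auto simp: supp_def)
    then have "conj_node ell x \<in> supp t" using x conj_tab_eq[OF n] by (simp add: supp_def)
    then show "x \<in> conj_node ell ` supp t" using conj_node_nodes(2)[OF n] by (metis imageI)
  next
    fix x assume "x \<in> conj_node ell ` supp t"
    then obtain z where z: "z \<in> supp t" "x = conj_node ell z" by blast
    then have "z \<in> nodes ell" using nD by blast
    then show "x \<in> supp ?u" using z conj_tab_eq[of x ell t] conj_node_nodes[of z ell] by (simp add: supp_def)
  qed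
  have val: "?u (conj_node ell z) = t z" if "z \<in> supp t" for z
    using that nD conj_node_nodes[of z ell] conj_tab_eq[of "conj_node ell z" ell t] by auto
  have inj: "inj_on (conj_node ell) (supp t)"
    by (rule inj_onI) (use conj_node_eq_iff nD in blast)
  have "young ell (supp ?u)" unfolding young_def s
  proof (intro conjI ballI impI)
    show "finite (conj_node ell ` supp t)" using young_finite[OF y] by simp
    show "conj_node ell ` supp t \<subseteq> nodes ell" using conj_node_nodes(1) nD by blast
    fix y' x assume y': "y' \<in> conj_node ell ` supp t" and x: "x \<in> nodes ell" "nw_le x y'"
    then obtain z where z: "z \<in> supp t" "y' = conj_node ell z" by blast
    have zn: "z \<in> nodes ell" using z nD by blast
    have "nw_le (conj_node ell x) z"
      using x conj_node_nodes(3)[OF x(1), of y'] conj_node_nodes[OF zn] z(2) by simp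
    then have "conj_node ell x \<in> supp t" using youngD[OF y z(1)] conj_node_nodes(1)[OF x(1)] by blast
    then show "x \<in> conj_node ell ` supp t" using conj_node_nodes(2)[OF x(1)] by (metis imageI)
  qed
  moreover have "bij_betw ?u (supp ?u) {1..n}"
  proof -
    have "bij_betw (?u \<circ> conj_node ell) (supp t) {1..n}"
      using tabs_bij[OF t] by (subst bij_betw_cong[where g = t]) (simp_all add: val)
    moreover have "bij_betw (conj_node ell) (supp t) (supp ?u)" using inj s by (simp add: bij_betw_def)
    ultimately show ?thesis using bij_betw_comp_iff[of "conj_node ell" "supp t" "supp ?u" ?u "{1..n}"] by simp
  qed
  moreover have "?u a \<le> ?u b" if ab: "a \<in> supp ?u" "b \<in> supp ?u" "nw_le a b" for a b
  proof -
    obtain a' b' where a': "a' \<in> supp t" "a = conj_node ell a'" "b' \<in> supp t" "b = conj_node ell b'"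
      using ab(1,2) unfolding s by blast
    then have "nw_le a' b'" using conj_node_nodes(3)[of a' ell b'] nD ab(3) by blast
    then show ?thesis using a' val tabs_mono[OF t a'(1,3)] by simp
  qed
  ultimately show ut: "?u \<in> tabs ell n" by (simp add: tabs_def)
  show "conj_tab ell ?u = t"
  proof
    fix x show "conj_tab ell ?u x = t x"
    proof (cases "x \<in> nodes ell")
      case True
      then show ?thesis using conj_node_nodes[OF True] conj_tab_eq[of "conj_node ell x" ell t] conj_tab_eq[OF True, of ?u] by simp
    next
      case False
      obtain i j c where x: "x = (i, j, c)" by (metis prod_cases3)
      have "x \<notin> supp t" using False nD by blast
      then have "t x = 0" by (simp add: supp_def)
      moreover have "conj_tab ell ?u x = 0"
      proof (cases "1 \<le> c \<and> c \<le> ell")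
        case True
        then have "(j, i, ell + 1 - c) \<notin> nodes ell" using False x by auto
        then show ?thesis using out[of "(j, i, ell + 1 - c)"] by (simp add: conj_tab_def[of ell ?u] x)
      next
        case False
        then show ?thesis by (simp only: conj_tab_def[of ell ?u] x prod.case atLeastAtMost_iff if_False)
      qed
      ultimately show ?thesis by simp
    qed
  qed
  show "nd ?u m = conj_node ell (nd t m)" if "1 \<le> m" "m \<le> n"
    using nd_eq[OF ut, of "conj_node ell (nd t m)" m] val[of "nd t m"] that t by simp
qed

lemma conj_mpart:
  assumes lam: "lam \<in> multipartitions ell n"
  shows diagram_conj_mpart: "diagram ell (conj_mpart ell lam) = conj_node ell ` diagram ell lam"
    and conj_mpart_multipartitions: "conj_mpart ell lam \<in> multipartitions ell n"
proof -
  let ?D = "diagram ell lam"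
  obtain t where t: "t \<in> tabs ell n" "supp t = ?D" using tabs_exist[OF young_diagram[OF lam]] by blast
  note u = conj_tab_tabs[OF t(1)] and su = supp_conj_tab[OF t(1), unfolded t(2)]
  have y: "young ell (conj_node ell ` ?D)" "card (conj_node ell ` ?D) = n"
    using tabs_young[OF u] tabs_card[OF u] unfolding su by simp_all
  have mem: "(i, j, c) \<in> conj_node ell ` ?D \<longleftrightarrow> 1 \<le> c \<and> c \<le> ell \<and> (j, i, ell + 1 - c) \<in> ?D" for i j c
  proof
    assume "(i, j, c) \<in> conj_node ell ` ?D"
    then obtain i' j' c' where "(i', j', c') \<in> ?D" "(i, j, c) = (j', i', ell + 1 - c')" by (auto simp: conj_node_def)
    then show "1 \<le> c \<and> c \<le> ell \<and> (j, i, ell + 1 - c) \<in> ?D" by auto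
  next
    assume "1 \<le> c \<and> c \<le> ell \<and> (j, i, ell + 1 - c) \<in> ?D"
    then show "(i, j, c) \<in> conj_node ell ` ?D" by (intro image_eqI[of _ _ "(j, i, ell + 1 - c)"]) auto
  qed
  have "conj_mpart ell lam = shape_of (conj_node ell ` ?D)"
  proof (intro ext)
    fix c i
    show "conj_mpart ell lam c i = shape_of (conj_node ell ` ?D) c i"
    proof (cases "1 \<le> c \<and> c \<le> ell \<and> 1 \<le> i")
      case True
      then have "{j. (i, j, c) \<in> conj_node ell ` ?D} = {j. 1 \<le> j \<and> i \<le> lam (ell + 1 - c) j}"
        unfolding mem by auto
      then show ?thesis using True by (simp add: conj_mpart_def conj_part_def shape_of_def)
    next
      case False
      then have "{j. (i, j, c) \<in> conj_node ell ` ?D} = {}" unfolding mem by auto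
      then show ?thesis using False by (auto simp: conj_mpart_def conj_part_def shape_of_def)
    qed
  qed
  then show "diagram ell (conj_mpart ell lam) = conj_node ell ` ?D" "conj_mpart ell lam \<in> multipartitions ell n"
    using shape_of_young[OF y(1)] y(2) by simp_all
qed

lemma final_tab:
  assumes lam: "lam \<in> multipartitions ell n"
  shows final_tab_tabs: "final_tab ell lam \<in> tabs ell n" and supp_final_tab: "supp (final_tab ell lam) = diagram ell lam"
    and conj_final_tab: "conj_tab ell (final_tab ell lam) = init_tab ell (conj_mpart ell lam)"
    and final_tab_less_iff: "x \<in> diagram ell lam \<Longrightarrow> y \<in> diagram ell lam \<Longrightarrow>
      final_tab ell lam x < final_tab ell lam y \<longleftrightarrow> rd_less (conj_node ell x) (conj_node ell y)"
proof -
  note lam' = conj_mpart_multipartitions[OF lam]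
  note i = init_tab_tabs[OF lam'] and si = supp_init_tab[OF lam', unfolded diagram_conj_mpart[OF lam]]
  have nD: "diagram ell lam \<subseteq> nodes ell" using young_nodes[OF young_diagram(1)[OF lam]] .
  show "final_tab ell lam \<in> tabs ell n" unfolding final_tab_def by (rule conj_tab_tabs[OF i])
  have "conj_node ell ` conj_node ell ` diagram ell lam = (\<lambda>x. x) ` diagram ell lam"
    unfolding image_image by (rule image_cong[OF refl]) (use conj_node_nodes(2) nD in blast)
  then show "supp (final_tab ell lam) = diagram ell lam"
    unfolding final_tab_def supp_conj_tab[OF i] si by simp
  show "conj_tab ell (final_tab ell lam) = init_tab ell (conj_mpart ell lam)"
    unfolding final_tab_def by (rule conj_conj_tab[OF i])
  assume xy: "x \<in> diagram ell lam" "y \<in> diagram ell lam"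
  then have n: "x \<in> nodes ell" "y \<in> nodes ell" using nD by blast+
  show "final_tab ell lam x < final_tab ell lam y \<longleftrightarrow> rd_less (conj_node ell x) (conj_node ell y)"
    unfolding final_tab_def conj_tab_eq[OF n(1)] conj_tab_eq[OF n(2)]
    by (rule init_tab_less_iff[OF lam']) (use xy diagram_conj_mpart[OF lam] in auto)
qed

text \<open>The row reading and the column reading order every pair of nodes that standardness does not
  order in opposite ways. So each filling lies between the two in the weak order.\<close>
lemma Invs_init_final:
  assumes lam: "lam \<in> multipartitions ell n" and u: "u \<in> tabs ell n" "supp u = diagram ell lam"
  defines "a \<equiv> init_tab ell lam" and "z \<equiv> final_tab ell lam"
  shows "Invs a z = Invs a u \<union> Invs u z \<and> Invs a u \<inter> Invs u z = {}"
proof -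
  let ?D = "diagram ell lam"
  note a = init_tab[OF lam, folded a_def] and z = final_tab[OF lam, folded z_def]
  have opp: "a x < a y \<longleftrightarrow> z y < z x" if "x \<in> ?D" "y \<in> ?D" "\<not> nw_le x y" "\<not> nw_le y x" for x y
  proof -
    obtain i j c where x: "x = (i, j, c)" by (metis prod_cases3)
    obtain i' j' c' where y: "y = (i', j', c')" by (metis prod_cases3)
    show ?thesis unfolding a(3)[OF that(1,2)] z(4)[OF that(2,1)] unfolding x y conj_node_simp rd_less_simp
    proof -
      have b: "1 \<le> c" "c \<le> ell" "1 \<le> c'" "c' \<le> ell" using that(1,2) unfolding x y by simp_all
      have "c = c' \<Longrightarrow> \<not> (i \<le> i' \<and> j \<le> j')" "c = c' \<Longrightarrow> \<not> (i' \<le> i \<and> j' \<le> j)"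
        using that(3,4) unfolding x y by simp_all
      then show "(c < c' \<or> c = c' \<and> (i < i' \<or> i = i' \<and> j < j')) \<longleftrightarrow>
        (ell + 1 - c' < ell + 1 - c \<or> ell + 1 - c' = ell + 1 - c \<and> (j' < j \<or> j' = j \<and> i' < i))"
        using b by linarith
    qed
  qed
  have incomp: "\<not> nw_le x y \<and> \<not> nw_le y x"
    if "s \<in> tabs ell n" "t \<in> tabs ell n" "supp s = ?D" "supp t = ?D" "x \<in> ?D" "y \<in> ?D" "s x < s y" "t y < t x" for s t x y
    using tabs_mono[OF that(1), of y x] tabs_mono[OF that(2), of x y] that by auto
  have "Invs a z = Invs a u \<union> Invs u z"
  proof (intro Set.set_eqI iffI)
    fix p assume p: "p \<in> Invs a z"
    obtain x y where xy: "p = (x, y)" by (cases p)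
    have h: "x \<in> ?D" "y \<in> ?D" "a x < a y" "z y < z x" using p by (simp_all add: Invs_def xy z(2))
    have "u x \<noteq> 0" using h(1) u(2) by (auto simp: supp_def)
    then have "u x \<noteq> u y" using tabs_eqD[OF u(1), of x y] h(3) by auto
    then show "p \<in> Invs a u \<union> Invs u z" using h xy u(2) z(2) by (auto simp: Invs_def)
  next
    fix p assume p: "p \<in> Invs a u \<union> Invs u z"
    obtain x y where xy: "p = (x, y)" by (cases p)
    from p consider "x \<in> ?D" "y \<in> ?D" "a x < a y" "u y < u x" | "x \<in> ?D" "y \<in> ?D" "u x < u y" "z y < z x"
      by (auto simp: Invs_def xy u(2) z(2))
    then show "p \<in> Invs a z"
    proof cases
      case 1
      then show ?thesis using opp[of x y] incomp[OF a(1) u(1) a(2) u(2), of x y] xy by (simp add: Invs_def z(2))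
    next
      case 2
      then show ?thesis using opp[of x y] incomp[OF u(1) z(1) u(2) z(2), of x y] xy by (simp add: Invs_def z(2))
    qed
  qed
  moreover have "Invs a u \<inter> Invs u z = {}" by (auto simp: Invs_def)
  ultimately show ?thesis by (rule conjI)
qed

lemma card_Invs_init_final:
  assumes lam: "lam \<in> multipartitions ell n" and u: "u \<in> tabs ell n" "supp u = diagram ell lam"
  shows "card (Invs (init_tab ell lam) (final_tab ell lam)) =
    card (Invs (init_tab ell lam) u) + card (Invs u (final_tab ell lam))"
proof -
  have "finite (Invs (init_tab ell lam) u)" "finite (Invs u (final_tab ell lam))"
    using finite_Invs young_finite[OF young_diagram(1)[OF lam]] u(2) supp_final_tab[OF lam] by metis+
  then show ?thesis using Invs_init_final[OF assms] card_Un_disjoint by metis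
qed

section \<open>The seminormal basis in terms of matrix units\<close>

context hecke_ring
begin

lemma comm_prod_list: "(\<And>y. y \<in> set ys \<Longrightarrow> x * y = y * x) \<Longrightarrow> x * prod_list ys = prod_list ys * x" for x :: 'a
proof (induction ys)
  case (Cons y ys)
  have "x * y = y * x" "x * prod_list ys = prod_list ys * x" using Cons by simp_all
  then show ?case by (simp add: comm_mult)
qed simp

lemma T_comm_L_prod:
  assumes i: "1 \<le> i" "i < n" and m: "m \<le> n" "i \<noteq> m"
  shows "T i * prod_list (map (\<lambda>k. L k - sc c) [1..<Suc m]) = prod_list (map (\<lambda>k. L k - sc c) [1..<Suc m]) * T i"
proof -
  let ?f = "\<lambda>k. L k - sc c"
  have far: "T i * ?f k = ?f k * T i" if "1 \<le> k" "k \<le> n" "k \<noteq> i" "k \<noteq> Suc i" for k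
    using T_L_comm(1)[OF i that] T_sc[of i c] by (simp add: left_diff_distrib right_diff_distrib)
  show ?thesis
  proof (cases "i < m")
    case True
    have "[1..<Suc m] = [1..<i] @ [i..<Suc m]" using upt_add_eq_append[of 1 i "Suc m - i"] i True by simp
    also have "[i..<Suc m] = [i, Suc i] @ [Suc (Suc i)..<Suc m]" using True by (simp add: upt_conv_Cons)
    finally have e: "prod_list (map ?f [1..<Suc m]) =
        prod_list (map ?f [1..<i]) * ((?f i * ?f (Suc i)) * prod_list (map ?f [Suc (Suc i)..<Suc m]))"
      by (simp add: mult.assoc)
    show ?thesis unfolding e
    proof (rule comm_mult[OF comm_prod_list comm_mult[OF T_comm_L_pair[OF i] comm_prod_list]])
      show "T i * y = y * T i" if y: "y \<in> set (map ?f [1..<i])" for y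
      proof -
        obtain k where k: "y = ?f k" "1 \<le> k" "k < i" using y by auto
        then show ?thesis using far[of k] i by simp
      qed
      show "T i * y = y * T i" if y: "y \<in> set (map ?f [Suc (Suc i)..<Suc m])" for y
      proof -
        obtain k where k: "y = ?f k" "Suc i < k" "k \<le> m" using y by auto
        then show ?thesis using far[of k] i m by simp
      qed
    qed
  next
    case False
    show ?thesis
    proof (rule comm_prod_list)
      fix y assume y: "y \<in> set (map ?f [1..<Suc m])"
      then obtain k where k: "y = ?f k" "1 \<le> k" "k \<le> m" by auto
      then show "T i * y = y * T i" using far[of k] i False m by simp
    qed
  qed
qed

end

locale shaped = seminormal ell n q Q sc T
  for ell n :: nat and q :: "'k::field" and Q :: "nat \<Rightarrow> 'k"
    and sc :: "'k \<Rightarrow> 'a::ring_1" and T :: "nat \<Rightarrow> 'a" +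
  fixes lam :: mpart
  assumes lam: "lam \<in> multipartitions ell n"
begin

abbreviation a :: tab where "a \<equiv> init_tab ell lam"
abbreviation D :: "node set" where "D \<equiv> diagram ell lam"

lemmas a_tabs = init_tab_tabs[OF lam] and supp_a = supp_init_tab[OF lam] and a_less = init_tab_less_iff[OF lam]
  and young_D = young_diagram(1)[OF lam] and card_D = young_diagram(2)[OF lam]

lemma nd_a_D: "1 \<le> k \<Longrightarrow> k \<le> n \<Longrightarrow> nd a k \<in> D"
  using nd_supp[OF a_tabs] supp_a by blast

lemma a_le_iff: "x \<in> D \<Longrightarrow> y \<in> D \<Longrightarrow> a x \<le> a y \<longleftrightarrow> \<not> rd_less y x"
  using a_less[of y x] by (simp add: linorder_not_less[symmetric])

lemma finite_D: "finite D" by (rule young_finite[OF young_D])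

definition row_start :: "nat \<Rightarrow> node" where
  "row_start k = (case nd a k of (i, j, c) \<Rightarrow> (i, 1, c))"

text \<open>The block of an entry of the initial tableau is labelled by the first entry of its row.\<close>
definition blk :: "nat \<Rightarrow> nat" where
  "blk k = (if k \<in> {1..n} then a (row_start k) else 0)"

lemma row_start: "nd a k = (i, j, c) \<Longrightarrow> row_start k = (i, 1, c)"
  by (simp add: row_start_def)

lemma row_start_D: "1 \<le> k \<Longrightarrow> k \<le> n \<Longrightarrow> row_start k \<in> D"
proof -
  assume k: "1 \<le> k" "k \<le> n"
  obtain i j c where e: "nd a k = (i, j, c)" by (metis prod_cases3)
  then show ?thesis using nd_a_D[OF k] by (simp add: row_start)
qed

lemma blk_mono:
  assumes "1 \<le> k" "k \<le> l" "l \<le> n"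
  shows "blk k \<le> blk l"
proof -
  have k: "1 \<le> k" "k \<le> n" "1 \<le> l" "l \<le> n" using assms by auto
  obtain i j c where x: "nd a k = (i, j, c)" by (metis prod_cases3)
  obtain i' j' c' where y: "nd a l = (i', j', c')" by (metis prod_cases3)
  have "\<not> rd_less (nd a l) (nd a k)"
    using a_less[OF nd_a_D nd_a_D, of l k] k assms a_tabs by simp
  then have "\<not> rd_less (row_start l) (row_start k)" by (auto simp: row_start[OF x] row_start[OF y] x y)
  then show ?thesis using a_le_iff[OF row_start_D row_start_D, of k l] k by (simp add: blk_def)
qed

lemma blk_eq_iff:
  assumes k: "1 \<le> k" "k \<le> n" and l: "1 \<le> l" "l \<le> n"
  shows "blk k = blk l \<longleftrightarrow> row_start k = row_start l"
proof -
  have "row_start k \<in> supp a" using row_start_D[OF k] supp_a by simp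
  then have "a (row_start k) \<noteq> 0" by (simp add: supp_def)
  then show ?thesis using tabs_eqD[OF a_tabs, of "row_start k" "row_start l"] k l by (auto simp: blk_def)
qed

lemma young_subgroup_eq: "young_subgroup ell n lam = block_perms n blk"
proof (intro Set.set_eqI iffI)
  fix w
  let ?row = "\<lambda>i c. {a (i, j, c) | j. (i, j, c) \<in> D}"
  have row: "k \<in> ?row i c \<longleftrightarrow> 1 \<le> k \<and> k \<le> n \<and> row_start k = (i, 1, c)" for k i c
  proof
    assume "k \<in> ?row i c"
    then obtain j where j: "k = a (i, j, c)" "(i, j, c) \<in> D" by blast
    then have "(i, j, c) \<in> supp a" using supp_a by simp
    then have "k \<noteq> 0" using j(1) by (simp add: supp_def)
    moreover from this have "nd a k = (i, j, c)" using nd_eq[OF a_tabs] j(1) by simp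
    moreover have "k \<le> n" using tabs_le[OF a_tabs] j(1) by simp
    ultimately show "1 \<le> k \<and> k \<le> n \<and> row_start k = (i, 1, c)" by (simp add: row_start)
  next
    assume k: "1 \<le> k \<and> k \<le> n \<and> row_start k = (i, 1, c)"
    obtain i' j' c' where e: "nd a k = (i', j', c')" by (metis prod_cases3)
    have "i' = i" "c' = c" using k row_start[OF e] by simp_all
    then have "nd a k = (i, j', c)" using e by simp
    moreover have "a (nd a k) = k" "nd a k \<in> D" using k a_tabs nd_a_D by simp_all
    ultimately show "k \<in> ?row i c" by (intro CollectI exI[of _ j']) simp
  qed
  {
    assume w: "w \<in> young_subgroup ell n lam"
    then have p: "w permutes {1..n}" and inv: "\<And>i c. w ` ?row i c = ?row i c"
      unfolding young_subgroup_def Let_def by blast+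
    have "blk (w k) = blk k" for k
    proof (cases "k \<in> {1..n}")
      case True
      then have k: "1 \<le> k" "k \<le> n" by simp_all
      obtain i c where rs: "row_start k = (i, 1, c)" by (cases "nd a k") (simp add: row_start_def)
      then have "k \<in> ?row i c" using row k by blast
      then have "w k \<in> ?row i c" using inv by blast
      then have "1 \<le> w k \<and> w k \<le> n \<and> row_start (w k) = (i, 1, c)" using row by blast
      then show ?thesis using blk_eq_iff[of "w k" k] k rs by simp
    next
      case False then show ?thesis using permutes_not_in[OF p False] by simp
    qed
    then show "w \<in> block_perms n blk" using p by (simp add: block_perms_def)
  next
    assume w: "w \<in> block_perms n blk"
    then have p: "w permutes {1..n}" and b: "\<And>k. blk (w k) = blk k" by (simp_all add: block_perms_def)
    have sub: "w ` ?row i c \<subseteq> ?row i c" for i c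
    proof (rule image_subsetI)
      fix k assume "k \<in> ?row i c"
      then have k: "1 \<le> k" "k \<le> n" "row_start k = (i, 1, c)" using row by blast+
      then show "w k \<in> ?row i c"
        unfolding row using permutes_range[OF p k(1,2)] blk_eq_iff[of "w k" k] b[of k] by simp
    qed
    have fin: "finite (?row i c)" for i c
    proof (rule finite_subset)
      show "?row i c \<subseteq> {1..n}" using row by auto
    qed simp
    have "w ` ?row i c = ?row i c" for i c
      using endo_inj_surj[OF fin sub] permutes_inj_on[OF p] by blast
    then show "w \<in> young_subgroup ell n lam" unfolding young_subgroup_def Let_def using p by blast
  }
qed

lemma same_block_next:
  assumes i: "1 \<le> i" "i < n" "blk i = blk (Suc i)"
  obtains r j c where "nd a i = (r, j, c)" "nd a (Suc i) = (r, Suc j, c)"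
proof -
  have k: "1 \<le> i" "i \<le> n" "1 \<le> Suc i" "Suc i \<le> n" using i by auto
  obtain r j c where x: "nd a i = (r, j, c)" by (metis prod_cases3)
  obtain r' j' c' where y: "nd a (Suc i) = (r', j', c')" by (metis prod_cases3)
  have "row_start i = row_start (Suc i)" using blk_eq_iff[OF k] i by simp
  then have e: "r' = r" "c' = c" using row_start[OF x] row_start[OF y] by simp_all
  have "rd_less (nd a i) (nd a (Suc i))" using a_less[OF nd_a_D nd_a_D, of i "Suc i"] k a_tabs by simp
  then have "j < j'" using x y e by simp
  have yD: "(r, j', c) \<in> D" using nd_a_D[OF k(3,4)] y e by simp
  have "j' = Suc j"
  proof (rule ccontr)
    assume "j' \<noteq> Suc j"
    then have z: "(r, Suc j, c) \<in> D" "rd_less (nd a i) (r, Suc j, c)" "rd_less (r, Suc j, c) (nd a (Suc i))"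
      using yD \<open>j < j'\<close> x y e by auto
    have "i < a (r, Suc j, c)" "a (r, Suc j, c) < Suc i"
      using a_less[OF nd_a_D[OF k(1,2)] z(1)] a_less[OF z(1) nd_a_D[OF k(3,4)]] z(2,3) k a_tabs by simp_all
    then show False by simp
  qed
  then show ?thesis using that x y e by simp
qed

lemma F_T_fix:
  assumes t: "t \<in> tabs ell n" and i: "1 \<le> i" "i < n" and s: "sperm i \<circ> t \<notin> tabs ell n"
  shows "F t * (T i * v) = sc (dg i t) * (F t * v)"
proof -
  have "F t * (T i * (F u * v)) = (if u = t then sc (dg i t) * (F t * v) else 0)" if u: "u \<in> tabs ell n" for u
  proof -
    have "t \<noteq> sperm i \<circ> u" using s u by (metis comp_sperm_sperm(2))
    then show ?thesis using F_T_F[OF u t i, of v] by auto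
  qed
  then have "(\<Sum>u\<in>tabs ell n. F t * (T i * (F u * v))) = (\<Sum>u\<in>tabs ell n. if u = t then sc (dg i t) * (F t * v) else 0)"
    by (intro sum.cong) auto
  also have "\<dots> = sc (dg i t) * (F t * v)" using t finite_tabs by simp
  finally show ?thesis by (simp add: F_sum_v flip: sum_distrib_left)
qed

lemma diag_adjacent: "b \<noteq> 0 \<Longrightarrow> diag b (q * b) = q" "b \<noteq> 0 \<Longrightarrow> diag b (inverse q * b) = -1"
proof -
  assume b: "b \<noteq> 0"
  have q1': "q - 1 \<noteq> 0" "1 - q \<noteq> 0" using q1 by auto
  have "diag b (q * b) = (q - 1) * (q * b) / ((q - 1) * b)" by (simp add: diag_def algebra_simps)
  then show "diag b (q * b) = q" using q1' b by simp
  have "diag b (inverse q * b) = (q - 1) * (inverse q * b) / ((1 - q) * (inverse q * b))"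
    using q0 by (simp add: diag_def left_diff_distrib) 
  then have "diag b (inverse q * b) = (q - 1) / (1 - q)" using b q0 by simp
  also have "\<dots> = -1" using q1' by (simp add: divide_eq_eq)
  finally show "diag b (inverse q * b) = -1" .
qed

lemma res_at_0: "2 \<le> n \<Longrightarrow> t \<in> tabs ell n \<Longrightarrow> 1 \<le> k \<Longrightarrow> k \<le> n \<Longrightarrow> res_at t k \<noteq> 0"
  using nres_0[of "nd t k"] nd_supp[of t ell n k] young_nodes[OF tabs_young, of t ell n] by blast

lemma F_a_T:
  assumes i: "1 \<le> i" "i < n" "blk i = blk (Suc i)"
  shows "F a * (T i * v) = sc q * (F a * v)"
proof -
  obtain r j c where x: "nd a i = (r, j, c)" "nd a (Suc i) = (r, Suc j, c)" by (rule same_block_next[OF i])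
  then have s: "sperm i \<circ> a \<notin> tabs ell n" using swap_tabsD[OF a_tabs i(1,2)] by auto
  have "res_at a (Suc i) = q * res_at a i"
    using x q0 by (simp add: node_res_def power_int_add power_int_diff)
  then have "dg i a = q" using diag_adjacent(1)[OF res_at_0[OF _ a_tabs, of i]] i by simp
  then show ?thesis using F_T_fix[OF a_tabs i(1,2) s] by simp
qed

definition below :: "nat \<Rightarrow> nat" where
  "below r = (\<Sum>c=1..<r. psize (lam c))"

text \<open>The second factor of \<open>m\<^sub>\<lambda>\<close>. It is symmetric enough to commute with the Young subgroup.\<close>
definition U :: "'a" where
  "U = prod_list [L k - sc (Q r). r \<leftarrow> [2..<Suc ell], k \<leftarrow> [1..<Suc (below r)]]"

definition U_val :: "tab \<Rightarrow> 'k" where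
  "U_val t = (\<Prod>r=2..ell. \<Prod>k=1..below r. res_at t k - Q r)"

lemma below_eq: "r \<le> Suc ell \<Longrightarrow> below r = card {x \<in> D. comp_of x < r}"
  using card_diagram_less(2)[OF lam] by (simp add: below_def)

lemma below_le: "r \<le> Suc ell \<Longrightarrow> below r \<le> n"
  unfolding below_eq card_D[symmetric] by (rule card_mono[OF finite_D]) blast

lemma a_le_below: assumes "x \<in> D" "r \<le> Suc ell" shows "a x \<le> below r \<longleftrightarrow> comp_of x < r"
proof
  assume c: "comp_of x < r"
  have "{z \<in> D. rd_less z x \<or> z = x} \<subseteq> {z \<in> D. comp_of z < r}"
  proof
    fix z assume z: "z \<in> {z \<in> D. rd_less z x \<or> z = x}"
    obtain i j d where "z = (i, j, d)" by (metis prod_cases3)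
    moreover obtain i' j' d' where "x = (i', j', d')" by (metis prod_cases3)
    ultimately show "z \<in> {z \<in> D. comp_of z < r}" using z c by auto
  qed
  then show "a x \<le> below r"
    unfolding below_eq[OF assms(2)] init_tab_eq_card[OF lam assms(1)] by (rule card_mono[rotated]) (simp add: finite_D)
next
  assume le: "a x \<le> below r"
  show "comp_of x < r"
  proof (rule ccontr)
    assume c: "\<not> comp_of x < r"
    have "insert x {z \<in> D. comp_of z < r} \<subseteq> {z \<in> D. rd_less z x \<or> z = x}"
    proof
      fix z assume z: "z \<in> insert x {z \<in> D. comp_of z < r}"
      obtain i j d where "z = (i, j, d)" by (metis prod_cases3)
      moreover obtain i' j' d' where "x = (i', j', d')" by (metis prod_cases3)
      ultimately show "z \<in> {z \<in> D. rd_less z x \<or> z = x}" using z c assms(1) by auto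
    qed
    then have "card (insert x {z \<in> D. comp_of z < r}) \<le> a x"
      unfolding init_tab_eq_card[OF lam assms(1)] by (rule card_mono[rotated]) (simp add: finite_D)
    then show False using le c finite_D unfolding below_eq[OF assms(2)] by simp
  qed
qed

lemma U_nested: "U = prod_list (map (\<lambda>r. prod_list (map (\<lambda>k. L k - sc (Q r)) [1..<Suc (below r)])) [2..<Suc ell])"
proof -
  have "prod_list (concat (map h xs)) = prod_list (map (\<lambda>x. prod_list (h x)) xs)" for h :: "nat \<Rightarrow> 'a list" and xs
    by (induction xs) simp_all
  then show ?thesis unfolding U_def by (simp only: concat_map_singleton)
qed

lemma scal_comm_U [simp]: "scal_comm U"
  unfolding U_def by (rule scal_comm_prod_list) (auto simp del: upt_Suc)

lemma U_comm_T:
  assumes i: "1 \<le> i" "i < n" "blk i = blk (Suc i)"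
  shows "U * T i = T i * U"
proof -
  obtain r0 j c where x: "nd a i = (r0, j, c)" "nd a (Suc i) = (r0, Suc j, c)" by (rule same_block_next[OF i])
  have D: "nd a i \<in> D" "nd a (Suc i) \<in> D" using nd_a_D i by simp_all
  have "i \<noteq> below r" if r: "r \<le> ell" for r
  proof
    assume e: "i = below r"
    have "a (nd a i) \<le> below r" "\<not> a (nd a (Suc i)) \<le> below r" using a_tabs i e by simp_all
    then show False using a_le_below[OF D(1), of r] a_le_below[OF D(2), of r] r x by simp
  qed
  then have "T i * U = U * T i"
    unfolding U_nested
  proof (intro comm_prod_list)
    fix y assume ne: "\<And>r. r \<le> ell \<Longrightarrow> i \<noteq> below r"
      and y: "y \<in> set (map (\<lambda>r. prod_list (map (\<lambda>k. L k - sc (Q r)) [1..<Suc (below r)])) [2..<Suc ell])"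
    then obtain r where r: "y = prod_list (map (\<lambda>k. L k - sc (Q r)) [1..<Suc (below r)])" "r \<le> ell"
      by (auto simp del: upt_Suc)
    have "below r \<le> n" using below_le[of r] r(2) by simp
    from T_comm_L_prod[OF i(1,2) this ne[OF r(2)]] show "T i * y = y * T i" unfolding r(1) .
  qed
  then show ?thesis by simp
qed

lemma F_prod_list_right:
  assumes "\<And>x v. x \<in> set xs \<Longrightarrow> F t * (f x * v) = sc (g x) * (F t * v)"
  shows "F t * (prod_list (map f xs) * v) = sc (prod_list (map g xs)) * (F t * v)"
  using assms by (induction xs arbitrary: v) (simp_all add: mult.assoc)

lemma F_U: assumes t: "t \<in> tabs ell n" shows "F t * (U * v) = sc (U_val t) * (F t * v)"
proof -
  have inner: "F t * (prod_list (map (\<lambda>k. L k - sc (Q r)) [1..<Suc (below r)]) * v) =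
      sc (prod_list (map (\<lambda>k. res_at t k - Q r) [1..<Suc (below r)])) * (F t * v)" if r: "r \<le> ell" for r v
  proof (rule F_prod_list_right)
    fix k v assume "k \<in> set [1..<Suc (below r)]"
    then have "1 \<le> k" "k \<le> n" using below_le[of r] r by auto
    then show "F t * ((L k - sc (Q r)) * v) = sc (res_at t k - Q r) * (F t * v)"
      using F_L[OF t, of k v] by (simp add: left_diff_distrib right_diff_distrib sc_diff)
  qed
  have conv: "prod_list (map h [m..<Suc l]) = (\<Prod>k=m..l. h k)" for h :: "nat \<Rightarrow> 'k" and m l
    by (simp only: prod.distinct_set_conv_list[OF distinct_upt, symmetric] set_upt atLeastLessThanSuc_atLeastAtMost)
  show ?thesis
    unfolding U_nested U_val_def
    using F_prod_list_right[of "[2..<Suc ell]" t "\<lambda>r. prod_list (map (\<lambda>k. L k - sc (Q r)) [1..<Suc (below r)])"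
        "\<lambda>r. prod_list (map (\<lambda>k. res_at t k - Q r) [1..<Suc (below r)])" v] inner
    by (simp add: conv del: upt_Suc)
qed

definition top_gamma :: 'k where
  "top_gamma = qfact_mpart ell q lam * U_val a"

lemma card_block: assumes k: "1 \<le> k" "k \<le> n" "nd a k = (i, j, c)"
  shows "card {l \<in> {1..k}. blk l = blk k} = j"
proof -
  have kD: "(i, j, c) \<in> D" using nd_a_D[OF k(1,2)] k(3) by simp
  have ak: "a (i, j, c) = k" using nd_entry[OF a_tabs k(1,2)] k(3) by simp
  have "{l \<in> {1..k}. blk l = blk k} = (\<lambda>b. a (i, b, c)) ` {1..j}"
  proof (intro Set.set_eqI iffI)
    fix l assume "l \<in> {l \<in> {1..k}. blk l = blk k}"
    then have l: "1 \<le> l" "l \<le> k" "l \<le> n" "blk l = blk k" using k(2) by auto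
    obtain i' b c' where x: "nd a l = (i', b, c')" by (metis prod_cases3)
    have "i' = i" "c' = c" using blk_eq_iff[OF l(1,3) k(1,2)] l(4) row_start[OF x] row_start[OF k(3)] by simp_all
    then have x: "nd a l = (i, b, c)" using x by simp
    have "\<not> rd_less (nd a k) (nd a l)" using a_le_iff[OF nd_a_D[OF l(1,3)] nd_a_D[OF k(1,2)]] l(2)
      unfolding nd_entry[OF a_tabs l(1,3)] nd_entry[OF a_tabs k(1,2)] by simp
    then have "b \<le> j" using x k(3) by simp
    moreover have "1 \<le> b" using nd_a_D[OF l(1,3)] x by simp
    moreover have "l = a (i, b, c)" using a_tabs l x by (metis nd_entry)
    ultimately show "l \<in> (\<lambda>b. a (i, b, c)) ` {1..j}" by simp
  next
    fix l assume "l \<in> (\<lambda>b. a (i, b, c)) ` {1..j}"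
    then obtain b where b: "1 \<le> b" "b \<le> j" "l = a (i, b, c)" by auto
    have bD: "(i, b, c) \<in> D" using kD b by simp
    then have "(i, b, c) \<in> supp a" using supp_a by simp
    then have l0: "l \<noteq> 0" using b(3) by (simp add: supp_def)
    have x: "nd a l = (i, b, c)" using nd_eq[OF a_tabs b(3)[symmetric] l0] .
    have "l \<le> a (nd a k)" unfolding b(3) using a_le_iff[OF bD nd_a_D[OF k(1,2)]] b(2) k(3) by simp
    then have l: "1 \<le> l" "l \<le> k" using l0 unfolding k(3) ak by simp_all
    then show "l \<in> {l \<in> {1..k}. blk l = blk k}"
      using blk_eq_iff[of l k] k row_start[OF x] row_start[OF k(3)] by simp
  qed
  moreover have "inj_on (\<lambda>b. a (i, b, c)) {1..j}"
  proof (rule inj_onI)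
    fix b b' assume b: "b \<in> {1..j}" "b' \<in> {1..j}" "a (i, b, c) = a (i, b', c)"
    have "(i, b, c) \<in> supp a" using kD b(1) supp_a by simp
    then show "b = b'" using tabs_eqD[OF a_tabs b(3)] by (simp add: supp_def)
  qed
  ultimately show ?thesis by (simp add: card_image)
qed

lemma poincare_qfact: "(\<Sum>w\<in>block_perms n blk. q ^ inv_count n w) = qfact_mpart ell q lam"
proof -
  have "(\<Sum>w\<in>block_perms n blk. q ^ inv_count n w) = (\<Prod>k=1..n. qint q (card {l\<in>{1..k}. blk l = blk k}))"
    by (rule poincare_block_perms[OF blk_mono])
  also have "\<dots> = (\<Prod>k=1..n. qint q (fst (snd (nd a k))))"
  proof (rule prod.cong[OF refl])
    fix k assume k: "k \<in> {1..n}"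
    obtain i j c where x: "nd a k = (i, j, c)" by (metis prod_cases3)
    show "qint q (card {l\<in>{1..k}. blk l = blk k}) = qint q (fst (snd (nd a k)))"
      using card_block[of k i j c] k x by simp
  qed
  also have "\<dots> = (\<Prod>x\<in>D. qint q (fst (snd x)))"
  proof (rule prod.reindex_bij_betw)
    show "bij_betw (nd a) {1..n} D"
    proof (rule bij_betwI[where g = a])
      show "nd a \<in> {1..n} \<rightarrow> D" using nd_a_D by auto
      show "a \<in> D \<rightarrow> {1..n}" using bij_betw_imp_funcset[OF tabs_bij[OF a_tabs]] supp_a by simp
      show "a (nd a k) = k" if "k \<in> {1..n}" for k using a_tabs that by simp
      show "nd a (a x) = x" if "x \<in> D" for x
      proof (rule nd_eq[OF a_tabs refl])
        have "x \<in> supp a" using that unfolding supp_a .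
        then show "a x \<noteq> 0" by (simp add: supp_def)
      qed
    qed
  qed
  also have "\<dots> = (\<Prod>(c, i, j)\<in>(SIGMA c:{1..ell}. SIGMA i:{i. lam c i \<noteq> 0}. {1..lam c i}). qint q j)"
  proof (rule prod.reindex_bij_witness[where i = "\<lambda>(c, i, j). (i, j, c)" and j = "\<lambda>(i, j, c). (c, i, j)"])
    fix p assume p: "p \<in> (SIGMA c:{1..ell}. SIGMA i:{i. lam c i \<noteq> 0}. {1..lam c i})"
    obtain c i j where e: "p = (c, i, j)" by (metis prod_cases3)
    have "lam c 0 = 0" using p multipartitionsD(1)[OF lam, of c] by (auto simp: e is_partition_def)
    then have "i \<noteq> 0" using p e by (cases i) auto
    then show "(\<lambda>(c, i, j). (i, j, c)) p \<in> D" using p e by simp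
  qed auto
  also have "\<dots> = (\<Prod>c=1..ell. \<Prod>(i, j)\<in>(SIGMA i:{i. lam c i \<noteq> 0}. {1..lam c i}). qint q j)"
  proof -
    have fin: "finite (SIGMA i:{i. lam c i \<noteq> 0}. {1..lam c i})" if "c \<in> {1..ell}" for c
      using multipartitionsD(1)[OF lam, of c] that by (simp add: is_partition_def)
    show ?thesis by (subst prod.Sigma) (use fin in auto)
  qed
  also have "\<dots> = (\<Prod>c=1..ell. \<Prod>i | lam c i \<noteq> 0. qfact q (lam c i))"
  proof (rule prod.cong[OF refl])
    fix c assume c: "c \<in> {1..ell}"
    have fin: "finite {i. lam c i \<noteq> 0}" using multipartitionsD(1)[OF lam, of c] c by (simp add: is_partition_def)
    show "(\<Prod>(i, j)\<in>(SIGMA i:{i. lam c i \<noteq> 0}. {1..lam c i}). qint q j) = (\<Prod>i | lam c i \<noteq> 0. qfact q (lam c i))"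
      unfolding qfact_def by (subst prod.Sigma) (use fin in auto)
  qed
  finally show ?thesis by (simp add: qfact_mpart_def)
qed

lemma F_a_sym_U: "F a * (sym blk * (U * v)) = sc top_gamma * (F a * v)"
proof -
  have FT: "F a * T i = sc q * F a" if "1 \<le> i" "i < n" "blk i = blk (Suc i)" for i
    using F_a_T[OF that, of 1] by simp
  have "F a * sym blk = (\<Sum>w\<in>block_perms n blk. sc (q ^ inv_count n w) * F a)"
    unfolding sym_def sum_distrib_left
    by (rule sum.cong[OF refl], rule right_eigen_T_of[OF _ blk_mono FT])
  also have "\<dots> = sc (qfact_mpart ell q lam) * F a"
    by (simp add: poincare_qfact[symmetric] sc_sum sum_distrib_right)
  finally have "F a * (sym blk * (U * v)) = sc (qfact_mpart ell q lam) * (F a * (U * v))"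
    by (simp add: mult.assoc[symmetric])
  then show ?thesis by (simp add: F_U[OF a_tabs] top_gamma_def)
qed

text \<open>Apart from the initial tableau, no standard tableau of shape \<open>\<lambda>\<close> survives under \<open>m\<^sub>\<lambda>\<close>. Take one
  whose first disagreement with the initial tableau comes earliest. It cannot be in a later
  component, because of \<open>U\<close>. So the entry \<open>k\<close> starts the next row too early. Exchanging it with
  \<open>k - 1\<close>, an entry of the same block, leads to an earlier disagreement, or is impossible because
  \<open>k\<close> lies just below \<open>k - 1\<close>, where \<open>T\<^sub>k\<^sub>-\<^sub>1\<close> acts by \<open>-1\<close> but has to act by \<open>q\<close>.\<close>
lemma F_sym_U_0:
  assumes "y \<in> tabs ell n" "supp y = D" "y \<noteq> a"
  shows "F y * (sym blk * (U * v)) = 0"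
proof (rule ccontr)
  assume nz: "F y * (sym blk * (U * v)) \<noteq> 0"
  have symU: "sym blk * U = U * sym blk"
    unfolding sym_def sum_distrib_left sum_distrib_right
    by (rule sum.cong[OF refl], rule comm_T_of[OF _ blk_mono U_comm_T, symmetric])
  define v' where "v' = sym blk * (U * v)"
  have v'U: "v' = U * (sym blk * v)" unfolding v'_def by (simp add: mult.assoc[symmetric] symU)
  have Tv': "T i * v' = sc q * v'" if "1 \<le> i" "i < n" "blk i = blk (Suc i)" for i
    using T_sym[OF that] unfolding v'_def by (simp add: mult.assoc[symmetric])
  define P where "P y k \<longleftrightarrow> y \<in> tabs ell n \<and> supp y = D \<and> F y * v' \<noteq> 0 \<and> 1 \<le> k \<and> k \<le> n \<and> nd y k \<noteq> nd a k" for y k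
  have "\<exists>k. P y k"
  proof (rule ccontr)
    assume "\<not> (\<exists>k. P y k)"
    then have "\<And>k. 1 \<le> k \<Longrightarrow> k \<le> n \<Longrightarrow> nd y k = nd a k" using assms nz unfolding P_def v'_def by blast
    then show False using tabs_eqI[OF assms(1) a_tabs] assms(3) by blast
  qed
  then have ex: "\<exists>k. \<exists>y. P y k" by blast
  define k where "k = (LEAST k. \<exists>y. P y k)"
  obtain y where Py: "P y k" using LeastI_ex[OF ex] unfolding k_def by blast
  have least: "\<not> P y' m" if "m < k" for y' m using not_less_Least[of m "\<lambda>k. \<exists>y. P y k"] that unfolding k_def by blast
  have y: "y \<in> tabs ell n" "supp y = D" "F y * v' \<noteq> 0" and k: "1 \<le> k" "k \<le> n" and ne: "nd y k \<noteq> nd a k"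
    using Py unfolding P_def by blast+
  have agree: "nd y m = nd a m" if "1 \<le> m" "m < k" for m
    using least[OF that(2), of y] y k that unfolding P_def by auto
  let ?x = "nd a k" and ?z = "nd y k"
  have xD: "?x \<in> D" using nd_a_D[OF k] .
  have zD: "?z \<in> D" using nd_supp[OF y(1) k] y(2) by simp
  have before: "y w < k" if w: "w \<in> D" "rd_less w ?x" for w
  proof -
    have "a w < k" using a_less[OF w(1) xD] w(2) a_tabs k by simp
    moreover have "a w \<noteq> 0" using w(1) supp_a by (auto simp: supp_def)
    ultimately have "nd y (a w) = w" "1 \<le> a w" using agree[of "a w"] nd_eq[OF a_tabs refl, of w] by simp_all
    then have "y w = a w" using nd_entry[OF y(1), of "a w"] \<open>a w < k\<close> k by simp
    then show ?thesis using \<open>a w < k\<close> by simp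
  qed
  have after: "rd_less w ?x" if w: "w \<in> D" "nw_le w ?z" "w \<noteq> ?z" for w
  proof -
    have yz: "y ?z = k" using y(1) k by simp
    have "y w \<le> k" using tabs_mono[OF y(1), of w ?z] w y(2) zD yz by simp
    moreover have "y w \<noteq> 0" using w(1) y(2) by (auto simp: supp_def)
    moreover have "y w \<noteq> k" using nd_eq[OF y(1), of w k] w(3) k by auto
    ultimately have wk: "1 \<le> y w" "y w < k" by simp_all
    then have "nd a (y w) = w" using agree[of "y w"] nd_eq[OF y(1) refl, of w] by simp
    then have "a w = y w" using nd_entry[OF a_tabs, of "y w"] wk k by simp
    then show ?thesis using a_less[OF w(1) xD] wk a_tabs k by simp
  qed
  have xz: "rd_less ?x ?z"
  proof -
    have "\<not> rd_less ?z ?x" using before[OF zD] y(1) k by auto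
    then show ?thesis using rd_less_total[OF ne] by blast
  qed
  obtain r j c where x: "?x = (r, j, c)" by (metis prod_cases3)
  obtain r' j' c' where z: "?z = (r', j', c')" by (metis prod_cases3)
  have bx: "1 \<le> r" "1 \<le> j" "1 \<le> c" "c \<le> ell" "j \<le> lam c r" using xD unfolding x by simp_all
  have bz: "1 \<le> r'" "1 \<le> j'" "1 \<le> c'" "c' \<le> ell" "j' \<le> lam c' r'" using zD unfolding z by simp_all
  have zdown: "(i1, j1, c') \<in> D" if "1 \<le> i1" "i1 \<le> r'" "1 \<le> j1" "j1 \<le> j'" for i1 j1
    using youngD[OF young_D zD, of "(i1, j1, c')"] that bz unfolding z by simp
  have cc: "c' = c"
  proof (rule ccontr)
    assume "c' \<noteq> c"
    then have c: "c < c'" using xz unfolding x z by simp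
    have "(1, 1, c') = ?z"
    proof (rule ccontr)
      assume n: "(1, 1, c') \<noteq> ?z"
      have "rd_less (1, 1, c') ?x" by (rule after) (use zdown[of 1 1] bz n in \<open>auto simp: z\<close>)
      then show False using c unfolding x by simp
    qed
    then have "res_at y k = Q c'" by (simp add: node_res_def flip: \<open>(1, 1, c') = ?z\<close>)
    moreover have "k \<le> below c'" using a_le_below[OF xD, of c'] c bz unfolding nd_entry[OF a_tabs k] unfolding x by simp
    moreover have "2 \<le> c'" using c bx by simp
    ultimately have "U_val y = 0"
      unfolding U_val_def using k bz
      by (intro prod_zero[OF finite_atLeastAtMost] bexI[of _ c'] prod_zero[OF finite_atLeastAtMost] bexI[of _ k]) auto
    then have "F y * v' = 0" unfolding v'U using F_U[OF y(1)] by simp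
    then show False using y(3) by simp
  qed
  have rr: "r < r'"
  proof (rule ccontr)
    assume "\<not> r < r'"
    then have "r' = r" "j < j'" using xz cc unfolding x z by auto
    then have "rd_less ?x ?x" by (intro after[OF xD]) (simp_all add: x z cc)
    then show False by simp
  qed
  have r': "r' = Suc r"
  proof (rule ccontr)
    assume n: "r' \<noteq> Suc r"
    have "rd_less (Suc r, j', c') ?x" by (rule after) (use zdown[of "Suc r" j'] rr n bz in \<open>auto simp: z\<close>)
    then show False unfolding x using cc by simp
  qed
  have j': "j' = 1"
  proof (rule ccontr)
    assume n: "j' \<noteq> 1"
    have "rd_less (Suc r, 1, c') ?x" by (rule after) (use zdown[of "Suc r" 1] r' n bz in \<open>auto simp: z\<close>)
    then show False unfolding x using cc by simp
  qed
  have "rd_less (r, 1, c') ?x" by (rule after) (use zdown[of r 1] r' bx bz in \<open>auto simp: z\<close>)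
  then have j2: "2 \<le> j" unfolding x using cc by simp
  let ?w = "(r, j - 1, c)"
  have wD: "?w \<in> D" using xD j2 unfolding x in_diagram by arith
  have aw: "a ?w = k - 1"
  proof -
    have "rd_less ?w ?x" using j2 unfolding x by simp
    then have "a ?w < k" using a_less[OF wD xD] a_tabs k by simp
    moreover have "\<not> a ?w < k - 1"
    proof
      assume lt: "a ?w < k - 1"
      have k1: "1 \<le> k - 1" "k - 1 \<le> n" using lt k by auto
      obtain r1 j1 c1 where u: "nd a (k - 1) = (r1, j1, c1)" by (metis prod_cases3)
      have "rd_less ?w (nd a (k - 1))" "rd_less (nd a (k - 1)) ?x"
        using a_less[OF wD nd_a_D[OF k1]] a_less[OF nd_a_D[OF k1] xD] lt k1 k a_tabs by simp_all
      then show False unfolding u x by auto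
    qed
    ultimately show ?thesis by simp
  qed
  have "?w \<in> supp a" using wD supp_a by simp
  then have k2: "1 \<le> k - 1" using aw by (simp add: supp_def)
  define i where "i = k - 1"
  have i: "1 \<le> i" "i < n" "Suc i = k" using k2 k by (simp_all add: i_def)
  have ndi: "nd a i = ?w" using nd_eq[OF a_tabs, of ?w i] aw i by (simp add: i_def)
  then have ndy: "nd y i = ?w" using agree[of i] i by simp
  have bi: "blk i = blk (Suc i)" using blk_eq_iff[of i "Suc i"] i row_start[OF ndi] row_start[OF x] by simp
  have TF: "F y * (T i * v') = sc q * (F y * v')" using Tv'[OF i(1,2) bi] by simp
  have n2: "2 \<le> n" using i by simp
  have z': "?z = (Suc r, 1, c)" using z r' j' cc by simp
  show False
  proof (cases "sperm i \<circ> y \<in> tabs ell n")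
    case False
    then have "nw_le ?w ?z" using swap_tabs[OF y(1) i(1,2)] ndy i(3) by auto
    then have "j - 1 = 1" using z' j2 by simp
    moreover have "q powi (int 1 - int (Suc r)) = inverse q * q powi (int 1 - int r)"
      using power_int_add[of q "int 1 - int r" "- 1"] q0 by (simp add: power_int_minus mult.commute)
    ultimately have "res_at y (Suc i) = inverse q * res_at y i"
      using ndy z' i(3) by (simp add: node_res_def)
    then have "dg i y = -1" using diag_adjacent(2)[OF res_at_0[OF n2 y(1) i(1)]] i(2) by simp
    then have "sc (q + 1) * (F y * v') = 0"
      using F_T_fix[OF y(1) i(1,2) False, of v'] TF by (simp add: sc_add sc_minus distrib_right)
    moreover have "q + 1 \<noteq> 0"
    proof
      assume "q + 1 = 0"
      then have "q = -1" by (simp add: eq_neg_iff_add_eq_0)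
      then show False using q_pow[of 2] n2 by simp
    qed
    ultimately show False using y(3) by simp
  next
    case True
    let ?y2 = "sperm i \<circ> y"
    have "nd ?y2 i \<noteq> nd a i"
      using swap_nd[OF y(1) i(1,2) True, of i] i ndi z' by simp
    then have F2: "F ?y2 * v' = 0"
      using least[of i ?y2] True swap_supp[OF y(1) i(1,2)] y(2) i unfolding P_def by auto
    have "F y * (T i * (F u * v')) = (if u = y then sc (dg i y) * (F y * v') else 0)" if u: "u \<in> tabs ell n" for u
    proof -
      consider "u = y" | "u \<noteq> y" "u = ?y2" | "u \<noteq> y" "u \<noteq> ?y2" by blast
      then show ?thesis
      proof cases
        case 1 show ?thesis unfolding 1 using F_T_F[OF y(1) y(1) i(1,2), of v'] by simp
      next
        case 2 show ?thesis unfolding if_not_P[OF 2(1)] unfolding 2(2) F2 by simp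
      next
        case 3
        then have "y \<noteq> sperm i \<circ> u" by auto
        then show ?thesis using F_T_F[OF u y(1) i(1,2), of v'] 3(1) by auto
      qed
    qed
    then have "(\<Sum>u\<in>tabs ell n. F y * (T i * (F u * v'))) = (\<Sum>u\<in>tabs ell n. if u = y then sc (dg i y) * (F y * v') else 0)"
      by (intro sum.cong) auto
    also have "\<dots> = sc (dg i y) * (F y * v')" using y(1) finite_tabs by simp
    finally have "F y * (T i * v') = sc (dg i y) * (F y * v')" by (simp add: F_sum_v flip: sum_distrib_left)
    then have "sc (q - dg i y) * (F y * v') = 0" using TF by (simp add: sc_diff left_diff_distrib)
    then have "dg i y = q" using y(3) by simp
    then have "(q - 1) * res_at y (Suc i) = q * (res_at y (Suc i) - res_at y i)"
      using res_at_neighbours(1)[OF y(1) i(1,2) order_refl] by (simp add: diag_def divide_eq_eq)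
    then have "res_at y (Suc i) = q * res_at y i" by (simp add: algebra_simps)
    then show False using res_at_neighbours(2)[OF y(1) i(1,2) order_refl True] by blast
  qed
qed

text \<open>Insert the sum of all \<open>F\<^sub>y\<close> to the left of \<open>m\<^sub>\<lambda>\<close>. Tableaux of other shapes vanish because \<open>T\<^sub>w\<close>
  preserves shapes, those of the same shape by \<open>F_sym_U_0\<close>, and on the initial one \<open>m\<^sub>\<lambda>\<close> is a scalar.\<close>
theorem seminormal_Psi:
  assumes s: "s \<in> tabs ell n" "supp s = D" and t: "t \<in> tabs ell n" "supp t = D"
  shows "F s * (T_of (dp n s a) * (sym blk * (U * (T_of (dp n a t) * F t)))) = sc top_gamma * (Psi s a * Psi a t)"
proof -
  let ?v = "T_of (dp n a t) * F t"
  let ?m = "sym blk * (U * ?v)"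
  have "F s * (T_of (dp n s a) * (F y * ?m)) = (if y = a then F s * (T_of (dp n s a) * (F a * ?m)) else 0)" if y: "y \<in> tabs ell n" for y
  proof (cases "supp y = D")
    case True
    then show ?thesis using F_sym_U_0[OF y True] by auto
  next
    case False
    then show ?thesis
      using F_T_of_F_0[OF s(1) y dp_permutes[OF s(1) a_tabs]] s(2) supp_a by auto
  qed
  then have "(\<Sum>y\<in>tabs ell n. F s * (T_of (dp n s a) * (F y * ?m))) =
      (\<Sum>y\<in>tabs ell n. if y = a then F s * (T_of (dp n s a) * (F a * ?m)) else 0)"
    by (intro sum.cong) auto
  also have "\<dots> = F s * (T_of (dp n s a) * (F a * ?m))" using a_tabs finite_tabs by simp
  finally have "F s * (T_of (dp n s a) * ?m) = F s * (T_of (dp n s a) * (F a * ?m))"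
    by (simp add: F_sum_v flip: sum_distrib_left)
  also have "\<dots> = sc top_gamma * (F s * (T_of (dp n s a) * (F a * ?v)))"
    by (simp add: F_a_sym_U scal_comm_v)
  also have "F s * (T_of (dp n s a) * (F a * ?v)) = Psi s a * Psi a t"
    using F_F[OF a_tabs a_tabs] by (simp add: Psi_def mult.assoc)
  finally show ?thesis .
qed

end

section \<open>The gamma coefficients\<close>

lemma card_insert_filter:
  assumes "finite E" "y \<notin> E"
  shows "card {x \<in> insert y E. P x} = card {x \<in> E. P x} + (if P y then 1 else 0)"
proof (cases "P y")
  case True
  then have "{x \<in> insert y E. P x} = insert y {x \<in> E. P x}" by auto
  then show ?thesis using assms True by simp
next
  case False
  then have "{x \<in> insert y E. P x} = {x \<in> E. P x}" by auto
  then show ?thesis using False by simp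
qed

lemma subshape_eq: "subshape t k = shape_of {x. 1 \<le> t x \<and> t x \<le> k}"
  by (simp add: subshape_def shape_of_def)

lemma dominates_iff_card:
  assumes "young ell A" "young ell B"
  shows "dominates ell (shape_of A) (shape_of B) \<longleftrightarrow>
    (\<forall>c\<in>{1..ell}. \<forall>r\<ge>1. card {x \<in> B. upto_row c r x} \<le> card {x \<in> A. upto_row c r x})"
proof -
  have "card {x \<in> S. upto_row c r x} = (\<Sum>b=1..<c. psize (shape_of S b)) + (\<Sum>i=1..r. shape_of S c i)"
    if "young ell S" "c \<in> {1..ell}" for S c r
    using card_upto_row[OF shape_of_young(2)[OF that(1)], of c r] that(2) unfolding shape_of_young(1)[OF that(1)] by simp
  then show ?thesis using assms unfolding dominates_def by auto
qed

text \<open>Interchanging \<open>i\<close> and \<open>i + 1\<close> changes only the shape at step \<open>i\<close>, by moving one node. This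
  raises the shape exactly when the node moves up in the row reading order.\<close>
lemma swap_dominates_iff:
  assumes t: "t \<in> tabs ell n" and i: "1 \<le> i" "i < n" and s: "sperm i \<circ> t \<in> tabs ell n"
  shows "tab_strictly_dominates ell n (sperm i \<circ> t) t \<longleftrightarrow> rd_less (nd t (Suc i)) (nd t i)"
proof -
  let ?s = "sperm i \<circ> t" and ?x = "nd t (Suc i)" and ?y = "nd t i"
  let ?S = "\<lambda>u k. {x. 1 \<le> u x \<and> u x \<le> k}"
  have other: "?S ?s k = ?S t k" if "k \<noteq> i" for k
  proof (rule Set.set_eqI)
    fix x
    have "1 \<le> sperm i (t x) \<and> sperm i (t x) \<le> k \<longleftrightarrow> 1 \<le> t x \<and> t x \<le> k"
      using that i by (cases "t x = i"; cases "t x = Suc i") auto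
    then show "x \<in> ?S ?s k \<longleftrightarrow> x \<in> ?S t k" by simp
  qed
  have ent: "t ?y = i" "t ?x = Suc i" "?s ?x = i" "?s ?y = Suc i" using t i by simp_all
  define E where "E = ?S t (i - 1)"
  have St: "?S t i = insert ?y E"
  proof (rule Set.set_eqI)
    fix w
    have "w = ?y" if "t w = i" using nd_eq[OF t that] i by simp
    then show "w \<in> ?S t i \<longleftrightarrow> w \<in> insert ?y E" using ent i unfolding E_def by (cases "t w = i") auto
  qed
  have Ss: "?S ?s i = insert ?x E"
  proof (rule Set.set_eqI)
    fix w
    have w: "w = ?x" if "t w = Suc i" using nd_eq[OF t that] i by simp
    consider "t w = i" | "t w = Suc i" | "t w \<noteq> i" "t w \<noteq> Suc i" by blast
    then show "w \<in> ?S ?s i \<longleftrightarrow> w \<in> insert ?x E"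
    proof cases
      case 1
      then have "w \<noteq> ?x" using ent by auto
      then show ?thesis using 1 i by (simp add: E_def)
    next
      case 2
      then show ?thesis using w i ent by (simp add: E_def)
    next
      case 3
      then have "w \<noteq> ?x" using ent by auto
      then show ?thesis using 3 by (simp add: E_def) arith
    qed
  qed
  have nE: "?x \<notin> E" "?y \<notin> E" using ent i by (simp_all add: E_def)
  have young_S: "young ell (?S u k)" if "u \<in> tabs ell n" "k \<le> n" for u k
    using tabs_young[OF restrict_tab_tabs(1)[OF that]] restrict_tab_tabs(2)[OF that] by simp
  have fE: "finite E" unfolding E_def by (rule young_finite[OF young_S[OF t]]) (use i in simp)
  have ne: "?s \<noteq> t"
  proof
    assume "?s = t"
    then have "?s ?x = t ?x" by simp
    then show False unfolding ent by simp
  qed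
  have dk: "dominates ell (subshape ?s k) (subshape t k)" if "k \<noteq> i" for k
    unfolding subshape_eq other[OF that] by (simp add: dominates_def)
  have "tab_strictly_dominates ell n ?s t \<longleftrightarrow> dominates ell (subshape ?s i) (subshape t i)"
  proof
    assume "tab_strictly_dominates ell n ?s t"
    then show "dominates ell (subshape ?s i) (subshape t i)"
      using i unfolding tab_strictly_dominates_def tab_dominates_def by simp
  next
    assume d: "dominates ell (subshape ?s i) (subshape t i)"
    have "dominates ell (subshape ?s k) (subshape t k)" for k using d dk[of k] by (cases "k = i") simp_all
    then show "tab_strictly_dominates ell n ?s t"
      using ne unfolding tab_strictly_dominates_def tab_dominates_def by simp
  qed
  also have "\<dots> \<longleftrightarrow> (\<forall>c\<in>{1..ell}. \<forall>r\<ge>1. card {x \<in> ?S t i. upto_row c r x} \<le> card {x \<in> ?S ?s i. upto_row c r x})"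
    unfolding subshape_eq
    by (rule dominates_iff_card[OF young_S[OF s] young_S[OF t]]) (use i in simp_all)
  also have "\<dots> \<longleftrightarrow> (\<forall>c\<in>{1..ell}. \<forall>r\<ge>1. upto_row c r ?y \<longrightarrow> upto_row c r ?x)"
    unfolding St Ss card_insert_filter[OF fE nE(1)] card_insert_filter[OF fE nE(2)] by auto
  also have "\<dots> \<longleftrightarrow> rd_less ?x ?y"
  proof -
    obtain r1 j1 c1 where x: "?x = (r1, j1, c1)" by (metis prod_cases3)
    obtain r2 j2 c2 where y: "?y = (r2, j2, c2)" by (metis prod_cases3)
    have "?y \<in> nodes ell" using nd_supp[OF t, of i] young_nodes[OF tabs_young[OF t]] i by auto
    then have b: "1 \<le> c2" "c2 \<le> ell" "1 \<le> r2" unfolding y by simp_all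
    have n1: "\<not> (c2 = c1 \<and> r2 \<le> r1 \<and> j2 \<le> j1)" using swap_tabsD[OF t i s] unfolding x y by simp
    have "nd ?s i = ?x" "nd ?s (Suc i) = ?y" using swap_nd[OF t i s] i by simp_all
    then have n2: "\<not> (c1 = c2 \<and> r1 \<le> r2 \<and> j1 \<le> j2)" using swap_tabsD[OF s i] t unfolding x y by simp
    show ?thesis
    proof
      assume "\<forall>c\<in>{1..ell}. \<forall>r\<ge>1. upto_row c r ?y \<longrightarrow> upto_row c r ?x"
      then have "upto_row c2 r2 ?y \<longrightarrow> upto_row c2 r2 ?x" using b by simp
      then have "c1 < c2 \<or> c1 = c2 \<and> r1 \<le> r2" unfolding x y by simp
      then show "rd_less ?x ?y" unfolding x y using n1 n2 by auto
    next
      assume "rd_less ?x ?y"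
      then have "c1 < c2 \<or> c1 = c2 \<and> r1 \<le> r2" unfolding x y by auto
      then show "\<forall>c\<in>{1..ell}. \<forall>r\<ge>1. upto_row c r ?y \<longrightarrow> upto_row c r ?x" unfolding x y by auto
    qed
  qed
  finally show ?thesis .
qed

context shaped
begin

lemma qint_ne_0: "1 \<le> b \<Longrightarrow> b \<le> n \<Longrightarrow> qint q b \<noteq> 0"
  using power_diff_1_eq[of q b] q_pow[of b] by (auto simp: qint_def)

lemma res_a_ne_Q:
  assumes k: "1 \<le> k" "k \<le> below r" and r: "r \<le> ell"
  shows "res_at a k \<noteq> Q r"
proof -
  have kn: "k \<le> n" using k below_le[of r] r by simp
  obtain i j c where x: "nd a k = (i, j, c)" by (metis prod_cases3)
  have xD: "nd a k \<in> D" using nd_a_D[OF k(1) kn] .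
  have "a (nd a k) \<le> below r" using k unfolding nd_entry[OF a_tabs k(1) kn] by simp
  then have c: "c < r" using a_le_below[OF xD, of r] r unfolding x by simp
  have k1: "k - 1 < n" "Suc (k - 1) = k" "k - 1 \<le> n" using k kn by simp_all
  have R: "restrict_tab a (k - 1) \<in> tabs ell (k - 1)" using restrict_tab_tabs(1)[OF a_tabs k1(3)] .
  have "nd a k \<in> addable ell (supp (restrict_tab a (k - 1)))"
    using restrict_tab_addable[OF a_tabs k1(1)] k1(2) by simp
  note abs_content_le_card[OF tabs_young[OF R] this]
  also have "int (card {z \<in> supp (restrict_tab a (k - 1)). comp_of z = comp_of (nd a k)}) \<le> int (card (supp (restrict_tab a (k - 1))))"
    using young_finite[OF tabs_young[OF R]] by (intro of_nat_mono card_mono) auto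
  finally have "\<bar>content (nd a k)\<bar> < int n" using tabs_card[OF R] k1 by simp
  then have "q powi content (nd a k) * Q c \<noteq> Q r" using xD c r unfolding x by (intro Q_sep) simp_all
  then show ?thesis by (simp add: node_res_def x)
qed

lemma top_gamma_0: "top_gamma \<noteq> 0"
proof -
  have "qint q (card {l\<in>{1..k}. blk l = blk k}) \<noteq> 0" if "k \<in> {1..n}" for k
  proof (rule qint_ne_0)
    have "card {k} \<le> card {l\<in>{1..k}. blk l = blk k}" by (rule card_mono) (use that in auto)
    then show "1 \<le> card {l\<in>{1..k}. blk l = blk k}" by simp
    have "card {l\<in>{1..k}. blk l = blk k} \<le> card {1..k}" by (rule card_mono) auto
    then show "card {l\<in>{1..k}. blk l = blk k} \<le> n" using that by simp
  qed
  then have "(\<Prod>k=1..n. qint q (card {l\<in>{1..k}. blk l = blk k})) \<noteq> 0" by simp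
  moreover have "(\<Sum>w\<in>block_perms n blk. q ^ inv_count n w) = (\<Prod>k=1..n. qint q (card {l\<in>{1..k}. blk l = blk k}))"
    by (rule poincare_block_perms) (rule blk_mono)
  ultimately have "qfact_mpart ell q lam \<noteq> 0" using poincare_qfact by simp
  moreover have "U_val a \<noteq> 0" unfolding U_val_def using res_a_ne_Q by simp
  ultimately show ?thesis by (simp add: top_gamma_def)
qed

lemma U_val_a:
  "U_val a = (\<Prod>(s, t)\<in>{(s, t). 1 \<le> s \<and> s < t \<and> t \<le> ell}.
     \<Prod>(i, j)\<in>{(i, j). 1 \<le> i \<and> 1 \<le> j \<and> j \<le> lam s i}. q powi (int j - int i) * Q s - Q t)"
proof -
  let ?R = "\<lambda>s. {(i, j). 1 \<le> i \<and> 1 \<le> j \<and> j \<le> lam s i}"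
  let ?g = "\<lambda>s r. \<Prod>(i, j)\<in>?R s. q powi (int j - int i) * Q s - Q r"
  have inner: "(\<Prod>k=1..below r. res_at a k - Q r) = (\<Prod>s=1..<r. ?g s r)" if r: "r \<in> {2..ell}" for r
  proof -
    have r': "r \<le> Suc ell" using r by simp
    have "(\<Prod>k=1..below r. res_at a k - Q r) = (\<Prod>x\<in>{x \<in> D. comp_of x < r}. nres x - Q r)"
    proof (rule prod.reindex_bij_betw[where h = "nd a" and g = "\<lambda>x. nres x - Q r"])
      show "bij_betw (nd a) {1..below r} {x \<in> D. comp_of x < r}"
      proof (rule bij_betwI[where g = a])
        have kn: "1 \<le> k \<and> k \<le> n" if "k \<in> {1..below r}" for k using that below_le[OF r'] by simp
        show "nd a \<in> {1..below r} \<rightarrow> {x \<in> D. comp_of x < r}"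
        proof
          fix k assume k: "k \<in> {1..below r}"
          have xD: "nd a k \<in> D" using nd_a_D kn[OF k] by blast
          have "a (nd a k) \<le> below r" using nd_entry[OF a_tabs, of k] kn[OF k] k by simp
          then show "nd a k \<in> {x \<in> D. comp_of x < r}" using a_le_below[OF xD r'] xD by blast
        qed
        have nz: "a x \<noteq> 0" if "x \<in> D" for x
        proof -
          have "x \<in> supp a" using that unfolding supp_a .
          then show ?thesis by (simp add: supp_def)
        qed
        show "a \<in> {x \<in> D. comp_of x < r} \<rightarrow> {1..below r}"
        proof
          fix x assume "x \<in> {x \<in> D. comp_of x < r}"
          then have x: "x \<in> D" "comp_of x < r" by simp_all
          then show "a x \<in> {1..below r}" using a_le_below[OF x(1) r'] nz[OF x(1)] by simp
        qed
        show "a (nd a k) = k" if "k \<in> {1..below r}" for k using nd_entry[OF a_tabs, of k] kn[OF that] by simp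
        show "nd a (a x) = x" if "x \<in> {x \<in> D. comp_of x < r}" for x
          using nd_eq[OF a_tabs refl nz] that by simp
      qed
    qed
    also have "\<dots> = (\<Prod>(s, i, j)\<in>(SIGMA s:{1..<r}. ?R s). q powi (int j - int i) * Q s - Q r)"
      by (rule prod.reindex_bij_witness[where i = "\<lambda>(s, i, j). (i, j, s)" and j = "\<lambda>(i, j, s). (s, i, j)"])
        (use r in \<open>auto simp: node_res_def\<close>)
    also have "\<dots> = (\<Prod>s=1..<r. ?g s r)"
    proof -
      have "finite (?R s)" if "s \<in> {1..<r}" for s
        using card_rows(1)[OF multipartitionsD(1)[OF lam, of s]] that r by simp
      then show ?thesis by (subst prod.Sigma) auto
    qed
    finally show ?thesis .
  qed
  have "U_val a = (\<Prod>r=2..ell. \<Prod>s=1..<r. ?g s r)" unfolding U_val_def using inner by (rule prod.cong[OF refl])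
  also have "\<dots> = (\<Prod>(r, s)\<in>(SIGMA r:{2..ell}. {1..<r}). ?g s r)" by (rule prod.Sigma) auto
  also have "\<dots> = (\<Prod>(s, r)\<in>{(s, t). 1 \<le> s \<and> s < t \<and> t \<le> ell}. ?g s r)"
    by (rule prod.reindex_bij_witness[where i = "\<lambda>(s, r). (r, s)" and j = "\<lambda>(r, s). (s, r)"]) auto
  finally show ?thesis .
qed

lemma Std_D: "t \<in> Std ell n lam \<longleftrightarrow> t \<in> tabs ell n \<and> supp t = D"
  unfolding Std_eq_tabs[OF lam] by simp

lemma a_Std: "a \<in> Std ell n lam" using a_tabs supp_a by (simp add: Std_D)

lemma descent_iff_dominates:
  assumes t: "t \<in> Std ell n lam" and i: "1 \<le> i" "i < n" and s: "sperm i \<circ> t \<in> tabs ell n"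
  shows "tab_strictly_dominates ell n (sperm i \<circ> t) t \<longleftrightarrow> a (nd t (Suc i)) < a (nd t i)"
proof -
  have tt: "t \<in> tabs ell n" "supp t = D" using t Std_D by simp_all
  have "nd t (Suc i) \<in> D" "nd t i \<in> D" using nd_supp[OF tt(1), of i] nd_supp[OF tt(1), of "Suc i"] tt(2) i by simp_all
  then show ?thesis using swap_dominates_iff[OF tt(1) i s] a_less by simp
qed

lemma swap_ratio:
  assumes t: "t \<in> tabs ell n" and i: "1 \<le> i" "i < n" and s: "sperm i \<circ> t \<in> tabs ell n"
  shows "(q * residue q Q (sperm i \<circ> t) i - residue q Q t i) * (residue q Q (sperm i \<circ> t) i - q * residue q Q t i)
      / (residue q Q (sperm i \<circ> t) i - residue q Q t i)\<^sup>2 = phi (res_at t i) (res_at t (Suc i))"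
    and "phi (res_at t i) (res_at t (Suc i)) \<noteq> 0"
proof -
  have "residue q Q (sperm i \<circ> t) i = res_at t (Suc i)" "residue q Q t i = res_at t i"
    using residue_eq[OF s i(1), of q Q] residue_eq[OF t i(1), of q Q] swap_nd[OF t i s i(1)] i by simp_all
  then show "(q * residue q Q (sperm i \<circ> t) i - residue q Q t i) * (residue q Q (sperm i \<circ> t) i - q * residue q Q t i)
      / (residue q Q (sperm i \<circ> t) i - residue q Q t i)\<^sup>2 = phi (res_at t i) (res_at t (Suc i))"
    unfolding phi_commute[of "res_at t i"] by (simp only: phi_def)
  show "phi (res_at t i) (res_at t (Suc i)) \<noteq> 0"
    using phi_factors[OF t i order_refl s] by (simp add: phi_def)
qed

lemma gam_a_a [simp]: "gam a a = 1" by (simp add: gam_def)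

text \<open>Every standard tableau is linked to the initial one by descents, and along each of them
  condition (b) forces the quotient.\<close>
theorem gamma_coeff_eq:
  assumes t: "t \<in> Std ell n lam"
  shows "gamma_coeff ell n q Q lam t = top_gamma * gam a t"
proof -
  define g where "g t = (if t \<in> Std ell n lam then top_gamma * gam a t else 0)" for t
  have g0: "top_gamma * gam a t \<noteq> 0" if "t \<in> Std ell n lam" for t
    using Psi_Psi_gam[OF a_tabs, of t] that top_gamma_0 supp_a unfolding Std_D by simp
  have sys: "gamma_system ell n q Q lam g"
    unfolding gamma_system_def
  proof (intro conjI ballI impI)
    show "g t \<noteq> 0" if "t \<in> Std ell n lam" for t using g0[OF that] that by (simp add: g_def)
    show "g a = qfact_mpart ell q lam * (\<Prod>(s, t)\<in>{(s, t). 1 \<le> s \<and> s < t \<and> t \<le> ell}.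
          \<Prod>(i, j)\<in>{(i, j). 1 \<le> i \<and> 1 \<le> j \<and> j \<le> lam s i}. q powi (int j - int i) * Q s - Q t)"
      using a_Std by (simp add: g_def top_gamma_def U_val_a)
    fix s t i assume s: "s \<in> Std ell n lam" and t: "t \<in> Std ell n lam" and i: "i \<in> {1..<n}"
      and st: "s = sperm i \<circ> t \<and> tab_strictly_dominates ell n s t"
    have i': "1 \<le> i" "i < n" using i by simp_all
    have tt: "t \<in> tabs ell n" using t Std_D by blast
    have ss: "sperm i \<circ> t \<in> tabs ell n" using s st Std_D by blast
    have lt: "a (nd t (Suc i)) < a (nd t i)" using st descent_iff_dominates[OF t i' ss] by blast
    have "g t = phi (res_at t i) (res_at t (Suc i)) * g s"
      using gam_descent[OF tt i' lt] s t st by (simp add: g_def)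
    moreover have "g s \<noteq> 0" using g0[OF s] s by (simp add: g_def)
    ultimately show "g t / g s = (q * residue q Q s i - residue q Q t i) * (residue q Q s i - q * residue q Q t i)
            / (residue q Q s i - residue q Q t i)\<^sup>2"
      using swap_ratio(1)[OF tt i' ss] st by simp
  qed
  have uniq: "h = g" if h: "gamma_system ell n q Q lam h \<and> (\<forall>t. t \<notin> Std ell n lam \<longrightarrow> h t = 0)" for h
  proof
    have top: "h a = g a" using h sys unfolding gamma_system_def by simp
    have nz: "h t \<noteq> 0" if "t \<in> Std ell n lam" for t using h that unfolding gamma_system_def by simp
    have rat: "h t / h s = (q * residue q Q s i - residue q Q t i) * (residue q Q s i - q * residue q Q t i)
            / (residue q Q s i - residue q Q t i)\<^sup>2"
      if "s \<in> Std ell n lam" "t \<in> Std ell n lam" "i \<in> {1..<n}" "s = sperm i \<circ> t" "tab_strictly_dominates ell n s t" for s t i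
      using h that unfolding gamma_system_def by blast
    have "h t = g t" if "t \<in> Std ell n lam" for t
      using that
    proof (induction "card (Invs a t)" arbitrary: t rule: less_induct)
      case less
      have tt: "t \<in> tabs ell n" "supp t = D" using less.prems Std_D by simp_all
      show ?case
      proof (cases "a = t")
        case False
        have sp: "supp a = supp t" using tt supp_a by simp
        obtain i where i: "1 \<le> i" "i < n" and lt: "a (nd t (Suc i)) < a (nd t i)" and u: "sperm i \<circ> t \<in> tabs ell n"
          and c: "card (Invs a t) = Suc (card (Invs a (sperm i \<circ> t)))"
          by (rule tab_descent[OF tt(1) a_tabs sp False])
        let ?u = "sperm i \<circ> t"
        have us: "?u \<in> Std ell n lam" using u swap_supp[OF tt(1) i] tt(2) by (simp add: Std_D)
        have IH: "h ?u = g ?u" using less.hyps[of ?u] c us by simp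
        have "tab_strictly_dominates ell n ?u t" using lt descent_iff_dominates[OF less.prems i u] by blast
        from rat[OF us less.prems _ refl this] i swap_ratio(1)[OF tt(1) i u]
        have "h t / h ?u = phi (res_at t i) (res_at t (Suc i))" by simp
        then have "h t = phi (res_at t i) (res_at t (Suc i)) * h ?u" using nz[OF us] by (simp add: divide_eq_eq)
        also have "\<dots> = g t" unfolding IH using gam_descent[OF tt(1) i lt] us less.prems by (simp add: g_def)
        finally show ?thesis .
      qed (use top in simp)
    qed
    then show "h t = g t" for t using h by (cases "t \<in> Std ell n lam") (simp_all add: g_def)
  qed
  have "gamma_coeff ell n q Q lam = g"
    unfolding gamma_coeff_def
  proof (rule the_equality)
    show "gamma_system ell n q Q lam g \<and> (\<forall>t. t \<notin> Std ell n lam \<longrightarrow> g t = 0)" using sys by (simp add: g_def)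
  qed (rule uniq)
  then show ?thesis using t by (simp add: g_def)
qed

lemma gam_a_ne_0: "t \<in> tabs ell n \<Longrightarrow> supp t = D \<Longrightarrow> gam a t \<noteq> 0"
  using Psi_Psi_gam[OF a_tabs, of t] supp_a by simp

end

section \<open>The dual parameters\<close>

lemma d_perm_eq:
  assumes "lam \<in> multipartitions ell n" "t \<in> tabs ell n" "supp t = diagram ell lam"
  shows "d_perm ell n lam t = dp n (init_tab ell lam) t" "d'_perm ell n lam t = dp n (final_tab ell lam) t"
proof -
  have i: "init_tab ell lam \<in> tabs ell n" "supp (init_tab ell lam) = supp t"
    using init_tab_tabs[OF assms(1)] supp_init_tab[OF assms(1)] assms(3) by simp_all
  have f: "final_tab ell lam \<in> tabs ell n" "supp (final_tab ell lam) = supp t"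
    using final_tab_tabs[OF assms(1)] supp_final_tab[OF assms(1)] assms(3) by simp_all
  show "d_perm ell n lam t = dp n (init_tab ell lam) t"
    unfolding d_perm_def
  proof (rule the_equality)
    show "dp n (init_tab ell lam) t permutes {1..n} \<and> dp n (init_tab ell lam) t \<circ> init_tab ell lam = t"
      using dp_permutes[OF i(1) assms(2) i(2)] dp_comp[OF i(1) assms(2) i(2)] by (rule conjI)
  qed (elim conjE, rule dp_unique[OF i(1) assms(2) i(2)])
  show "d'_perm ell n lam t = dp n (final_tab ell lam) t"
    unfolding d'_perm_def
  proof (rule the_equality)
    show "dp n (final_tab ell lam) t permutes {1..n} \<and> dp n (final_tab ell lam) t \<circ> final_tab ell lam = t"
      using dp_permutes[OF f(1) assms(2) f(2)] dp_comp[OF f(1) assms(2) f(2)] by (rule conjI)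
  qed (elim conjE, rule dp_unique[OF f(1) assms(2) f(2)])
qed

lemma pinv_dp:
  assumes "s \<in> tabs ell n" "t \<in> tabs ell n" "supp s = supp t"
  shows "pinv (dp n s t) = dp n t s"
proof -
  have "dp n t s \<circ> dp n s t = id" using dp_dp[OF assms(1,2,1,3)] assms(3) dp_self[OF assms(1)] by simp
  then have "dp n t s \<circ> dp n s t \<circ> pinv (dp n s t) = pinv (dp n s t)" by simp
  then show ?thesis unfolding comp_assoc permutes_inv_o(1)[OF dp_permutes[OF assms]] by simp
qed

lemma conj_tab_conj_node: "x \<in> nodes ell \<Longrightarrow> conj_tab ell t (conj_node ell x) = t x"
  using conj_tab_eq[of "conj_node ell x" ell t] conj_node_nodes[of x ell] by simp

lemma dp_conj:
  assumes s: "s \<in> tabs ell n" and t: "t \<in> tabs ell n"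
  shows "dp n (conj_tab ell s) (conj_tab ell t) = dp n s t"
proof
  fix k show "dp n (conj_tab ell s) (conj_tab ell t) k = dp n s t k"
  proof (cases "k \<in> {1..n}")
    case True
    then have k: "1 \<le> k" "k \<le> n" by simp_all
    have "nd s k \<in> nodes ell" using nd_supp[OF s k] young_nodes[OF tabs_young[OF s]] by blast
    then show ?thesis using nd_conj_tab[OF s k] conj_tab_conj_node[of "nd s k" ell t] by (simp add: dp_def)
  next
    case False then show ?thesis unfolding dp_def by (simp only: if_False)
  qed
qed

lemma Invs_conj:
  assumes s: "s \<in> tabs ell n" and t: "t \<in> tabs ell n" and st: "supp s = supp t"
  shows "bij_betw (\<lambda>(x, y). (conj_node ell x, conj_node ell y)) (Invs s t) (Invs (conj_tab ell s) (conj_tab ell t))"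
proof -
  have n: "x \<in> nodes ell" if "x \<in> supp t" for x using that young_nodes[OF tabs_young[OF t]] by blast
  let ?f = "\<lambda>(x, y). (conj_node ell x, conj_node ell y)"
  show ?thesis
  proof (rule bij_betw_imageI)
    show "inj_on ?f (Invs s t)"
    proof (rule inj_onI)
      fix p p' assume p: "p \<in> Invs s t" "p' \<in> Invs s t" "?f p = ?f p'"
      obtain x y where xy: "p = (x, y)" by (cases p)
      obtain x' y' where xy': "p' = (x', y')" by (cases p')
      have "x \<in> nodes ell" "y \<in> nodes ell" "x' \<in> nodes ell" "y' \<in> nodes ell"
        using p n unfolding xy xy' Invs_def by simp_all
      then show "p = p'" using p(3) conj_node_eq_iff unfolding xy xy' by simp
    qed
    show "?f ` Invs s t = Invs (conj_tab ell s) (conj_tab ell t)"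
    proof (rule equalityI; rule subsetI)
      fix p assume "p \<in> ?f ` Invs s t"
      then obtain p' where p': "p = ?f p'" "p' \<in> Invs s t" by (rule imageE)
      obtain x y where "p' = (x, y)" by (cases p')
      with p' have xy: "(x, y) \<in> Invs s t" "p = (conj_node ell x, conj_node ell y)" by simp_all
      then have h: "x \<in> supp t" "y \<in> supp t" "s x < s y" "t y < t x" by (simp_all add: Invs_def)
      show "p \<in> Invs (conj_tab ell s) (conj_tab ell t)"
        using h conj_tab_conj_node[OF n[OF h(1)]] conj_tab_conj_node[OF n[OF h(2)]]
        unfolding xy(2) Invs_def supp_conj_tab[OF t] by simp
    next
      fix p assume p: "p \<in> Invs (conj_tab ell s) (conj_tab ell t)"
      obtain x' y' where e: "p = (x', y')" by (cases p)
      have "x' \<in> conj_node ell ` supp t" "y' \<in> conj_node ell ` supp t"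
        using p unfolding e Invs_def supp_conj_tab[OF t] by simp_all
      then obtain x y where xy: "x \<in> supp t" "y \<in> supp t" "x' = conj_node ell x" "y' = conj_node ell y" by blast
      have "(x, y) \<in> Invs s t"
        using p xy conj_tab_conj_node[OF n[OF xy(1)]] conj_tab_conj_node[OF n[OF xy(2)]]
        unfolding e Invs_def by simp
      then show "p \<in> ?f ` Invs s t" by (rule image_eqI[rotated]) (simp add: e xy)
    qed
  qed
qed

lemma psize_conj:
  assumes lam: "lam \<in> multipartitions ell n" and c: "1 \<le> c" "c \<le> ell"
  shows "psize (conj_mpart ell lam c) = psize (lam (ell + 1 - c))"
proof -
  let ?D = "diagram ell lam"
  have nD: "?D \<subseteq> nodes ell" by (rule young_nodes[OF young_diagram(1)[OF lam]])
  have "psize (conj_mpart ell lam c) = card {x \<in> diagram ell (conj_mpart ell lam). comp_of x = c}"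
    using card_diagram_comp(2)[OF conj_mpart_multipartitions[OF lam] c] by simp
  also have "{x \<in> diagram ell (conj_mpart ell lam). comp_of x = c} = conj_node ell ` {x \<in> ?D. comp_of x = ell + 1 - c}"
  proof -
    have co: "comp_of (conj_node ell x) = c \<longleftrightarrow> comp_of x = ell + 1 - c" if "x \<in> ?D" for x
    proof -
      obtain i j d where x: "x = (i, j, d)" by (metis prod_cases3)
      have "1 \<le> d" "d \<le> ell" using that unfolding x by simp_all
      then show ?thesis using c unfolding x by auto
    qed
    show ?thesis unfolding diagram_conj_mpart[OF lam] using co by blast
  qed
  also have "card \<dots> = card {x \<in> ?D. comp_of x = ell + 1 - c}"
  proof (rule card_image, rule inj_onI)
    fix x y assume xy: "x \<in> {x \<in> ?D. comp_of x = ell + 1 - c}" "y \<in> {x \<in> ?D. comp_of x = ell + 1 - c}"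
      and eq: "conj_node ell x = conj_node ell y"
    have "x \<in> nodes ell" "y \<in> nodes ell" using xy nD by blast+
    then show "x = y" using eq conj_node_eq_iff by blast
  qed
  also have "\<dots> = psize (lam (ell + 1 - c))"
    using card_diagram_comp(2)[OF lam, of "ell + 1 - c"] c by simp
  finally show ?thesis .
qed

lemma prod_list_rev_commute:
  fixes xs :: "'a::monoid_mult list"
  assumes "\<And>x y. x \<in> set xs \<Longrightarrow> y \<in> set xs \<Longrightarrow> x * y = y * x"
  shows "prod_list (rev xs) = prod_list xs"
  using assms
proof (induction xs)
  case (Cons x xs)
  have "prod_list ys * x = x * prod_list ys" if "set ys \<subseteq> set (x # xs)" for ys
    using that
  proof (induction ys)
    case (Cons y ys)
    have "y * x = x * y" using Cons.prems \<open>\<And>xa y. xa \<in> set (x # xs) \<Longrightarrow> y \<in> set (x # xs) \<Longrightarrow> xa * y = y * xa\<close>[of y x] by simp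
    then show ?case using Cons by (simp add: mult.assoc) (simp flip: mult.assoc)
  qed simp
  then have "prod_list xs * x = x * prod_list xs" by (rule) auto
  moreover have "prod_list (rev xs) = prod_list xs" by (rule Cons.IH) (rule Cons.prems, simp_all)
  ultimately show ?case by simp
qed simp

context shaped
begin

abbreviation qi :: 'k where "qi \<equiv> inverse q"
abbreviation Qi :: "nat \<Rightarrow> 'k" where "Qi \<equiv> (\<lambda>j. Q (ell + 1 - j))"

text \<open>Replacing each \<open>T\<^sub>i\<close>, \<open>i \<ge> 1\<close>, by \<open>-q\<^sup>-\<^sup>1 T\<^sub>i\<close> gives generators for the parameters
  \<open>q\<^sup>-\<^sup>1, Q\<^sub>\<ell>, \<dots>, Q\<^sub>1\<close> with the same Jucys-Murphy elements. For the conjugate shape they turn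
  \<open>n\<^sub>s\<^sub>t\<close> into \<open>m\<^sub>s\<^sub>'\<^sub>t\<^sub>'\<close>.\<close>
definition Ti :: "nat \<Rightarrow> 'a" where
  "Ti i = (if i = 0 then T 0 else sc (- qi) * T i)"

lemma Ti_simps: "Ti 0 = T 0" "1 \<le> i \<Longrightarrow> Ti i = sc (- qi) * T i"
  by (simp_all add: Ti_def)

lemma qi_powi: "qi powi e = q powi (- e)"
  by (simp add: power_int_inverse power_int_minus)

lemma separated_conj: "separated ell n qi Qi"
proof
  show "1 \<le> n" by (rule n1)
  show "qi \<noteq> 0" using q0 by simp
  show "Q (ell + 1 - c) \<noteq> 0" if "2 \<le> n" "1 \<le> c" "c \<le> ell" for c using Q0[of "ell + 1 - c"] that by simp
  show "qi ^ d \<noteq> 1" if "1 \<le> d" "d \<le> n" for d using q_pow[OF that] by (simp add: power_inverse)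
  show "qi powi e * Q (ell + 1 - c) \<noteq> Q (ell + 1 - d)"
    if "1 \<le> c" "c \<le> ell" "1 \<le> d" "d \<le> ell" "c \<noteq> d" "\<bar>e\<bar> < int n" for c d e
    unfolding qi_powi using Q_sep[of "ell + 1 - c" "ell + 1 - d" "- e"] that by simp
qed

lemma hecke_ring_conj: "hecke_ring ell n qi Qi sc Ti"
proof
  show "qi \<noteq> 0" using q0 by simp
  show "sc (x + y) = sc x + sc y" "sc (x * y) = sc x * sc y" "sc 1 = 1" for x y
    by (simp_all add: sc_add sc_mult)
  have scc: "sc x * (sc c * y) = sc c * (sc x * y)" for x c y by (simp add: mult.commute)
  show "Ti i * sc c = sc c * Ti i" for i c
    by (cases "i = 0") (simp_all add: Ti_def T_sc mult.assoc scc mult.commute[of c qi])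
  have "map (\<lambda>c. T 0 - sc (Q (ell + 1 - c))) [1..<Suc ell] = rev (map (\<lambda>c. T 0 - sc (Q c)) [1..<Suc ell])"
    by (rule nth_equalityI) (simp_all add: rev_nth del: upt_Suc)
  moreover have "prod_list (rev (map (\<lambda>c. T 0 - sc (Q c)) [1..<Suc ell])) = prod_list (map (\<lambda>c. T 0 - sc (Q c)) [1..<Suc ell])"
  proof (rule prod_list_rev_commute)
    fix x y assume "x \<in> set (map (\<lambda>c. T 0 - sc (Q c)) [1..<Suc ell])" "y \<in> set (map (\<lambda>c. T 0 - sc (Q c)) [1..<Suc ell])"
    then obtain c d where "x = T 0 - sc (Q c)" "y = T 0 - sc (Q d)" by auto
    then show "x * y = y * x" using T_sc[of 0] sc_commute[of "Q c" "Q d"] by (simp add: left_diff_distrib right_diff_distrib)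
  qed
  ultimately show "prod_list (map (\<lambda>c. Ti 0 - sc (Q (ell + 1 - c))) [1..<Suc ell]) = 0"
    unfolding Ti_simps using T_cyc by simp
  show "Ti 0 * Ti 1 * Ti 0 * Ti 1 = Ti 1 * Ti 0 * Ti 1 * Ti 0" if "2 \<le> n"
    using T_0101[OF that] by (simp add: Ti_def mult.assoc)
  show "(Ti i - sc qi) * (Ti i + 1) = 0" if i: "1 \<le> i" "i < n" for i
  proof -
    have "Ti i - sc qi = sc (- qi) * (T i + 1)" "Ti i + 1 = sc (- qi) * (T i - sc q)"
      using q0 i by (simp_all add: Ti_simps distrib_left right_diff_distrib sc_minus sc_mult[symmetric])
    then have "(Ti i - sc qi) * (Ti i + 1) = sc (- qi) * ((T i + 1) * (sc (- qi) * (T i - sc q)))" by (simp only: mult.assoc)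
    also have "\<dots> = sc (- qi) * (sc (- qi) * ((T i + 1) * (T i - sc q)))"
      by (subst scal_comm_v) (intro scal_comm_intros, rule refl)
    also have "(T i + 1) * (T i - sc q) = (T i - sc q) * (T i + 1)"
      using T_sc[of i q] by (simp add: distrib_left distrib_right right_diff_distrib left_diff_distrib)
    also have "\<dots> = 0" by (rule T_quad[OF i])
    finally show ?thesis by simp
  qed
  show "Ti i * Ti j = Ti j * Ti i" if "Suc i < j" "j < n" for i j
  proof (cases "i = 0")
    case True
    have "j \<noteq> 0" using that by simp
    then show ?thesis using T_far[OF that] unfolding True Ti_def by (simp only: if_True if_False mult.assoc T_sc_v simp_thms)
  next
    case False
    have "j \<noteq> 0" using that by simp
    then show ?thesis using T_far[OF that] False unfolding Ti_def by (simp only: if_False mult.assoc T_sc_v simp_thms)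
  qed
  show "Ti i * Ti (Suc i) * Ti i = Ti (Suc i) * Ti i * Ti (Suc i)" if "1 \<le> i" "Suc i < n" for i
    using T_braid[OF that] that by (simp add: Ti_def mult.assoc)
qed

lemma shaped_conj: "shaped ell n qi Qi sc Ti (conj_mpart ell lam)"
  by (intro shaped.intro seminormal.intro separated_conj hecke_ring_conj shaped_axioms.intro conj_mpart_multipartitions[OF lam])

interpretation cj: shaped ell n qi Qi sc Ti "conj_mpart ell lam"
  by (rule shaped_conj)

abbreviation z :: tab where "z \<equiv> final_tab ell lam"

lemmas z_tabs = final_tab_tabs[OF lam] and supp_z = supp_final_tab[OF lam]

lemma conj_z: "init_tab ell (conj_mpart ell lam) = conj_tab ell z"
  by (rule conj_final_tab[OF lam, symmetric])

lemma cj_L: "1 \<le> m \<Longrightarrow> m \<le> n \<Longrightarrow> cj.L m = L m"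
proof (induction m rule: dec_induct)
  case base show ?case unfolding cj.L_1 L_1 Ti_simps ..
next
  case (step m)
  have "cj.L (Suc m) = sc q * (sc qi * (sc qi * (T m * (L m * T m))))"
    unfolding cj.L_Suc[OF step.hyps(1)] using step Ti_simps(2)[OF step.hyps(1)]
    by (simp add: mult.assoc sc_minus)
  also have "\<dots> = L (Suc m)"
  proof -
    have "q * (qi * qi) = qi" using q0 by simp
    then show ?thesis unfolding L_Suc[OF step.hyps(1)] sc_sc by (simp only:)
  qed
  finally show ?case .
qed

lemma cj_word_prod: "set is \<subseteq> {1..<n} \<Longrightarrow> cj.word_prod is = sc ((- qi) ^ length is) * word_prod is"
proof (induction "is")
  case (Cons i "is")
  have "cj.word_prod (i # is) = sc (- qi) * T i * (sc ((- qi) ^ length is) * word_prod is)"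
    using Cons Ti_simps(2)[of i] by simp
  also have "\<dots> = sc (- qi) * (sc ((- qi) ^ length is) * (T i * word_prod is))"
    unfolding mult.assoc T_sc_v ..
  also have "\<dots> = sc ((- qi) ^ length (i # is)) * word_prod (i # is)"
    unfolding sc_sc list.size power_Suc word_prod_simps by (simp only: add_Suc_right add_0_right power_Suc)
  finally show ?case .
qed simp

lemma cj_T_of:
  assumes "w permutes {1..n}"
  shows "cj.T_of w = sc ((- qi) ^ inv_count n w) * T_of w"
proof -
  obtain "is" where r: "is \<in> reduced_words n w" using reduced_words_exist[OF assms] by blast
  then have "set is \<subseteq> {1..<n}" "length is = inv_count n w" using reduced_words_iff by blast+
  then show ?thesis unfolding cj.T_of_reduced[OF r] T_of_reduced[OF r] using cj_word_prod by simp
qed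

lemma cj_res: "t \<in> tabs ell n \<Longrightarrow> 1 \<le> k \<Longrightarrow> k \<le> n \<Longrightarrow> cj.res_at (conj_tab ell t) k = res_at t k"
  using nd_conj_tab[of t ell n k] node_res_conj[of "nd t k" ell q Q]
    subsetD[OF young_nodes[OF tabs_young, of t ell n] nd_supp[of t ell n k]] by simp

lemma cj_Rset: "1 \<le> k \<Longrightarrow> k \<le> n \<Longrightarrow> cj.Rset k = Rset k"
proof (rule equalityI; rule subsetI)
  assume k: "1 \<le> k" "k \<le> n"
  fix r
  {
    assume "r \<in> cj.Rset k"
    then obtain t where t: "t \<in> tabs ell n" "r = cj.res_at t k" unfolding cj.Rset_def by blast
    then have "r = res_at (conj_tab ell t) k"
      using cj_res[OF conj_tab_tabs[OF t(1)] k] conj_conj_tab[OF t(1)] by simp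
    then show "r \<in> Rset k" using conj_tab_tabs[OF t(1)] unfolding Rset_def by blast
  next
    assume "r \<in> Rset k"
    then obtain t where t: "t \<in> tabs ell n" "r = res_at t k" unfolding Rset_def by blast
    then have "r = cj.res_at (conj_tab ell t) k" using cj_res[OF t(1) k] by simp
    then show "r \<in> cj.Rset k" using conj_tab_tabs[OF t(1)] unfolding cj.Rset_def by blast
  }
qed

lemma cj_F:
  assumes t: "t \<in> tabs ell n"
  shows "cj.F (conj_tab ell t) = F t"
  unfolding cj.F_def F_def
proof (rule arg_cong[where f = prod_list], rule arg_cong[where f = concat], rule map_cong[OF refl])
  fix k assume "k \<in> set [1..<Suc n]"
  then have k: "1 \<le> k" "k \<le> n" by auto
  show "map (\<lambda>c. sc (inverse (cj.res_at (conj_tab ell t) k - c)) * (cj.L k - sc c)) (enum_set (cj.Rset k - {cj.res_at (conj_tab ell t) k}))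
    = map (\<lambda>c. sc (inverse (res_at t k - c)) * (L k - sc c)) (enum_set (Rset k - {res_at t k}))"
    unfolding cj_res[OF t k] cj_Rset[OF k] cj_L[OF k] ..
qed

lemma inv_count_dp_z:
  "t \<in> tabs ell n \<Longrightarrow> supp t = D \<Longrightarrow> inv_count n (dp n z t) = card (Invs z t)"
  "t \<in> tabs ell n \<Longrightarrow> supp t = D \<Longrightarrow> inv_count n (dp n t z) = card (Invs z t)"
  using dp_inv_count[OF z_tabs, of t] dp_inv_count[OF _ z_tabs, of t] card_Invs_commute[of t z] supp_z by simp_all

lemma cj_Psi:
  assumes t: "t \<in> tabs ell n" "supp t = D"
  shows "cj.Psi (conj_tab ell t) (conj_tab ell z) = sc ((- qi) ^ card (Invs z t)) * Psi t z"
    "cj.Psi (conj_tab ell z) (conj_tab ell t) = sc ((- qi) ^ card (Invs z t)) * Psi z t"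
proof -
  have p: "dp n t z permutes {1..n}" "dp n z t permutes {1..n}"
    using dp_permutes[OF t(1) z_tabs] dp_permutes[OF z_tabs t(1)] t(2) supp_z by simp_all
  show "cj.Psi (conj_tab ell t) (conj_tab ell z) = sc ((- qi) ^ card (Invs z t)) * Psi t z"
    unfolding cj.Psi_def Psi_def dp_conj[OF t(1) z_tabs] cj_F[OF t(1)] cj_F[OF z_tabs] cj_T_of[OF p(1)]
      inv_count_dp_z(2)[OF t] mult.assoc F_sc_v ..
  show "cj.Psi (conj_tab ell z) (conj_tab ell t) = sc ((- qi) ^ card (Invs z t)) * Psi z t"
    unfolding cj.Psi_def Psi_def dp_conj[OF z_tabs t(1)] cj_F[OF t(1)] cj_F[OF z_tabs] cj_T_of[OF p(2)]
      inv_count_dp_z(1)[OF t] mult.assoc F_sc_v ..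
qed

definition n_mid :: "'a" where
  "n_mid = (\<Sum>w\<in>young_subgroup ell n (conj_mpart ell lam). sc ((- q) powi (- int (perm_length n w))) * T_of w) *
     prod_list [L k - sc (Q (ell + 1 - r)).
       r \<leftarrow> [2..<Suc ell], k \<leftarrow> [1..<Suc (\<Sum>c=ell + 2 - r..ell. psize (lam c))]]"

definition m_mid :: "'a" where
  "m_mid = (\<Sum>w\<in>young_subgroup ell n lam. T_of w) *
     prod_list [L k - sc (Q r). r \<leftarrow> [2..<Suc ell], k \<leftarrow> [1..<Suc (\<Sum>c=1..<r. psize (lam c))]]"

lemma m_mid: "m_mid = sym blk * U"
  unfolding m_mid_def sym_def young_subgroup_eq U_def below_def ..

lemma cj_below: "r \<le> ell \<Longrightarrow> 2 \<le> r \<Longrightarrow> cj.below r = (\<Sum>c=ell + 2 - r..ell. psize (lam c))"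
proof -
  assume r: "r \<le> ell" "2 \<le> r"
  have "cj.below r = (\<Sum>c=1..<r. psize (lam (ell + 1 - c)))"
    unfolding cj.below_def by (rule sum.cong[OF refl]) (use psize_conj[OF lam] r in auto)
  also have "\<dots> = (\<Sum>c=ell + 2 - r..ell. psize (lam c))"
    by (rule sum.reindex_bij_witness[where i = "\<lambda>c. ell + 1 - c" and j = "\<lambda>c. ell + 1 - c"]) (use r in auto)
  finally show ?thesis .
qed

lemma qi_pow: "(- qi) ^ m = (- q) powi (- int m)"
proof -
  have "- qi = inverse (- q)" by simp
  then show ?thesis by (simp only: power_inverse power_int_minus power_int_of_nat)
qed

lemma n_mid: "n_mid = cj.sym cj.blk * cj.U"
proof -
  have "cj.sym cj.blk = (\<Sum>w\<in>young_subgroup ell n (conj_mpart ell lam). sc ((- q) powi (- int (perm_length n w))) * T_of w)"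
    unfolding cj.sym_def cj.young_subgroup_eq
  proof (rule sum.cong[OF refl])
    fix w assume "w \<in> block_perms n cj.blk"
    then have p: "w permutes {1..n}" unfolding block_perms_def by blast
    show "cj.T_of w = sc ((- q) powi (- int (perm_length n w))) * T_of w"
      unfolding cj_T_of[OF p] perm_length_eq[OF p] qi_pow ..
  qed
  moreover have "cj.U = prod_list [L k - sc (Q (ell + 1 - r)).
       r \<leftarrow> [2..<Suc ell], k \<leftarrow> [1..<Suc (\<Sum>c=ell + 2 - r..ell. psize (lam c))]]"
    unfolding cj.U_def
  proof (rule arg_cong[where f = prod_list], rule arg_cong[where f = concat], rule map_cong[OF refl])
    fix r assume "r \<in> set [2..<Suc ell]"
    then have r: "r \<le> ell" "2 \<le> r" by auto
    have "cj.L k = L k" if "k \<in> set [1..<Suc (cj.below r)]" for k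
      using that cj.below_le[of r] r by (intro cj_L) auto
    then have "map (\<lambda>k. cj.L k - sc (Q (ell + 1 - r))) [1..<Suc (cj.below r)] = map (\<lambda>k. L k - sc (Q (ell + 1 - r))) [1..<Suc (cj.below r)]"
      by (intro map_cong refl) (simp del: upt_Suc)
    then show "map (\<lambda>k. cj.L k - sc (Q (ell + 1 - r))) [1..<Suc (cj.below r)] =
      map (\<lambda>k. L k - sc (Q (ell + 1 - r))) [1..<Suc (\<Sum>c=ell + 2 - r..ell. psize (lam c))]"
      unfolding cj_below[OF r] .
  qed
  ultimately show ?thesis unfolding n_mid_def by simp
qed

lemma f_Psi:
  assumes s: "s \<in> tabs ell n" "supp s = D" and t: "t \<in> tabs ell n" "supp t = D"
  shows "F s * (T_of (dp n s a) * m_mid * T_of (dp n a t)) * F t = sc top_gamma * (Psi s a * Psi a t)"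
  using seminormal_Psi[OF s t] by (simp add: m_mid mult.assoc)

lemma g_Psi:
  assumes s: "s \<in> tabs ell n" "supp s = D" and t: "t \<in> tabs ell n" "supp t = D"
  shows "F s * (sc ((- q) powi (- int (card (Invs z s)) - int (card (Invs z t)))) * T_of (dp n s z) * n_mid * T_of (dp n z t)) * F t =
    sc ((- q) powi (- int (card (Invs z s)) - int (card (Invs z t))) * cj.top_gamma) * (Psi s z * Psi z t)"
proof -
  let ?s = "conj_tab ell s" and ?t = "conj_tab ell t" and ?z = "conj_tab ell z"
  let ?e = "(- qi) ^ card (Invs z s)" and ?f = "(- qi) ^ card (Invs z t)"
  have ef: "?e * ?f = (- q) powi (- int (card (Invs z s)) - int (card (Invs z t)))"
    using q0 unfolding qi_pow by (simp add: power_int_add[symmetric])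
  have p: "dp n s z permutes {1..n}" "dp n z t permutes {1..n}"
    using dp_permutes[OF s(1) z_tabs] dp_permutes[OF z_tabs t(1)] s(2) t(2) supp_z by simp_all
  have sp: "supp ?s = diagram ell (conj_mpart ell lam)" "supp ?t = diagram ell (conj_mpart ell lam)"
    using supp_conj_tab[OF s(1)] supp_conj_tab[OF t(1)] diagram_conj_mpart[OF lam] s(2) t(2) by simp_all
  have scm: "scal_comm n_mid" unfolding n_mid cj.sym_def
    by (intro scal_comm_intros(4) cj.scal_comm_sum cj.scal_comm_word cj.scal_comm_U)
  have "cj.F ?s * (cj.T_of (dp n ?s ?z) * (cj.sym cj.blk * (cj.U * (cj.T_of (dp n ?z ?t) * cj.F ?t)))) =
      sc cj.top_gamma * (cj.Psi ?s ?z * cj.Psi ?z ?t)"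
    using cj.seminormal_Psi[OF conj_tab_tabs[OF s(1)] sp(1) conj_tab_tabs[OF t(1)] sp(2)] unfolding conj_z .
  then have "F s * (sc ?e * T_of (dp n s z) * (n_mid * (sc ?f * T_of (dp n z t) * F t))) =
      sc cj.top_gamma * ((sc ?e * Psi s z) * (sc ?f * Psi z t))"
    unfolding cj_F[OF s(1)] cj_F[OF t(1)] dp_conj[OF s(1) z_tabs] dp_conj[OF z_tabs t(1)] cj_T_of[OF p(1)] cj_T_of[OF p(2)]
      inv_count_dp_z(1)[OF t] inv_count_dp_z(2)[OF s] cj_Psi(1)[OF s] cj_Psi(2)[OF t] n_mid by (simp only: mult.assoc)
  moreover have "scal_comm (Psi s z)" by (simp add: Psi_def)
  ultimately have "sc (?e * ?f) * (F s * (T_of (dp n s z) * (n_mid * (T_of (dp n z t) * F t)))) =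
      sc (cj.top_gamma * (?e * ?f)) * (Psi s z * Psi z t)"
    by (simp add: mult.assoc scal_comm_v[OF scm] scal_comm_v[OF scal_comm_word(2)] scal_comm_v[of "Psi s z"] mult.commute mult.left_commute)
  then show ?thesis unfolding ef by (simp add: mult.assoc mult.commute)
qed

lemma cj_gamma_0: "cj.top_gamma \<noteq> 0"
  by (rule cj.top_gamma_0)

lemma cj_phi: "cj.phi x y = qi ^ 2 * phi x y"
proof -
  have "(qi * x - y) * (x - qi * y) = qi ^ 2 * ((q * x - y) * (x - q * y))"
    using q0 by (simp add: field_simps power2_eq_square)
  then show ?thesis by (simp add: cj.phi_def phi_def)
qed

lemma cj_gam:
  assumes t: "t \<in> tabs ell n" "supp t = D"
  shows "cj.gam (conj_tab ell z) (conj_tab ell t) = qi ^ (2 * card (Invs z t)) * gam z t"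
proof -
  have sp: "supp z = supp t" using t(2) supp_z by simp
  have "cj.gam (conj_tab ell z) (conj_tab ell t) = (\<Prod>p\<in>Invs (conj_tab ell z) (conj_tab ell t). case p of (x, y) \<Rightarrow> cj.phi (cj.nres x) (cj.nres y))"
    by (simp add: cj.gam_def)
  also have "\<dots> = (\<Prod>p\<in>Invs z t. case (case p of (x, y) \<Rightarrow> (conj_node ell x, conj_node ell y)) of (x, y) \<Rightarrow> cj.phi (cj.nres x) (cj.nres y))"
    by (rule prod.reindex_bij_betw[OF Invs_conj[OF z_tabs t(1) sp], symmetric])
  also have "\<dots> = (\<Prod>p\<in>Invs z t. qi ^ 2 * (case p of (x, y) \<Rightarrow> phi (nres x) (nres y)))"
  proof (rule prod.cong[OF refl])
    fix p assume p: "p \<in> Invs z t"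
    obtain x y where xy: "p = (x, y)" by (cases p)
    have "x \<in> nodes ell" "y \<in> nodes ell" using p young_nodes[OF tabs_young[OF t(1)]] unfolding xy Invs_def by auto
    then show "(case (case p of (x, y) \<Rightarrow> (conj_node ell x, conj_node ell y)) of (x, y) \<Rightarrow> cj.phi (cj.nres x) (cj.nres y)) =
        qi ^ 2 * (case p of (x, y) \<Rightarrow> phi (nres x) (nres y))"
      unfolding xy prod.case cj_phi using node_res_conj[of x ell q Q] node_res_conj[of y ell q Q] by simp
  qed
  also have "\<dots> = qi ^ (2 * card (Invs z t)) * gam z t"
    unfolding prod.distrib gam_def by (simp add: power_mult)
  finally show ?thesis .
qed

lemma gam_z:
  assumes t: "t \<in> tabs ell n" "supp t = D"
  shows "gam a z = gam a t * gam z t"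
proof -
  have fin: "finite (Invs a t)" "finite (Invs t z)" using finite_Invs finite_D t(2) supp_z by metis+
  have un: "Invs a z = Invs a t \<union> Invs t z \<and> Invs a t \<inter> Invs t z = {}"
    using Invs_init_final[OF lam t] .
  have "gam a z = gam a t * gam t z"
    using un prod.union_disjoint[OF fin] unfolding gam_def by simp
  moreover have "gam t z = gam z t"
    unfolding gam_def
    by (rule prod.reindex_bij_witness[where i = "\<lambda>(x, y). (y, x)" and j = "\<lambda>(x, y). (y, x)"])
      (use t(2) supp_z phi_commute in \<open>auto simp: Invs_def\<close>)
  ultimately show ?thesis by simp
qed

text \<open>The values \<open>\<gamma>\<^sub>u\<close> and \<open>\<gamma>'\<^sub>u\<^sub>'\<close> are products over the inversions between \<open>a\<close> and \<open>u\<close> and between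
  \<open>u\<close> and \<open>z\<close>, which together are the inversions between \<open>a\<close> and \<open>z\<close>. Each factor of \<open>\<gamma>'\<close> is
  \<open>q\<^sup>-\<^sup>2\<close> times the corresponding factor of \<open>\<gamma>\<close>, which accounts for the powers of \<open>q\<close>.\<close>
theorem alpha:
  assumes s: "s \<in> Std ell n lam" and t: "t \<in> Std ell n lam"
  defines "e \<equiv> int (card (Invs z s)) + int (card (Invs z t))"
    and "g \<equiv> gamma_coeff ell n q Q lam" and "g' \<equiv> gamma_coeff ell n qi Qi (conj_mpart ell lam)"
  defines "al \<equiv> (- q) powi (- e) * (g z * g' (conj_tab ell z) / (g s * g t))"
  shows "al \<noteq> 0"
    and "al = (- q) powi e * (g' (conj_tab ell s) * g' (conj_tab ell t) / (g z * g' (conj_tab ell z)))"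
    and "F s * (sc ((- q) powi (- e)) * T_of (dp n s z) * n_mid * T_of (dp n z t)) * F t =
      sc al * (F s * (T_of (dp n s a) * m_mid * T_of (dp n a t)) * F t)"
proof -
  have ss: "s \<in> tabs ell n" "supp s = D" and tt: "t \<in> tabs ell n" "supp t = D"
    using s t unfolding Std_D by simp_all
  have zS: "z \<in> Std ell n lam" using z_tabs supp_z by (simp add: Std_D)
  have gv: "g u = top_gamma * gam a u" if "u \<in> Std ell n lam" for u unfolding g_def by (rule gamma_coeff_eq[OF that])
  have gv': "g' (conj_tab ell u) = cj.top_gamma * (qi ^ (2 * card (Invs z u)) * gam z u)" if u: "u \<in> Std ell n lam" for u
  proof -
    have uu: "u \<in> tabs ell n" "supp u = D" using u unfolding Std_D by simp_all
    have "conj_tab ell u \<in> Std ell n (conj_mpart ell lam)"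
      unfolding cj.Std_D using conj_tab_tabs[OF uu(1)] supp_conj_tab[OF uu(1)] diagram_conj_mpart[OF lam] uu(2) by simp
    from cj.gamma_coeff_eq[OF this] show ?thesis unfolding g'_def conj_z cj_gam[OF uu] .
  qed
  have zz: "gam z z = 1" by (simp add: gam_def)
  note nz = top_gamma_0 cj_gamma_0 gam_a_ne_0[OF ss] gam_a_ne_0[OF tt] gam_a_ne_0[OF z_tabs supp_z]
  have ge1: "gam z s = gam a z / gam a s" using nz(3) unfolding gam_z[OF ss] by simp
  have ge2: "gam z t = gam a z / gam a t" using nz(4) unfolding gam_z[OF tt] by simp
  note ge = ge1 ge2
  have G: "g z * g' (conj_tab ell z) = top_gamma * gam a z * cj.top_gamma"
    unfolding gv[OF zS] gv'[OF zS] zz by simp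
  have al: "al = (- q) powi (- e) * (top_gamma * gam a z * cj.top_gamma / (top_gamma * gam a s * (top_gamma * gam a t)))"
    unfolding al_def G gv[OF s] gv[OF t] ..
  show "al \<noteq> 0" unfolding al using nz q0 by simp
  have qe: "qi ^ (2 * card (Invs z s)) * qi ^ (2 * card (Invs z t)) = (- q) powi (- e) * (- q) powi (- e)"
  proof -
    have sq: "qi ^ (2 * m) = (- q) powi (- int m) * (- q) powi (- int m)" for m
      unfolding qi_pow[symmetric] by (simp add: power_mult power2_eq_square power_mult_distrib[symmetric])
    have "(- q) powi (- e) = (- q) powi (- int (card (Invs z s))) * (- q) powi (- int (card (Invs z t)))"
      using power_int_add[of "- q" "- int (card (Invs z s))" "- int (card (Invs z t))"] q0 by (simp add: e_def)
    then show ?thesis unfolding sq by (simp only: mult_ac)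
  qed
  have "(- q) powi e * (g' (conj_tab ell s) * g' (conj_tab ell t) / (g z * g' (conj_tab ell z)))
    = (- q) powi e * ((qi ^ (2 * card (Invs z s)) * qi ^ (2 * card (Invs z t))) * (cj.top_gamma * gam z s * (cj.top_gamma * gam z t))
      / (top_gamma * gam a z * cj.top_gamma))"
    unfolding gv'[OF s] gv'[OF t] G by (simp add: mult_ac)
  also have "\<dots> = ((- q) powi e * (- q) powi (- e)) * ((- q) powi (- e) * (cj.top_gamma * gam z s * (cj.top_gamma * gam z t)
      / (top_gamma * gam a z * cj.top_gamma)))"
    unfolding qe by (simp add: mult_ac)
  also have "(- q) powi e * (- q) powi (- e) = 1" using q0 by (simp add: power_int_minus)
  also have "cj.top_gamma * gam z s * (cj.top_gamma * gam z t) / (top_gamma * gam a z * cj.top_gamma)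
      = top_gamma * gam a z * cj.top_gamma / (top_gamma * gam a s * (top_gamma * gam a t))"
    unfolding ge using nz by (simp add: field_simps)
  finally show "al = (- q) powi e * (g' (conj_tab ell s) * g' (conj_tab ell t) / (g z * g' (conj_tab ell z)))"
    unfolding al by simp
  have "Psi s z * Psi z t = sc (gam a z / (gam a s * gam a t)) * (Psi s a * Psi a t)"
  proof (rule Psi_base_change[OF a_tabs z_tabs ss(1) tt(1)])
    show "supp a = supp t" "supp z = supp t" "supp s = supp t" using supp_a supp_z ss tt by simp_all
    fix u assume "u \<in> tabs ell n" "supp u = supp a"
    then show "card (Invs a z) = card (Invs a u) + card (Invs u z)"
      using card_Invs_init_final[OF lam, of u] supp_a by simp
  qed
  moreover have "- e = - int (card (Invs z s)) - int (card (Invs z t))" by (simp add: e_def)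
  moreover have "(- q) powi (- e) * cj.top_gamma * (gam a z / (gam a s * gam a t)) = al * top_gamma"
    unfolding al using nz by (simp add: field_simps)
  ultimately show "F s * (sc ((- q) powi (- e)) * T_of (dp n s z) * n_mid * T_of (dp n z t)) * F t =
      sc al * (F s * (T_of (dp n s a) * m_mid * T_of (dp n a t)) * F t)"
    using g_Psi[OF ss tt] f_Psi[OF ss tt] by (simp add: mult.assoc)
qed

end

section \<open>Evaluation of noncommutative polynomials\<close>

abbreviation words :: "nat \<Rightarrow> (word \<Rightarrow>\<^sub>0 'k::field) set" where
  "words n \<equiv> carrier (free_algebra n)"

abbreviation (input) "pkeys \<equiv> Poly_Mapping.keys"
abbreviation (input) "plookup \<equiv> Poly_Mapping.lookup"

lemma fa_carrier: "p \<in> words n \<longleftrightarrow> (\<forall>w\<in>pkeys p. set (letters w) \<subseteq> {..<n})"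
  by (simp add: free_algebra_def)

lemma fa_simps [simp]:
  "x \<otimes>\<^bsub>free_algebra n\<^esub> y = x * y" "\<one>\<^bsub>free_algebra n\<^esub> = 1" "\<zero>\<^bsub>free_algebra n\<^esub> = 0"
  "x \<oplus>\<^bsub>free_algebra n\<^esub> y = x + y"
  by (simp_all add: free_algebra_def)

lemma letters_simps [simp]: "letters 0 = []" "letters (u + v) = letters u @ letters v"
  by (simp_all add: zero_word_def plus_word_def)

lemma fa_add: "p \<in> words n \<Longrightarrow> r \<in> words n \<Longrightarrow> p + r \<in> words n"
  unfolding fa_carrier using keys_add[of p r] by blast

lemma fa_mult: "p \<in> words n \<Longrightarrow> r \<in> words n \<Longrightarrow> p * r \<in> words n"
  unfolding fa_carrier
proof
  fix w assume p: "\<forall>w\<in>pkeys p. set (letters w) \<subseteq> {..<n}" "\<forall>w\<in>pkeys r. set (letters w) \<subseteq> {..<n}"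
    and "w \<in> pkeys (p * r)"
  then obtain u v where "u \<in> pkeys p" "v \<in> pkeys r" "w = u + v" using keys_mult[of p r] by blast
  then show "set (letters w) \<subseteq> {..<n}" using p by auto
qed

lemma fa_basic: "0 \<in> words n" "1 \<in> words n" "scal c \<in> words n"
  "i < n \<Longrightarrow> gen i \<in> words n" "p \<in> words n \<Longrightarrow> - p \<in> words n"
  by (simp_all add: scal_def gen_def fa_carrier)

lemma fa_diff: "p \<in> words n \<Longrightarrow> r \<in> words n \<Longrightarrow> p - r \<in> words n"
  using fa_add[OF _ fa_basic(5), of p n r] by simp

lemma fa_sum: "(\<And>x. x \<in> A \<Longrightarrow> f x \<in> words n) \<Longrightarrow> sum f A \<in> words n"
  by (induction A rule: infinite_finite_induct) (simp_all only: sum.infinite sum.empty fa_basic sum.insert fa_add insert_iff simp_thms)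

lemma fa_prod_list: "(\<And>x. x \<in> set xs \<Longrightarrow> x \<in> words n) \<Longrightarrow> prod_list xs \<in> words n"
  by (induction xs) (simp_all only: prod_list.Nil prod_list.Cons fa_basic fa_mult list.set insert_iff simp_thms)

lemma fa_gens: "set is \<subseteq> {..<n} \<Longrightarrow> prod_list (map gen is) \<in> words n"
  by (rule fa_prod_list) (use fa_basic(4) in \<open>auto\<close>)

lemma ring_fa: "ring (free_algebra n)"
proof (rule ringI)
  show "abelian_group (free_algebra n)"
  proof (rule abelian_groupI)
    fix x y z assume x: "x \<in> words n"
    show "\<exists>y\<in>words n. y \<oplus>\<^bsub>free_algebra n\<^esub> x = \<zero>\<^bsub>free_algebra n\<^esub>"
      by (rule bexI[OF _ fa_basic(5)[OF x]]) simp
    show "x \<oplus>\<^bsub>free_algebra n\<^esub> y \<oplus>\<^bsub>free_algebra n\<^esub> z = x \<oplus>\<^bsub>free_algebra n\<^esub> (y \<oplus>\<^bsub>free_algebra n\<^esub> z)"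
      by (simp add: add.assoc)
    show "x \<oplus>\<^bsub>free_algebra n\<^esub> y = y \<oplus>\<^bsub>free_algebra n\<^esub> x" by (simp add: add.commute)
    show "\<zero>\<^bsub>free_algebra n\<^esub> \<oplus>\<^bsub>free_algebra n\<^esub> x = x" by simp
    show "x \<oplus>\<^bsub>free_algebra n\<^esub> y \<in> words n" if "y \<in> words n"
      unfolding fa_simps by (rule fa_add[OF x that])
  qed (simp add: fa_basic)
  show "Group.monoid (free_algebra n)"
    by (rule monoidI) (simp_all add: fa_mult fa_basic mult.assoc)
qed (simp_all add: distrib_left distrib_right)

lemma sum_monomials: "(\<Sum>w\<in>pkeys p. Poly_Mapping.single w (plookup p w)) = p"
proof (rule poly_mapping_eqI)
  fix k
  have "plookup (\<Sum>w\<in>pkeys p. Poly_Mapping.single w (plookup p w)) k =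
      (\<Sum>w\<in>pkeys p. if w = k then plookup p w else 0)"
    by (simp add: lookup_sum lookup_single when_def)
  then show "plookup (\<Sum>w\<in>pkeys p. Poly_Mapping.single w (plookup p w)) k = plookup p k"
    by (simp add: in_keys_iff)
qed

text \<open>Homomorphisms from the free algebra to a ring with a central homomorphism \<open>sc\<close> from the
  field.\<close>
locale evaluation =
  fixes sc :: "'k::field \<Rightarrow> 'a::ring_1" and T :: "nat \<Rightarrow> 'a"
  assumes scadd: "sc (a + b) = sc a + sc b" and scmult: "sc (a * b) = sc a * sc b" and scone: "sc 1 = 1"
    and Tsc: "T i * sc c = sc c * T i"
begin

definition val :: "(word \<Rightarrow>\<^sub>0 'k) \<Rightarrow> 'a" where
  "val p = (\<Sum>w\<in>pkeys p. sc (plookup p w) * prod_list (map T (letters w)))"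

lemma sczero: "sc 0 = 0" using scadd[of 0 0] by simp

lemma val_superset:
  assumes "finite A" "pkeys p \<subseteq> A"
  shows "val p = (\<Sum>w\<in>A. sc (plookup p w) * prod_list (map T (letters w)))"
  unfolding val_def by (rule sum.mono_neutral_left[OF assms]) (simp add: in_keys_iff sczero)

lemma val_add: "val (p + r) = val p + val r"
proof -
  let ?A = "pkeys p \<union> pkeys r"
  have "finite ?A" by simp
  note v = val_superset[OF this]
  show ?thesis
    using v[OF keys_add] v[of p] v[of r] by (simp add: lookup_add scadd distrib_right sum.distrib)
qed

lemma val_0 [simp]: "val 0 = 0" by (simp add: val_def)

lemma val_minus: "val (- p) = - val p" using val_add[of p "- p"] by (simp add: eq_neg_iff_add_eq_0 add.commute)

lemma val_diff: "val (p - r) = val p - val r" using val_add[of p "- r"] by (simp add: val_minus)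

lemma val_sum: "val (sum f A) = (\<Sum>x\<in>A. val (f x))"
  by (induction A rule: infinite_finite_induct) (simp_all add: val_add)

lemma val_single: "val (Poly_Mapping.single w c) = sc c * prod_list (map T (letters w))"
  by (cases "c = 0") (simp_all add: val_def sczero)

lemma prod_list_sc: "prod_list (map T is) * sc c = sc c * prod_list (map T is)"
  by (induction "is") (simp_all add: mult.assoc, simp add: Tsc flip: mult.assoc)

lemma val_mult: "val (p * r) = val p * val r"
proof -
  let ?s = "\<lambda>p w. Poly_Mapping.single w (plookup p w)"
  have "p * r = (\<Sum>u\<in>pkeys p. ?s p u) * (\<Sum>v\<in>pkeys r. ?s r v)" by (simp only: sum_monomials)
  also have "\<dots> = (\<Sum>u\<in>pkeys p. \<Sum>v\<in>pkeys r. ?s p u * ?s r v)" by (rule sum_product)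
  finally have "val (p * r) = (\<Sum>u\<in>pkeys p. \<Sum>v\<in>pkeys r. val (?s p u * ?s r v))"
    by (simp add: val_sum)
  also have "\<dots> = (\<Sum>u\<in>pkeys p. \<Sum>v\<in>pkeys r. val (?s p u) * val (?s r v))"
  proof (intro sum.cong refl)
    fix u v
    have "sc (a * b) * (x * y) = (sc a * x) * (sc b * y)" if "x * sc b = sc b * x" for a b x y
      using that by (simp add: scmult mult.assoc) (simp flip: mult.assoc)
    then show "val (?s p u * ?s r v) = val (?s p u) * val (?s r v)"
      using prod_list_sc[of "letters u" "plookup r v"] by (simp add: mult_single val_single)
  qed
  also have "\<dots> = val p * val r" unfolding val_single val_def[of p] val_def[of r] by (rule sum_product[symmetric])
  finally show ?thesis .
qed

lemma val_1 [simp]: "val 1 = 1" using val_single[of 0 1] by (simp add: scone)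

lemma val_gen [simp]: "val (gen i) = T i" by (simp add: gen_def val_single scone)

lemma val_scal [simp]: "val (scal c) = sc c" by (simp add: scal_def val_single)

lemma val_prod_list: "val (prod_list ps) = prod_list (map val ps)"
  by (induction ps) (simp_all add: val_mult)

lemma val_gens: "val (prod_list (map gen is)) = prod_list (map T is)"
  by (simp add: val_prod_list comp_def)

end

sublocale hecke_ring \<subseteq> free: evaluation sc T
  by (rule evaluation.intro) (rule sc_add sc_mult sc_1 T_sc)+

lemma relators_carrier:
  assumes "1 \<le> n" shows "hecke_relators ell n q Q \<subseteq> words n"
proof
  fix r assume "r \<in> hecke_relators ell n q Q"
  then consider "r = prod_list [gen 0 - scal (Q c). c \<leftarrow> [1..<Suc ell]]"
    | "2 \<le> n" "r = gen 0 * gen 1 * gen 0 * gen 1 - gen 1 * gen 0 * gen 1 * gen 0"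
    | i where "i < n" "r = (gen i - scal q) * (gen i + 1)"
    | i j where "i < n" "j < n" "r = gen i * gen j - gen j * gen i"
    | i where "i < n" "i + 1 < n" "r = gen i * gen (i + 1) * gen i - gen (i + 1) * gen i * gen (i + 1)"
    unfolding hecke_relators_def by (auto split: if_splits simp del: upt_Suc)
  then show "r \<in> words n"
  proof cases
    case 1
    show ?thesis unfolding 1
    proof (rule fa_prod_list)
      fix x assume "x \<in> set [gen 0 - scal (Q c). c \<leftarrow> [1..<Suc ell]]"
      then obtain c where "x = gen 0 - scal (Q c)" by (auto simp del: upt_Suc)
      then show "x \<in> words n" using fa_diff[OF fa_basic(4) fa_basic(3), of 0 n "Q c"] assms by simp
    qed
  qed (simp_all only: fa_diff fa_mult fa_add fa_basic assms One_nat_def[symmetric] Suc_le_eq numeral_2_eq_2 Suc_lessD)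
qed

lemma hecke_ideal_ideal: "1 \<le> n \<Longrightarrow> ideal (hecke_ideal ell n q Q) (free_algebra n)"
  unfolding hecke_ideal_def by (rule ring.genideal_ideal[OF ring_fa relators_carrier])

lemma fa_minus: "p \<in> words n \<Longrightarrow> \<ominus>\<^bsub>free_algebra n\<^esub> p = - p"
  by (rule abelian_group.minus_equality[OF ring.is_abelian_group[OF ring_fa]]) (simp_all add: fa_basic)

lemma hecke_ideal_minimal:
  assumes n: "1 \<le> n" and rel: "\<And>r. r \<in> hecke_relators ell n q Q \<Longrightarrow> P r"
    and zero: "P 0" and add: "\<And>p r. P p \<Longrightarrow> P r \<Longrightarrow> P (p + r)" and minus: "\<And>p. P p \<Longrightarrow> P (- p)"
    and mult: "\<And>p x. P p \<Longrightarrow> x \<in> words n \<Longrightarrow> P (x * p)" "\<And>p x. P p \<Longrightarrow> x \<in> words n \<Longrightarrow> P (p * x)"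
    and p: "p \<in> hecke_ideal ell n q Q"
  shows "P p"
proof -
  let ?C = "words n"
  have "ideal {p \<in> ?C. P p} (free_algebra n)"
  proof (rule idealI[OF ring_fa])
    show "subgroup {p \<in> ?C. P p} (add_monoid (free_algebra n))"
    proof
      show "{p \<in> ?C. P p} \<subseteq> carrier (add_monoid (free_algebra n))" by auto
      show "x \<otimes>\<^bsub>add_monoid (free_algebra n)\<^esub> y \<in> {p \<in> ?C. P p}" if "x \<in> {p \<in> ?C. P p}" "y \<in> {p \<in> ?C. P p}" for x y
        using that fa_add[of x n y] add[of x y] by simp
      show "\<one>\<^bsub>add_monoid (free_algebra n)\<^esub> \<in> {p \<in> ?C. P p}" using zero fa_basic(1)[of n] by simp
      show "inv\<^bsub>add_monoid (free_algebra n)\<^esub> x \<in> {p \<in> ?C. P p}" if "x \<in> {p \<in> ?C. P p}" for x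
      proof -
        have x: "x \<in> ?C" "P x" using that by blast+
        have "inv\<^bsub>add_monoid (free_algebra n)\<^esub> x = - x" using fa_minus[OF x(1)] by (simp add: a_inv_def)
        then show ?thesis using fa_basic(5)[OF x(1)] minus[OF x(2)] by simp
      qed
    qed
    show "x \<otimes>\<^bsub>free_algebra n\<^esub> p \<in> {p \<in> ?C. P p}" "p \<otimes>\<^bsub>free_algebra n\<^esub> x \<in> {p \<in> ?C. P p}"
      if "p \<in> {p \<in> ?C. P p}" "x \<in> ?C" for p x
      using that fa_mult mult unfolding fa_simps(1) by blast+
  qed
  then have "hecke_ideal ell n q Q \<subseteq> {p \<in> ?C. P p}"
    unfolding hecke_ideal_def
  proof (rule ring.genideal_minimal[OF ring_fa])
    show "hecke_relators ell n q Q \<subseteq> {p \<in> ?C. P p}" using relators_carrier[OF n] rel by blast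
  qed
  then show ?thesis using p by blast
qed

lemma (in hecke_ring) val_relator:
  assumes "r \<in> hecke_relators ell n q Q"
  shows "free.val r = 0"
proof -
  from assms consider "r = prod_list [gen 0 - scal (Q c). c \<leftarrow> [1..<Suc ell]]"
    | "2 \<le> n" "r = gen 0 * gen 1 * gen 0 * gen 1 - gen 1 * gen 0 * gen 1 * gen 0"
    | i where "1 \<le> i" "i < n" "r = (gen i - scal q) * (gen i + 1)"
    | i j where "i < n" "j < n" "i + 1 < j \<or> j + 1 < i" "r = gen i * gen j - gen j * gen i"
    | i where "1 \<le> i" "i + 1 < n" "r = gen i * gen (i + 1) * gen i - gen (i + 1) * gen i * gen (i + 1)"
    unfolding hecke_relators_def by (auto split: if_splits simp del: upt_Suc)
  then show ?thesis
  proof cases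
    case 1
    then show ?thesis using T_cyc by (simp add: free.val_prod_list comp_def free.val_diff del: upt_Suc)
  next
    case 2
    then show ?thesis using T_0101 by (simp add: free.val_diff free.val_mult)
  next
    case 3
    then show ?thesis using T_quad[of i] by (simp add: free.val_diff free.val_mult free.val_add del: upt_Suc)
  next
    case 4
    then show ?thesis using T_far[of i j] T_far[of j i] by (auto simp: free.val_diff free.val_mult)
  next
    case 5
    then show ?thesis using T_braid[of i] by (simp add: free.val_diff free.val_mult Suc_eq_plus1)
  qed
qed

lemma (in hecke_ring) val_ideal:
  assumes n: "1 \<le> n" and p: "p \<in> hecke_ideal ell n q Q"
  shows "free.val p = 0"
  by (rule hecke_ideal_minimal[where P = "\<lambda>p. free.val p = 0", OF n _ _ _ _ _ _ p])
    (simp_all add: val_relator free.val_add free.val_minus free.val_mult)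

section \<open>Semisimple rings are von Neumann regular\<close>

lemma left_idealD:
  assumes "left_ideal I R"
  shows "I \<subseteq> carrier R" "\<zero>\<^bsub>R\<^esub> \<in> I" "x \<in> I \<Longrightarrow> y \<in> I \<Longrightarrow> x \<oplus>\<^bsub>R\<^esub> y \<in> I" "a \<in> carrier R \<Longrightarrow> x \<in> I \<Longrightarrow> a \<otimes>\<^bsub>R\<^esub> x \<in> I"
proof -
  have a: "additive_subgroup I R" and m: "\<forall>a\<in>carrier R. \<forall>x\<in>I. a \<otimes>\<^bsub>R\<^esub> x \<in> I" using assms unfolding left_ideal_def by (rule conjunct1, rule conjunct2)
  show "I \<subseteq> carrier R" by (rule additive_subgroup.a_subset[OF a])
  show "\<zero>\<^bsub>R\<^esub> \<in> I" by (rule additive_subgroup.zero_closed[OF a])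
  show "x \<in> I \<Longrightarrow> y \<in> I \<Longrightarrow> x \<oplus>\<^bsub>R\<^esub> y \<in> I" by (rule additive_subgroup.a_closed[OF a])
  show "a \<in> carrier R \<Longrightarrow> x \<in> I \<Longrightarrow> a \<otimes>\<^bsub>R\<^esub> x \<in> I" using m by simp
qed

context ring
begin

lemma left_idealI:
  assumes "I \<subseteq> carrier R" "\<zero> \<in> I" "\<And>x y. x \<in> I \<Longrightarrow> y \<in> I \<Longrightarrow> x \<oplus> y \<in> I" "\<And>a x. a \<in> carrier R \<Longrightarrow> x \<in> I \<Longrightarrow> a \<otimes> x \<in> I"
  shows "left_ideal I R"
proof -
  have inv: "\<ominus> x \<in> I" if "x \<in> I" for x
  proof -
    have "x \<in> carrier R" using that assms(1) by blast
    then have "(\<ominus> \<one>) \<otimes> x = \<ominus> x" by (simp add: l_minus)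
    then show ?thesis using assms(4)[of "\<ominus> \<one>" x] that by simp
  qed
  have "subgroup I (add_monoid R)"
    by (rule subgroup.intro) (use assms(1-3) inv in \<open>auto simp: a_inv_def\<close>)
  then show ?thesis unfolding left_ideal_def using assms(4) by (simp add: additive_subgroup.intro)
qed

lemma left_ideal_minus: "left_ideal I R \<Longrightarrow> x \<in> I \<Longrightarrow> \<ominus> x \<in> I"
  using left_idealD(4)[of I R "\<ominus> \<one>" x] left_idealD(1)[of I R] l_minus[of \<one> x] by auto

lemma left_ideal_sum:
  assumes I: "left_ideal I R" and J: "left_ideal J R"
  shows "left_ideal {x \<oplus> y | x y. x \<in> I \<and> y \<in> J} R"
proof (rule left_idealI)
  note i = left_idealD[OF I] and j = left_idealD[OF J]
  show "{x \<oplus> y | x y. x \<in> I \<and> y \<in> J} \<subseteq> carrier R" using i(1) j(1) by auto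
  show "\<zero> \<in> {x \<oplus> y | x y. x \<in> I \<and> y \<in> J}" using i(2) j(2) by (intro CollectI exI[of _ \<zero>]) simp
  fix v assume "v \<in> {x \<oplus> y | x y. x \<in> I \<and> y \<in> J}"
  then obtain x y where v: "v = x \<oplus> y" "x \<in> I" "y \<in> J" by blast
  have c: "x \<in> carrier R" "y \<in> carrier R" using v i(1) j(1) by blast+
  show "a \<otimes> v \<in> {x \<oplus> y | x y. x \<in> I \<and> y \<in> J}" if "a \<in> carrier R" for a
    using i(4)[OF that v(2)] j(4)[OF that v(3)] r_distr[OF c that] v(1) by blast
  fix v' assume "v' \<in> {x \<oplus> y | x y. x \<in> I \<and> y \<in> J}"
  then obtain x' y' where v': "v' = x' \<oplus> y'" "x' \<in> I" "y' \<in> J" by blast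
  have c': "x' \<in> carrier R" "y' \<in> carrier R" using v' i(1) j(1) by blast+
  have "v \<oplus> v' = (x \<oplus> x') \<oplus> (y \<oplus> y')" unfolding v v' using c c' by (simp add: a_ac)
  then show "v \<oplus> v' \<in> {x \<oplus> y | x y. x \<in> I \<and> y \<in> J}" using i(3)[OF v(2) v'(2)] j(3)[OF v(3) v'(3)] by blast
qed

definition left_span :: "'a set set \<Rightarrow> 'a set" where
  "left_span \<S> = \<Inter>{J. left_ideal J R \<and> \<Union>\<S> \<subseteq> J}"

lemma left_span_least: "left_ideal J R \<Longrightarrow> \<Union>\<S> \<subseteq> J \<Longrightarrow> left_span \<S> \<subseteq> J"
  unfolding left_span_def by blast

lemma left_span_left_ideal:
  assumes "\<Union>\<S> \<subseteq> carrier R"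
  shows "left_ideal (left_span \<S>) R" "\<Union>\<S> \<subseteq> left_span \<S>"
proof -
  have "left_ideal (carrier R) R" by (rule left_idealI) auto
  then have "left_span \<S> \<subseteq> carrier R" using assms by (rule left_span_least)
  then show "left_ideal (left_span \<S>) R"
  proof (rule left_idealI)
    show "\<zero> \<in> left_span \<S>" unfolding left_span_def using left_idealD(2) by blast
    show "x \<oplus> y \<in> left_span \<S>" if "x \<in> left_span \<S>" "y \<in> left_span \<S>" for x y
      unfolding left_span_def
    proof
      fix J assume J: "J \<in> {J. left_ideal J R \<and> \<Union>\<S> \<subseteq> J}"
      then have "x \<in> J" "y \<in> J" using that unfolding left_span_def by blast+
      then show "x \<oplus> y \<in> J" using left_idealD(3)[of J R x y] J by simp
    qed
    show "a \<otimes> x \<in> left_span \<S>" if "a \<in> carrier R" "x \<in> left_span \<S>" for a x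
      unfolding left_span_def
    proof
      fix J assume J: "J \<in> {J. left_ideal J R \<and> \<Union>\<S> \<subseteq> J}"
      then have "x \<in> J" using that unfolding left_span_def by blast
      then show "a \<otimes> x \<in> J" using left_idealD(4)[of J R a x] J that by simp
    qed
  qed
  show "\<Union>\<S> \<subseteq> left_span \<S>" unfolding left_span_def by blast
qed

lemma left_ideal_finsum:
  assumes I: "left_ideal I R" and "finite A" "\<And>x. x \<in> A \<Longrightarrow> f x \<in> I"
  shows "(\<Oplus>x\<in>A. f x) \<in> I"
  using assms(2,3)
proof (induction A rule: finite_induct)
  case empty then show ?case using left_idealD(2)[OF I] by simp
next
  case (insert x A)
  have "f \<in> insert x A \<rightarrow> carrier R" using insert.prems left_idealD(1)[OF I] by blast
  then have "(\<Oplus>x\<in>insert x A. f x) = f x \<oplus> (\<Oplus>x\<in>A. f x)" using insert.hyps by (intro finsum_insert) auto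
  then show ?case using insert left_idealD(3)[OF I, of "f x" "\<Oplus>x\<in>A. f x"] by simp
qed

text \<open>The left ideal generated by \<open>u\<close> has a complement: the sum of as many of the simple ideals as
  possible without meeting it. The component of \<open>1\<close> in the left ideal is the required multiple
  of \<open>u\<close>.\<close>
lemma semisimple_regular:
  assumes ss: "semisimple_ring R" and u: "u \<in> carrier R"
  shows "\<exists>y\<in>carrier R. u = u \<otimes> y \<otimes> u"
proof -
  obtain S where fS: "finite S" and mS: "\<forall>M\<in>S. minimal_left_ideal M R"
    and dS: "\<forall>x\<in>carrier R. \<exists>!y. y \<in> (\<Pi>\<^sub>E M\<in>S. M) \<and> x = (\<Oplus>M\<in>S. y M)"
    using ss unfolding semisimple_ring_def by (elim conjE exE)
  have S: "finite S" "\<And>M. M \<in> S \<Longrightarrow> minimal_left_ideal M R" using fS mS by simp_all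
  have dec: "\<exists>y. y \<in> (\<Pi>\<^sub>E M\<in>S. M) \<and> x = (\<Oplus>M\<in>S. y M)" if "x \<in> carrier R" for x
    by (rule ex1_implies_ex[OF bspec[OF dS that]])
  have Sl: "left_ideal M R" if "M \<in> S" for M using S(2)[OF that] unfolding minimal_left_ideal_def by blast
  have US: "\<Union>\<S> \<subseteq> carrier R" if "\<S> \<subseteq> S" for \<S> using that left_idealD(1)[OF Sl] by blast
  define I where "I = {a \<otimes> u | a. a \<in> carrier R}"
  have I: "left_ideal I R"
  proof (rule left_idealI)
    show "I \<subseteq> carrier R" using u by (auto simp: I_def)
    show "\<zero> \<in> I" unfolding I_def by (intro CollectI exI[of _ \<zero>]) (use u in simp)
    show "x \<oplus> y \<in> I" if "x \<in> I" "y \<in> I" for x y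
    proof -
      obtain a b where ab: "x = a \<otimes> u" "a \<in> carrier R" "y = b \<otimes> u" "b \<in> carrier R" using \<open>x \<in> I\<close> \<open>y \<in> I\<close> unfolding I_def by blast
      then show ?thesis unfolding I_def by (intro CollectI exI[of _ "a \<oplus> b"]) (use u in \<open>simp add: l_distr\<close>)
    qed
    show "a \<otimes> x \<in> I" if "a \<in> carrier R" "x \<in> I" for a x
    proof -
      obtain b where b: "x = b \<otimes> u" "b \<in> carrier R" using \<open>x \<in> I\<close> unfolding I_def by blast
      then show ?thesis unfolding I_def by (intro CollectI exI[of _ "a \<otimes> b"]) (use u that in \<open>simp add: m_assoc\<close>)
    qed
  qed
  have uI: "u \<in> I" unfolding I_def by (intro CollectI exI[of _ \<one>]) (use u in simp)
  define \<F> where "\<F> = {\<S>. \<S> \<subseteq> S \<and> I \<inter> left_span \<S> = {\<zero>}}"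
  have "finite \<F>" unfolding \<F>_def by (rule finite_subset[of _ "Pow S"]) (use S(1) in auto)
  moreover have "{} \<in> \<F>"
  proof -
    have "left_ideal {\<zero>} R" by (rule left_idealI) auto
    then have "left_span {} \<subseteq> {\<zero>}" by (rule left_span_least) simp
    moreover have "\<zero> \<in> left_span {}" using left_span_left_ideal(1)[of "{}"] left_idealD(2) by blast
    ultimately show ?thesis unfolding \<F>_def using left_idealD(2)[OF I] by blast
  qed
  ultimately obtain \<S> where \<S>: "\<S> \<in> \<F>" and max: "\<And>\<S>'. \<S>' \<in> \<F> \<Longrightarrow> \<S> \<subseteq> \<S>' \<Longrightarrow> \<S> = \<S>'"
    using finite_has_maximal[of \<F>] by blast
  have sub: "\<S> \<subseteq> S" and zero: "I \<inter> left_span \<S> = {\<zero>}" using \<S> unfolding \<F>_def by blast+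
  note N = left_span_left_ideal[OF US[OF sub]]
  define P where "P = {x \<oplus> y | x y. x \<in> I \<and> y \<in> left_span \<S>}"
  have P: "left_ideal P R" unfolding P_def by (rule left_ideal_sum[OF I N(1)])
  have IP: "x \<in> P" if "x \<in> I" for x
    unfolding P_def using that left_idealD(2)[OF N(1)] left_idealD(1)[OF I] by (intro CollectI exI[of _ x] exI[of _ \<zero>]) auto
  have NP: "x \<in> P" if "x \<in> left_span \<S>" for x
    unfolding P_def using that left_idealD(2)[OF I] left_idealD(1)[OF N(1)] by (intro CollectI exI[of _ \<zero>] exI[of _ x]) auto
  have MP: "M \<subseteq> P" if M: "M \<in> S" for M
  proof (cases "M \<in> \<S>")
    case True
    then show ?thesis using N(2) NP by blast
  next
    case False
    note Ml = Sl[OF M]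
    let ?Q = "{x \<oplus> y | x y. x \<in> left_span \<S> \<and> y \<in> M}"
    have Q: "left_ideal ?Q R" by (rule left_ideal_sum[OF N(1) Ml])
    have "\<Union>(insert M \<S>) \<subseteq> ?Q"
    proof
      fix x assume "x \<in> \<Union>(insert M \<S>)"
      then consider "x \<in> M" | "x \<in> left_span \<S>" using N(2) by blast
      then show "x \<in> ?Q"
      proof cases
        case 1 then show ?thesis using left_idealD(2)[OF N(1)] left_idealD(1)[OF Ml] by (intro CollectI exI[of _ \<zero>] exI[of _ x]) auto
      next
        case 2 then show ?thesis using left_idealD(2)[OF Ml] left_idealD(1)[OF N(1)] by (intro CollectI exI[of _ x] exI[of _ \<zero>]) auto
      qed
    qed
    then have hQ: "left_span (insert M \<S>) \<subseteq> ?Q" by (rule left_span_least[OF Q])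
    have sub': "insert M \<S> \<subseteq> S" using sub M by blast
    have "insert M \<S> \<notin> \<F>" using max[of "insert M \<S>"] False by blast
    then have "I \<inter> left_span (insert M \<S>) \<noteq> {\<zero>}" using sub' unfolding \<F>_def by blast
    moreover have "\<zero> \<in> I \<inter> left_span (insert M \<S>)"
      using left_idealD(2)[OF I] left_idealD(2)[OF left_span_left_ideal(1)[OF US[OF sub']]] by blast
    ultimately obtain x where x: "x \<in> I" "x \<in> ?Q" "x \<noteq> \<zero>" using hQ by blast
    then obtain p m where pm: "x = p \<oplus> m" "p \<in> left_span \<S>" "m \<in> M" by blast
    have c: "p \<in> carrier R" "m \<in> carrier R" using pm left_idealD(1)[OF N(1)] left_idealD(1)[OF Ml] by blast+
    have m0: "m \<noteq> \<zero>"
    proof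
      assume "m = \<zero>"
      then have "x \<in> I \<inter> left_span \<S>" using x pm c by simp
      then show False using zero x(3) by blast
    qed
    have "m = x \<oplus> (\<ominus> p)" unfolding pm(1) using c by (simp add: a_ac r_neg)
    then have "m \<in> P" using x(1) left_ideal_minus[OF N(1) pm(2)] unfolding P_def by blast
    have "left_ideal (P \<inter> M) R"
    proof (rule left_idealI)
      show "P \<inter> M \<subseteq> carrier R" using left_idealD(1)[OF P] by (rule le_infI1)
      show "\<zero> \<in> P \<inter> M" using left_idealD(2)[OF P] left_idealD(2)[OF Ml] by (rule IntI)
      show "x \<oplus> y \<in> P \<inter> M" if "x \<in> P \<inter> M" "y \<in> P \<inter> M" for x y
        using left_idealD(3)[OF P, of x y] left_idealD(3)[OF Ml, of x y] that by simp
      show "b \<otimes> x \<in> P \<inter> M" if "b \<in> carrier R" "x \<in> P \<inter> M" for b x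
        using left_idealD(4)[OF P, of b x] left_idealD(4)[OF Ml, of b x] that by simp
    qed
    then have "P \<inter> M = {\<zero>} \<or> P \<inter> M = M" using S(2)[OF M] unfolding minimal_left_ideal_def by blast
    then show ?thesis using \<open>m \<in> P\<close> pm(3) m0 by blast
  qed
  obtain y where y: "y \<in> (\<Pi>\<^sub>E M\<in>S. M)" "\<one> = (\<Oplus>M\<in>S. y M)" using dec[of \<one>] by blast
  have "(\<Oplus>M\<in>S. y M) \<in> P" by (rule left_ideal_finsum[OF P S(1)]) (use y(1) MP in \<open>auto simp: PiE_def Pi_def\<close>)
  then have "\<one> \<in> P" using y(2) by simp
  then obtain a p where ap: "\<one> = a \<otimes> u \<oplus> p" "a \<in> carrier R" "p \<in> left_span \<S>" unfolding P_def I_def by blast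
  have pc: "p \<in> carrier R" using ap(3) left_idealD(1)[OF N(1)] by blast
  have "u \<otimes> \<one> = u \<otimes> (a \<otimes> u) \<oplus> u \<otimes> p" unfolding ap(1) using u ap(2) pc by (simp add: r_distr)
  then have eq: "u = (u \<otimes> a \<otimes> u) \<oplus> u \<otimes> p" using u ap(2) by (simp add: m_assoc)
  have up: "u \<otimes> p \<in> left_span \<S>" using left_idealD(4)[OF N(1) u ap(3)] .
  have uauI: "u \<otimes> a \<otimes> u \<in> I" unfolding I_def using u ap(2) by (intro CollectI exI[of _ "u \<otimes> a"]) simp
  have "u \<otimes> p = u \<oplus> (\<ominus> (u \<otimes> a \<otimes> u))"
  proof -
    have "u \<otimes> p = ((u \<otimes> a \<otimes> u) \<oplus> u \<otimes> p) \<oplus> (\<ominus> (u \<otimes> a \<otimes> u))"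
      using u ap(2) pc by (simp add: a_ac r_neg)
    then show ?thesis unfolding eq[symmetric] .
  qed
  then have "u \<otimes> p \<in> I" using left_idealD(3)[OF I uI left_ideal_minus[OF I uauI]] by simp
  then have "u \<otimes> p = \<zero>" using up zero by blast
  then have "u = u \<otimes> a \<otimes> u" using eq u ap(2) by simp
  then show ?thesis using ap(2) by blast
qed

end

lemma hecke_class_eq_iff:
  assumes n: "1 \<le> n" and x: "x \<in> words n" and y: "y \<in> words n"
  shows "hecke_class ell n q Q x = hecke_class ell n q Q y \<longleftrightarrow> x - y \<in> hecke_ideal ell n q Q"
proof -
  let ?J = "hecke_ideal ell n q Q" and ?R = "free_algebra n"
  interpret ideal ?J ?R by (rule hecke_ideal_ideal[OF n])
  have coset: "?J +>\<^bsub>?R\<^esub> v = {h + v | h. h \<in> ?J}" for v unfolding a_r_coset_def' fa_simps(4) by blast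
  show ?thesis
  proof
    assume "hecke_class ell n q Q x = hecke_class ell n q Q y"
    then have "x \<in> {h + y | h. h \<in> ?J}"
      using a_rcos_self[OF x] unfolding hecke_class_def coset by simp
    then show "x - y \<in> ?J" by auto
  next
    assume xy: "x - y \<in> ?J"
    have sum: "a + b \<in> ?J" if "a \<in> ?J" "b \<in> ?J" for a b 
      using additive_subgroup.a_closed[OF ideal.axioms(1)[OF hecke_ideal_ideal[OF n]] that] by (simp only: fa_simps(4))
    have neg: "- a \<in> ?J" if "a \<in> ?J" for a
    proof -
      have "a \<in> carrier ?R" using that by (rule Icarr)
      then show ?thesis using additive_subgroup.a_inv_closed[OF ideal.axioms(1)[OF hecke_ideal_ideal[OF n]] that] fa_minus[of a n] by (simp only:)
    qed
    have "y - x \<in> ?J" using neg[OF xy] by simp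
    have "h + x \<in> {h + y | h. h \<in> ?J}" if "h \<in> ?J" for h
      using sum[OF that xy] by (intro CollectI exI[of _ "h + (x - y)"]) simp
    moreover have "h + y \<in> {h + x | h. h \<in> ?J}" if "h \<in> ?J" for h
      using sum[OF that \<open>y - x \<in> ?J\<close>] by (intro CollectI exI[of _ "h + (y - x)"]) simp
    ultimately show "hecke_class ell n q Q x = hecke_class ell n q Q y"
      unfolding hecke_class_def coset by blast
  qed
qed

lemma hecke_class_mult:
  assumes n: "1 \<le> n" and x: "x \<in> words n" and y: "y \<in> words n"
  shows "hecke_class ell n q Q x \<otimes>\<^bsub>hecke_algebra ell n q Q\<^esub> hecke_class ell n q Q y = hecke_class ell n q Q (x * y)"
    "hecke_class ell n q Q x \<in> carrier (hecke_algebra ell n q Q)"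
proof -
  interpret ideal "hecke_ideal ell n q Q" "free_algebra n" by (rule hecke_ideal_ideal[OF n])
  note h = rcos_ring_hom
  show "hecke_class ell n q Q x \<otimes>\<^bsub>hecke_algebra ell n q Q\<^esub> hecke_class ell n q Q y = hecke_class ell n q Q (x * y)"
    unfolding hecke_class_def hecke_algebra_def using ring_hom_mult[OF h x y] by simp
  show "hecke_class ell n q Q x \<in> carrier (hecke_algebra ell n q Q)"
    unfolding hecke_class_def hecke_algebra_def using ring_hom_closed[OF h x] .
qed

lemma hecke_carrierE:
  assumes n: "1 \<le> n" and c: "c \<in> carrier (hecke_algebra ell n q Q)"
  obtains x where "x \<in> words n" "c = hecke_class ell n q Q x"
  using c unfolding hecke_algebra_def FactRing_simps hecke_class_def by auto

lemma hecke_regular: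
  assumes n: "1 \<le> n" and ss: "semisimple_ring (hecke_algebra ell n q Q)" and u: "u \<in> words n"
  obtains y where "y \<in> words n" "u - u * y * u \<in> hecke_ideal ell n q Q"
proof -
  let ?c = "hecke_class ell n q Q" and ?H = "hecke_algebra ell n q Q"
  have "ring ?H" using ss unfolding semisimple_ring_def by blast
  from ring.semisimple_regular[OF this ss hecke_class_mult(2)[OF n u u]]
  obtain c where c: "c \<in> carrier ?H" "?c u = ?c u \<otimes>\<^bsub>?H\<^esub> c \<otimes>\<^bsub>?H\<^esub> ?c u" by blast
  obtain y where y: "y \<in> words n" "c = ?c y" by (rule hecke_carrierE[OF n c(1)])
  have "?c u = ?c (u * y * u)"
    using c(2) unfolding y(2) hecke_class_mult(1)[OF n u y(1)] hecke_class_mult(1)[OF n fa_mult[OF u y(1)] u] .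
  then have "u - u * y * u \<in> hecke_ideal ell n q Q"
    using hecke_class_eq_iff[OF n u fa_mult[OF fa_mult[OF u y(1)] u]] by blast
  then show ?thesis using that y(1) by blast
qed

section \<open>Rings of additive endomorphisms\<close>

typedef (overloaded) 'v endo = "{f :: 'v::{ab_group_add, zero_neq_one} \<Rightarrow> 'v. \<forall>x y. f (x + y) = f x + f y}"
  morphisms app Endo
proof
  show "id \<in> {f :: 'v \<Rightarrow> 'v. \<forall>x y. f (x + y) = f x + f y}" by simp
qed

lemma app_add: "app f (x + y) = app f x + app f y"
  using app[of f] by blast

lemma app_zero [simp]: "app f 0 = 0"
  using app_add[of f 0 0] by simp

lemma app_Endo: "(\<And>x y. f (x + y) = f x + f y) \<Longrightarrow> app (Endo f) v = f v"
  by (subst Endo_inverse) auto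

lemma endo_eqI: "(\<And>v. app f v = app g v) \<Longrightarrow> f = g"
  by (rule app_inject[THEN iffD1]) (rule ext)

instantiation endo :: ("{ab_group_add, zero_neq_one}") ring_1
begin

definition "0 = Endo (\<lambda>_. 0)"
definition "1 = Endo (\<lambda>v. v)"
definition "f + g = Endo (\<lambda>v. app f v + app g v)"
definition "- f = Endo (\<lambda>v. - app f v)"
definition "f - g = Endo (\<lambda>v. app f v - app g v)"
definition "f * g = Endo (\<lambda>v. app f (app g v))"

lemma app_zero_endo: "app 0 v = 0"
  unfolding zero_endo_def by (rule app_Endo) simp
lemma app_one_endo: "app 1 v = v"
  unfolding one_endo_def by (rule app_Endo) simp
lemma app_plus_endo: "app (f + g) v = app f v + app g v"
  unfolding plus_endo_def by (rule app_Endo) (simp add: app_add)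
lemma app_uminus_endo: "app (- f) v = - app f v"
  unfolding uminus_endo_def by (rule app_Endo) (simp add: app_add)
lemma app_minus_endo: "app (f - g) v = app f v - app g v"
  unfolding minus_endo_def by (rule app_Endo) (simp add: app_add)
lemma app_times_endo: "app (f * g) v = app f (app g v)"
  unfolding times_endo_def by (rule app_Endo) (simp add: app_add)

lemmas app_simps = app_zero_endo app_one_endo app_plus_endo app_uminus_endo app_minus_endo app_times_endo

instance
proof
  show "(0 :: 'a endo) \<noteq> 1"
  proof
    assume "(0 :: 'a endo) = 1"
    then have "app (0 :: 'a endo) 1 = app 1 1" by simp
    then show False by (simp add: app_simps)
  qed
qed (rule endo_eqI, simp add: app_simps app_add)+

end

lemmas endo_simps [simp] = app_simps

lemma sum_app: "app (sum f A) v = (\<Sum>x\<in>A. app (f x) v)"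
  by (induction A rule: infinite_finite_induct) simp_all

section \<open>Semisimplicity separates the parameters\<close>

text \<open>If \<open>u\<close> maps some vector to a common eigenvector of the generators that \<open>u\<close> kills, then \<open>u\<close> has
  no quasi-inverse.\<close>
lemma nonsemisimple_criterion:
  fixes sc :: "'k::field \<Rightarrow> 'v::{ab_group_add, zero_neq_one} endo" and T :: "nat \<Rightarrow> 'v endo"
  assumes H: "hecke_ring ell n q Q sc T" and n: "1 \<le> n" and u: "u \<in> words n"
    and eig: "\<And>i. i < n \<Longrightarrow> app (T i) z = app (sc (c i)) z"
    and z: "app (evaluation.val sc T u) e = z" "z \<noteq> 0" and uz: "app (evaluation.val sc T u) z = 0"
  shows "\<not> semisimple_ring (hecke_algebra ell n q Q)"
proof
  interpret hecke_ring ell n q Q sc T by (rule H)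
  assume "semisimple_ring (hecke_algebra ell n q Q)"
  then obtain y where y: "y \<in> words n" "u - u * y * u \<in> hecke_ideal ell n q Q"
    by (rule hecke_regular[OF n _ u])
  have word: "\<exists>d. app (prod_list (map T is)) z = app (sc d) z" if "set is \<subseteq> {..<n}" for "is"
    using that
  proof (induction "is")
    case Nil show ?case by (intro exI[of _ 1]) simp
  next
    case (Cons i "is")
    then obtain d where d: "app (prod_list (map T is)) z = app (sc d) z" by auto
    have "app (prod_list (map T (i # is))) z = app (T i * sc d) z" using d by simp
    also have "\<dots> = app (sc d) (app (T i) z)" unfolding T_sc by simp
    also have "\<dots> = app (sc (d * c i)) z" using eig[of i] Cons.prems by (simp add: sc_mult)
    finally show ?case by blast
  qed
  have "\<exists>d. app (free.val y) z = app (sc d) z"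
  proof -
    obtain d where d: "\<And>w. w \<in> pkeys y \<Longrightarrow> app (prod_list (map T (letters w))) z = app (sc (d w)) z"
    proof -
      have "\<forall>w\<in>pkeys y. \<exists>d. app (prod_list (map T (letters w))) z = app (sc d) z"
        using word y(1) unfolding fa_carrier by blast
      from bchoice[OF this] show ?thesis using that by blast
    qed
    have "app (free.val y) z = (\<Sum>w\<in>pkeys y. app (sc (plookup y w * d w)) z)"
      unfolding free.val_def sum_app by (rule sum.cong[OF refl]) (simp add: d sc_mult)
    also have "\<dots> = app (sc (\<Sum>w\<in>pkeys y. plookup y w * d w)) z"
      by (simp add: sc_sum sum_app)
    finally show ?thesis by blast
  qed
  then obtain d where d: "app (free.val y) z = app (sc d) z" by blast
  have "free.val u = free.val u * free.val y * free.val u"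
    using val_ideal[OF n y(2)] by (simp add: free.val_diff free.val_mult)
  then have "z = app (free.val u * free.val y * free.val u) e" using z(1) by simp
  also have "\<dots> = app (free.val u * sc d) z" using z(1) d by simp
  also have "free.val u * sc d = sc d * free.val u"
    using free.val_mult[of u "scal d"] free.val_mult[of "scal d" u]
  proof -
    have "scal_comm (free.val u)"
      unfolding free.val_def by (intro scal_comm_sum scal_comm_intros scal_comm_prod_list) auto
    then show ?thesis unfolding scal_comm_def by blast
  qed
  also have "app (sc d * free.val u) z = 0" using uz by simp
  finally show False using z(2) by simp
qed

definition scale_fun :: "'k::field \<Rightarrow> (('b \<Rightarrow> 'k)) endo" where
  "scale_fun c = Endo (\<lambda>f w. c * f w)"

text \<open>The action of the Hecke algebra of type A on a tensor power, written on functions of words.\<close>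
definition word_T :: "'k::field \<Rightarrow> nat \<Rightarrow> ((nat \<Rightarrow> 'o::linorder) \<Rightarrow> 'k) endo" where
  "word_T q i = Endo (\<lambda>f w. if w i < w (Suc i) then f (w \<circ> sperm i) else if w i = w (Suc i) then q * f w
     else q * f (w \<circ> sperm i) + (q - 1) * f w)"

lemma app_scale_fun [simp]: "app (scale_fun c) f w = c * f w"
proof -
  have "app (scale_fun c) f = (\<lambda>w. c * f w)"
    unfolding scale_fun_def by (rule app_Endo) (simp add: fun_eq_iff distrib_left)
  then show ?thesis by simp
qed

lemma app_word_T: "app (word_T q i) f w = (if w i < w (Suc i) then f (w \<circ> sperm i) else if w i = w (Suc i) then q * f w
     else q * f (w \<circ> sperm i) + (q - 1) * f w)"
proof -
  have "app (word_T q i) f = (\<lambda>w. if w i < w (Suc i) then f (w \<circ> sperm i) else if w i = w (Suc i) then q * f w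
     else q * f (w \<circ> sperm i) + (q - 1) * f w)"
    unfolding word_T_def by (rule app_Endo) (simp add: fun_eq_iff algebra_simps)
  then show ?thesis by simp
qed

lemma scale_fun_hom: "scale_fun (a + b) = scale_fun a + scale_fun b" "scale_fun (a * b) = scale_fun a * scale_fun b"
  "scale_fun 1 = 1"
  by (rule endo_eqI, rule ext, simp add: algebra_simps)+

lemma word_T_sc: "word_T q i * scale_fun c = scale_fun c * word_T q i"
  by (rule endo_eqI, rule ext) (simp add: app_word_T algebra_simps)

lemma word_T_quad:
  fixes q :: "'k::field"
  shows "(word_T q i - scale_fun q) * (word_T q i + 1) = (0 :: ((nat \<Rightarrow> 'o::linorder) \<Rightarrow> 'k) endo)"
proof (rule endo_eqI, rule ext)
  fix f :: "(nat \<Rightarrow> 'o) \<Rightarrow> 'k" and w :: "nat \<Rightarrow> 'o"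
  show "app ((word_T q i - scale_fun q) * (word_T q i + 1)) f w = app 0 f w"
    by (cases "w i" "w (Suc i)" rule: linorder_cases) (simp_all add: app_word_T algebra_simps less_imp_not_eq less_imp_not_eq2 less_not_sym)
qed

lemma word_T_far:
  fixes q :: "'k::field"
  assumes "Suc i < j"
  shows "word_T q i * word_T q j = (word_T q j * word_T q i :: ((nat \<Rightarrow> 'o::linorder) \<Rightarrow> 'k) endo)"
proof (rule endo_eqI, rule ext)
  fix f :: "(nat \<Rightarrow> 'o) \<Rightarrow> 'k" and w :: "nat \<Rightarrow> 'o"
  have e: "w \<circ> sperm j \<circ> sperm i = w \<circ> sperm i \<circ> sperm j"
    unfolding comp_assoc sperm_far_commute[OF assms] ..
  have s: "sperm i j = j" "sperm i (Suc j) = Suc j" "sperm j i = i" "sperm j (Suc i) = Suc i" using assms by simp_all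
  show "app (word_T q i * word_T q j) f w = app (word_T q j * word_T q i) f w"
    by (cases "w i" "w (Suc i)" rule: linorder_cases; cases "w j" "w (Suc j)" rule: linorder_cases)
      (simp_all add: app_word_T s e algebra_simps less_imp_not_eq less_imp_not_eq2 less_not_sym)
qed

lemma word_T_braid:
  fixes q :: "'k::field"
  shows "word_T q i * word_T q (Suc i) * word_T q i =
    (word_T q (Suc i) * word_T q i * word_T q (Suc i) :: ((nat \<Rightarrow> 'o::linorder) \<Rightarrow> 'k) endo)"
proof (rule endo_eqI, rule ext)
  fix f :: "(nat \<Rightarrow> 'o) \<Rightarrow> 'k" and w :: "nat \<Rightarrow> 'o"
  define p where "p w = w \<circ> sperm i" for w :: "nat \<Rightarrow> 'o"
  define r where "r w = w \<circ> sperm (Suc i)" for w :: "nat \<Rightarrow> 'o"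
  have v: "p w i = w (Suc i)" "p w (Suc i) = w i" "p w (Suc (Suc i)) = w (Suc (Suc i))"
    "r w i = w i" "r w (Suc i) = w (Suc (Suc i))" "r w (Suc (Suc i)) = w (Suc i)" "p (p w) = w" "r (r w) = w"
    "p (r (p w)) = r (p (r w))" for w
    using sperm_braid[of i] by (simp_all add: p_def r_def comp_assoc)
  have T: "app (word_T q i) f w = (if w i < w (Suc i) then f (p w) else if w i = w (Suc i) then q * f w
     else q * f (p w) + (q - 1) * f w)" 
    "app (word_T q (Suc i)) f w = (if w (Suc i) < w (Suc (Suc i)) then f (r w) else if w (Suc i) = w (Suc (Suc i)) then q * f w
     else q * f (r w) + (q - 1) * f w)" for f w
    by (simp_all add: app_word_T p_def r_def)
  have pe: "p w = w" if "w i = w (Suc i)" for w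
  proof
    fix k show "p w k = w k" using that by (cases "k = i"; cases "k = Suc i") (simp_all add: p_def)
  qed
  have re: "r w = w" if "w (Suc i) = w (Suc (Suc i))" for w
  proof
    fix k show "r w k = w k" using that by (cases "k = Suc i"; cases "k = Suc (Suc i)") (simp_all add: r_def)
  qed
  show "app (word_T q i * word_T q (Suc i) * word_T q i) f w = app (word_T q (Suc i) * word_T q i * word_T q (Suc i)) f w"
    by (cases "w i" "w (Suc i)" rule: linorder_cases; cases "w (Suc i)" "w (Suc (Suc i))" rule: linorder_cases;
        cases "w i" "w (Suc (Suc i))" rule: linorder_cases)
      (use pe[of w] re[of w] in \<open>simp_all add: T v algebra_simps less_imp_not_eq less_imp_not_eq2 less_not_sym\<close>)
qed

lemma prod_list_two_factors:
  fixes g :: "nat \<Rightarrow> 'a::ring_1"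
  assumes comm: "\<And>a b. g a * g b = g b * g a" and ij: "i \<in> set xs" "j \<in> set xs" "i \<noteq> j" and zero: "g i * g j = 0"
  shows "prod_list (map g xs) = 0"
proof -
  have c: "g a * prod_list (map g ys) = prod_list (map g ys) * g a" for a ys
  proof (induction ys)
    case (Cons b ys)
    show ?case unfolding list.map prod_list.Cons by (metis Cons.IH comm[of a b] mult.assoc)
  qed simp
  have pull: "\<exists>r. prod_list (map g ys) = g a * r" if "a \<in> set ys" for a ys
    using that
  proof (induction ys)
    case (Cons b ys)
    show ?case
    proof (cases "a = b")
      case True then show ?thesis by auto
    next
      case False
      then obtain r where "prod_list (map g ys) = g a * r" using Cons by auto
      then have "prod_list (map g (b # ys)) = g a * (g b * r)"
        by (simp add: comm[of b a] flip: mult.assoc)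
      then show ?thesis by blast
    qed
  qed simp
  obtain ys zs where xs: "xs = ys @ i # zs" using split_list[OF ij(1)] by blast
  have j: "j \<in> set (ys @ zs)" using ij(2,3) unfolding xs by auto
  obtain r where r: "prod_list (map g (ys @ zs)) = g j * r" using pull[OF j] by blast
  have "prod_list (map g xs) = g i * prod_list (map g (ys @ zs))"
    unfolding xs by (simp add: c[of i ys] flip: mult.assoc)
  also have "\<dots> = (g i * g j) * r" unfolding r by (simp add: mult.assoc)
  finally show ?thesis unfolding zero by simp
qed

text \<open>If \<open>q\<^sup>d = 1\<close>, the Poincare polynomial of the symmetric group vanishes at \<open>q\<close>, so the sum of all
  \<open>T\<^sub>w\<close> has square zero where \<open>T\<^sub>0\<close> is a scalar. It does not act by zero on the word \<open>1, 2, \<dots>\<close>.\<close>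
lemma semisimple_q_pow:
  fixes q :: "'k::field"
  assumes ell: "1 \<le> ell" and n: "1 \<le> n" and q: "q \<noteq> 0" "q \<noteq> 1"
    and ss: "semisimple_ring (hecke_algebra ell n q Q)" and d: "1 \<le> d" "d \<le> n"
  shows "q ^ d \<noteq> 1"
proof
  assume qd: "q ^ d = 1"
  define T :: "nat \<Rightarrow> ((nat \<Rightarrow> nat) \<Rightarrow> 'k) endo" where "T i = (if i = 0 then scale_fun (Q 1) else word_T q i)" for i
  have T: "T 0 = scale_fun (Q 1)" "\<And>i. 1 \<le> i \<Longrightarrow> T i = word_T q i" by (simp_all add: T_def)
  have H: "hecke_ring ell n q Q scale_fun T"
  proof
    show "q \<noteq> 0" by (rule q(1))
    show "scale_fun (a + b) = scale_fun a + scale_fun b" "scale_fun (a * b) = scale_fun a * scale_fun b" "scale_fun 1 = 1" for a b :: 'k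
      by (rule scale_fun_hom)+
    have ss: "scale_fun a * scale_fun b = scale_fun b * scale_fun a" for a b :: 'k
      by (simp only: scale_fun_hom(2)[symmetric] mult.commute)
    show "T i * scale_fun c = scale_fun c * T i" for i c
      by (cases "i = 0") (simp_all only: T_def if_True if_False simp_thms ss word_T_sc)
    have "[1..<Suc ell] = 1 # [Suc 1..<Suc ell]" by (rule upt_rec[THEN trans]) (use ell in simp)
    then have "prod_list (map (\<lambda>c. T 0 - scale_fun (Q c)) [1..<Suc ell]) =
        (T 0 - scale_fun (Q 1)) * prod_list (map (\<lambda>c. T 0 - scale_fun (Q c)) [Suc 1..<Suc ell])"
      by (simp only: list.map prod_list.Cons)
    then show "prod_list (map (\<lambda>c. T 0 - scale_fun (Q c)) [1..<Suc ell]) = 0" unfolding T(1) by simp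
    have T0: "T 0 * T i = T i * T 0" for i
      by (cases "i = 0") (simp_all only: T_def if_True if_False simp_thms word_T_sc)
    show "T 0 * T 1 * T 0 * T 1 = T 1 * T 0 * T 1 * T 0" 
    proof -
      have "T 0 * T 1 * T 0 * T 1 = (T 0 * T 1) * (T 0 * T 1)" by (simp only: mult.assoc)
      also have "\<dots> = (T 1 * T 0) * (T 1 * T 0)" unfolding T0[of 1] ..
      also have "\<dots> = T 1 * T 0 * T 1 * T 0" by (simp only: mult.assoc)
      finally show ?thesis .
    qed
    show "(T i - scale_fun q) * (T i + 1) = 0" if "1 \<le> i" for i using T(2)[OF that] word_T_quad by simp
    show "T i * T j = T j * T i" if "Suc i < j" for i j
    proof (cases "i = 0")
      case True then show ?thesis by (simp only: T0)
    next
      case False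
      then show ?thesis using that word_T_far[OF that] T(2)[of i] T(2)[of j] by simp
    qed
    show "T i * T (Suc i) * T i = T (Suc i) * T i * T (Suc i)" if "1 \<le> i" for i
      using word_T_braid T(2)[of i] T(2)[of "Suc i"] that by simp
  qed
  interpret hecke_ring ell n q Q scale_fun T by (rule H)
  let ?one = "\<lambda>_::nat. 0::nat"
  let ?S = "block_perms n ?one"
  define u :: "word \<Rightarrow>\<^sub>0 'k" where "u = (\<Sum>w\<in>?S. prod_list (map gen (SOME is. is \<in> reduced_words n w)))"
  have S: "w permutes {1..n}" if "w \<in> ?S" for w using that unfolding block_perms_def by blast
  have uc: "u \<in> words n"
    unfolding u_def
  proof (rule fa_sum)
    fix w assume "w \<in> ?S"
    then obtain "is" where "is \<in> reduced_words n w" using reduced_words_exist[OF S] by blast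
    then have "(SOME is. is \<in> reduced_words n w) \<in> reduced_words n w" by (rule someI)
    then show "prod_list (map gen (SOME is. is \<in> reduced_words n w)) \<in> words n"
      using reduced_words_iff by (intro fa_gens) auto
  qed
  have vu: "free.val u = sym ?one"
    unfolding u_def free.val_sum free.val_gens sym_def T_of_def word_prod_def ..
  have Tu: "T i * sym ?one = scale_fun q * sym ?one" if "1 \<le> i" "i < n" for i by (rule T_sym[OF that refl])
  define e :: "(nat \<Rightarrow> nat) \<Rightarrow> 'k" where "e w = (if w = id then 1 else 0)" for w
  have at_id: "app (T_of w) f id = f (pinv w)" if "w permutes {1..n}" for w f
    using that
  proof (induction "inv_count n (pinv w)" arbitrary: w f rule: less_induct)
    case less
    have pv: "pinv w permutes {1..n}" using permutes_inv[OF less.prems] .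
    show ?case using pv
    proof (cases rule: permutes_eq_id_or_descent)
      case 1
      then have "w = id" using permutes_inv_inv[OF less.prems] by (metis inv_id)
      then show ?thesis by (simp only: T_of_id endo_simps inv_id)
    next
      case (2 i)
      let ?u = "sperm i \<circ> w"
      have pu: "?u permutes {1..n}" using permutes_compose[OF less.prems sperm_permutes[OF 2(1,2)]] .
      have iu: "pinv ?u = pinv w \<circ> sperm i"
        using o_inv_distrib[OF bij_sperm permutes_bij[OF less.prems], of i] by simp
      have asc: "pinv ?u i < pinv ?u (Suc i)" unfolding iu using 2(3) by simp
      have w: "sperm i \<circ> ?u = w" by (rule comp_sperm_sperm(2))
      have "T_of w = T_of ?u * T i" using T_of_sperm_comp(1)[OF pu 2(1,2) asc] unfolding w .
      moreover have "inv_count n (pinv ?u) < inv_count n (pinv w)"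
        unfolding iu using inv_count_comp_sperm_descent[OF 2] by simp
      ultimately have "app (T_of w) f id = app (T i) f (pinv ?u)" using less.hyps[of ?u "app (T i) f"] pu by simp
      also have "\<dots> = f (pinv ?u \<circ> sperm i)" using asc 2(1) by (simp only: T(2)[OF 2(1)] app_word_T if_True)
      also have "pinv ?u \<circ> sperm i = pinv w" unfolding iu by (rule comp_sperm_sperm(1))
      finally show ?thesis .
    qed
  qed
  define z where "z = app (sym ?one) e"
  have "z id = (\<Sum>w\<in>?S. e (pinv w))"
  proof -
    have fs: "(sum f A) x = (\<Sum>w\<in>A. f w x)" for f :: "(nat \<Rightarrow> nat) \<Rightarrow> (nat \<Rightarrow> nat) \<Rightarrow> 'k" and A x
      by (induction A rule: infinite_finite_induct) simp_all
    show ?thesis unfolding z_def sym_def sum_app fs by (rule sum.cong[OF refl]) (use at_id S in blast)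
  qed
  also have "\<dots> = (\<Sum>w\<in>?S. if w = id then 1 else 0)"
  proof (rule sum.cong[OF refl])
    fix w assume "w \<in> ?S"
    then have "pinv w = id \<longleftrightarrow> w = id" using permutes_inv_inv[OF S] inv_id by metis
    then show "e (pinv w) = (if w = id then 1 else 0)" by (simp only: e_def)
  qed
  also have "\<dots> = 1" using id_block_perms[of n ?one] by (simp only: sum.delta finite_block_perms if_True)
  finally have z0: "z \<noteq> 0" by auto
  have poin: "(\<Sum>w\<in>?S. q ^ inv_count n w) = 0"
  proof -
    have "(\<Sum>w\<in>?S. q ^ inv_count n w) = (\<Prod>k=1..n. qint q (card {j\<in>{1..k}. ?one j = ?one k}))"
      by (rule poincare_block_perms) simp
    also have "\<dots> = (\<Prod>k=1..n. qint q k)"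
    proof (rule prod.cong[OF refl])
      fix k
      have "{j\<in>{1..k}. ?one j = ?one k} = {1..k}" by blast
      then show "qint q (card {j\<in>{1..k}. ?one j = ?one k}) = qint q k" by (simp only: card_atLeastAtMost diff_Suc_1 add_diff_cancel_right' Suc_eq_plus1)
    qed
    also have "\<dots> = 0"
    proof (rule prod_zero)
      have "(q - 1) * qint q d = 0" using power_diff_1_eq[of q d] qd by (simp add: qint_def)
      then have "qint q d = 0" using q(2) by simp
      then show "\<exists>k\<in>{1..n}. qint q k = 0" using d by (intro bexI[of _ d]) simp_all
    qed simp
    finally show ?thesis .
  qed
  have "sym ?one * sym ?one = (\<Sum>w\<in>?S. scale_fun (q ^ inv_count n w) * sym ?one)"
    unfolding sym_def[of ?one] sum_distrib_right
    by (rule sum.cong[OF refl], fold sym_def, rule left_eigen_T_of[where blk = "\<lambda>_. 0"]) (use Tu in \<open>simp_all only: le_refl\<close>)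
  also have "\<dots> = scale_fun (\<Sum>w\<in>?S. q ^ inv_count n w) * sym ?one" by (simp only: sc_sum sum_distrib_right)
  finally have uu: "sym ?one * sym ?one = 0" unfolding poin sc_0 by simp
  have "\<not> semisimple_ring (hecke_algebra ell n q Q)"
  proof (rule nonsemisimple_criterion[OF H n uc])
    show "app (free.val u) e = z" unfolding vu z_def ..
    show "z \<noteq> 0" by (rule z0)
    show "app (free.val u) z = 0" unfolding vu z_def endo_simps(6)[symmetric] uu by simp
    show "app (T i) z = app (scale_fun ((\<lambda>i. if i = 0 then Q 1 else q) i)) z" if "i < n" for i
    proof (cases "i = 0")
      case False
      then have "T i * sym ?one = scale_fun q * sym ?one" using Tu that by simp
      then show ?thesis unfolding z_def if_not_P[OF False] endo_simps(6)[symmetric] by simp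
    qed (simp add: T(1))
  qed
  then show False using ss by blast
qed

text \<open>The two-dimensional module on which \<open>T\<^sub>0\<close> has the eigenvalues \<open>Q\<^sub>i\<close> and \<open>Q\<^sub>j\<close>, extended to tensor
  powers: the letter \<open>False\<close> at position 1 is raised to \<open>True\<close>.\<close>
definition refl_T :: "'k::field \<Rightarrow> 'k \<Rightarrow> ((nat \<Rightarrow> bool) \<Rightarrow> 'k) endo" where
  "refl_T a b = Endo (\<lambda>f w. if w 1 then f (w(1 := False)) else (a + b) * f w - a * b * f (w(1 := True)))"

lemma app_refl_T: "app (refl_T a b) f w = (if w 1 then f (w(1 := False)) else (a + b) * f w - a * b * f (w(1 := True)))"
proof -
  have "app (refl_T a b) f = (\<lambda>w. if w 1 then f (w(1 := False)) else (a + b) * f w - a * b * f (w(1 := True)))"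
    unfolding refl_T_def by (rule app_Endo) (simp add: fun_eq_iff algebra_simps)
  then show ?thesis by simp
qed

lemma refl_T_sc: "refl_T a b * scale_fun c = scale_fun c * refl_T a b"
  by (rule endo_eqI, rule ext) (simp add: app_refl_T algebra_simps)

lemma refl_T_quad:
  fixes a b :: "'k::field"
  shows "(refl_T a b - scale_fun a) * (refl_T a b - scale_fun b) = 0"
proof (rule endo_eqI, rule ext)
  fix f :: "(nat \<Rightarrow> bool) \<Rightarrow> 'k" and w :: "nat \<Rightarrow> bool"
  have "w(1 := w 1) = w" by simp
  then have e: "w 1 \<Longrightarrow> w(1 := True) = w" "\<not> w 1 \<Longrightarrow> w(1 := False) = w" by (simp_all add: fun_eq_iff)
  show "app ((refl_T a b - scale_fun a) * (refl_T a b - scale_fun b)) f w = app 0 f w"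
    by (cases "w 1") (simp_all add: app_refl_T e algebra_simps)
qed

lemma refl_T_far:
  fixes a b :: "'k::field"
  assumes "2 \<le> j" shows "refl_T a b * word_T q j = word_T q j * refl_T a b"
proof (rule endo_eqI, rule ext)
  fix f :: "(nat \<Rightarrow> bool) \<Rightarrow> 'k" and w :: "nat \<Rightarrow> bool"
  have u: "(w(1 := x)) \<circ> sperm j = (w \<circ> sperm j)(1 := x)" for x
  proof
    fix k show "((w(1 := x)) \<circ> sperm j) k = ((w \<circ> sperm j)(1 := x)) k"
      using assms by (cases "k = j"; cases "k = Suc j"; cases "k = 1") simp_all
  qed
  have v: "(w(1 := x)) j = w j" "(w(1 := x)) (Suc j) = w (Suc j)" "(w \<circ> sperm j) 1 = w 1" for x using assms by simp_all
  show "app (refl_T a b * word_T q j) f w = app (word_T q j * refl_T a b) f w"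
    by (cases "w 1"; cases "w j" "w (Suc j)" rule: linorder_cases)
      (simp_all only: app_refl_T app_word_T endo_simps u v if_True if_False simp_thms, simp_all add: algebra_simps)
qed

lemma refl_T_0101:
  fixes a b :: "'k::field"
  shows "refl_T a b * word_T q 1 * refl_T a b * word_T q 1 = word_T q 1 * refl_T a b * word_T q 1 * refl_T a b"
proof (rule endo_eqI, rule ext)
  fix f :: "(nat \<Rightarrow> bool) \<Rightarrow> 'k" and w :: "nat \<Rightarrow> bool"
  define g where "g x y = f (w(1 := x, 2 := y))" for x y
  define W where "W x y = w(1 := x, 2 := y)" for x y
  have w: "w = W (w 1) (w 2)" by (simp add: W_def fun_eq_iff)
  have up: "(W x y)(1 := z) = W z y" "W x y 1 = x" "W x y 2 = y" "W x y (Suc 1) = y" for x y z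
    by (simp_all add: W_def fun_eq_iff numeral_2_eq_2)
  have sw: "W x y \<circ> sperm 1 = W y x" for x y
  proof
    fix k
    have "Suc 1 = (2::nat)" by simp
    then show "(W x y \<circ> sperm 1) k = W y x k"
      by (cases "k = 1"; cases "k = 2") (simp_all add: W_def sperm_def Transposition.transpose_def)
  qed
  have rf: "app (refl_T a b) h (W x y) = (if x then h (W False y) else (a + b) * h (W x y) - a * b * h (W True y))" for h x y
    by (simp only: app_refl_T up)
  have wt: "app (word_T q 1) h (W x y) = (if x < y then h (W y x) else if x = y then q * h (W x y) else q * h (W y x) + (q - 1) * h (W x y))" for h x y
    by (simp only: app_word_T up sw)
  have "app (refl_T a b * word_T q 1 * refl_T a b * word_T q 1) f (W x y) = app (word_T q 1 * refl_T a b * word_T q 1 * refl_T a b) f (W x y)" for x y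
    by (cases x; cases y) (simp_all add: rf wt algebra_simps)
  then show "app (refl_T a b * word_T q 1 * refl_T a b * word_T q 1) f w = app (word_T q 1 * refl_T a b * word_T q 1 * refl_T a b) f w"
    by (subst (1 2) w)
qed

text \<open>The product \<open>u\<close> of the \<open>L\<^sub>k - Q\<^sub>j\<close> commutes with all \<open>T\<^sub>m\<close>, \<open>m \<ge> 1\<close>. It maps the word \<open>e\<close> without
  \<open>True\<close> to an eigenvector \<open>z\<close> with \<open>T\<^sub>0 z = Q\<^sub>i z\<close> and \<open>T\<^sub>m z = q z\<close>, whence \<open>L\<^sub>k z = q\<^sup>k\<^sup>-\<^sup>1 Q\<^sub>i z\<close> and
  \<open>u z = 0\<close>. Each factor raises one more position of \<open>e\<close>, so the coefficient of \<open>z\<close> at the word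
  with \<open>n\<close> letters \<open>True\<close> is \<open>1\<close>.\<close>
lemma semisimple_Q_sep:
  fixes q :: "'k::field"
  assumes n: "1 \<le> n" and q: "q \<noteq> 0"
    and ss: "semisimple_ring (hecke_algebra ell n q Q)" and ij: "1 \<le> i" "i \<le> ell" "1 \<le> j" "j \<le> ell" "i \<noteq> j" and d: "d < n"
  shows "q ^ d * Q i \<noteq> Q j"
proof
  assume qd: "q ^ d * Q i = Q j"
  define T :: "nat \<Rightarrow> ((nat \<Rightarrow> bool) \<Rightarrow> 'k) endo" where "T m = (if m = 0 then refl_T (Q i) (Q j) else word_T q m)" for m
  have T: "T 0 = refl_T (Q i) (Q j)" "\<And>m. 1 \<le> m \<Longrightarrow> T m = word_T q m" by (simp_all add: T_def)
  have sc2: "scale_fun a * scale_fun b = scale_fun b * scale_fun a" for a b :: 'k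
    by (simp only: scale_fun_hom(2)[symmetric] mult.commute)
  have H: "hecke_ring ell n q Q scale_fun T"
  proof
    show "q \<noteq> 0" by (rule q)
    show "scale_fun (a + b) = scale_fun a + scale_fun b" "scale_fun (a * b) = scale_fun a * scale_fun b" "scale_fun 1 = 1" for a b :: 'k
      by (rule scale_fun_hom)+
    show Tsc: "T m * scale_fun c = scale_fun c * T m" for m c
      by (cases "m = 0") (simp_all only: T_def if_True if_False simp_thms refl_T_sc word_T_sc)
    show "prod_list (map (\<lambda>c. T 0 - scale_fun (Q c)) [1..<Suc ell]) = 0"
    proof (rule prod_list_two_factors[where i = i and j = j])
      show "(T 0 - scale_fun (Q a)) * (T 0 - scale_fun (Q b)) = (T 0 - scale_fun (Q b)) * (T 0 - scale_fun (Q a))" for a b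
        using Tsc[of 0 "Q a"] Tsc[of 0 "Q b"] sc2[of "Q a" "Q b"] by (simp add: left_diff_distrib right_diff_distrib)
      show "(T 0 - scale_fun (Q i)) * (T 0 - scale_fun (Q j)) = 0" unfolding T(1) by (rule refl_T_quad)
    qed (use ij in \<open>simp_all del: upt_Suc\<close>)
    show "T 0 * T 1 * T 0 * T 1 = T 1 * T 0 * T 1 * T 0" using refl_T_0101 T(1) T(2)[OF order_refl] by simp
    show "(T m - scale_fun q) * (T m + 1) = 0" if "1 \<le> m" for m unfolding T(2)[OF that] by (rule word_T_quad)
    show "T l * T m = T m * T l" if lm: "Suc l < m" for l m
    proof (cases "l = 0")
      case True
      have "2 \<le> m" "1 \<le> m" using lm True by simp_all
      then show ?thesis unfolding True T(1) T(2)[OF \<open>1 \<le> m\<close>] by (intro refl_T_far)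
    next
      case False
      then have "1 \<le> l" "1 \<le> m" using lm by simp_all
      then show ?thesis unfolding T(2)[OF \<open>1 \<le> l\<close>] T(2)[OF \<open>1 \<le> m\<close>] by (intro word_T_far[OF lm])
    qed
    show "T m * T (Suc m) * T m = T (Suc m) * T m * T (Suc m)" if m: "1 \<le> m" for m
    proof -
      have "1 \<le> Suc m" by simp
      show ?thesis unfolding T(2)[OF m] T(2)[OF \<open>1 \<le> Suc m\<close>] by (rule word_T_braid)
    qed
  qed
  interpret hecke_ring ell n q Q scale_fun T by (rule H)
  let ?P = "\<lambda>m. prod_list (map (\<lambda>k. L k - scale_fun (Q j)) (rev [1..<Suc m]))"
  define e :: "(nat \<Rightarrow> bool) \<Rightarrow> 'k" where "e w = (if \<exists>k. w k then 0 else 1)" for w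
  define g where "g m = app (?P m) e" for m
  have g0: "g 0 = e" by (simp add: g_def)
  have gS: "g (Suc m) = app (L (Suc m) - scale_fun (Q j)) (g m)" for m unfolding g_def by simp
  (* the functions supported on words without True after position m *)
  define low where "low m f \<longleftrightarrow> (\<forall>w. (\<exists>k>m. w k) \<longrightarrow> f w = 0)" for m and f :: "(nat \<Rightarrow> bool) \<Rightarrow> 'k"
  have low_T: "low m (app (T l) f)" if f: "low m f" and l: "l < m" for m l f
    unfolding low_def
  proof (intro allI impI)
    fix w :: "nat \<Rightarrow> bool" assume "\<exists>k>m. w k"
    then obtain k where k: "m < k" "w k" by blast
    have z: "f v = 0" if "v k" for v using f k(1) that unfolding low_def by blast
    show "app (T l) f w = 0"
    proof (cases "l = 0")
      case True
      have "(w(1 := x)) k" for x using k l by simp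
      then have "f (w(1 := x)) = 0" for x by (rule z)
      then show ?thesis unfolding True T(1) app_refl_T using z[of w, OF k(2)] by simp
    next
      case False
      have "(w \<circ> sperm l) k" using k l by simp
      then have "f (w \<circ> sperm l) = 0" by (rule z)
      moreover have "1 \<le> l" using False by simp
      ultimately show ?thesis unfolding T(2)[OF \<open>1 \<le> l\<close>] app_word_T using z[of w, OF k(2)] by simp
    qed
  qed
  have low_word: "low m (app (word_prod is) f)" if "low m f" "\<And>l. l \<in> set is \<Longrightarrow> l < m" for m "is" f
    using that(2)
  proof (induction "is")
    case Nil then show ?case using that(1) by simp
  next
    case (Cons l "is") then show ?case using low_T[of m "app (word_prod is) f" l] by simp
  qed
  have low_L: "low m (app (L m) f)" if f: "low m f" and m: "1 \<le> m" for m f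
  proof -
    have 1: "low m (app (word_prod [1..<m]) f)" by (rule low_word[OF f]) simp
    have 2: "low m (app (T 0) (app (word_prod [1..<m]) f))" by (rule low_T[OF 1]) (use m in simp)
    have 3: "low m (app (word_prod (rev [1..<m])) (app (T 0) (app (word_prod [1..<m]) f)))" by (rule low_word[OF 2]) simp
    then show ?thesis unfolding L_def low_def by simp
  qed
  have low_g: "low m (g m)" for m
  proof (induction m)
    case 0 show ?case unfolding g0 low_def e_def by auto
  next
    case (Suc m)
    have f: "low (Suc m) (g m)" using Suc unfolding low_def by (meson Suc_lessD)
    show ?case using low_L[OF f] f unfolding gS low_def by simp
  qed
  define tr where "tr m k \<longleftrightarrow> 1 \<le> k \<and> k \<le> m" for m k :: nat
  have shift: "app (word_prod [l..<Suc m]) f (\<lambda>k. 1 \<le> k \<and> k \<le> Suc m \<and> k \<noteq> l) = f (tr m)" if "1 \<le> l" "l \<le> Suc m" for l m f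
    using that
  proof (induction "Suc m - l" arbitrary: l)
    case 0
    then have l: "l = Suc m" by simp
    have "(\<lambda>k. 1 \<le> k \<and> k \<le> Suc m \<and> k \<noteq> l) = tr m" unfolding l by (auto simp: tr_def fun_eq_iff)
    then show ?case unfolding l by simp
  next
    case (Suc x)
    let ?w = "\<lambda>l k. 1 \<le> k \<and> k \<le> Suc m \<and> k \<noteq> l"
    have lm: "l < Suc m" using Suc.hyps(2) by simp
    have sw: "?w l \<circ> sperm l = ?w (Suc l)"
    proof
      fix k show "(?w l \<circ> sperm l) k = ?w (Suc l) k"
        using lm Suc.prems(1) by (cases "k = l"; cases "k = Suc l") simp_all
    qed
    have "?w l l < ?w l (Suc l)" using lm by simp
    then have "app (word_prod [l..<Suc m]) f (?w l) = app (word_prod [Suc l..<Suc m]) f (?w (Suc l))"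
      unfolding upt_conv_Cons[OF lm] word_prod_simps endo_simps T(2)[OF Suc.prems(1)] app_word_T sw by simp
    also have "\<dots> = f (tr m)" using Suc.hyps(1)[of "Suc l"] Suc.hyps(2) lm by simp
    finally show ?case .
  qed
  have eqs: "app (word_prod is) f (tr m) = q ^ length is * f (tr m)" if "\<And>l. l \<in> set is \<Longrightarrow> 1 \<le> l \<and> l < m" for "is" f m
    using that
  proof (induction "is")
    case Nil show ?case by simp
  next
    case (Cons l "is")
    have l: "1 \<le> l" "l < m" using Cons.prems[of l] by simp_all
    have "tr m l = tr m (Suc l)" using l by (simp add: tr_def)
    then have "app (word_prod (l # is)) f (tr m) = q * app (word_prod is) f (tr m)"
      unfolding word_prod_simps endo_simps T(2)[OF l(1)] app_word_T by simp
    then show ?case using Cons by simp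
  qed
  have top: "g m (tr m) = 1" for m
  proof (induction m)
    case 0 show ?case unfolding g0 e_def tr_def by simp
  next
    case (Suc m)
    let ?w = "\<lambda>k. 1 \<le> k \<and> k \<le> Suc m \<and> k \<noteq> 1"
    have t1: "tr (Suc m) 1" "(tr (Suc m))(1 := False) = ?w" by (auto simp: tr_def fun_eq_iff)
    have "app (L (Suc m)) (g m) (tr (Suc m)) = q powi (- int m) * (q ^ m * app (T 0) (app (word_prod [1..<Suc m]) (g m)) (tr (Suc m)))"
      unfolding L_def endo_simps app_scale_fun by (subst eqs) (auto simp: less_Suc_eq_le simp del: upt_Suc)
    also have "\<dots> = app (word_prod [1..<Suc m]) (g m) ?w"
      unfolding T(1) app_refl_T t1(2) using t1(1) q by (simp add: power_int_minus)
    also have "\<dots> = g m (tr m)" by (rule shift) simp_all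
    finally have "app (L (Suc m)) (g m) (tr (Suc m)) = 1" using Suc by simp
    moreover have "g m (tr (Suc m)) = 0"
    proof -
      have "tr (Suc m) (Suc m)" by (simp add: tr_def)
      then show ?thesis using low_g[of m] unfolding low_def by blast
    qed
    ultimately show ?case unfolding gS by simp
  qed
  have z0: "g n \<noteq> 0"
  proof
    assume "g n = 0"
    then show False using top[of n] by simp
  qed
  have Lcomm: "(L k - scale_fun (Q j)) * (L m - scale_fun (Q j)) = (L m - scale_fun (Q j)) * (L k - scale_fun (Q j))"
    if "1 \<le> k" "k \<le> n" "1 \<le> m" "m \<le> n" for k m
  proof -
    have "L a * scale_fun c = scale_fun c * L a" for a c using scal_comm_L[of a] unfolding scal_comm_def by blast
    then show ?thesis using L_L_comm(1)[OF that] by (simp add: left_diff_distrib right_diff_distrib)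
  qed
  have Prev: "?P n = prod_list (map (\<lambda>k. L k - scale_fun (Q j)) [1..<Suc n])"
    unfolding rev_map[symmetric]
    by (rule prod_list_rev_commute) (use Lcomm in \<open>auto simp del: upt_Suc\<close>)
  have Te: "app (T m) e = app (scale_fun q) e" if "1 \<le> m" for m
  proof
    fix w
    have "(\<exists>k. (w \<circ> sperm m) k) \<longleftrightarrow> (\<exists>k. w k)" by (metis comp_apply sperm_sperm(1))
    then have es: "e (w \<circ> sperm m) = e w" by (simp only: e_def)
    have "e w = 0" if "w m \<noteq> w (Suc m)" using that unfolding e_def by auto
    then show "app (T m) e w = app (scale_fun q) e w"
      unfolding T(2)[OF that] app_word_T app_scale_fun es by auto
  qed
  have Tg: "app (T m) (g n) = app (scale_fun q) (g n)" if m: "1 \<le> m" "m < n" for m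
  proof -
    have "T m * ?P n = ?P n * T m" unfolding Prev by (rule T_comm_L_prod) (use m in simp_all)
    then have "app (T m) (g n) = app (?P n) (app (T m) e)" unfolding g_def endo_simps(6)[symmetric] by simp
    also have "\<dots> = app (scale_fun q) (g n)"
    proof -
      have "scal_comm (?P n)" by (rule scal_comm_prod_list) auto
      then have "?P n * scale_fun q = scale_fun q * ?P n" unfolding scal_comm_def by blast
      then show ?thesis unfolding Te[OF m(1)] g_def endo_simps(6)[symmetric] by simp
    qed
    finally show ?thesis .
  qed
  have T0g: "app (T 0) (g n) = app (scale_fun (Q i)) (g n)"
  proof -
    have "[1..<Suc n] = 1 # [Suc 1..<Suc n]" by (rule upt_rec[THEN trans]) (use n in simp)
    then have "?P n = (T 0 - scale_fun (Q j)) * prod_list (map (\<lambda>k. L k - scale_fun (Q j)) [Suc 1..<Suc n])"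
      unfolding Prev by (simp only: list.map prod_list.Cons L_1)
    then have "(T 0 - scale_fun (Q i)) * ?P n = 0"
      using refl_T_quad[of "Q i" "Q j"] unfolding T(1) by (simp flip: mult.assoc)
    then have "app (T 0 - scale_fun (Q i)) (g n) = 0" unfolding g_def endo_simps(6)[symmetric] by simp
    then show ?thesis by simp
  qed
  have Lg: "app (L m) (g n) = app (scale_fun (q ^ (m - 1) * Q i)) (g n)" if "1 \<le> m" "m \<le> n" for m
    using that
  proof (induction m rule: dec_induct)
    case base show ?case unfolding L_1 T0g by simp
  next
    case (step m)
    have mn: "1 \<le> m" "m < n" using step by simp_all
    have sT: "app (T m) (app (scale_fun c) (g n)) = app (scale_fun (c * q)) (g n)" for c
      using T_sc[of m c] Tg[OF mn] unfolding endo_simps(6)[symmetric] by (simp add: sc_mult)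
    have "app (L (Suc m)) (g n) = app (scale_fun (inverse q)) (app (T m) (app (L m) (app (T m) (g n))))"
      unfolding L_Suc[OF mn(1)] by simp
    also have "app (L m) (app (T m) (g n)) = app (scale_fun q) (app (L m) (g n))"
      unfolding Tg[OF mn] using scal_comm_L[of m] unfolding scal_comm_def endo_simps(6)[symmetric] by simp
    also have "\<dots> = app (scale_fun (q * (q ^ (m - 1) * Q i))) (g n)"
    proof -
      have "app (L m) (g n) = app (scale_fun (q ^ (m - 1) * Q i)) (g n)" by (rule step.IH) (use mn in simp)
      then show ?thesis by (simp only: sc_mult[of q] endo_simps)
    qed
    also have "app (scale_fun (inverse q)) (app (T m) \<dots>) = app (scale_fun (inverse q * (q * (q ^ (m - 1) * Q i) * q))) (g n)"
      unfolding sT by (simp add: sc_mult)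
    also have "inverse q * (q * (q ^ (m - 1) * Q i) * q) = q ^ (Suc m - 1) * Q i"
      using q mn(1) by (cases m) (simp_all add: field_simps)
    finally show ?case .
  qed
  define u where "u = prod_list (map (\<lambda>k. jm q k - scal (Q j)) (rev [1..<Suc n]))"
  have vjm: "free.val (jm q k) = L k" for k
    unfolding jm_def L_def by (simp add: free.val_mult free.val_gens word_prod_def)
  have vu: "free.val u = ?P n" unfolding u_def by (simp add: free.val_prod_list comp_def free.val_diff vjm del: upt_Suc)
  have uc: "u \<in> words n" unfolding u_def
  proof (rule fa_prod_list)
    fix x assume "x \<in> set (map (\<lambda>k. jm q k - scal (Q j)) (rev [1..<Suc n]))"
    then obtain k where k: "x = jm q k - scal (Q j)" "1 \<le> k" "k \<le> n" by auto
    show "x \<in> words n" unfolding k jm_def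
      by (intro fa_diff fa_mult fa_basic fa_gens) (use k n in auto)
  qed
  have kill: "app (prod_list (map (\<lambda>k. L k - scale_fun (Q j)) ks)) (g n) = app (scale_fun (prod_list (map (\<lambda>k. q ^ (k - 1) * Q i - Q j) ks))) (g n)"
    if "\<And>k. k \<in> set ks \<Longrightarrow> 1 \<le> k \<and> k \<le> n" for ks
    using that
  proof (induction ks)
    case Nil show ?case by simp
  next
    case (Cons k ks)
    let ?c = "prod_list (map (\<lambda>k. q ^ (k - 1) * Q i - Q j) ks)"
    have k: "1 \<le> k" "k \<le> n" using Cons.prems[of k] by simp_all
    have "app (prod_list (map (\<lambda>k. L k - scale_fun (Q j)) (k # ks))) (g n) = app (L k) (app (scale_fun ?c) (g n)) - app (scale_fun (Q j)) (app (scale_fun ?c) (g n))"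
    proof -
      have "app (prod_list (map (\<lambda>k. L k - scale_fun (Q j)) ks)) (g n) = app (scale_fun ?c) (g n)"
        by (rule Cons.IH) (rule Cons.prems, simp)
      then show ?thesis by (simp only: list.map prod_list.Cons endo_simps)
    qed
    also have "app (L k) (app (scale_fun ?c) (g n)) = app (scale_fun ?c) (app (L k) (g n))"
      using scal_comm_L[of k] unfolding scal_comm_def endo_simps(6)[symmetric] by simp
    also have "\<dots> - app (scale_fun (Q j)) (app (scale_fun ?c) (g n)) = app (scale_fun ((q ^ (k - 1) * Q i - Q j) * ?c)) (g n)"
      unfolding Lg[OF k] by (simp add: fun_eq_iff algebra_simps)
    finally show ?case by (simp only: list.map prod_list.Cons)
  qed
  have "\<not> semisimple_ring (hecke_algebra ell n q Q)"
  proof (rule nonsemisimple_criterion[OF H n uc])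
    show "app (free.val u) e = g n" unfolding vu g_def ..
    show "g n \<noteq> 0" by (rule z0)
    have zero: "0 = q ^ (Suc d - 1) * Q i - Q j" using qd by simp
    have mem: "Suc d \<in> set (rev [1..<Suc n])" using d by (simp del: upt_Suc)
    have "0 \<in> set (map (\<lambda>k. q ^ (k - 1) * Q i - Q j) (rev [1..<Suc n]))"
      unfolding set_map by (rule image_eqI[where x = "Suc d"], rule zero, rule mem)
    then have c0: "prod_list (map (\<lambda>k. q ^ (k - 1) * Q i - Q j) (rev [1..<Suc n])) = 0" by (simp only: prod_list_zero_iff)
    have "app (?P n) (g n) = app (scale_fun (prod_list (map (\<lambda>k. q ^ (k - 1) * Q i - Q j) (rev [1..<Suc n])))) (g n)"
      by (rule kill) auto
    then show "app (free.val u) (g n) = 0" unfolding vu c0 sc_0 by simp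
    show "app (T m) (g n) = app (scale_fun ((\<lambda>m. if m = 0 then Q i else q) m)) (g n)" if "m < n" for m
    proof (cases "m = 0")
      case True then show ?thesis using T0g by simp
    next
      case False then show ?thesis using Tg[of m] that by simp
    qed
  qed
  then show False using ss by blast
qed

theorem semisimple_separated:
  fixes q :: "'k::field"
  assumes "1 \<le> ell" "1 \<le> n" "q \<noteq> 0" "q \<noteq> 1" "2 \<le> n \<Longrightarrow> \<forall>c\<in>{1..ell}. Q c \<noteq> 0"
    and ss: "semisimple_ring (hecke_algebra ell n q Q)"
  shows "separated ell n q Q"
proof
  show "1 \<le> n" "q \<noteq> 0" by (rule assms)+
  show "Q c \<noteq> 0" if "2 \<le> n" "1 \<le> c" "c \<le> ell" for c using assms(5) that by simp
  show "q ^ d \<noteq> 1" if "1 \<le> d" "d \<le> n" for d by (rule semisimple_q_pow[OF assms(1-4) ss that])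
  show "q powi e * Q c \<noteq> Q d" if "1 \<le> c" "c \<le> ell" "1 \<le> d" "d \<le> ell" "c \<noteq> d" "\<bar>e\<bar> < int n" for c d e
  proof (cases "0 \<le> e")
    case True
    then have "q ^ nat e * Q c \<noteq> Q d" using that by (intro semisimple_Q_sep[OF assms(2,3) ss]) simp_all
    then show ?thesis using True by (simp add: power_int_def)
  next
    case False
    then have "q ^ nat (- e) * Q d \<noteq> Q c" using that by (intro semisimple_Q_sep[OF assms(2,3) ss]) simp_all
    then show ?thesis using False assms(3) by (auto simp: power_int_def field_simps)
  qed
qed

section \<open>A faithful representation\<close>

lemma gens_single: "prod_list (map gen is) = Poly_Mapping.single (Word is) (1 :: 'k::field)"
proof (induction "is")
  case Nil
  have "(0 :: word) = Word []" by (simp add: zero_word_def)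
  then show ?case using single_one[where 'a = word and 'b = 'k] by simp
next
  case (Cons i "is")
  have "Word [i] + Word is = Word (i # is)" by (simp add: plus_word_def)
  then show ?case using Cons by (simp add: gen_def mult_single)
qed

lemma single_eq_gens: "Poly_Mapping.single w c = scal c * prod_list (map gen (letters w))"
  unfolding gens_single scal_def by (simp add: mult_single)

lemma scal_hom: "scal (a + b) = scal a + scal b" "scal (a * b) = scal a * scal b" "scal 1 = 1"
  "gen i * scal c = scal c * gen i"
  by (simp_all add: scal_def gen_def mult_single single_add)

text \<open>Left multiplication on the quotient by the ideal of relations is carried over to a complement
  of the ideal. On the ideal itself every element acts through a character, so that the unit acts
  as the identity.\<close>
theorem faithful_representation:
  fixes q :: "'k::field"
  assumes ell: "1 \<le> ell" and n: "1 \<le> n" and q: "q \<noteq> 0"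
  obtains sc :: "'k \<Rightarrow> (word \<Rightarrow>\<^sub>0 'k) endo" and T :: "nat \<Rightarrow> (word \<Rightarrow>\<^sub>0 'k) endo"
  where "hecke_ring ell n q Q sc T"
    "\<And>p. p \<in> words n \<Longrightarrow> evaluation.val sc T p = 0 \<Longrightarrow> p \<in> hecke_ideal ell n q Q"
proof -
  let ?J = "hecke_ideal ell n q Q" and ?C = "words n"
  have Jid: "ideal ?J (free_algebra n)" by (rule hecke_ideal_ideal[OF n])
  have J0: "0 \<in> ?J" using additive_subgroup.zero_closed[OF ideal.axioms(1)[OF Jid]] by simp
  have Jadd: "x + y \<in> ?J" if "x \<in> ?J" "y \<in> ?J" for x y
    using additive_subgroup.a_closed[OF ideal.axioms(1)[OF Jid] that] by simp
  have Jl: "x * y \<in> ?J" if "x \<in> ?C" "y \<in> ?J" for x y using ideal.I_l_closed[OF Jid that(2,1)] by simp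
  have Jr: "y * x \<in> ?J" if "x \<in> ?C" "y \<in> ?J" for x y using ideal.I_r_closed[OF Jid that(2,1)] by simp
  have JC: "x \<in> ?C" if "x \<in> ?J" for x using ideal.Icarr[OF Jid that] .
  interpret tr: evaluation "scal :: 'k \<Rightarrow> _" "\<lambda>i. if i < n then gen i else 0"
    by (rule evaluation.intro) (simp_all add: scal_hom)
  have tr_C: "tr.val p \<in> ?C" for p
    unfolding tr.val_def
  proof (intro fa_sum fa_mult fa_basic fa_prod_list)
    fix w x assume "x \<in> set (map (\<lambda>i. if i < n then gen i else (0 :: word \<Rightarrow>\<^sub>0 'k)) (letters w))"
    then show "x \<in> ?C" using fa_basic(1,4) by (auto split: if_splits)
  qed
  have tr_id: "tr.val p = p" if "p \<in> ?C" for p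
  proof -
    have "tr.val p = (\<Sum>w\<in>pkeys p. Poly_Mapping.single w (plookup p w))"
      unfolding tr.val_def
    proof (rule sum.cong[OF refl])
      fix w assume "w \<in> pkeys p"
      then have "set (letters w) \<subseteq> {..<n}" using that fa_carrier by blast
      then have m: "map (\<lambda>i. if i < n then gen i else (0 :: word \<Rightarrow>\<^sub>0 'k)) (letters w) = map gen (letters w)" by auto
      show "scal (plookup p w) * prod_list (map (\<lambda>i. if i < n then gen i else 0) (letters w)) =
          Poly_Mapping.single w (plookup p w)"
        unfolding m single_eq_gens ..
    qed
    then show ?thesis unfolding sum_monomials .
  qed
  (* The vectors may involve generators with index n or more, which the map tr.val kills:
     the ideal is extended to all of them so that it is stable under every left multiplication. *)
  define J' where "J' = {p. tr.val p \<in> ?J}"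
  have J'_id: "p \<in> J' \<longleftrightarrow> p \<in> ?J" if "p \<in> ?C" for p using tr_id[OF that] by (simp add: J'_def)
  have J'0: "0 \<in> J'" using J0 by (simp add: J'_def)
  have J'add: "x + y \<in> J'" if "x \<in> J'" "y \<in> J'" for x y using that Jadd by (simp add: J'_def tr.val_add)
  have J'l: "x * y \<in> J'" if "y \<in> J'" for x y using that Jl[OF tr_C] by (simp add: J'_def tr.val_mult)
  have J'r: "y * x \<in> J'" if "y \<in> J'" for x y using that Jr[OF tr_C] by (simp add: J'_def tr.val_mult)
  have J'minus: "- y \<in> J'" if "y \<in> J'" for y using J'l[OF that, of "- 1"] by simp
  have J'diff: "x - y \<in> J'" if "x \<in> J'" "y \<in> J'" for x y using J'add[OF that(1) J'minus[OF that(2)]] by simp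
  define scale where "scale c p = scal c * p" for c :: 'k and p :: "word \<Rightarrow>\<^sub>0 'k"
  have vs: "vector_space scale"
    by (rule vector_space.intro) (simp_all add: scale_def scal_hom distrib_left distrib_right mult.assoc)
  interpret vs: vector_space scale by (rule vs)
  interpret vp: vector_space_pair scale scale by (rule vector_space_pair.intro[OF vs vs])
  obtain B where B: "B \<subseteq> J'" "vs.independent B" "J' \<subseteq> vs.span B" by (rule vs.maximal_independent_subset)
  obtain C where C: "B \<subseteq> C" "vs.independent C" "UNIV \<subseteq> vs.span C"
    by (rule vs.maximal_independent_subset_extend[OF subset_UNIV B(2)])
  obtain pr where lin: "Vector_Spaces.linear scale scale pr" and prC: "\<forall>x\<in>C. pr x = (if x \<in> B then 0 else x)"
    using vp.linear_independent_extend[OF C(2), of "\<lambda>x. if x \<in> B then 0 else x"] by blast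
  have pr_add: "pr (x + y) = pr x + pr y" for x y by (rule vp.linear_add[OF lin])
  have pr_sc: "pr (scal c * x) = scal c * pr x" for c x using vp.linear_scale[OF lin, of c x] by (simp add: scale_def)
  have pr0: "pr 0 = 0" using pr_add[of 0 0] by simp
  have pr_diff: "pr (x - y) = pr x - pr y" for x y using pr_add[of "x - y" y] by simp
  have pr_mod: "pr x - x \<in> J'" for x
  proof -
    have "vs.span C \<subseteq> {x. pr x - x \<in> J'}"
    proof (rule vs.span_minimal)
      show "C \<subseteq> {x. pr x - x \<in> J'}"
      proof
        fix x assume "x \<in> C"
        then show "x \<in> {x. pr x - x \<in> J'}" using prC B(1) J'minus J'0 by (cases "x \<in> B") auto
      qed
      show "vs.subspace {x. pr x - x \<in> J'}"
      proof (rule vs.subspaceI)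
        show "0 \<in> {x. pr x - x \<in> J'}" using pr0 J'0 by simp
        fix x y c assume x: "x \<in> {x. pr x - x \<in> J'}"
        show "x + y \<in> {x. pr x - x \<in> J'}" if "y \<in> {x. pr x - x \<in> J'}"
          using J'add[of "pr x - x" "pr y - y"] x that by (simp add: pr_add algebra_simps)
        show "scale c x \<in> {x. pr x - x \<in> J'}"
          using J'l[of "pr x - x" "scal c"] x by (simp add: scale_def pr_sc right_diff_distrib)
      qed
    qed
    then show ?thesis using C(3) by blast
  qed
  have pr_J: "pr x = 0" if "x \<in> J'" for x
  proof -
    have "vs.span B \<subseteq> {x. pr x = 0}"
    proof (rule vs.span_minimal)
      show "B \<subseteq> {x. pr x = 0}" using prC C(1) by auto
      show "vs.subspace {x. pr x = 0}" by (rule vs.subspaceI) (simp_all add: pr0 pr_add scale_def pr_sc)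
    qed
    then show ?thesis using B(3) that by blast
  qed
  have pr_eq: "pr x = pr y" if "x - y \<in> J'" for x y using pr_J[OF that] by (simp add: pr_diff)
  have pr_pr: "pr (pr x) = pr x" for x by (rule pr_eq[OF pr_mod])
  have pr_mult: "pr (p * pr x) = pr (p * x)" for p x
    by (rule pr_eq) (use J'l[OF pr_mod, of p x] in \<open>simp add: right_diff_distrib\<close>)
  interpret ch: evaluation "\<lambda>c::'k. c" "\<lambda>i::nat. if i = 0 then Q 1 else q"
    by (rule evaluation.intro) simp_all
  define A where "A p = Endo (\<lambda>v. pr (p * pr v) + scal (ch.val p) * (v - pr v))" for p
  have A: "app (A p) v = pr (p * v) + scal (ch.val p) * (v - pr v)" for p v
    unfolding A_def by (subst app_Endo) (simp_all add: pr_add distrib_left pr_mult algebra_simps)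
  have A_add: "A (x + y) = A x + A y" for x y
    by (rule endo_eqI) (simp add: A ch.val_add scal_hom distrib_right pr_add)
  have A_0: "A 0 = 0" using A_add[of 0 0] by simp
  have A_diff: "A (x - y) = A x - A y" for x y using A_add[of "x - y" y] by simp
  have A_mult: "A (x * y) = A x * A y" for x y
  proof (rule endo_eqI)
    fix v
    have 1: "pr (app (A y) v) = pr (y * v)"
      by (simp add: A pr_add pr_pr pr_sc pr_diff)
    have "app (A x * A y) v = pr (x * pr (app (A y) v)) + scal (ch.val x) * (app (A y) v - pr (app (A y) v))"
      by (simp add: A[of x] pr_mult)
    also have "\<dots> = pr (x * (y * v)) + scal (ch.val x) * (scal (ch.val y) * (v - pr v))"
      unfolding 1 pr_mult by (simp add: A)
    finally show "app (A (x * y)) v = app (A x * A y) v" by (simp add: A ch.val_mult scal_hom mult.assoc)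
  qed
  have A_1: "A 1 = 1" by (rule endo_eqI) (simp add: A scal_hom)
  have A_sum: "A (sum f X) = (\<Sum>x\<in>X. A (f x))" for f :: "word \<Rightarrow> _" and X
    by (induction X rule: infinite_finite_induct) (simp_all add: A_0 A_add)
  have A_prod: "A (prod_list ps) = prod_list (map A ps)" for ps by (induction ps) (simp_all add: A_1 A_mult)
  have A_rel: "A r = 0" if r: "r \<in> hecke_relators ell n q Q" and c: "ch.val r = 0" for r
  proof (rule endo_eqI)
    fix v
    have "r \<in> ?J" using ring.genideal_self[OF ring_fa relators_carrier[OF n]] r unfolding hecke_ideal_def by blast
    then have "r \<in> J'" using J'_id JC by blast
    then have "pr (r * v) = 0" by (intro pr_J J'r)
    then show "app (A r) v = app 0 v" using c by (simp add: A scal_def)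
  qed
  define sc where "sc c = A (scal c)" for c
  define T where "T i = A (gen i)" for i
  have H: "hecke_ring ell n q Q sc T"
  proof
    show "q \<noteq> 0" by (rule q)
    show "sc (a + b) = sc a + sc b" "sc (a * b) = sc a * sc b" "sc 1 = 1" for a b
      by (simp_all add: sc_def scal_hom A_add A_mult A_1)
    show "T i * sc c = sc c * T i" for i c by (simp add: sc_def T_def A_mult[symmetric] scal_hom)
    have "A (prod_list [gen 0 - scal (Q c). c \<leftarrow> [1..<Suc ell]]) = 0"
    proof (rule A_rel)
      have "ch.val (gen 0 - scal (Q 1)) = 0" by (simp add: ch.val_diff)
      moreover have "1 \<in> set [1..<Suc ell]" using ell by (simp del: upt_Suc)
      ultimately show "ch.val (prod_list [gen 0 - scal (Q c). c \<leftarrow> [1..<Suc ell]]) = 0"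
        unfolding ch.val_prod_list prod_list_zero_iff by (force simp del: upt_Suc)
    qed (simp add: hecke_relators_def del: upt_Suc)
    then show "prod_list (map (\<lambda>c. T 0 - sc (Q c)) [1..<Suc ell]) = 0"
      by (simp add: A_prod T_def sc_def comp_def A_diff del: upt_Suc)
    show "T 0 * T 1 * T 0 * T 1 = T 1 * T 0 * T 1 * T 0" if "2 \<le> n"
    proof -
      have "A (gen 0 * gen 1 * gen 0 * gen 1 - gen 1 * gen 0 * gen 1 * gen 0) = 0"
        by (rule A_rel) (use that in \<open>simp_all add: hecke_relators_def ch.val_diff ch.val_mult\<close>)
      then show ?thesis by (simp add: A_diff A_mult T_def)
    qed
    show "(T i - sc q) * (T i + 1) = 0" if i: "1 \<le> i" "i < n" for i
    proof -
      have "(gen i - scal q) * (gen i + 1) \<in> hecke_relators ell n q Q" using i unfolding hecke_relators_def by blast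
      moreover have "ch.val ((gen i - scal q) * (gen i + 1)) = 0" using i by (simp add: ch.val_diff ch.val_mult)
      ultimately have "A ((gen i - scal q) * (gen i + 1)) = 0" by (rule A_rel)
      then show ?thesis by (simp add: A_diff A_mult A_add A_1 T_def sc_def)
    qed
    show "T i * T j = T j * T i" if ij: "Suc i < j" "j < n" for i j
    proof -
      have "i < n" "i + 1 < j \<or> j + 1 < i" using ij by simp_all
      then have "gen i * gen j - gen j * gen i \<in> hecke_relators ell n q Q" using ij(2) unfolding hecke_relators_def by blast
      moreover have "ch.val (gen i * gen j - gen j * gen i) = 0" by (simp add: ch.val_diff ch.val_mult)
      ultimately have "A (gen i * gen j - gen j * gen i) = 0" by (rule A_rel)
      then show ?thesis by (simp add: A_diff A_mult T_def)
    qed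
    show "T i * T (Suc i) * T i = T (Suc i) * T i * T (Suc i)" if i: "1 \<le> i" "Suc i < n" for i
    proof -
      have "i + 1 < n" using i by simp
      then have "gen i * gen (i + 1) * gen i - gen (i + 1) * gen i * gen (i + 1) \<in> hecke_relators ell n q Q"
        using i(1) unfolding hecke_relators_def by blast
      moreover have "ch.val (gen i * gen (i + 1) * gen i - gen (i + 1) * gen i * gen (i + 1)) = 0"
        using i by (simp add: ch.val_diff ch.val_mult)
      ultimately have "A (gen i * gen (i + 1) * gen i - gen (i + 1) * gen i * gen (i + 1)) = 0" by (rule A_rel)
      then show ?thesis unfolding Suc_eq_plus1 by (simp add: A_diff A_mult T_def)
    qed
  qed
  interpret hecke_ring ell n q Q sc T by (rule H)
  have val: "free.val p = A p" for p
  proof -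
    have "A p = A (\<Sum>w\<in>pkeys p. scal (plookup p w) * prod_list (map gen (letters w)))"
      unfolding single_eq_gens[symmetric] sum_monomials ..
    also have "\<dots> = free.val p"
    proof -
      have T': "map T ws = map A (map gen ws)" for ws by (simp add: T_def)
      show ?thesis unfolding A_sum free.val_def A_mult A_prod sc_def T' ..
    qed
    finally show ?thesis by simp
  qed
  have "p \<in> ?J" if p: "p \<in> ?C" and z: "free.val p = 0" for p
  proof -
    have "app (A p) (pr 1) = 0" using z unfolding val by simp
    then have "pr p = 0" by (simp add: A pr_mult pr_pr)
    then have "p \<in> J'" using pr_mod[of p] J'minus[of "- p"] by simp
    then show ?thesis using J'_id[OF p] by blast
  qed
  with H show ?thesis by (rule that)
qed

section \<open>The seminormal bases in the Hecke algebra\<close>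

lemma T_perm_carrier:
  assumes "w permutes {1..n}"
  shows "T_perm n w \<in> words n" "star (T_perm n w) \<in> words n"
    "\<exists>is. is \<in> reduced_words n w \<and> T_perm n w = prod_list (map gen is) \<and> star (T_perm n w) = prod_list (map gen (rev is))"
proof -
  define ws where "ws = (SOME is. is \<in> reduced_words n w)"
  obtain "is" where "is \<in> reduced_words n w" using reduced_words_exist[OF assms] by blast
  then have ws: "ws \<in> reduced_words n w" unfolding ws_def by (rule someI)
  have T: "T_perm n w = prod_list (map gen ws)" unfolding T_perm_def ws_def ..
  have S: "star (T_perm n w) = prod_list (map gen (rev ws))" unfolding T gens_single star_def by simp
  have "set ws \<subseteq> {..<n}" using ws reduced_words_iff by auto
  then show "T_perm n w \<in> words n" "star (T_perm n w) \<in> words n"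
    unfolding S unfolding T by (intro fa_gens; simp)+
  show "\<exists>is. is \<in> reduced_words n w \<and> T_perm n w = prod_list (map gen is) \<and> star (T_perm n w) = prod_list (map gen (rev is))"
    using ws T S by blast
qed

lemma jm_carrier: "1 \<le> k \<Longrightarrow> k \<le> n \<Longrightarrow> jm q k \<in> words n"
  unfolding jm_def by (intro fa_mult fa_basic fa_gens) auto

lemma jm_prod_carrier:
  assumes "\<And>r. r \<in> set rs \<Longrightarrow> h r \<le> n"
  shows "prod_list [jm q k - scal (f r). r \<leftarrow> rs, k \<leftarrow> [1..<Suc (h r)]] \<in> words n"
proof (rule fa_prod_list)
  fix x assume "x \<in> set [jm q k - scal (f r). r \<leftarrow> rs, k \<leftarrow> [1..<Suc (h r)]]"
  then obtain r k where k: "x = jm q k - scal (f r)" "r \<in> set rs" "1 \<le> k" "k \<le> h r" by auto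
  then have "k \<le> n" using assms[OF k(2)] by simp
  then show "x \<in> words n" unfolding k(1) by (intro fa_diff jm_carrier fa_basic k(3))
qed

lemma F_elt_carrier: "F_elt ell n q Q t \<in> words n"
  unfolding F_elt_def
proof (rule fa_prod_list)
  fix x assume "x \<in> set [scal (inverse (residue q Q t k - c)) * (jm q k - scal c).
     k \<leftarrow> [1..<Suc n], c \<leftarrow> enum_set (residue_set ell n q Q k - {residue q Q t k})]"
  then obtain k c where k: "x = scal (inverse (residue q Q t k - c)) * (jm q k - scal c)" "1 \<le> k" "k \<le> n" by auto
  show "x \<in> words n" unfolding k(1) by (intro fa_mult fa_diff jm_carrier fa_basic k)
qed

context shaped
begin

lemma val_T_perm: "free.val (T_perm n w) = T_of w"
  unfolding T_perm_def free.val_gens T_of_def word_prod_def ..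

lemma val_star_T_perm:
  assumes "w permutes {1..n}"
  shows "free.val (star (T_perm n w)) = T_of (pinv w)"
proof -
  obtain "is" where r: "is \<in> reduced_words n w" and s: "(star (T_perm n w) :: word \<Rightarrow>\<^sub>0 'k) = prod_list (map gen (rev is))"
    using T_perm_carrier(3)[OF assms] by blast
  have "rev is \<in> reduced_words n (pinv w)"
    using r inv_count_inv[OF assms] unfolding reduced_words_iff by (simp add: word_perm_rev)
  then have "T_of (pinv w) = word_prod (rev is)" by (rule T_of_reduced)
  then show ?thesis unfolding s free.val_gens word_prod_def by simp
qed

lemma val_jm: "free.val (jm q k) = L k"
  unfolding jm_def L_def by (simp add: free.val_mult free.val_gens word_prod_def)

lemma val_jm_prod:
  "free.val (prod_list [jm q k - scal (f r). r \<leftarrow> rs, k \<leftarrow> h r]) = prod_list [L k - sc (f r). r \<leftarrow> rs, k \<leftarrow> h r]"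
  by (simp add: free.val_prod_list map_concat comp_def free.val_diff val_jm)

lemma val_F:
  assumes t: "t \<in> tabs ell n"
  shows "free.val (F_elt ell n q Q t) = F t"
  unfolding F_elt_def F_def free.val_prod_list map_concat map_map
proof (rule arg_cong[where f = prod_list], rule arg_cong[where f = concat], rule map_cong[OF refl])
  fix k assume "k \<in> set [1..<Suc n]"
  then have k: "1 \<le> k" "k \<le> n" by auto
  have R: "residue_set ell n q Q k = Rset k" unfolding residue_set_eq[OF k] Rset_def ..
  show "(map free.val \<circ> (\<lambda>k. map (\<lambda>c. scal (inverse (residue q Q t k - c)) * (jm q k - scal c))
      (enum_set (residue_set ell n q Q k - {residue q Q t k})))) k =
    map (\<lambda>c. sc (inverse (res_at t k - c)) * (L k - sc c)) (enum_set (Rset k - {res_at t k}))"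
    unfolding comp_apply R residue_eq[OF t k] map_map
    by (rule map_cong[OF refl]) (simp add: free.val_mult free.val_diff val_jm)
qed

lemma below_le_n: "r \<in> set [2..<Suc ell] \<Longrightarrow> (\<Sum>c=1..<r. psize (lam c)) \<le> n"
  using below_le[of r] by (simp add: below_def del: upt_Suc)

lemma above_le_n: "r \<in> set [2..<Suc ell] \<Longrightarrow> (\<Sum>c=ell + 2 - r..ell. psize (lam c)) \<le> n"
proof -
  assume "r \<in> set [2..<Suc ell]"
  then have "{ell + 2 - r..ell} \<subseteq> {1..ell}" by auto
  then have "(\<Sum>c=ell + 2 - r..ell. psize (lam c)) \<le> (\<Sum>c=1..ell. psize (lam c))" by (intro sum_mono2) auto
  then show ?thesis using multipartitionsD(3)[OF lam] by simp
qed

lemma young_permutes: "w \<in> young_subgroup ell n mu \<Longrightarrow> w permutes {1..n}"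
  by (simp add: young_subgroup_def)

lemma f_elt_val:
  assumes s: "s \<in> tabs ell n" "supp s = D" and t: "t \<in> tabs ell n" "supp t = D"
  shows "free.val (f_elt ell n q Q lam s t) = F s * (T_of (dp n s a) * m_mid * T_of (dp n a t)) * F t"
    "f_elt ell n q Q lam s t \<in> words n"
proof -
  have p: "dp n a s permutes {1..n}" "dp n a t permutes {1..n}"
    using dp_permutes[OF a_tabs s(1)] dp_permutes[OF a_tabs t(1)] supp_a s(2) t(2) by simp_all
  have inv: "pinv (dp n a s) = dp n s a" by (rule pinv_dp[OF a_tabs s(1)]) (simp add: supp_a s(2))
  show "free.val (f_elt ell n q Q lam s t) = F s * (T_of (dp n s a) * m_mid * T_of (dp n a t)) * F t"
    unfolding f_elt_def m_elt_def d_perm_eq(1)[OF lam s] d_perm_eq(1)[OF lam t] free.val_mult val_F[OF s(1)] val_F[OF t(1)]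
      val_star_T_perm[OF p(1)] inv val_T_perm free.val_sum val_jm_prod m_mid_def by (simp only: mult.assoc)
  show "f_elt ell n q Q lam s t \<in> words n"
    unfolding f_elt_def m_elt_def d_perm_eq(1)[OF lam s] d_perm_eq(1)[OF lam t]
    by (intro fa_mult F_elt_carrier T_perm_carrier p fa_sum jm_prod_carrier below_le_n young_permutes)
qed

lemma g_elt_val:
  assumes s: "s \<in> tabs ell n" "supp s = D" and t: "t \<in> tabs ell n" "supp t = D"
  shows "free.val (g_elt ell n q Q lam s t) =
      F s * (sc ((- q) powi (- (int (card (Invs z s)) + int (card (Invs z t))))) * T_of (dp n s z) * n_mid * T_of (dp n z t)) * F t"
    "g_elt ell n q Q lam s t \<in> words n"
proof -
  have p: "dp n z s permutes {1..n}" "dp n z t permutes {1..n}"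
    using dp_permutes[OF z_tabs s(1)] dp_permutes[OF z_tabs t(1)] supp_z s(2) t(2) by simp_all
  have inv: "pinv (dp n z s) = dp n s z" by (rule pinv_dp[OF z_tabs s(1)]) (simp add: supp_z s(2))
  have len: "perm_length n (dp n z s) = card (Invs z s)" "perm_length n (dp n z t) = card (Invs z t)"
    unfolding perm_length_eq[OF p(1)] perm_length_eq[OF p(2)] using inv_count_dp_z(1)[OF s] inv_count_dp_z(1)[OF t] .
  have e: "- int (card (Invs z s)) - int (card (Invs z t)) = - (int (card (Invs z s)) + int (card (Invs z t)))" by simp
  show "free.val (g_elt ell n q Q lam s t) =
      F s * (sc ((- q) powi (- (int (card (Invs z s)) + int (card (Invs z t))))) * T_of (dp n s z) * n_mid * T_of (dp n z t)) * F t"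
    unfolding g_elt_def n_elt_def n_final_def d_perm_eq(2)[OF lam s] d_perm_eq(2)[OF lam t] len e free.val_mult val_F[OF s(1)] val_F[OF t(1)]
      val_star_T_perm[OF p(1)] inv val_T_perm free.val_sum free.val_scal val_jm_prod n_mid_def by (simp only: mult.assoc)
  show "g_elt ell n q Q lam s t \<in> words n"
    unfolding g_elt_def n_elt_def n_final_def d_perm_eq(2)[OF lam s] d_perm_eq(2)[OF lam t]
    by (intro fa_mult F_elt_carrier T_perm_carrier p fa_sum fa_basic jm_prod_carrier above_le_n young_permutes)
qed

end

theorem theorem1p1:
  fixes ell n :: nat
    and q :: "'k::field" and Q :: "nat \<Rightarrow> 'k"
    and lam :: mpart and s t :: tab
  assumes "ell \<ge> 1" and "n \<ge> 1"
    and "q \<noteq> 0" and "q \<noteq> 1"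
    and "n \<ge> 2 \<Longrightarrow> \<forall>c\<in>{1..ell}. Q c \<noteq> 0"
    and "semisimple_ring (hecke_algebra ell n q Q)"
    and "lam \<in> multipartitions ell n"
    and "s \<in> Std ell n lam" and "t \<in> Std ell n lam"
  shows "\<exists>alpha :: 'k. alpha \<noteq> 0 \<and>
    hecke_class ell n q Q (g_elt ell n q Q lam s t) =
      hecke_class ell n q Q (scal alpha) \<otimes>\<^bsub>hecke_algebra ell n q Q\<^esub>
      hecke_class ell n q Q (f_elt ell n q Q lam s t) \<and>
    (let lam' = conj_mpart ell lam;
         s' = conj_tab ell s;
         t' = conj_tab ell t;
         e = int (perm_length n (d_perm ell n lam' s'))
           + int (perm_length n (d_perm ell n lam' t'));
         gam = gamma_coeff ell n q Q lam;
         gam' = gamma'_coeff ell n q Q lam'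
     in alpha = (- q) powi (- e) *
          (gam (final_tab ell lam) * gam' (init_tab ell lam') / (gam s * gam t)) \<and>
        alpha = (- q) powi e *
          (gam' s' * gam' t' / (gam (final_tab ell lam) * gam' (init_tab ell lam'))))"
proof -
  have sep: "separated ell n q Q" using assms(1-6) by (rule semisimple_separated)
  obtain sc :: "'k \<Rightarrow> (word \<Rightarrow>\<^sub>0 'k) endo" and T where H: "hecke_ring ell n q Q sc T"
    and faithful: "\<And>p. p \<in> words n \<Longrightarrow> evaluation.val sc T p = 0 \<Longrightarrow> p \<in> hecke_ideal ell n q Q"
    by (rule faithful_representation[OF assms(1-3), where Q = Q]) (rule that, assumption, blast)
  interpret shaped ell n q Q sc T lam
    by (intro shaped.intro seminormal.intro sep H shaped_axioms.intro assms(7))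
  have ss: "s \<in> tabs ell n" "supp s = D" and tt: "t \<in> tabs ell n" "supp t = D"
    using assms(8,9) unfolding Std_D by simp_all
  let ?lam' = "conj_mpart ell lam"
  let ?e = "int (card (Invs z s)) + int (card (Invs z t))"
  define al where "al = (- q) powi (- ?e) * (gamma_coeff ell n q Q lam z *
    gamma_coeff ell n qi Qi ?lam' (conj_tab ell z) / (gamma_coeff ell n q Q lam s * gamma_coeff ell n q Q lam t))"
  note al = alpha[OF assms(8,9), folded al_def]
  have len: "perm_length n (d_perm ell n ?lam' (conj_tab ell u)) = card (Invs z u)" if u: "u \<in> tabs ell n" "supp u = D" for u
  proof -
    have "d_perm ell n ?lam' (conj_tab ell u) = dp n (init_tab ell ?lam') (conj_tab ell u)"
      by (rule d_perm_eq(1)[OF conj_mpart_multipartitions[OF lam] conj_tab_tabs[OF u(1)]])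
        (simp add: supp_conj_tab[OF u(1)] diagram_conj_mpart[OF lam] u(2))
    also have "\<dots> = dp n z u" unfolding conj_z by (rule dp_conj[OF z_tabs u(1)])
    finally show ?thesis
      using perm_length_eq[OF dp_permutes[OF z_tabs u(1)]] inv_count_dp_z(1)[OF u] supp_z u(2) by simp
  qed
  have fc: "f_elt ell n q Q lam s t \<in> words n" and gc: "g_elt ell n q Q lam s t \<in> words n"
    using f_elt_val(2)[OF ss tt] g_elt_val(2)[OF ss tt] .
  have afc: "scal al * f_elt ell n q Q lam s t \<in> words n" by (rule fa_mult[OF fa_basic(3) fc])
  have "free.val (g_elt ell n q Q lam s t - scal al * f_elt ell n q Q lam s t) = 0"
    unfolding free.val_diff free.val_mult free.val_scal f_elt_val(1)[OF ss tt] g_elt_val(1)[OF ss tt] al(3) by simp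
  then have "g_elt ell n q Q lam s t - scal al * f_elt ell n q Q lam s t \<in> hecke_ideal ell n q Q"
    by (rule faithful[OF fa_diff[OF gc afc]])
  then have "hecke_class ell n q Q (g_elt ell n q Q lam s t) = hecke_class ell n q Q (scal al * f_elt ell n q Q lam s t)"
    using hecke_class_eq_iff[OF assms(2) gc afc] by blast
  then have cls: "hecke_class ell n q Q (g_elt ell n q Q lam s t) =
      hecke_class ell n q Q (scal al) \<otimes>\<^bsub>hecke_algebra ell n q Q\<^esub> hecke_class ell n q Q (f_elt ell n q Q lam s t)"
    unfolding hecke_class_mult(1)[OF assms(2) fa_basic(3) fc] .
  show ?thesis
    unfolding Let_def len[OF ss] len[OF tt] gamma'_coeff_def conj_z
    by (rule exI[of _ al], intro conjI, rule al(1), rule cls, rule al_def, rule al(2))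
qed

end
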